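(* Let $m>1$ be an integer and let $G$ be a subgroup of $\mathbf{Aut}_m$. Let $L$ be a link and $D$ one of its diagrams. Then: (1) the number of $G$-equivalence classes of $m$-colorings of $D$ is a topological invariant of $L$, i.e., it is the same for every diagram of $L$; (2) the multi-set whose elements are the numbers of $m$-colorings in each $G$-equivalence class of $m$-colorings of $D$ (one element per class) is a topological invariant of $L$, i.e., it is the same for every diagram of $L$.
   Context: Given a diagram $D$ of a link and an integer $m>1$, an $m$-coloring (Fox coloring) of $D$ is an assignment $\mathcal{C}$ of elements of $\mathbf{Z}_m=\mathbf{Z}/m\mathbf{Z}$ (colors) to the arcs of $D$ such that at each crossing, with over-arc $b$ and under-arcs $a,c$, one has $2\mathcal{C}(b)=\mathcal{C}(a)+\mathcal{C}(c)$ in $\mathbf{Z}_m$. An $m$-coloring is trivial if it assigns the same color to every arc, and non-trivial otherwise. $m\mathcal{C}D$ denotes the set of non-trivial $m$-colorings of $D$. $\mathbf{Aut}_m$ is the group (under composition) of permutations $f$ of $\mathbf{Z}_m$ with $f(a\ast b)=f(a)\ast f(b)$ for all $a,b\in\mathbf{Z}_m$, where $x\ast y=2y-x$; it consists exactly of the maps $f_{\lambda,\mu}(x)=\lambda x+\mu$ with $\lambda\in\mathbf{Z}_m^{\ast}$ (the units) and $\mu\in\mathbf{Z}_m$. A subgroup $G$ of $\mathbf{Aut}_m$ acts on $m\mathcal{C}D$ by $(g\mathcal{C})(a)=g(\mathcal{C}(a))$ for each arc $a$ of $D$. The $G$-equivalence classes of $m$-colorings of $D$ are the orbits of this action on $m\mathcal{C}D$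 (so only non-trivial colorings are considered). *)

theory Defs
  imports "HOL-Analysis.Analysis" "HOL-Algebra.Bij" "HOL-Algebra.Group_Action"
    "HOL-Library.Multiset" "HOL-Library.FuncSet" "HOL-Number_Theory.Cong"
begin

section \<open>Links and ambient isotopy\<close>

text \<open>
  Three-space is written as plane times height, so that \<open>fst\<close> is the projection onto
  the plane of the diagram and \<open>snd\<close> is the height seen by an observer above that plane.
\<close>

type_synonym space = "(real^2) \<times> real"

definition link :: "space set \<Rightarrow> bool" where
  "link L \<longleftrightarrow> (\<exists>F. finite F \<and> pairwise disjnt F \<and> L = \<Union>F \<and>
     (\<forall>S\<in>F. S homeomorphic sphere (0::complex) 1))"

text \<open>An ambient isotopy is a homotopy from the identity through self-homeomorphisms of space.\<close>

definition ambient_isotopic :: "space set \<Rightarrow> space set \<Rightarrow> bool" where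
  "ambient_isotopic K L \<longleftrightarrow>
     (\<exists>h. homotopic_with_canon (\<lambda>f. \<exists>g. homeomorphism UNIV UNIV f g) UNIV UNIV id h \<and> h ` K = L)"

section \<open>Diagrams\<close>

text \<open>
  A closed polygon is given by the cyclic list of its vertices, a polygonal link by the list
  of its component polygons.
\<close>

definition edge :: "space list \<Rightarrow> nat \<Rightarrow> space set" where
  "edge vs i = closed_segment (vs ! i) (vs ! (Suc i mod length vs))"

definition edge_ends :: "space list \<Rightarrow> nat \<Rightarrow> space set" where
  "edge_ends vs i = {vs ! i, vs ! (Suc i mod length vs)}"

definition polygon_image :: "space list \<Rightarrow> space set" where
  "polygon_image vs = (\<Union>i<length vs. edge vs i)"

definition simple_polygon :: "space list \<Rightarrow> bool" where
  "simple_polygon vs \<longleftrightarrow> 3 \<le> length vs \<and> distinct vs \<and>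
     (\<forall>i<length vs. \<forall>j<length vs. i \<noteq> j \<longrightarrow>
        edge vs i \<inter> edge vs j = edge_ends vs i \<inter> edge_ends vs j)"

type_synonym diagram = "space list list"

definition support :: "diagram \<Rightarrow> space set" where
  "support D = (\<Union>vs\<in>set D. polygon_image vs)"

definition vertices :: "diagram \<Rightarrow> space set" where
  "vertices D = (\<Union>vs\<in>set D. set vs)"

definition polygonal_link :: "diagram \<Rightarrow> bool" where
  "polygonal_link D \<longleftrightarrow> (\<forall>vs\<in>set D. simple_polygon vs) \<and>
     (\<forall>i<length D. \<forall>j<length D. i \<noteq> j \<longrightarrow> disjnt (polygon_image (D ! i)) (polygon_image (D ! j)))"

text \<open>
  A diagram is a regular projection of a polygonal link together with the over/under
  information at its crossings; it is recorded by the polygonal link itself, the heights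
  serving only to tell which strand of a crossing is the upper one.  Regularity means that no
  three points of the link have the same projection and that the projection of a vertex is not
  the projection of any other point.  This excludes vertical edges and overlapping or merely
  touching projected edges, so there are finitely many crossings and all of them are transverse
  double points.
\<close>

definition regular_projection :: "diagram \<Rightarrow> bool" where
  "regular_projection D \<longleftrightarrow>
     (\<forall>x\<in>support D. \<forall>y\<in>support D. \<forall>z\<in>support D.
        fst x = fst y \<and> fst y = fst z \<longrightarrow> x = y \<or> y = z \<or> x = z) \<and>
     (\<forall>x\<in>vertices D. \<forall>y\<in>support D. fst x = fst y \<longrightarrow> x = y)"

definition diagram_of :: "diagram \<Rightarrow> space set \<Rightarrow> bool" where
  "diagram_of D L \<longleftrightarrow>
     polygonal_link D \<and> regular_projection D \<and> ambient_isotopic (support D) L"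

text \<open>\<open>crossing D v u\<close>: at some crossing, the point \<open>v\<close> of the link lies over the point \<open>u\<close>.\<close>

definition crossing :: "diagram \<Rightarrow> space \<Rightarrow> space \<Rightarrow> bool" where
  "crossing D v u \<longleftrightarrow> v \<in> support D \<and> u \<in> support D \<and> fst v = fst u \<and> snd u < snd v"

text \<open>
  Cutting the link at its lower crossing points leaves the arcs; a component that never
  passes under a crossing is a single closed arc.
\<close>

definition arcs :: "diagram \<Rightarrow> space set set" where
  "arcs D = components (support D - {u. \<exists>v. crossing D v u})"

definition under_arcs :: "diagram \<Rightarrow> space \<Rightarrow> space set set" where
  "under_arcs D u = {a \<in> arcs D. u \<in> closure a}"

section \<open>Fox colorings\<close>

abbreviation Z_mod :: "int \<Rightarrow> int set" where
  "Z_mod m \<equiv> {0..<m}"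

text \<open>
  The two ends meeting at an under-crossing may belong to the same arc; then
  \<open>under_arcs D u\<close> is a singleton and \<open>a = c\<close> below.
\<close>

definition colorings :: "int \<Rightarrow> diagram \<Rightarrow> (space set \<Rightarrow> int) set" where
  "colorings m D = {C \<in> arcs D \<rightarrow>\<^sub>E Z_mod m.
     \<forall>v u. crossing D v u \<longrightarrow>
       (\<forall>a b c. b \<in> arcs D \<and> v \<in> b \<and> under_arcs D u = {a, c} \<longrightarrow>
          [2 * C b = C a + C c] (mod m))}"

definition trivial_coloring :: "diagram \<Rightarrow> (space set \<Rightarrow> int) \<Rightarrow> bool" where
  "trivial_coloring D C \<longleftrightarrow> (\<forall>a\<in>arcs D. \<forall>b\<in>arcs D. C a = C b)"

definition nontrivial_colorings :: "int \<Rightarrow> diagram \<Rightarrow> (space set \<Rightarrow> int) set" where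
  "nontrivial_colorings m D = {C \<in> colorings m D. \<not> trivial_coloring D C}"

section \<open>Equivalence classes of colorings\<close>

definition quandle_op :: "int \<Rightarrow> int \<Rightarrow> int \<Rightarrow> int" where
  "quandle_op m x y = (2 * y - x) mod m"

definition Aut_group :: "int \<Rightarrow> (int \<Rightarrow> int) monoid" where
  "Aut_group m = (BijGroup (Z_mod m))
     \<lparr>carrier := {f \<in> Bij (Z_mod m). \<forall>a\<in>Z_mod m. \<forall>b\<in>Z_mod m.
        f (quandle_op m a b) = quandle_op m (f a) (f b)}\<rparr>"

definition coloring_action ::
    "diagram \<Rightarrow> (int \<Rightarrow> int) \<Rightarrow> (space set \<Rightarrow> int) \<Rightarrow> space set \<Rightarrow> int" where
  "coloring_action D g C = (\<lambda>a\<in>arcs D. g (C a))"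

definition coloring_classes ::
    "int \<Rightarrow> (int \<Rightarrow> int) set \<Rightarrow> diagram \<Rightarrow> (space set \<Rightarrow> int) set set" where
  "coloring_classes m G D =
     orbits ((Aut_group m)\<lparr>carrier := G\<rparr>) (nontrivial_colorings m D) (coloring_action D)"

text \<open>There are only finitely many arcs, hence colorings, so \<open>card\<close> and \<open>mset_set\<close> are meaningful.\<close>

definition class_sizes :: "int \<Rightarrow> (int \<Rightarrow> int) set \<Rightarrow> diagram \<Rightarrow> nat multiset" where
  "class_sizes m G D = image_mset card (mset_set (coloring_classes m G D))"

end

theory Submission
  imports Defs "HOL-Library.Z2"
begin

text \<open>
  A color \<open>c\<close> is identified with the reflection of the circle with angle \<open>2 \<pi> c / m\<close>; the Fox relation then
  says that \<open>\<gamma> b + \<gamma> a + \<gamma> b + \<gamma> c = 0\<close> in the dihedral group.  Instead of checking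
  Reidemeister moves, we describe colorings intrinsically: they are the based equivalence classes of locally
  constant cocycles on the complement of the link, with values in the dihedral group of order \<open>2 m\<close>, whose sign
  is non-trivial around every point of the link (equivalently, homomorphisms of the link group sending
  meridians to reflections, but no fundamental group is needed).  In one direction, a coloring provides
  a potential that jumps by \<open>\<gamma> A\<close> across the curtain hanging from the arc \<open>A\<close>; the Fox
  relation is exactly what makes it extend below the crossings, and its differences form the cocycle.  In the other
  direction, a cocycle can be normalised to vanish above the link, and its jump is then constant along
  the curtain below each arc.  A homeomorphism of space carrying one link to the other, moved so as to match the base
  points, transports cocycles and so gives a bijection of colorings.  It commutes with all affine maps
  \<open>c \<mapsto> l c + \<mu>\<close>, hence with the action of every automorphism; commutation with the constant maps
  \<open>l = 0\<close> shows that trivial colorings correspond to trivial ones.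
\<close>

section \<open>Local cocycles\<close>

text \<open>\<open>ambient_isotopic\<close> only provides a continuous family of homeomorphisms, so
  the links in between need not be polygonal or have diagrams. Whatever replaces a coloring must
  therefore be expressed by open sets and survive every homeomorphism; this is why the condition at
  the link is the absence of a local potential for the sign, not a statement about meridian loops.
  The second obstacle is the curtains: a potential is under control only off them, i.e. on the sky,
  which is open, contractible and dense in the complement. Relations are checked on the sky and
  extended by density, and the values of a section on a curtain carry no information. The group is
  not commutative, so sides matter: constants act on potentials from the left, jumps from the right.
  Since reflections are their own inverses, a jump does not depend on the direction in which a
  curtain is crossed, and the link needs no orientation.\<close>

definition cocycle_on :: "'a set \<Rightarrow> ('a \<Rightarrow> 'a \<Rightarrow> 'g::group_add) \<Rightarrow> bool" where
  "cocycle_on S w \<longleftrightarrow> (\<forall>a\<in>S. \<forall>b\<in>S. \<forall>c\<in>S. w a b + w b c = w a c)"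

definition cocycle :: "'a::metric_space set \<Rightarrow> ('a \<Rightarrow> 'a \<Rightarrow> 'g::group_add) \<Rightarrow> bool" where
  "cocycle X w \<longleftrightarrow> (\<forall>x\<in>X. \<exists>e>0. cocycle_on (ball x e) w)"

text \<open>Non-abelian change of gauge. The restriction to \<open>T\<close> allows \<open>k\<close>
  to be known on a dense set only.\<close>

definition gauge_on ::
    "'a::metric_space set \<Rightarrow> 'a set \<Rightarrow> ('a \<Rightarrow> 'g::group_add) \<Rightarrow> ('a \<Rightarrow> 'a \<Rightarrow> 'g) \<Rightarrow> ('a \<Rightarrow> 'a \<Rightarrow> 'g) \<Rightarrow> bool" where
  "gauge_on X T k w w' \<longleftrightarrow>
     (\<forall>x\<in>X. \<exists>e>0. \<forall>a\<in>ball x e \<inter> T. \<forall>b\<in>ball x e \<inter> T. w' a b = - k a + w a b + k b)"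

lemmas group_add_simps = add.assoc minus_add diff_conv_add_uminus

lemma cocycle_onD: "cocycle_on S w \<Longrightarrow> a \<in> S \<Longrightarrow> b \<in> S \<Longrightarrow> c \<in> S \<Longrightarrow> w a b + w b c = w a c"
  by (auto simp: cocycle_on_def)

lemma cocycle_on_subset: "cocycle_on S w \<Longrightarrow> T \<subseteq> S \<Longrightarrow> cocycle_on T w"
  unfolding cocycle_on_def by blast

lemma cocycle_on_refl: "cocycle_on S w \<Longrightarrow> a \<in> S \<Longrightarrow> w a a = 0"
  using cocycle_onD[of S w a a a] by (metis add.right_neutral add_left_cancel)

lemma cocycle_on_sym: "cocycle_on S w \<Longrightarrow> a \<in> S \<Longrightarrow> b \<in> S \<Longrightarrow> w b a = - w a b"
  using cocycle_onD[of S w a b a] cocycle_on_refl[of S w a]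
    by (simp add: eq_neg_iff_add_eq_0 neg_eq_iff_add_eq_0 minus_unique)

lemma cocycle_subset: "cocycle X w \<Longrightarrow> Y \<subseteq> X \<Longrightarrow> cocycle Y w"
  unfolding cocycle_def by blast

lemma ball_min: "ball x (min a b) = ball x a \<inter> ball x b"
  by auto

lemma cocycle_gauge:
  assumes "cocycle X w" shows "cocycle X (\<lambda>a b. k a + w a b - k b)"
  unfolding cocycle_def
proof
  fix x assume "x \<in> X"
  then obtain e where "e > 0" "cocycle_on (ball x e) w" using assms by (auto simp: cocycle_def)
  then show "\<exists>e>0. cocycle_on (ball x e) (\<lambda>a b. k a + w a b - k b)"
    apply (intro exI[of _ e])
    apply (simp add: cocycle_on_def group_add_simps del: add_uminus_conv_diff)
    by (metis add.assoc)
qed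

lemma cocycle_hom:
  assumes "cocycle X w" "\<And>a b. f (a + b) = f a + f b"
  shows "cocycle X (\<lambda>a b. f (w a b))"
  using assms(1) unfolding cocycle_def cocycle_on_def by (metis assms(2))

lemma dense_in_ball:
  assumes "X \<subseteq> closure T" "x \<in> X" "e > 0"
  obtains a where "a \<in> T" "a \<in> ball x e"
  using assms closure_approachable[of x T] by (metis dist_commute mem_ball subsetD)

text \<open>At a point \<open>x\<close> off \<open>T\<close> the gauge is forced by any nearby
  \<open>a\<close> in \<open>T\<close>: \<open>w x a\<close> leads to \<open>a\<close>,
  \<open>k a\<close> changes the gauge there, \<open>w' a x\<close> leads back. Density provides
  \<open>a\<close>, and the cocycle rules make its choice irrelevant.\<close>

lemma gauge_extend:
  fixes w w' :: "'a::metric_space \<Rightarrow> 'a \<Rightarrow> 'g::group_add"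
  assumes X: "open X" and dense: "X \<subseteq> closure T" and w: "cocycle X w" and w': "cocycle X w'"
    and k: "gauge_on X T k w w'"
  obtains k' where "\<And>x. x \<in> T \<Longrightarrow> k' x = k x" "gauge_on X UNIV k' w w'"
proof -
  define good where "good x e \<longleftrightarrow> e > 0 \<and> ball x e \<subseteq> X \<and> cocycle_on (ball x e) w \<and> cocycle_on (ball x e) w' \<and>
    (\<forall>a\<in>ball x e \<inter> T. \<forall>b\<in>ball x e \<inter> T. w' a b = - k a + w a b + k b)" for x e
  have ex_good: "\<exists>e. good x e" if x: "x \<in> X" for x
  proof -
    obtain e1 where e1: "e1 > 0" "ball x e1 \<subseteq> X" using X x by (meson open_contains_ball)
    obtain e2 where e2: "e2 > 0" "cocycle_on (ball x e2) w" using w x by (auto simp: cocycle_def)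
    obtain e3 where e3: "e3 > 0" "cocycle_on (ball x e3) w'" using w' x by (auto simp: cocycle_def)
    obtain e4 where e4: "e4 > 0"
        "\<forall>a\<in>ball x e4 \<inter> T. \<forall>b\<in>ball x e4 \<inter> T. w' a b = - k a + w a b + k b"
      using k x unfolding gauge_on_def by blast
    have "good x (min (min e1 e2) (min e3 e4))"
      unfolding good_def using e1 e2 e3 e4
      by (auto simp: ball_min intro: cocycle_on_subset)
    then show ?thesis by blast
  qed
  define ee where "ee x = (SOME e. good x e)" for x
  have ee: "good x (ee x)" if "x \<in> X" for x
    unfolding ee_def using ex_good[OF that] by (rule someI_ex)
  define aa where "aa x = (SOME a. a \<in> T \<and> a \<in> ball x (ee x))" for x
  have aa: "aa x \<in> T" "aa x \<in> ball x (ee x)" if "x \<in> X" for x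
  proof -
    have "ee x > 0" using ee[OF that] by (simp add: good_def)
    then have "\<exists>a. a \<in> T \<and> a \<in> ball x (ee x)" using dense_in_ball[OF dense that] by blast
    then show "aa x \<in> T" "aa x \<in> ball x (ee x)" unfolding aa_def by (metis (mono_tags, lifting) someI_ex)+
  qed
  define k' where "k' x = (if x \<in> T then k x else w x (aa x) + k (aa x) + w' (aa x) x)" for x
  \<comment> \<open>Two balls are involved, the one around \<open>x0\<close> and the one chosen for
    \<open>x\<close>; a point \<open>b\<close> of \<open>T\<close> close to \<open>x\<close> lies in
    both and links the two formulas.\<close>
  have key: "w' a x = - k a + w a x + k' x"
    if g: "good x0 e" and x: "x \<in> ball x0 e" and a: "a \<in> ball x0 e" "a \<in> T" for x0 e x a
  proof (cases "x \<in> T")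
    case True
    then show ?thesis using g x a by (auto simp: good_def k'_def)
  next
    case False
    have xX: "x \<in> X" using g x by (auto simp: good_def)
    have gx: "good x (ee x)" using ee xX by blast
    have pos: "ee x > 0" using gx by (simp add: good_def)
    obtain r where r: "r > 0" "ball x r \<subseteq> ball x0 e" using x by (meson open_ball open_contains_ball)
    obtain b where b: "b \<in> T" "b \<in> ball x (min (ee x) r)"
      using dense_in_ball[OF dense xX, of "min (ee x) r"] pos r by auto
    have bx: "b \<in> ball x (ee x)" and b0: "b \<in> ball x0 e" using b r by auto
    let ?a = "aa x"
    note A = aa[OF xX]
    have xx: "x \<in> ball x (ee x)" using pos by simp
    have "w x ?a + k ?a + w' ?a x = w x ?a + k ?a + (w' ?a b + w' b x)"
      using cocycle_onD[of "ball x (ee x)" w' ?a b x] gx A bx xx by (simp add: good_def)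
    also have "w' ?a b = - k ?a + w ?a b + k b" using gx A bx b by (auto simp: good_def)
    also have "w x ?a + k ?a + (- k ?a + w ?a b + k b + w' b x) = (w x ?a + w ?a b) + k b + w' b x"
      by (simp add: group_add_simps del: add_uminus_conv_diff)
    also have "w x ?a + w ?a b = w x b"
      using cocycle_onD[of "ball x (ee x)" w x ?a b] gx A bx xx by (simp add: good_def)
    finally have k'x: "k' x = w x b + k b + w' b x" using False by (simp add: k'_def)
    have "w' a x = w' a b + w' b x"
      using cocycle_onD[of "ball x0 e" w' a b x] g a b0 x by (simp add: good_def)
    also have "w' a b = - k a + w a b + k b" using g a b b0 by (auto simp: good_def)
    also have "w a b = w a x + w x b"
      using cocycle_onD[of "ball x0 e" w a x b] g a b0 x by (simp add: good_def)
    finally show ?thesis using k'x by (simp add: group_add_simps del: add_uminus_conv_diff)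
  qed
  have "gauge_on X UNIV k' w w'"
    unfolding gauge_on_def
  proof
    fix x assume x: "x \<in> X"
    obtain e where g: "good x e" using ex_good[OF x] by blast
    have e: "e > 0" using g by (simp add: good_def)
    have "w' y z = - k' y + w y z + k' z" if y: "y \<in> ball x e" and z: "z \<in> ball x e" for y z
    proof -
      obtain a where a: "a \<in> T" "a \<in> ball x e" using dense_in_ball[OF dense x e] by blast
      have c': "cocycle_on (ball x e) w'" and c: "cocycle_on (ball x e) w" using g by (auto simp: good_def)
      have "w' y z = w' y a + w' a z" using cocycle_onD[OF c' y a(2) z] by simp
      also have "w' y a = - (- k a + w a y + k' y)"
        using cocycle_on_sym[OF c' a(2) y] key[OF g y a(2,1)] by simp
      also have "w' a z = - k a + w a z + k' z" using key[OF g z a(2,1)] .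
      also have "w a z = w a y + w y z" using cocycle_onD[OF c a(2) y z] by simp
      finally show ?thesis by (simp add: group_add_simps del: add_uminus_conv_diff)
    qed
    then show "\<exists>e>0. \<forall>a\<in>ball x e \<inter> UNIV. \<forall>b\<in>ball x e \<inter> UNIV. w' a b = - k' a + w a b + k' b"
      using e by auto
  qed
  then show ?thesis using that[of k'] by (simp add: k'_def)
qed

text \<open>Short pieces of the path lie in balls on which \<open>w\<close> is a cocycle, and
  potentials on adjacent pieces can be matched; \<open>Bolzano\<close> does the subdivision. The
  potential is fixed at the end 1 because all paths of a contraction end in the same point.\<close>

lemma cocycle_path_trivial:
  fixes w :: "'a::metric_space \<Rightarrow> 'a \<Rightarrow> 'g::group_add" and c :: "real \<Rightarrow> 'a"
  assumes w: "cocycle Y w" and c: "continuous_on {0..1} c" "c ` {0..1} \<subseteq> Y"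
  obtains \<kappa> :: "real \<Rightarrow> 'g" where "\<kappa> 1 = 0"
    "\<And>t. t \<in> {0..1} \<Longrightarrow> \<exists>d>0. \<forall>s\<in>{0..1}. \<forall>s'\<in>{0..1}. \<bar>s - t\<bar> < d \<longrightarrow> \<bar>s' - t\<bar> < d \<longrightarrow>
        w (c s) (c s') = - \<kappa> s + \<kappa> s'"
proof -
  \<comment> \<open>The bounds 0 and 1 are premises inside \<open>P\<close>, because
    \<open>Bolzano\<close> also asks about intervals that stick out of the unit interval.\<close>
  define P where "P a b \<longleftrightarrow> (0 \<le> a \<longrightarrow> b \<le> 1 \<longrightarrow> (\<exists>\<kappa>. \<forall>t\<in>{a..b}. \<exists>d>0. \<forall>s\<in>{a..b}. \<forall>s'\<in>{a..b}.
     \<bar>s - t\<bar> < d \<longrightarrow> \<bar>s' - t\<bar> < d \<longrightarrow> w (c s) (c s') = - \<kappa> s + (\<kappa> s' :: 'g)))" for a b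
  have loc: "\<exists>d>0. \<forall>s\<in>{0..1}. \<bar>s - t\<bar> < d \<longrightarrow> c s \<in> ball (c t) e"
    if "t \<in> {0..1}" "e > 0" for t e
    using c(1) that unfolding continuous_on_iff by (metis dist_commute dist_real_def mem_ball)
  have coc: "\<exists>e>0. cocycle_on (ball (c t) e) w" if "t \<in> {0..1}" for t
    using w c(2) that unfolding cocycle_def by blast
  have "P 0 1"
  proof (rule Bolzano)
    fix x y z :: real assume xy: "P x y" and yz: "P y z" and le: "x \<le> y" "y \<le> z"
    show "P x z"
      unfolding P_def
    proof (intro impI)
      assume 0: "0 \<le> x" "z \<le> 1"
      obtain \<kappa>1 where k1: "\<forall>t\<in>{x..y}. \<exists>d>0. \<forall>s\<in>{x..y}. \<forall>s'\<in>{x..y}.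
          \<bar>s - t\<bar> < d \<longrightarrow> \<bar>s' - t\<bar> < d \<longrightarrow> w (c s) (c s') = - \<kappa>1 s + \<kappa>1 s'"
        using xy le 0 order_trans unfolding P_def by blast
      obtain \<kappa>2 where k2: "\<forall>t\<in>{y..z}. \<exists>d>0. \<forall>s\<in>{y..z}. \<forall>s'\<in>{y..z}.
          \<bar>s - t\<bar> < d \<longrightarrow> \<bar>s' - t\<bar> < d \<longrightarrow> w (c s) (c s') = - \<kappa>2 s + \<kappa>2 s'"
        using yz le 0 order_trans unfolding P_def by blast
      \<comment> \<open>The right half is translated on the left by the constant that makes both
        potentials agree at \<open>y\<close>; this does not affect
        \<open>- \<kappa> s + \<kappa> s'\<close>.\<close>
      define \<kappa> where "\<kappa> t = (if t \<le> y then \<kappa>1 t else \<kappa>1 y - \<kappa>2 y + \<kappa>2 t)" for t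
      have yy: "\<kappa> s = \<kappa>1 y - \<kappa>2 y + \<kappa>2 s" if "s \<ge> y" for s
        using that by (auto simp: \<kappa>_def)
      have "\<exists>d>0. \<forall>s\<in>{x..z}. \<forall>s'\<in>{x..z}. \<bar>s - t\<bar> < d \<longrightarrow> \<bar>s' - t\<bar> < d \<longrightarrow>
          w (c s) (c s') = - \<kappa> s + \<kappa> s'" if t: "t \<in> {x..z}" for t
      proof -
        consider "t < y" | "t > y" | "t = y" by linarith
        then show ?thesis
        proof cases
          case 1
          then obtain d where "d > 0" and d: "\<forall>s\<in>{x..y}. \<forall>s'\<in>{x..y}.
             \<bar>s - t\<bar> < d \<longrightarrow> \<bar>s' - t\<bar> < d \<longrightarrow> w (c s) (c s') = - \<kappa>1 s + \<kappa>1 s'"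
            using bspec[OF k1, of t] t by auto
          then show ?thesis using 1 by (intro exI[of _ "min d (y - t)"]) (auto simp: \<kappa>_def abs_less_iff)
        next
          case 2
          then obtain d where "d > 0" and d: "\<forall>s\<in>{y..z}. \<forall>s'\<in>{y..z}.
             \<bar>s - t\<bar> < d \<longrightarrow> \<bar>s' - t\<bar> < d \<longrightarrow> w (c s) (c s') = - \<kappa>2 s + \<kappa>2 s'"
            using bspec[OF k2, of t] t by auto
          then show ?thesis using 2
            by (intro exI[of _ "min d (t - y)"])
              (auto simp: yy abs_less_iff group_add_simps simp del: add_uminus_conv_diff)
        next
          \<comment> \<open>At the seam, points of the two halves are compared through
            \<open>c y\<close>, inside a ball on which \<open>w\<close> is a cocycle.\<close>
          case 3
          obtain e where e: "e > 0" "cocycle_on (ball (c y) e) w" using coc[of y] le 0 by auto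
          obtain d3 where d3: "d3 > 0" "\<forall>s\<in>{0..1}. \<bar>s - y\<bar> < d3 \<longrightarrow> c s \<in> ball (c y) e"
            using loc[of y e] e le 0 by auto
          obtain d1 where d1: "d1 > 0" "\<forall>s\<in>{x..y}. \<forall>s'\<in>{x..y}.
             \<bar>s - y\<bar> < d1 \<longrightarrow> \<bar>s' - y\<bar> < d1 \<longrightarrow> w (c s) (c s') = - \<kappa>1 s + \<kappa>1 s'"
            using bspec[OF k1, of y] le by auto
          obtain d2 where d2: "d2 > 0" "\<forall>s\<in>{y..z}. \<forall>s'\<in>{y..z}.
             \<bar>s - y\<bar> < d2 \<longrightarrow> \<bar>s' - y\<bar> < d2 \<longrightarrow> w (c s) (c s') = - \<kappa>2 s + \<kappa>2 s'"
            using bspec[OF k2, of y] le by auto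
          have yw: "w (c y) (c s) = - \<kappa> y + \<kappa> s" if "s \<in> {x..z}" "\<bar>s - y\<bar> < min d1 d2" for s
          proof (cases "s \<le> y")
            case True
            then show ?thesis using d1 that le by (auto simp: \<kappa>_def)
          next
            case False
            then have "w (c y) (c s) = - \<kappa>2 y + \<kappa>2 s" using d2 that le by auto
            then show ?thesis using False by (simp add: \<kappa>_def group_add_simps del: add_uminus_conv_diff)
          qed
          have "w (c s) (c s') = - \<kappa> s + \<kappa> s'"
            if s: "s \<in> {x..z}" "s' \<in> {x..z}" "\<bar>s - y\<bar> < min d3 (min d1 d2)" "\<bar>s' - y\<bar> < min d3 (min d1 d2)"
              for s s'
          proof -
            have B: "c y \<in> ball (c y) e" "c s \<in> ball (c y) e" "c s' \<in> ball (c y) e"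
              using d3 e s 0 by auto
            have "w (c s) (c s') = - w (c y) (c s) + w (c y) (c s')"
              using cocycle_onD[OF e(2) B(2,1,3)] cocycle_on_sym[OF e(2) B(1,2)] by simp
            then show ?thesis using yw[of s] yw[of s'] s
              by (simp add: group_add_simps del: add_uminus_conv_diff)
          qed
          then show ?thesis using 3 d1 d2 d3 by (intro exI[of _ "min d3 (min d1 d2)"]) auto
        qed
      qed
      then show "\<exists>\<kappa>. \<forall>t\<in>{x..z}. \<exists>d>0. \<forall>s\<in>{x..z}. \<forall>s'\<in>{x..z}.
         \<bar>s - t\<bar> < d \<longrightarrow> \<bar>s' - t\<bar> < d \<longrightarrow> w (c s) (c s') = - \<kappa> s + \<kappa> s'" by blast
    qed
  next
    fix x :: real assume x: "0 \<le> x" "x \<le> 1"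
    obtain e where e: "e > 0" "cocycle_on (ball (c x) e) w" using coc[of x] x by auto
    obtain d where d: "d > 0" "\<forall>s\<in>{0..1}. \<bar>s - x\<bar> < d \<longrightarrow> c s \<in> ball (c x) e"
      using loc[of x e] e x by auto
    have "P a b" if ab: "a \<le> x" "x \<le> b" "b - a < d" for a b
      unfolding P_def
    proof (intro impI)
      assume 0: "0 \<le> a" "b \<le> 1"
      have "w (c s) (c s') = - w (c x) (c s) + w (c x) (c s')" if s: "s \<in> {a..b}" "s' \<in> {a..b}" for s s'
      proof -
        have B: "c x \<in> ball (c x) e" "c s \<in> ball (c x) e" "c s' \<in> ball (c x) e"
          using d e s 0 ab x by auto
        show ?thesis
          using cocycle_onD[OF e(2) B(2,1,3)] cocycle_on_sym[OF e(2) B(1,2)] by simp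
      qed
      then show "\<exists>\<kappa>. \<forall>t\<in>{a..b}. \<exists>d>0. \<forall>s\<in>{a..b}. \<forall>s'\<in>{a..b}.
         \<bar>s - t\<bar> < d \<longrightarrow> \<bar>s' - t\<bar> < d \<longrightarrow> w (c s) (c s') = - \<kappa> s + \<kappa> s'"
        by (intro exI[of _ "\<lambda>s. w (c x) (c s)"]) (auto intro: exI[of _ 1])
    qed
    then show "\<exists>d>0. \<forall>a b. a \<le> x \<and> x \<le> b \<and> b - a < d \<longrightarrow> P a b" using d by blast
  qed auto
  then obtain \<kappa> where k: "\<forall>t\<in>{0..1}. \<exists>d>0. \<forall>s\<in>{0..1}. \<forall>s'\<in>{0..1}.
     \<bar>s - t\<bar> < d \<longrightarrow> \<bar>s' - t\<bar> < d \<longrightarrow> w (c s) (c s') = - \<kappa> s + \<kappa> s'"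
    unfolding P_def by auto
  show ?thesis
    by (rule that[of "\<lambda>t. - \<kappa> 1 + \<kappa> t"])
      (use k in \<open>simp_all add: group_add_simps del: add_uminus_conv_diff\<close>)
qed

text \<open>The contraction joins each \<open>x\<close> to the fixed point \<open>p\<close>, and
  \<open>k x\<close> is the holonomy of \<open>w\<close> from \<open>p\<close> to \<open>x\<close>
  along this path. For a nearby \<open>y\<close> the two paths stay close at all times, so the
  holonomies differ exactly by \<open>w x y\<close>.\<close>

lemma cocycle_contractible:
  fixes w :: "'a::euclidean_space \<Rightarrow> 'a \<Rightarrow> 'g::group_add"
  assumes T: "open T" "contractible T" and w: "cocycle T w"
  obtains k where "gauge_on T UNIV k (\<lambda>_ _. 0) w"
proof -
  obtain p where "homotopic_with_canon (\<lambda>x. True) T T id (\<lambda>x. p)"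
    using T(2) by (auto simp: contractible_def)
  then obtain h where h: "continuous_on ({0..1::real} \<times> T) h" "h ` ({0..1} \<times> T) \<subseteq> T"
    "\<And>x. x \<in> T \<Longrightarrow> h (0, x) = x" "\<And>x. x \<in> T \<Longrightarrow> h (1, x) = p"
    unfolding homotopic_with_def by (auto simp: image_subset_iff_funcset)
  have hT: "h (s, x) \<in> T" if "s \<in> {0..1}" "x \<in> T" for s x
    using h(2) that by blast
  have cont: "continuous_on {0..1} (\<lambda>s. h (s, x))" if "x \<in> T" for x
    by (rule continuous_on_compose2[OF h(1)]) (use that in \<open>auto intro!: continuous_intros\<close>)
  define K where "K x \<kappa> \<longleftrightarrow> \<kappa> 1 = (0::'g) \<and> (\<forall>t\<in>{0..1}. \<exists>d>0. \<forall>s\<in>{0..1}. \<forall>s'\<in>{0..1::real}.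
    \<bar>s - t\<bar> < d \<longrightarrow> \<bar>s' - t\<bar> < d \<longrightarrow> w (h (s, x)) (h (s', x)) = - \<kappa> s + \<kappa> s')" for x \<kappa>
  have exK: "\<exists>\<kappa>. K x \<kappa>" if "x \<in> T" for x
    by (rule cocycle_path_trivial[OF w cont[OF that]]) (use hT that in \<open>auto simp: K_def\<close>)
  define \<kappa> where "\<kappa> x = (SOME k. K x k)" for x
  have K: "K x (\<kappa> x)" if "x \<in> T" for x
    unfolding \<kappa>_def using exK[OF that] by (rule someI_ex)
  define k where "k x = \<kappa> x 0" for x
  have main: "\<exists>e>0. \<forall>y\<in>ball x e. w x y = - k x + k y" if x: "x \<in> T" for x
  proof -
    \<comment> \<open>\<open>\<epsilon>\<close> will be a Lebesgue number for the path of
      \<open>x\<close>, and \<open>\<delta>\<close> the distance below which the path of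
      \<open>y\<close> stays within \<open>\<epsilon>\<close> of it.\<close>
    define \<G> where "\<G> = {ball c e |c e. cocycle_on (ball c e) w}"
    have "compact ((\<lambda>s. h (s, x)) ` {0..1})"
      by (rule compact_continuous_image[OF cont[OF x]]) auto
    moreover have "(\<lambda>s. h (s, x)) ` {0..1} \<subseteq> \<Union>\<G>"
    proof (clarify)
      fix s :: real assume "s \<in> {0..1}"
      then have "h (s, x) \<in> T" using hT x by blast
      then obtain e where "e > 0" "cocycle_on (ball (h (s,x)) e) w" using w by (auto simp: cocycle_def)
      then show "h (s, x) \<in> \<Union>\<G>" by (auto simp: \<G>_def intro!: exI[of _ "ball (h (s,x)) e"])
    qed
    moreover have "open G" if "G \<in> \<G>" for G using that by (auto simp: \<G>_def)
    ultimately obtain \<epsilon> where \<epsilon>: "\<epsilon> > 0"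
      "\<And>y. y \<in> (\<lambda>s. h (s, x)) ` {0..1} \<Longrightarrow> \<exists>G\<in>\<G>. ball y \<epsilon> \<subseteq> G"
      using Heine_Borel_lemma by metis
    have coc: "cocycle_on (ball (h (s, x)) \<epsilon>) w" if "s \<in> {0..1}" for s
      using \<epsilon>(2)[of "h (s, x)"] that unfolding \<G>_def by (auto intro: cocycle_on_subset)
    obtain r where r: "r > 0" "cball x r \<subseteq> T" using T(1) x by (meson open_contains_cball)
    have "uniformly_continuous_on ({0..1} \<times> cball x r) h"
      by (rule compact_uniformly_continuous)
        (use h(1) r in \<open>auto intro: continuous_on_subset compact_Times\<close>)
    then obtain \<delta> where \<delta>: "\<delta> > 0" "\<And>a b. a \<in> {0..1} \<times> cball x r \<Longrightarrow> b \<in> {0..1} \<times> cball x r \<Longrightarrow>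
        dist b a < \<delta> \<Longrightarrow> dist (h b) (h a) < \<epsilon>"
      using \<epsilon>(1) unfolding uniformly_continuous_on_def by metis
    have "w x y = - k x + k y" if y: "y \<in> ball x (min r \<delta>)" for y
    proof -
      have yT: "y \<in> T" using y r by auto
      \<comment> \<open>A rung of the ladder between the two paths at time \<open>s\<close>. Each
        short piece of the ladder commutes, so \<open>D\<close> is locally constant; at time 1 both
        paths are at \<open>p\<close> and \<open>D\<close> is 0.\<close>
      define D where "D s = \<kappa> x s + w (h (s, x)) (h (s, y)) - \<kappa> y s" for s
      have "D 0 = D 1"
      proof (rule connected_local_const[of "{0..1::real}"])
        show "\<forall>a\<in>{0..1}. \<forall>\<^sub>F b in at a within {0..1}. D a = D b"
        proof
          fix s :: real assume s: "s \<in> {0..1}"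
          let ?B = "ball (h (s, x)) \<epsilon>"
          have hx: "h (s, x) \<in> ?B" using \<epsilon> by simp
          have hy: "h (s, y) \<in> ?B"
            using \<delta>(2)[of "(s, y)" "(s, x)"] s y r by (auto simp: dist_Pair_Pair dist_commute)
          have "\<exists>d>0. \<forall>s'\<in>{0..1}. \<bar>s' - s\<bar> < d \<longrightarrow> w (h (s, z)) (h (s', z)) = - \<kappa> z s + \<kappa> z s'"
            if z: "z \<in> T" for z
          proof -
            obtain d where "d > 0" "\<forall>r\<in>{0..1}. \<forall>s'\<in>{0..1::real}.
              \<bar>r - s\<bar> < d \<longrightarrow> \<bar>s' - s\<bar> < d \<longrightarrow> w (h (r, z)) (h (s', z)) = - \<kappa> z r + \<kappa> z s'"
              using K[OF z] s unfolding K_def by blast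
            then show ?thesis using s by (intro exI[of _ d]) auto
          qed
          then obtain dx dy where d: "dx > 0" "dy > 0"
            "\<And>s'. s'\<in>{0..1} \<Longrightarrow> \<bar>s' - s\<bar> < dx \<Longrightarrow> w (h (s, x)) (h (s', x)) = - \<kappa> x s + \<kappa> x s'"
            "\<And>s'. s'\<in>{0..1} \<Longrightarrow> \<bar>s' - s\<bar> < dy \<Longrightarrow> w (h (s, y)) (h (s', y)) = - \<kappa> y s + \<kappa> y s'"
            using x yT by metis
          have ev: "\<forall>\<^sub>F s' in at s within {0..1}. h (s', z) \<in> ?B" if "z \<in> T" "h (s, z) \<in> ?B" for z
          proof -
            have "((\<lambda>s. h (s, z)) \<longlongrightarrow> h (s, z)) (at s within {0..1})"
              using cont[OF that(1)] s unfolding continuous_on by blast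
            then show ?thesis by (rule topological_tendstoD) (use that(2) in auto)
          qed
          have evd: "\<forall>\<^sub>F s' in at s within {0..1}. s' \<in> {0..1} \<and> \<bar>s' - s\<bar> < min dx dy"
            unfolding eventually_at using d(1,2) by (intro exI[of _ "min dx dy"]) (auto simp: dist_real_def)
          show "\<forall>\<^sub>F s' in at s within {0..1}. D s = D s'"
            using ev[OF x hx] ev[OF yT hy] evd
          proof eventually_elim
            case (elim s')
            note c = cocycle_onD[OF coc[OF s]]
            have 1: "w (h (s,x)) (h (s',x)) = - \<kappa> x s + \<kappa> x s'"
              and 2: "w (h (s,y)) (h (s',y)) = - \<kappa> y s + \<kappa> y s'" using d(3,4) elim by auto
            have "w (h (s,x)) (h (s',x)) + w (h (s',x)) (h (s',y)) = w (h (s,x)) (h (s,y)) + w (h (s,y)) (h (s',y))"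
              using c[of "h (s,x)" "h (s',x)" "h (s',y)"] c[of "h (s,x)" "h (s,y)" "h (s',y)"] hx hy elim
                by simp
            then have "- \<kappa> x s + (\<kappa> x s' + w (h (s',x)) (h (s',y))) = w (h (s,x)) (h (s,y)) - \<kappa> y s + \<kappa> y s'"
              unfolding 1 2 by (simp add: group_add_simps del: add_uminus_conv_diff)
            then have "\<kappa> x s' + w (h (s',x)) (h (s',y)) = \<kappa> x s + (w (h (s,x)) (h (s,y)) - \<kappa> y s + \<kappa> y s')"
              by (metis add.assoc add_minus_cancel)
            then show ?case unfolding D_def by (simp add: group_add_simps del: add_uminus_conv_diff)
          qed
        qed
      qed auto
      moreover have "D 1 = 0"
      proof -
        have "w p p = 0" using coc[of 1] h(4)[OF x] cocycle_on_refl[of _ w p] \<epsilon>(1) by auto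
        then show ?thesis using K[OF x] K[OF yT] h(4)[OF x] h(4)[OF yT] by (simp add: D_def K_def)
      qed
      ultimately have "\<kappa> x 0 + w x y = \<kappa> y 0"
        using h(3)[OF x] h(3)[OF yT] by (simp add: D_def)
      then show ?thesis by (metis k_def minus_add_cancel)
    qed
    then show ?thesis using r(1) \<delta>(1) by (intro exI[of _ "min r \<delta>"]) auto
  qed
  have "gauge_on T UNIV k (\<lambda>_ _. 0) w"
    unfolding gauge_on_def
  proof
    fix x assume x: "x \<in> T"
    obtain e1 where e1: "e1 > 0" "\<forall>y\<in>ball x e1. w x y = - k x + k y" using main[OF x] by blast
    obtain e2 where e2: "e2 > 0" "cocycle_on (ball x e2) w" using w x by (auto simp: cocycle_def)
    have "w a b = - k a + 0 + k b" if "a \<in> ball x (min e1 e2)" "b \<in> ball x (min e1 e2)" for a b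
    proof -
      have "w a b = - w x a + w x b"
        using cocycle_onD[OF e2(2), of a x b] cocycle_on_sym[OF e2(2), of x a] that e2(1) by auto
      then show ?thesis using e1 that by (auto simp: group_add_simps simp del: add_uminus_conv_diff)
    qed
    then show "\<exists>e>0. \<forall>a\<in>ball x e \<inter> UNIV. \<forall>b\<in>ball x e \<inter> UNIV. w a b = - k a + 0 + k b"
      using e1 e2 by (intro exI[of _ "min e1 e2"]) auto
  qed
  then show ?thesis by (rule that)
qed

lemma locally_constant_on_connected:
  assumes "connected A" "a \<in> A" "b \<in> A"
    and "\<And>x. x \<in> A \<Longrightarrow> \<exists>e>0. \<forall>y\<in>ball x e \<inter> A. f y = f x"
  shows "f a = f (b::'a::metric_space)"
proof (rule connected_local_const[OF assms(1-3)], rule ballI)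
  fix x assume x: "x \<in> A"
  obtain e where "e > 0" "\<forall>y\<in>ball x e \<inter> A. f y = f x" using assms(4)[OF x] by blast
  then show "\<forall>\<^sub>F y in at x within A. f x = f y"
    unfolding eventually_at by (intro exI[of _ e]) (auto simp: dist_commute)
qed

text \<open>Sections behave like potentials, but only their values on \<open>T\<close> are under
  control, so \<open>- s a + s b\<close> is not meaningful elsewhere. Each point \<open>x\<close>
  therefore gets a reference section \<open>\<sigma> x\<close>, and the value of \<open>s\<close> at
  \<open>x\<close> is replaced by the constant by which \<open>s\<close> differs from
  \<open>\<sigma> x\<close> near \<open>x\<close>. On \<open>T\<close> the reference is 0 and this
  constant is \<open>s x\<close> itself.\<close>

lemma sections_cocycle:
  fixes sec :: "'a::real_normed_vector set \<Rightarrow> ('a \<Rightarrow> 'g::group_add) \<Rightarrow> bool"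
  assumes X: "open X" and dense: "X \<subseteq> closure T"
    and restr: "\<And>U V s. sec U s \<Longrightarrow> V \<subseteq> U \<Longrightarrow> open V \<Longrightarrow> sec V s"
    and uniq: "\<And>U s s' x. sec U s \<Longrightarrow> sec U s' \<Longrightarrow> x \<in> U \<Longrightarrow> U \<subseteq> X \<Longrightarrow> open U \<Longrightarrow>
       \<exists>g\<in>H. \<exists>e>0. \<forall>z\<in>ball x e \<inter> T. s' z = g + s z"
    and ex: "\<And>x. x \<in> X \<Longrightarrow> \<exists>e>0. ball x e \<subseteq> X \<and> (\<exists>s. sec (ball x e) s)"
    and zero: "\<And>x. x \<in> T \<Longrightarrow> \<exists>e>0. sec (ball x e) (\<lambda>_. 0)"
    and H: "\<And>g h. g \<in> H \<Longrightarrow> h \<in> H \<Longrightarrow> - g + h \<in> H"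
  obtains w where "cocycle X w"
    "\<And>x e s. ball x e \<subseteq> X \<Longrightarrow> sec (ball x e) s \<Longrightarrow> \<exists>\<kappa>. (\<forall>a\<in>ball x e \<inter> T. \<kappa> a = s a) \<and>
       (\<forall>a\<in>ball x e. \<kappa> a \<in> H) \<and> (\<forall>a\<in>ball x e. \<forall>b\<in>ball x e. w a b = - \<kappa> a + \<kappa> b)"
proof -
  define near where "near x g s s' \<longleftrightarrow> (\<exists>e>0. \<forall>z\<in>ball x e \<inter> T. s' z = g + s z)" for x :: 'a and g :: 'g and s s'
  have near_uniq: "g = g'" if "near x g s s'" "near x g' s s'" "x \<in> X" for x g g' s s'
  proof -
    obtain e e' where e: "e > 0" "e' > 0" "\<forall>z\<in>ball x e \<inter> T. s' z = g + s z" "\<forall>z\<in>ball x e' \<inter> T. s' z = g' + s z"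
      using \<open>near x g s s'\<close> \<open>near x g' s s'\<close> unfolding near_def by blast
    obtain z where "z \<in> T" "z \<in> ball x (min e e')"
      using dense_in_ball[OF dense \<open>x \<in> X\<close>, of "min e e'"] e by auto
    then have "g + s z = g' + s z" using e by (metis IntI ball_min IntD1 IntD2)
    then show ?thesis by simp
  qed
  define \<sigma> where "\<sigma> x = (if x \<in> T then (\<lambda>_. 0) else (SOME s. \<exists>e>0. sec (ball x e) s))" for x
  have \<sigma>: "\<exists>e>0. sec (ball x e) (\<sigma> x)" if "x \<in> X" for x
  proof (cases "x \<in> T")
    case False
    have "\<exists>s. \<exists>e>0. sec (ball x e) s" using ex[OF that] by blast
    from someI_ex[OF this] show ?thesis using False by (simp add: \<sigma>_def)
  qed (use zero in \<open>simp add: \<sigma>_def\<close>)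
  define \<kappa> where "\<kappa> s x = (THE g. near x g (\<sigma> x) s)" for s x
  have \<kappa>: "near x (\<kappa> s x) (\<sigma> x) s \<and> \<kappa> s x \<in> H" if s: "sec U s" "x \<in> U" "U \<subseteq> X" "open U" for U s x
  proof -
    have xX: "x \<in> X" using s by blast
    obtain e where e: "e > 0" "sec (ball x e) (\<sigma> x)" using \<sigma>[OF xX] by blast
    obtain r where r: "r > 0" "ball x r \<subseteq> U" using s by (meson open_contains_ball)
    let ?B = "ball x (min e r)"
    have "sec ?B (\<sigma> x)" by (rule restr[OF e(2)]) auto
    moreover have "sec ?B s" by (rule restr[OF s(1)]) (use r in auto)
    moreover have "?B \<subseteq> X" using r s by (auto simp: ball_min)
    ultimately obtain g where g: "g \<in> H" "near x g (\<sigma> x) s"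
      using uniq[of ?B "\<sigma> x" s x] e r s unfolding near_def by auto
    have "\<kappa> s x = g" unfolding \<kappa>_def using g near_uniq[OF _ _ xX] by blast
    then show ?thesis using g by simp
  qed
  have \<kappa>T: "\<kappa> s x = s x" if "sec U s" "x \<in> U" "U \<subseteq> X" "open U" "x \<in> T" for U s x
    using \<kappa>[OF that(1-4)] that(5) by (auto simp: near_def \<sigma>_def dest!: bspec[of _ _ x])
  \<comment> \<open>The intersection of two balls is convex, so the two sections differ on it by a
    single left constant, which drops out of \<open>- \<kappa> s a + \<kappa> s b\<close>.\<close>
  have const: "- \<kappa> s a + \<kappa> s b = - \<kappa> s' a + \<kappa> s' b"
    if s: "sec (ball x e) s" "ball x e \<subseteq> X" and s': "sec (ball x' e') s'" "ball x' e' \<subseteq> X"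
      and a: "a \<in> ball x e" "a \<in> ball x' e'" and b: "b \<in> ball x e" "b \<in> ball x' e'" for x e x' e' s s' a b
  proof -
    let ?C = "ball x e \<inter> ball x' e'"
    have C: "open ?C" "?C \<subseteq> X" "connected ?C" using s by (auto intro: convex_connected convex_Int)
    have ss: "sec ?C s" "sec ?C s'" using restr s s' C by auto
    have "\<kappa> s' a - \<kappa> s a = \<kappa> s' b - \<kappa> s b"
    proof (rule locally_constant_on_connected[OF C(3)])
      fix y assume y: "y \<in> ?C"
      obtain g where "near y g s s'"
        using uniq[OF ss y C(2,1)] unfolding near_def by blast
      then obtain r where r: "r > 0" "\<forall>z\<in>ball y r \<inter> T. s' z = g + s z" by (auto simp: near_def)
      have diff: "\<kappa> s' z - \<kappa> s z = g" if z: "z \<in> ball y r \<inter> ?C" for z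
      proof -
        have zX: "z \<in> X" using z C by auto
        obtain e1 e2 where e: "e1 > 0" "e2 > 0" "\<forall>z'\<in>ball z e1 \<inter> T. s z' = \<kappa> s z + \<sigma> z z'"
          "\<forall>z'\<in>ball z e2 \<inter> T. s' z' = \<kappa> s' z + \<sigma> z z'"
          using \<kappa>[OF ss(1) _ C(2,1), of z] \<kappa>[OF ss(2) _ C(2,1), of z] z unfolding near_def by auto
        obtain e3 where e3: "e3 > 0" "ball z e3 \<subseteq> ball y r" using z
          by (meson IntD1 open_ball open_contains_ball)
        obtain z' where z': "z' \<in> T" "z' \<in> ball z (min e1 (min e2 e3))"
          using dense_in_ball[OF dense zX, of "min e1 (min e2 e3)"] e e3 by auto
        then have "z' \<in> ball y r" using e3 by auto
        then have "s' z' = g + s z'" using r z' by blast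
        moreover have "s z' = \<kappa> s z + \<sigma> z z'" "s' z' = \<kappa> s' z + \<sigma> z z'" using e z' by (auto simp: ball_min)
        ultimately have "\<kappa> s' z + \<sigma> z z' = g + (\<kappa> s z + \<sigma> z z')" by metis
        then have "\<kappa> s' z = g + \<kappa> s z" by (metis add.assoc add_right_cancel)
        then show ?thesis by (simp add: add_diff_eq[symmetric])
      qed
      show "\<exists>r>0. \<forall>z\<in>ball y r \<inter> ?C. \<kappa> s' z - \<kappa> s z = \<kappa> s' y - \<kappa> s y"
        using diff r(1) y by (intro exI[of _ r]) auto
    qed (use a b in auto)
    then have "\<kappa> s' b = \<kappa> s' a - \<kappa> s a + \<kappa> s b" by simp
    then show ?thesis by (simp add: group_add_simps del: add_uminus_conv_diff)
  qed
  define Q where "Q a b g \<longleftrightarrow> (\<exists>x e s. sec (ball x e) s \<and> ball x e \<subseteq> X \<and> a \<in> ball x e \<and> b \<in> ball x e \<and>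
    g = - \<kappa> s a + \<kappa> s b)" for a b g
  define w where "w a b = (THE g. Q a b g)" for a b
  have w: "w a b = - \<kappa> s a + \<kappa> s b" if "sec (ball x e) s" "ball x e \<subseteq> X" "a \<in> ball x e" "b \<in> ball x e"
    for a b x e s
    unfolding w_def
  proof (rule the_equality)
    show "Q a b (- \<kappa> s a + \<kappa> s b)" using that unfolding Q_def by blast
    fix g assume "Q a b g"
    then show "g = - \<kappa> s a + \<kappa> s b" unfolding Q_def using const[OF that(1,2)] that(3,4) by metis
  qed
  show ?thesis
  proof (rule that)
    show "cocycle X w"
      unfolding cocycle_def
    proof
      fix x assume "x \<in> X"
      then obtain e s where e: "e > 0" "ball x e \<subseteq> X" "sec (ball x e) s" using ex by blast
      then show "\<exists>e>0. cocycle_on (ball x e) w"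
        by (intro exI[of _ e]) (auto simp: cocycle_on_def w[OF e(3,2)] group_add_simps simp del: add_uminus_conv_diff)
    qed
    fix x e s assume B: "ball x e \<subseteq> X" and s: "sec (ball x e) s"
    show "\<exists>\<kappa>. (\<forall>a\<in>ball x e \<inter> T. \<kappa> a = s a) \<and> (\<forall>a\<in>ball x e. \<kappa> a \<in> H) \<and>
      (\<forall>a\<in>ball x e. \<forall>b\<in>ball x e. w a b = - \<kappa> a + \<kappa> b)"
      by (rule exI[of _ "\<kappa> s"]) (use \<kappa>[OF s _ B] \<kappa>T[OF s _ B] w[OF s B] in auto)
  qed
qed

section \<open>Local structure of a regular projection\<close>

lemma support_eq: "support D = (\<Union>(vs, i)\<in>Sigma (set D) (\<lambda>vs. {..<length vs}). edge vs i)"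
  unfolding support_def polygon_image_def by auto

lemma finite_edges: "finite (Sigma (set D) (\<lambda>vs. {..<length vs}))"
  by auto

lemma compact_support: "compact (support D)"
  unfolding support_eq by (rule compact_UN[OF finite_edges]) (auto simp: edge_def)

lemma pred_index: "i < n \<Longrightarrow> \<exists>j<n. Suc j mod n = i" for i n :: nat
  by (cases i) (auto intro: exI[of _ "n - 1"] exI[of _ "i - 1"] simp: Suc_lessD)

lemma polygonal_link_same_polygon:
  assumes D: "polygonal_link D" and "vs \<in> set D" "vs' \<in> set D" "z \<in> polygon_image vs" "z \<in> polygon_image vs'"
  shows "vs' = vs"
proof (rule ccontr)
  assume ne: "vs' \<noteq> vs"
  obtain a b where "a < length D" "b < length D" "vs = D ! a" "vs' = D ! b"
    using assms by (metis in_set_conv_nth)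
  then have "disjnt (polygon_image vs) (polygon_image vs')"
    using D ne unfolding polygonal_link_def by metis
  then show False using assms by (auto simp: disjnt_def)
qed

text \<open>At a vertex the two segments are the adjacent edges, at any other point the two halves
  of its edge. No further edge contains \<open>z\<close>, because polygons are simple and components
  disjoint; since there are finitely many edges, a whole ball is free of the others.\<close>

lemma germ:
  assumes D: "polygonal_link D" and z: "z \<in> support D"
  obtains V1 V2 where
    "closed_segment z (z + V1) \<subseteq> support D" "closed_segment z (z + V2) \<subseteq> support D"
    "\<exists>e>0. support D \<inter> ball z e \<subseteq> closed_segment z (z + V1) \<union> closed_segment z (z + V2)"
    "closed_segment z (z + V1) \<inter> closed_segment z (z + V2) = {z}"
    "z + V1 \<in> vertices D" "z + V2 \<in> vertices D" "V1 \<noteq> 0" "V2 \<noteq> 0"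
    "z \<notin> vertices D \<Longrightarrow> \<exists>c>0. V2 = - c *\<^sub>R V1"
proof -
  define I where "I = Sigma (set D) (\<lambda>vs. {..<length vs})"
  define K where "K = {(vs, i) \<in> I. z \<notin> edge vs i}"
  have "finite K" unfolding K_def I_def by (rule finite_subset[OF _ finite_edges[of D]]) auto
  then have "closed (\<Union>(vs, i)\<in>K. edge vs i)" by (intro closed_UN) (auto simp: edge_def)
  then have "open (- (\<Union>(vs, i)\<in>K. edge vs i))" by (simp add: open_closed)
  moreover have "z \<in> - (\<Union>(vs, i)\<in>K. edge vs i)" by (auto simp: K_def)
  ultimately obtain e where e: "e > 0" "ball z e \<subseteq> - (\<Union>(vs, i)\<in>K. edge vs i)"
    by (meson open_contains_ball)
  have loc: "support D \<inter> ball z e \<subseteq> S"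
    if "\<And>vs i. vs \<in> set D \<Longrightarrow> i < length vs \<Longrightarrow> z \<in> edge vs i \<Longrightarrow> edge vs i \<subseteq> S" for S
    using e(2) that unfolding support_eq K_def I_def by fastforce
  have simple: "simple_polygon vs" if "vs \<in> set D" for vs
    using D that by (auto simp: polygonal_link_def)
  have in_poly: "z \<in> polygon_image vs" if "i < length vs" "z \<in> edge vs i" for vs i
    using that by (auto simp: polygon_image_def)
  have edge_supp: "edge vs i \<subseteq> support D" if "vs \<in> set D" "i < length vs" for vs i
    using that unfolding support_eq by fastforce
  show ?thesis
  proof (cases "z \<in> vertices D")
    case True
    then obtain vs i where vs: "vs \<in> set D" "i < length vs" and zi: "z = vs ! i"
      by (auto simp: vertices_def in_set_conv_nth)
    let ?n = "length vs"
    have s: "3 \<le> ?n" "distinct vs"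
      "\<And>i j. i < ?n \<Longrightarrow> j < ?n \<Longrightarrow> i \<noteq> j \<Longrightarrow> edge vs i \<inter> edge vs j = edge_ends vs i \<inter> edge_ends vs j"
      using simple[OF vs(1)] by (auto simp: simple_polygon_def)
    obtain j where j: "j < ?n" "Suc j mod ?n = i" using pred_index vs by blast
    have sn: "Suc k mod ?n < ?n" for k by (rule mod_less_divisor) (use vs(2) in linarith)
    have ij: "i \<noteq> j" "Suc i mod ?n \<noteq> i" "Suc i mod ?n \<noteq> j"
    proof -
      show "i \<noteq> j" "Suc i mod ?n \<noteq> i" using j s(1) by (auto simp: mod_Suc split: if_splits)
      show "Suc i mod ?n \<noteq> j" using j s(1) vs(2) by (auto simp: mod_Suc split: if_splits)
    qed
    define V1 where "V1 = vs ! (Suc i mod ?n) - z"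
    define V2 where "V2 = vs ! j - z"
    have e1: "edge vs i = closed_segment z (z + V1)" unfolding edge_def V1_def zi by simp
    have e2: "edge vs j = closed_segment z (z + V2)" unfolding edge_def V2_def zi j(2)
      by (simp add: closed_segment_commute)
    have "edge vs i \<inter> edge vs j = {z}"
      using s(3)[OF vs(2) j(1) ij(1)] ij nth_eq_iff_index_eq[OF s(2)] sn[of i] j vs(2)
      unfolding edge_ends_def zi by auto
    moreover have "support D \<inter> ball z e \<subseteq> edge vs i \<union> edge vs j"
    proof (rule loc)
      fix vs' k assume k: "vs' \<in> set D" "k < length vs'" "z \<in> edge vs' k"
      have zi': "z \<in> edge vs i" by (simp add: e1)
      have [simp]: "vs' = vs"
        using polygonal_link_same_polygon[OF D vs(1) k(1) in_poly[OF vs(2) zi'] in_poly[OF k(2,3)]] .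
      have "k = i \<or> k = j"
      proof (rule ccontr)
        assume "\<not> (k = i \<or> k = j)"
        then have "k \<noteq> i" "k \<noteq> j" by auto
        then have "z \<in> edge_ends vs k" using s(3)[of k i] k vs zi' by auto
        then consider "vs ! i = vs ! k" | "vs ! i = vs ! (Suc k mod ?n)" unfolding edge_ends_def zi by blast
        then show False
        proof cases
          case 1
          then show False using nth_eq_iff_index_eq[OF s(2) vs(2)] k \<open>k \<noteq> i\<close> by auto
        next
          case 2
          then have "Suc k mod ?n = Suc j mod ?n" using nth_eq_iff_index_eq[OF s(2) vs(2) sn] j by auto
          then show False using k j \<open>k \<noteq> j\<close> by (auto simp: mod_Suc split: if_splits)
        qed
      qed
      then show "edge vs' k \<subseteq> edge vs i \<union> edge vs j" by auto
    qed
    moreover have "V1 \<noteq> 0" "V2 \<noteq> 0"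
      unfolding V1_def V2_def zi using nth_eq_iff_index_eq[OF s(2)] vs(2) ij j(1) sn[of i] by auto
    moreover have "z + V1 \<in> vertices D" "z + V2 \<in> vertices D"
      unfolding V1_def V2_def vertices_def using vs(1) nth_mem[OF j(1)] nth_mem[OF sn[of i]] by auto
    ultimately show ?thesis
      using that[of V1 V2] e(1) edge_supp[OF vs] edge_supp[OF vs(1) j(1)] True unfolding e1 e2 by blast
  next
    case False
    obtain vs i where vs: "vs \<in> set D" "i < length vs" and zi: "z \<in> edge vs i"
      using z unfolding support_eq by auto
    let ?n = "length vs"
    define A B where "A = vs ! i" and "B = vs ! (Suc i mod ?n)"
    have "Suc i mod ?n < ?n" by (rule mod_less_divisor) (use vs(2) in linarith)
    then have AB: "A \<in> vertices D" "B \<in> vertices D"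
      unfolding A_def B_def vertices_def using vs nth_mem by blast+
    have e1: "edge vs i = closed_segment A B" by (simp add: edge_def A_def B_def)
    have zAB: "z \<in> closed_segment A B" "z \<noteq> A" "z \<noteq> B" using zi e1 AB False by auto
    have un: "closed_segment z (z + (B - z)) \<union> closed_segment z (z + (A - z)) = edge vs i"
      using Un_closed_segment[OF zAB(1)] by (simp add: e1 closed_segment_commute Un_commute)
    have int: "closed_segment z (z + (B - z)) \<inter> closed_segment z (z + (A - z)) = {z}"
      using Int_closed_segment[of z A B] zAB(1) by (simp add: closed_segment_commute Int_commute)
    have "support D \<inter> ball z e \<subseteq> edge vs i"
    proof (rule loc)
      fix vs' k assume k: "vs' \<in> set D" "k < length vs'" "z \<in> edge vs' k"
      have [simp]: "vs' = vs"
        using polygonal_link_same_polygon[OF D vs(1) k(1) in_poly[OF vs(2) zi] in_poly[OF k(2,3)]] .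
      have "k = i"
      proof (rule ccontr)
        assume "k \<noteq> i"
        then have "z \<in> edge_ends vs i"
          using simple[OF vs(1)] k vs zi unfolding simple_polygon_def by auto
        then show False using zAB by (auto simp: edge_ends_def A_def B_def)
      qed
      then show "edge vs' k \<subseteq> edge vs i" by simp
    qed
    moreover have "\<exists>c>0. A - z = - c *\<^sub>R (B - z)"
    proof -
      obtain u where u: "0 \<le> u" "u \<le> 1" "z = (1 - u) *\<^sub>R A + u *\<^sub>R B"
        using zAB(1) by (auto simp: in_segment)
      have u': "u \<noteq> 0" "u \<noteq> 1" using u zAB by auto
      have "A - z = - u *\<^sub>R (B - A)" "B - z = (1 - u) *\<^sub>R (B - A)" using u by (simp_all add: algebra_simps)
      then have "A - z = - (u / (1 - u)) *\<^sub>R (B - z)" using u' by simp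
      then show ?thesis using u u' by (intro exI[of _ "u / (1 - u)"]) auto
    qed
    ultimately show ?thesis
      using that[of "B - z" "A - z"] int un e(1) AB zAB edge_supp[OF vs] by auto
  qed
qed

section \<open>Plane geometry of the projected strands\<close>

definition det2 :: "real^2 \<Rightarrow> real^2 \<Rightarrow> real" where
  "det2 x y = x$1 * y$2 - x$2 * y$1"

lemma vec2_eq_iff: "x = y \<longleftrightarrow> x$1 = y$1 \<and> x$2 = (y::real^2)$2"
  by (simp add: vec_eq_iff forall_2)

lemma det2_zero_parallel:
  assumes "det2 x y = 0" "x \<noteq> 0" obtains c where "y = c *\<^sub>R x"
proof (cases "x$1 = 0")
  case True
  then have "x$2 \<noteq> 0" using assms(2) by (simp add: vec2_eq_iff)
  then show ?thesis using assms(1) True by (intro that[of "y$2 / x$2"]) (auto simp: vec2_eq_iff det2_def)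
next
  case False
  then show ?thesis using assms(1) by (intro that[of "y$1 / x$1"]) (auto simp: vec2_eq_iff det2_def field_simps)
qed

text \<open>Cramer's rule gives the dual coordinates.\<close>

lemma det2_basis:
  assumes "det2 d e \<noteq> 0"
  obtains al be where "linear al" "linear be" "al d = 1" "al e = 0" "be d = 0" "be e = (1::real)"
    "\<And>q. q = al q *\<^sub>R d + be q *\<^sub>R e"
proof (rule that[of "\<lambda>q. det2 q e / det2 d e" "\<lambda>q. det2 d q / det2 d e"])
  show "linear (\<lambda>q. det2 q e / det2 d e)" "linear (\<lambda>q. det2 d q / det2 d e)"
    by (rule linearI; simp add: det2_def add_divide_distrib[symmetric] algebra_simps)+
  show "q = (det2 q e / det2 d e) *\<^sub>R d + (det2 d q / det2 d e) *\<^sub>R e" for q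
  proof -
    have "det2 d e * q$i = det2 q e * d$i + det2 d q * e$i" if "i = 1 \<or> i = 2" for i :: 2
      using that by (auto simp: det2_def algebra_simps)
    then have "q$i = det2 q e / det2 d e * d$i + det2 d q / det2 d e * e$i" if "i = 1 \<or> i = 2" for i :: 2
      using assms that by (simp add: field_simps)
    then show ?thesis by (simp add: vec2_eq_iff)
  qed
qed (use assms in \<open>auto simp: det2_def\<close>)

locale regular_diagram =
  fixes D :: diagram
  assumes pl: "polygonal_link D" and rp: "regular_projection D"
begin

abbreviation "L \<equiv> support D"

lemma vertex_proj: "x \<in> vertices D \<Longrightarrow> y \<in> L \<Longrightarrow> fst x = fst y \<Longrightarrow> x = y"
  using rp unfolding regular_projection_def by blast

lemma no_triple: "x \<in> L \<Longrightarrow> y \<in> L \<Longrightarrow> z \<in> L \<Longrightarrow> fst x = fst y \<Longrightarrow> fst y = fst z \<Longrightarrow> x = y \<or> y = z \<or> x = z"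
  using rp unfolding regular_projection_def by blast

lemma segI: "0 \<le> t \<Longrightarrow> t \<le> 1 \<Longrightarrow> z + t *\<^sub>R V \<in> closed_segment z (z + V)" for z V :: space
  unfolding closed_segment_def by (auto intro!: exI[of _ t] simp: algebra_simps)

lemma segE: assumes "y \<in> closed_segment z (z + V)" obtains t where "0 \<le> t" "t \<le> 1" "y = z + t *\<^sub>R (V::space)"
  using assms unfolding closed_segment_def by (auto simp: algebra_simps)

text \<open>The two directions cannot project to the same direction: the vertex ending the shorter
  projection would lie over or under another point of the link. So the projections are opposite or
  independent, and opposite ones can be made equal up to sign by rescaling. The vertices at both
  ends of a straight strand are recorded for \<open>crossing_transverse\<close>.\<close>

lemma strand:
  assumes z: "z \<in> L"
  obtains V1 V2 \<tau> e where
    "fst V1 \<noteq> 0" "fst V2 = - fst V1 \<or> det2 (fst V1) (fst V2) \<noteq> 0" "\<tau> > 0" "e > 0"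
    "\<And>t. 0 \<le> t \<Longrightarrow> t \<le> \<tau> \<Longrightarrow> z + t *\<^sub>R V1 \<in> L \<and> z + t *\<^sub>R V2 \<in> L"
    "\<And>y. y \<in> L \<Longrightarrow> y \<in> ball z e \<Longrightarrow> \<exists>t\<ge>0. y = z + t *\<^sub>R V1 \<or> y = z + t *\<^sub>R V2"
    "z \<notin> vertices D \<Longrightarrow> V2 = - V1 \<and> (\<exists>a>0. \<exists>b>0. z + a *\<^sub>R V1 \<in> vertices D \<and> z - b *\<^sub>R V1 \<in> vertices D \<and>
       (\<forall>t. -b \<le> t \<longrightarrow> t \<le> a \<longrightarrow> z + t *\<^sub>R V1 \<in> L))"
proof -
  obtain V1 V2 e where V: "closed_segment z (z + V1) \<subseteq> L" "closed_segment z (z + V2) \<subseteq> L" "e > 0"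
    "L \<inter> ball z e \<subseteq> closed_segment z (z + V1) \<union> closed_segment z (z + V2)"
    "closed_segment z (z + V1) \<inter> closed_segment z (z + V2) = {z}"
    "z + V1 \<in> vertices D" "z + V2 \<in> vertices D" "V1 \<noteq> 0" "V2 \<noteq> 0"
    "z \<notin> vertices D \<Longrightarrow> \<exists>c>0. V2 = - c *\<^sub>R V1"
    using germ[OF pl z] by metis
  have nv: "fst V1 \<noteq> 0" "fst V2 \<noteq> 0"
    using vertex_proj[OF V(6) z] vertex_proj[OF V(7) z] V(8,9) by auto
  have in1: "z + t *\<^sub>R V1 \<in> closed_segment z (z + V1)" and in2: "z + t *\<^sub>R V2 \<in> closed_segment z (z + V2)"
    if "0 \<le> t" "t \<le> 1" for t using segI that by auto
  have npos: False if c: "fst V2 = c *\<^sub>R fst V1" "c > 0" for c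
  proof (cases "c \<ge> 1")
    case True
    have i: "z + (1/c) *\<^sub>R V2 \<in> closed_segment z (z + V2)" using in2[of "1/c"] True by auto
    have "z + V1 = z + (1/c) *\<^sub>R V2"
      by (rule vertex_proj) (use V(6) V(2) i c in auto)
    then have "z + V1 \<in> {z}" using V(5) i ends_in_segment(2)[of "z + V1" z] by (metis IntI)
    then show False using V(8) by simp
  next
    case False
    have i: "z + c *\<^sub>R V1 \<in> closed_segment z (z + V1)" using in1[of c] False c by auto
    have "z + V2 = z + c *\<^sub>R V1"
      by (rule vertex_proj) (use V(7) V(1) i c in auto)
    then have "z + V2 \<in> {z}" using V(5) i ends_in_segment(2)[of "z + V2" z] by (metis IntI)
    then show False using V(9) by simp
  qed
  have cases: "(\<exists>c>0. fst V2 = - c *\<^sub>R fst V1) \<or> det2 (fst V1) (fst V2) \<noteq> 0"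
  proof (cases "det2 (fst V1) (fst V2) = 0")
    case True
    then obtain c where c: "fst V2 = c *\<^sub>R fst V1" using det2_zero_parallel nv by blast
    moreover have "c \<noteq> 0" using nv c by auto
    moreover have "\<not> c > 0" using npos c by auto
    ultimately show ?thesis by (intro disjI1 exI[of _ "-c"]) auto
  qed simp
  show ?thesis
  proof (cases "\<exists>c>0. fst V2 = - c *\<^sub>R fst V1")
    case True
    then obtain c where c: "c > 0" "fst V2 = - c *\<^sub>R fst V1" by blast
    \<comment> \<open>Rescaled so that the projection is exactly \<open>- fst V1\<close>. The
      parameter along \<open>W\<close> may run up to \<open>c\<close>, whence
      \<open>min 1 c\<close>.\<close>
    define W where "W = (1/c) *\<^sub>R V2"
    show ?thesis
    proof (rule that[of V1 W "min 1 c" e])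
      show "fst W = - fst V1 \<or> det2 (fst V1) (fst W) \<noteq> 0" using c by (simp add: W_def)
      show "z + t *\<^sub>R V1 \<in> L \<and> z + t *\<^sub>R W \<in> L" if "0 \<le> t" "t \<le> min 1 c" for t
        using in1[of t] in2[of "t/c"] V(1,2) that c by (auto simp: W_def field_simps)
      show "\<exists>t\<ge>0. y = z + t *\<^sub>R V1 \<or> y = z + t *\<^sub>R W" if y: "y \<in> L" "y \<in> ball z e" for y
      proof -
        consider "y \<in> closed_segment z (z + V1)" | "y \<in> closed_segment z (z + V2)" using y V(4) by blast
        then show ?thesis
        proof cases
          case 1 then show ?thesis by (auto elim!: segE)
        next
          case 2
          then obtain t where "0 \<le> t" "y = z + t *\<^sub>R V2" by (auto elim!: segE)
          then show ?thesis using c by (intro exI[of _ "t*c"]) (auto simp: W_def)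
        qed
      qed
      assume "z \<notin> vertices D"
      then obtain c2 where c2: "c2 > 0" "V2 = - c2 *\<^sub>R V1" using V(10) by blast
      then have "c2 *\<^sub>R fst V1 = c *\<^sub>R fst V1" using c by simp
      then have c2c: "c2 = c" using nv by simp
      have W: "W = - V1" using c2 c c2c by (simp add: W_def)
      have "z + t *\<^sub>R V1 \<in> L" if t: "-c \<le> t" "t \<le> 1" for t
      proof (cases "t \<ge> 0")
        case True then show ?thesis using in1[of t] V(1) t by auto
      next
        case False
        then have "0 \<le> -t/c" "-t/c \<le> 1" using t c by (auto simp: field_simps)
          then have "z + (-t/c) *\<^sub>R V2 \<in> L" using in2[of "-t/c"] V(2) by blast
        then show ?thesis using c2 c2c c by simp
      qed
      moreover have "z - c *\<^sub>R V1 \<in> vertices D" using V(7) c2 c2c by simp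
      ultimately show "W = - V1 \<and> (\<exists>a>0. \<exists>b>0. z + a *\<^sub>R V1 \<in> vertices D \<and> z - b *\<^sub>R V1 \<in> vertices D \<and>
         (\<forall>t. -b \<le> t \<longrightarrow> t \<le> a \<longrightarrow> z + t *\<^sub>R V1 \<in> L))"
        using W c V(6) by (intro conjI exI[of _ 1] exI[of _ c]) auto
    qed (use nv V(3) c in auto)
  next
    case False
    then have det: "det2 (fst V1) (fst V2) \<noteq> 0" using cases by blast
    show ?thesis
    proof (rule that[of V1 V2 1 e])
      show "z + t *\<^sub>R V1 \<in> L \<and> z + t *\<^sub>R V2 \<in> L" if "0 \<le> t" "t \<le> 1" for t
        using in1[of t] in2[of t] V(1,2) that by auto
      show "\<exists>t\<ge>0. y = z + t *\<^sub>R V1 \<or> y = z + t *\<^sub>R V2" if y: "y \<in> L" "y \<in> ball z e" for y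
        using y V(4) by (force elim!: segE)
      assume "z \<notin> vertices D"
      then have False using V(10) False by force
      then show "V2 = - V1 \<and> (\<exists>a>0. \<exists>b>0. z + a *\<^sub>R V1 \<in> vertices D \<and> z - b *\<^sub>R V1 \<in> vertices D \<and>
         (\<forall>t. -b \<le> t \<longrightarrow> t \<le> a \<longrightarrow> z + t *\<^sub>R V1 \<in> L))" ..
    qed (use nv V(3) det in auto)
  qed
qed

text \<open>Of two projected edges leaving the same point in the same direction, one ends first (or
  both together); its end vertex has the same projection as a point of the other edge, and
  regularity makes these two points equal.\<close>

lemma overlap_point:
  assumes uv: "fst u = fst v" and ab: "a > 0" "a' > 0" "k > 0"
    and "u + a *\<^sub>R V \<in> vertices D" "v + a' *\<^sub>R W \<in> vertices D"
    and u: "\<And>t. 0 \<le> t \<Longrightarrow> t \<le> a \<Longrightarrow> u + t *\<^sub>R V \<in> L" and v: "\<And>t. 0 \<le> t \<Longrightarrow> t \<le> a' \<Longrightarrow> v + t *\<^sub>R W \<in> L"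
    and k: "fst W = k *\<^sub>R fst V"
  obtains t where "t > 0" "u + t *\<^sub>R V = v + (t/k) *\<^sub>R W"
proof (cases "a \<le> k * a'")
  case True
  then have "v + (a/k) *\<^sub>R W \<in> L" using ab v[of "a/k"] by (auto simp: field_simps)
  then have "u + a *\<^sub>R V = v + (a/k) *\<^sub>R W" using assms by (intro vertex_proj) auto
  then show ?thesis using that ab by blast
next
  case False
  then have "u + (k * a') *\<^sub>R V \<in> L" using ab u[of "k * a'"] by auto
  then have "v + a' *\<^sub>R W = u + (k * a') *\<^sub>R V" using assms by (intro vertex_proj) auto
  then show ?thesis using that[of "k * a'"] ab by auto
qed

text \<open>If the projections were parallel, \<open>overlap_point\<close> in both directions would
  make the two lines meet at a positive and at a negative parameter. Their difference is affine in
  the parameter, with opposite signs in the two equations; this forces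
  \<open>V = (1/k) *\<^sub>R W\<close> and \<open>u = v\<close>.\<close>

lemma crossing_transverse:
  assumes uv: "fst u = fst v" "u \<noteq> v" and nz: "fst V \<noteq> 0" "fst W \<noteq> 0"
    and ab: "a > 0" "b > 0" "u + a *\<^sub>R V \<in> vertices D" "u - b *\<^sub>R V \<in> vertices D"
    and u: "\<And>t. -b \<le> t \<Longrightarrow> t \<le> a \<Longrightarrow> u + t *\<^sub>R V \<in> L"
    and ab': "a' > 0" "b' > 0" "v + a' *\<^sub>R W \<in> vertices D" "v - b' *\<^sub>R W \<in> vertices D"
    and v: "\<And>t. -b' \<le> t \<Longrightarrow> t \<le> a' \<Longrightarrow> v + t *\<^sub>R W \<in> L"
  shows "det2 (fst V) (fst W) \<noteq> 0"
proof
  assume "det2 (fst V) (fst W) = 0"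
  then obtain k where k: "fst W = k *\<^sub>R fst V" using det2_zero_parallel nz by blast
  have main: False if k: "k > 0" "fst W = k *\<^sub>R fst V"
    and ab': "a' > 0" "b' > 0" "v + a' *\<^sub>R W \<in> vertices D" "v - b' *\<^sub>R W \<in> vertices D"
    and v: "\<And>t. -b' \<le> t \<Longrightarrow> t \<le> a' \<Longrightarrow> v + t *\<^sub>R W \<in> L" for k W a' b'
  proof -
    obtain t where t: "t > 0" "u + t *\<^sub>R V = v + (t/k) *\<^sub>R W"
      by (rule overlap_point[of u v a a' k V W]) (use assms(1) ab ab' k u v in auto)
    have u': "0 \<le> t \<Longrightarrow> t \<le> b \<Longrightarrow> u + t *\<^sub>R - V \<in> L" for t using u[of "-t"] ab by auto
    have v': "0 \<le> t \<Longrightarrow> t \<le> b' \<Longrightarrow> v + t *\<^sub>R - W \<in> L" for t using v[of "-t"] ab' by auto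
    obtain t' where t': "t' > 0" "u + t' *\<^sub>R (-V) = v + (t'/k) *\<^sub>R (-W)"
      by (rule overlap_point[of u v b b' k "-V" "-W"]) (use assms(1) ab ab' k u' v' in auto)
    have d: "t *\<^sub>R V - (t/k) *\<^sub>R W = v - u" "(t'/k) *\<^sub>R W - t' *\<^sub>R V = v - u"
      using t(2) t'(2) by (simp_all add: algebra_simps)
    define X where "X = V - (1/k) *\<^sub>R W"
    have "t *\<^sub>R X = v - u" "t' *\<^sub>R X = - (v - u)"
      using d by (simp_all add: X_def algebra_simps)
    then have "(t + t') *\<^sub>R X = 0" by (simp add: scaleR_left_distrib)
    then have "X = 0" using t(1) t'(1) by simp
    then have "V = (1/k) *\<^sub>R W" by (simp add: X_def)
    then have "u = v" using t(2) by simp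
    then show False using uv by simp
  qed
  have "k \<noteq> 0" using k nz by auto
  then consider "k > 0" | "k < 0" by linarith
  then show False
  proof cases
    case 1 then show ?thesis using main[OF _ k ab' v] by blast
  next
    case 2
    have "v + t *\<^sub>R - W \<in> L" if "- a' \<le> t" "t \<le> b'" for t using v[of "-t"] that by auto
    then show ?thesis using main[of "-k" "-W" b' a'] k ab' 2 by auto
  qed
qed

text \<open>A tube lemma: the part of the compact link outside the balls has a compact projection
  that misses \<open>p\<close>.\<close>

lemma fibre_nbhd:
  assumes "\<And>z. z \<in> L \<Longrightarrow> fst z = p \<Longrightarrow> e z > 0"
  obtains \<eta> where "\<eta> > 0" "\<And>y. y \<in> L \<Longrightarrow> dist p (fst y) < \<eta> \<Longrightarrow> \<exists>z\<in>L. fst z = p \<and> y \<in> ball z (e z)"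
proof -
  let ?C = "L - (\<Union>z\<in>{z\<in>L. fst z = p}. ball z (e z))"
  have "compact ?C" by (rule compact_diff[OF compact_support]) auto
  then have "compact (fst ` ?C)" by (rule compact_continuous_image[OF continuous_on_fst[OF continuous_on_id]])
  then have "open (- (fst ` ?C))" by (simp add: compact_imp_closed open_Compl)
  moreover have "p \<in> - (fst ` ?C)" using assms by fastforce
  ultimately obtain \<eta> where "\<eta> > 0" "ball p \<eta> \<subseteq> - (fst ` ?C)" by (meson open_contains_ball)
  note \<eta> = this
  have "\<exists>z\<in>L. fst z = p \<and> y \<in> ball z (e z)" if "y \<in> L" "dist p (fst y) < \<eta>" for y
  proof (rule ccontr)
    assume "\<not> ?thesis"
    then have "y \<in> ?C" using that(1) by auto
    then have "fst y \<in> fst ` ?C" by blast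
    then show False using \<eta>(2) that(2) by auto
  qed
  then show ?thesis using that \<eta>(1) by blast
qed

end

text \<open>
  The basis \<open>d, e\<close> of the plane with dual coordinates \<open>al, be\<close> gives four rays \<open>dir d e i\<close>,
  numbered counterclockwise; on the \<open>i\<close>-th ray \<open>par al be i\<close> is positive and \<open>nor al be i\<close> vanishes.
\<close>

definition par :: "('a \<Rightarrow> real) \<Rightarrow> ('a \<Rightarrow> real) \<Rightarrow> nat \<Rightarrow> 'a \<Rightarrow> real" where
  "par al be i = [al, be, \<lambda>q. - al q, \<lambda>q. - be q] ! i"

definition nor :: "('a \<Rightarrow> real) \<Rightarrow> ('a \<Rightarrow> real) \<Rightarrow> nat \<Rightarrow> 'a \<Rightarrow> real" where
  "nor al be i = [be, al, be, al] ! i"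

definition dir :: "'a::uminus \<Rightarrow> 'a \<Rightarrow> nat \<Rightarrow> 'a" where
  "dir d e i = [d, e, - d, - e] ! i"

lemma index4: "i < 4 \<longleftrightarrow> i = 0 \<or> i = 1 \<or> i = 2 \<or> i = (3::nat)"
  by auto

lemmas ray_defs = par_def nor_def dir_def

lemma dir_coord:
  assumes lin: "linear al" "linear be" and v: "al d = 1" "al e = 0" "be d = 0" "be e = (1::real)" and i: "i < 4"
  shows "al (t *\<^sub>R dir d e i) = t * [1,0,-1,0] ! i" "be (t *\<^sub>R dir d e i) = t * [0,1,0,-1] ! i"
  using i unfolding index4 dir_def
  by (elim disjE; simp add: v linear_scale[OF lin(1)] linear_scale[OF lin(2)] linear_neg[OF lin(1)] linear_neg[OF lin(2)])+

text \<open>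
  Above the parallelogram of size \<open>r\<close> around \<open>p\<close> the link consists of the half-lines issuing from
  the points \<open>Z i\<close> above \<open>p\<close>.  The alternatives of \<open>arm_cases\<close> are: no link above \<open>p\<close>, a straight
  strand, a corner, a crossing (whose upper strand is made of arms 0 and 2).
\<close>

definition arm_system where
  "arm_system L p al be d e r K Z V \<longleftrightarrow>
     linear al \<and> linear be \<and> al d = 1 \<and> al e = 0 \<and> be d = 0 \<and> be e = 1 \<and>
     (\<forall>q. al q *\<^sub>R d + be q *\<^sub>R e = q) \<and> 0 < r \<and> K \<subseteq> {..<4} \<and>
     (\<forall>i\<in>K. fst (Z i) = p \<and> fst (V i) = dir d e i) \<and>
     (\<forall>y::space. \<bar>al (fst y - p)\<bar> < r \<longrightarrow> \<bar>be (fst y - p)\<bar> < r \<longrightarrow>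
        (y \<in> L \<longleftrightarrow> (\<exists>i\<in>K. \<exists>t\<ge>0. y = Z i + t *\<^sub>R V i)))"

definition arm_cases :: "nat set \<Rightarrow> (nat \<Rightarrow> space) \<Rightarrow> bool" where
  "arm_cases K Z \<longleftrightarrow> K = {} \<or> K = {0, 2} \<and> Z 0 = Z 2 \<or> K = {0, 1} \<and> Z 0 = Z 1 \<or>
     K = {0, 1, 2, 3} \<and> Z 0 = Z 2 \<and> Z 1 = Z 3 \<and> snd (Z 1) < snd (Z 0)"

lemma arm_assemble:
  assumes de: "det2 d e \<noteq> 0" and K: "K \<subseteq> {..<4}"
    and ZV: "\<And>i. i \<in> K \<Longrightarrow> fst (Z i) = p \<and> fst (V i) = dir d e i"
    and \<tau>: "\<tau> > 0" "\<And>i t. i \<in> K \<Longrightarrow> 0 \<le> t \<Longrightarrow> t \<le> \<tau> \<Longrightarrow> Z i + t *\<^sub>R V i \<in> L"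
    and \<eta>: "\<eta> > 0" "\<And>y. y \<in> L \<Longrightarrow> dist p (fst y) < \<eta> \<Longrightarrow> \<exists>i\<in>K. \<exists>t\<ge>0. y = Z i + t *\<^sub>R V i"
  obtains al be r where "arm_system L p al be d e r K Z V"
proof -
  obtain al be where ab: "linear al" "linear be" "al d = 1" "al e = 0" "be d = 0" "be e = (1::real)"
    and q: "\<And>q. q = al q *\<^sub>R d + be q *\<^sub>R e" using det2_basis[OF de] by metis
  define M where "M = norm d + norm e"
  have "d \<noteq> 0" using ab linear_0[OF ab(1)] by auto
  then have M: "M > 0" unfolding M_def by (simp add: add_pos_nonneg)
  \<comment> \<open>\<open>\<eta> / M\<close> puts the parallelogram inside the disc of radius
    \<open>\<eta>\<close>, so that above it the link has no points off the arms;
    \<open>\<tau>\<close> keeps the arms inside the link.\<close>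
  define r where "r = min \<tau> (\<eta> / M)"
  have r: "r > 0" using \<tau> \<eta> M by (simp add: r_def)
  have "y \<in> L \<longleftrightarrow> (\<exists>i\<in>K. \<exists>t\<ge>0. y = Z i + t *\<^sub>R V i)"
    if y: "\<bar>al (fst y - p)\<bar> < r" "\<bar>be (fst y - p)\<bar> < r" for y
  proof
    assume yL: "y \<in> L"
    let ?q = "fst y - p"
    have "norm ?q \<le> norm (al ?q *\<^sub>R d) + norm (be ?q *\<^sub>R e)" by (subst q[of ?q]) (rule norm_triangle_ineq)
    also have "\<dots> = \<bar>al ?q\<bar> * norm d + \<bar>be ?q\<bar> * norm e" by simp
    also have "\<dots> < r * norm d + r * norm e"
      using y \<open>d \<noteq> 0\<close> by (intro add_less_le_mono mult_strict_right_mono mult_right_mono) auto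
    also have "\<dots> = r * M" by (simp add: M_def algebra_simps)
    also have "\<dots> \<le> (\<eta> / M) * M" using M by (intro mult_right_mono) (auto simp: r_def)
    also have "\<dots> = \<eta>" using M by simp
    finally show "\<exists>i\<in>K. \<exists>t\<ge>0. y = Z i + t *\<^sub>R V i"
      using \<eta>(2)[OF yL] by (simp add: dist_norm norm_minus_commute)
  next
    assume "\<exists>i\<in>K. \<exists>t\<ge>0. y = Z i + t *\<^sub>R V i"
    then obtain i t where it: "i \<in> K" "t \<ge> 0" "y = Z i + t *\<^sub>R V i" by blast
    then have "fst y - p = t *\<^sub>R dir d e i" using ZV by simp
    then have "t < r" using y it(1) K ab \<open>t \<ge> 0\<close>
      by (auto simp: index4 ray_defs linear_scale linear_neg subset_iff)
    then show "y \<in> L" using \<tau>(2)[OF it(1,2)] it(3) by (simp add: r_def)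
  qed
  moreover have "\<forall>q. al q *\<^sub>R d + be q *\<^sub>R e = q" using q by metis
  ultimately show ?thesis using that[of al be r] ab r K ZV unfolding arm_system_def by blast
qed

context regular_diagram
begin

text \<open>Regularity allows at most two points over \<open>p\<close>: none, one (a straight strand
  or a corner), or two. In the last case neither is a vertex, so both strands are straight, and they
  are transverse by \<open>crossing_transverse\<close>; the higher point is called \<open>v\<close>
  and receives the arms 0 and 2.\<close>

lemma arms:
  obtains al be d e r K Z V where "arm_system L p al be d e r K Z V" "arm_cases K Z"
    "\<And>z. z \<in> L \<Longrightarrow> fst z = p \<Longrightarrow> \<exists>i\<in>K. Z i = z"
proof -
  define F where "F = {z \<in> L. fst z = p}"
  have F: "z \<in> F \<longleftrightarrow> z \<in> L \<and> fst z = p" for z by (auto simp: F_def)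
  consider "F = {}" | z where "F = {z}" | u v where "F = {u, v}" "u \<noteq> v"
  proof (cases "F = {}")
    case False
    then obtain u where u: "u \<in> F" by blast
    show ?thesis
    proof (cases "F = {u}")
      case False
      then obtain v where v: "v \<in> F" "v \<noteq> u" using u by blast
      have "w = u \<or> w = v" if "w \<in> F" for w
        using no_triple[of w u v] u v that unfolding F by auto
      then have "F = {u, v}" using u v by blast
      then show ?thesis using that(3) v by auto
    qed (use that(2) in blast)
  qed (use that(1) in blast)
  then show ?thesis
  proof cases
    case 1
    define d e :: "real^2" where "d = (\<chi> i. if i = 1 then 1 else 0)" and "e = (\<chi> i. if i = 2 then 1 else 0)"
    have de: "det2 d e \<noteq> 0" by (simp add: det2_def d_def e_def)
    obtain \<eta> where \<eta>: "\<eta> > 0" "\<And>y. y \<in> L \<Longrightarrow> dist p (fst y) < \<eta> \<Longrightarrow> \<exists>z\<in>L. fst z = p \<and> y \<in> ball z 1"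
      using fibre_nbhd[of p "\<lambda>_. 1"] by (metis zero_less_one)
    obtain al be r where "arm_system L p al be d e r {} (\<lambda>_. undefined) (\<lambda>_. undefined)"
    proof (rule arm_assemble[OF de, where K = "{}" and \<tau> = 1 and \<eta> = \<eta> and p = p])
      show "\<exists>i\<in>{}. \<exists>t\<ge>0. y = undefined + t *\<^sub>R undefined" if "y \<in> L" "dist p (fst y) < \<eta>" for y
        using \<eta>(2)[OF that] 1 F by blast
    qed (use \<eta>(1) in auto)
    then show ?thesis by (rule that) (use 1 F in \<open>auto simp: arm_cases_def\<close>)
  next
    case (2 z)
    then have z: "z \<in> L" "fst z = p" using F by blast+
    obtain V1 V2 \<tau> e where V: "fst V1 \<noteq> 0" "fst V2 = - fst V1 \<or> det2 (fst V1) (fst V2) \<noteq> 0" "\<tau> > 0" "e > 0"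
      "\<And>t. 0 \<le> t \<Longrightarrow> t \<le> \<tau> \<Longrightarrow> z + t *\<^sub>R V1 \<in> L \<and> z + t *\<^sub>R V2 \<in> L"
      "\<And>y. y \<in> L \<Longrightarrow> y \<in> ball z e \<Longrightarrow> \<exists>t\<ge>0. y = z + t *\<^sub>R V1 \<or> y = z + t *\<^sub>R V2"
      by (rule strand[OF z(1)]) (rule that; assumption)
    obtain \<eta> where \<eta>: "\<eta> > 0" "\<And>y. y \<in> L \<Longrightarrow> dist p (fst y) < \<eta> \<Longrightarrow> \<exists>z\<in>L. fst z = p \<and> y \<in> ball z e"
      by (rule fibre_nbhd[of p "\<lambda>_. e", OF V(4)]) (erule that, blast)
    have \<eta>2: "\<exists>t\<ge>0. y = z + t *\<^sub>R V1 \<or> y = z + t *\<^sub>R V2" if y: "y \<in> L" "dist p (fst y) < \<eta>" for y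
    proof -
      obtain z' where z': "z' \<in> L" "fst z' = p" "y \<in> ball z' e" using \<eta>(2)[OF y] by blast
      then have "z' \<in> F" by (simp add: F)
      then have "z' = z" using 2 by simp
      then show ?thesis using V(6)[OF y(1)] z'(3) by simp
    qed
    define W where "W i = (if i = (0::nat) then V1 else V2)" for i
    show ?thesis
    proof (cases "fst V2 = - fst V1")
      case True
      \<comment> \<open>A quarter turn of \<open>fst V1\<close>, to complete it to a basis.\<close>
      define e' :: "real^2" where "e' = (\<chi> i. if i = 1 then - fst V1 $ 2 else fst V1 $ 1)"
      have "fst V1 $ 1 \<noteq> 0 \<or> fst V1 $ 2 \<noteq> 0" using V(1) by (auto simp: vec2_eq_iff)
      then have de: "det2 (fst V1) e' \<noteq> 0"
        using sum_squares_gt_zero_iff[of "fst V1 $ 1" "fst V1 $ 2"] by (auto simp: det2_def e'_def)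
      have "\<exists>i\<in>{0,2}. \<exists>t\<ge>0. y = z + t *\<^sub>R W i" if "y \<in> L" "dist p (fst y) < \<eta>" for y
        using \<eta>2[OF that] by (force simp: W_def)
      note arm = this
      obtain al be r where "arm_system L p al be (fst V1) e' r {0, 2} (\<lambda>_. z) W"
      proof (rule arm_assemble[OF de, where K = "{0, 2}" and Z = "\<lambda>_. z" and \<tau> = \<tau> and \<eta> = \<eta> and p = p and V = W
        and L = L])
        show "fst z = p \<and> fst (W i) = dir (fst V1) e' i" if "i \<in> {0, 2}" for i
          using that z True by (auto simp: W_def ray_defs)
        show "z + t *\<^sub>R W i \<in> L" if "0 \<le> t" "t \<le> \<tau>" for i t using V(5)[OF that] by (simp add: W_def)
      qed (use V(3) \<eta>(1) arm in auto)
      then show ?thesis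
      proof (rule that)
        show "\<exists>i\<in>{0, 2::nat}. z = z'" if "z' \<in> L" "fst z' = p" for z' using that F[of z'] 2 by auto
      qed (simp add: arm_cases_def)
    next
      case False
      then have de: "det2 (fst V1) (fst V2) \<noteq> 0" using V(2) by blast
      have "\<exists>i\<in>{0,1}. \<exists>t\<ge>0. y = z + t *\<^sub>R W i" if "y \<in> L" "dist p (fst y) < \<eta>" for y
        using \<eta>2[OF that] by (force simp: W_def)
      note arm = this
      obtain al be r where "arm_system L p al be (fst V1) (fst V2) r {0, 1} (\<lambda>_. z) W"
      proof (rule arm_assemble[OF de, where K = "{0, 1}" and Z = "\<lambda>_. z" and \<tau> = \<tau> and \<eta> = \<eta> and p = p and V = W
        and L = L])
        show "fst z = p \<and> fst (W i) = dir (fst V1) (fst V2) i" if "i \<in> {0, 1}" for i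
          using that z by (auto simp: W_def ray_defs)
        show "z + t *\<^sub>R W i \<in> L" if "0 \<le> t" "t \<le> \<tau>" for i t using V(5)[OF that] by (simp add: W_def)
      qed (use V(3) \<eta>(1) arm in auto)
      then show ?thesis
      proof (rule that)
        show "\<exists>i\<in>{0, 1::nat}. z = z'" if "z' \<in> L" "fst z' = p" for z' using that F[of z'] 2 by auto
      qed (simp add: arm_cases_def)
    qed
  next
    case (3 u0 v0)
    then have "u0 \<in> F" "v0 \<in> F" by auto
    then have "snd u0 \<noteq> snd v0" using 3(2) F by (metis prod_eq_iff)
    then obtain u v where uv: "F = {u, v}" "u \<noteq> v" "snd u < snd v"
    proof (cases "snd u0 < snd v0")
      case False
      then have "F = {v0, u0}" "snd v0 < snd u0" using 3 \<open>snd u0 \<noteq> snd v0\<close> by (auto simp: insert_commute)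
      then show ?thesis using that 3(2) by metis
    qed (use 3 that in metis)
    have u: "u \<in> L" "fst u = p" and v: "v \<in> L" "fst v = p" using uv(1) F by blast+
    have nv: "u \<notin> vertices D" "v \<notin> vertices D" using vertex_proj u v uv(2) by metis+
    \<comment> \<open>The local form of a straight strand through \<open>z\<close>. The parameters
      \<open>a\<close> and \<open>b\<close> belong to the vertices at its two ends, which enter the
      proof of transversality.\<close>
    define P where "P z V \<tau> e a b \<longleftrightarrow> fst V \<noteq> 0 \<and> \<tau> > 0 \<and> e > 0 \<and>
      (\<forall>t. 0 \<le> t \<longrightarrow> t \<le> \<tau> \<longrightarrow> z + t *\<^sub>R V \<in> L \<and> z + t *\<^sub>R (- V) \<in> L) \<and>
      (\<forall>y\<in>L. y \<in> ball z e \<longrightarrow> (\<exists>t\<ge>0. y = z + t *\<^sub>R V \<or> y = z + t *\<^sub>R (- V))) \<and>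
      a > 0 \<and> b > 0 \<and> z + a *\<^sub>R V \<in> vertices D \<and> z - b *\<^sub>R V \<in> vertices D \<and>
       (\<forall>t. -b \<le> t \<longrightarrow> t \<le> a \<longrightarrow> z + t *\<^sub>R V \<in> L)" for z V \<tau> e a b
    have ex: "\<exists>V \<tau> e a b. P z V \<tau> e a b" if z: "z \<in> L" "z \<notin> vertices D" for z
    proof -
      obtain V1 V2 \<tau> e where V: "fst V1 \<noteq> 0" "fst V2 = - fst V1 \<or> det2 (fst V1) (fst V2) \<noteq> 0" "\<tau> > 0" "e > 0"
        "\<And>t. 0 \<le> t \<Longrightarrow> t \<le> \<tau> \<Longrightarrow> z + t *\<^sub>R V1 \<in> L \<and> z + t *\<^sub>R V2 \<in> L"
        "\<And>y. y \<in> L \<Longrightarrow> y \<in> ball z e \<Longrightarrow> \<exists>t\<ge>0. y = z + t *\<^sub>R V1 \<or> y = z + t *\<^sub>R V2"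
        "z \<notin> vertices D \<Longrightarrow> V2 = - V1 \<and> (\<exists>a>0. \<exists>b>0. z + a *\<^sub>R V1 \<in> vertices D \<and> z - b *\<^sub>R V1 \<in> vertices D \<and>
         (\<forall>t. -b \<le> t \<longrightarrow> t \<le> a \<longrightarrow> z + t *\<^sub>R V1 \<in> L))"
        by (rule strand[OF z(1)]) (rule that; assumption)
      obtain a b where V2: "V2 = - V1"
        and ab: "a > 0" "b > 0" "z + a *\<^sub>R V1 \<in> vertices D" "z - b *\<^sub>R V1 \<in> vertices D"
        "\<forall>t. -b \<le> t \<longrightarrow> t \<le> a \<longrightarrow> z + t *\<^sub>R V1 \<in> L" using V(7)[OF z(2)] by blast
      have "P z V1 \<tau> e a b" unfolding P_def using V(1,3,4,5,6) ab unfolding V2 by blast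
      then show ?thesis by blast
    qed
    obtain V \<tau> e a b where PV: "P v V \<tau> e a b" using ex[OF v(1) nv(2)] by blast
    have V: "fst V \<noteq> 0" "\<tau> > 0" "e > 0"
      "\<And>t. 0 \<le> t \<Longrightarrow> t \<le> \<tau> \<Longrightarrow> v + t *\<^sub>R V \<in> L \<and> v + t *\<^sub>R (- V) \<in> L"
      "\<And>y. y \<in> L \<Longrightarrow> y \<in> ball v e \<Longrightarrow> (\<exists>t\<ge>0. y = v + t *\<^sub>R V \<or> y = v + t *\<^sub>R (- V))"
      "a > 0" "b > 0" "v + a *\<^sub>R V \<in> vertices D" "v - b *\<^sub>R V \<in> vertices D"
      "\<And>t. -b \<le> t \<Longrightarrow> t \<le> a \<Longrightarrow> v + t *\<^sub>R V \<in> L"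
      using PV unfolding P_def by blast+
    obtain W \<tau>' e' a' b' where PW: "P u W \<tau>' e' a' b'" using ex[OF u(1) nv(1)] by blast
    have W: "fst W \<noteq> 0" "\<tau>' > 0" "e' > 0"
      "\<And>t. 0 \<le> t \<Longrightarrow> t \<le> \<tau>' \<Longrightarrow> u + t *\<^sub>R W \<in> L \<and> u + t *\<^sub>R (- W) \<in> L"
      "\<And>y. y \<in> L \<Longrightarrow> y \<in> ball u e' \<Longrightarrow> (\<exists>t\<ge>0. y = u + t *\<^sub>R W \<or> y = u + t *\<^sub>R (- W))"
      "a' > 0" "b' > 0" "u + a' *\<^sub>R W \<in> vertices D" "u - b' *\<^sub>R W \<in> vertices D"
      "\<And>t. -b' \<le> t \<Longrightarrow> t \<le> a' \<Longrightarrow> u + t *\<^sub>R W \<in> L"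
      using PW unfolding P_def by blast+
    have de: "det2 (fst V) (fst W) \<noteq> 0"
      by (rule crossing_transverse[of v u V W a b a' b']) (use u v uv(2) V W in auto)
    define Z X where "Z i = (if i = (0::nat) \<or> i = 2 then v else u)"
      and "X i = [V, W, - V, - W] ! i" for i
    have ee': "min e e' > 0" using V(3) W(3) by simp
    obtain \<eta> where \<eta>: "\<eta> > 0" "\<And>y. y \<in> L \<Longrightarrow> dist p (fst y) < \<eta> \<Longrightarrow> \<exists>z\<in>L. fst z = p \<and> y \<in> ball z (min e e')"
      by (rule fibre_nbhd[of p "\<lambda>_. min e e'", OF ee']) (erule that, blast)
    have "\<exists>i\<in>{0,1,2,3}. \<exists>t\<ge>0. y = Z i + t *\<^sub>R X i" if y: "y \<in> L" "dist p (fst y) < \<eta>" for y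
    proof -
      obtain z' where z': "z' \<in> L" "fst z' = p" "y \<in> ball z' (min e e')" using \<eta>(2)[OF y] by blast
      then have "z' \<in> F" by (simp add: F)
      then have "z' = u \<or> z' = v" using uv(1) by simp
      then have "y \<in> ball v e \<or> y \<in> ball u e'" using z'(3) by auto
      then show ?thesis using V(5)[OF y(1)] W(5)[OF y(1)] by (auto simp: Z_def X_def)
    qed
    note arm = this
    obtain al be r where "arm_system L p al be (fst V) (fst W) r {0, 1, 2, 3} Z X"
    proof (rule arm_assemble[OF de, where K = "{0, 1, 2, 3}" and Z = Z and \<tau> = "min \<tau> \<tau>'" and \<eta> = \<eta> and p = p
      and V = X and L = L])
      show "fst (Z i) = p \<and> fst (X i) = dir (fst V) (fst W) i" if "i \<in> {0, 1, 2, 3}" for i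
        using that u v by (auto simp: Z_def X_def ray_defs)
      show "Z i + t *\<^sub>R X i \<in> L" if "i \<in> {0, 1, 2, 3}" "0 \<le> t" "t \<le> min \<tau> \<tau>'" for i t
        using that V(4)[of t] W(4)[of t] by (auto simp: Z_def X_def)
    qed (use V(2) W(2) \<eta>(1) arm in auto)
    then show ?thesis
    proof (rule that)
      show "\<exists>i\<in>{0, 1, 2, 3}. Z i = z" if "z \<in> L" "fst z = p" for z
        using that F[of z] uv(1) by (auto simp: Z_def)
    qed (use uv(3) in \<open>simp add: arm_cases_def Z_def\<close>)
  qed
qed

end

section \<open>Sky, walls and arcs\<close>

definition under_points :: "diagram \<Rightarrow> space set" where
  "under_points D = {u. \<exists>v. crossing D v u}"

definition sky :: "diagram \<Rightarrow> space set" where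
  "sky D = {y. \<forall>z\<in>support D. fst z = fst y \<longrightarrow> snd z < snd y}"

text \<open>
  In \<open>wall D y z \<phi>\<close> the point \<open>z\<close> is the only point of the link on the vertical line of \<open>y\<close>, and
  nearby the link projects onto the line \<open>\<phi> = 0\<close>: a ray shot upwards from \<open>y\<close> is about to cross the link.
\<close>

definition wall :: "diagram \<Rightarrow> space \<Rightarrow> space \<Rightarrow> (real^2 \<Rightarrow> real) \<Rightarrow> bool" where
  "wall D y z \<phi> \<longleftrightarrow> linear \<phi> \<and> (\<exists>q. \<phi> q \<noteq> 0) \<and> z \<in> support D \<and> fst z = fst y \<and> snd y < snd z \<and>
     (\<exists>\<eta>>0. \<exists>h. continuous_on (ball (fst y) \<eta>) h \<and>
        (\<forall>q\<in>ball (fst y) \<eta>. \<forall>t. (q, t) \<in> support D \<longleftrightarrow> \<phi> (q - fst y) = 0 \<and> t = h q))"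

definition cell :: "space \<Rightarrow> (real^2 \<Rightarrow> real) \<Rightarrow> (real^2 \<Rightarrow> real) \<Rightarrow> real \<Rightarrow> real \<Rightarrow> space set" where
  "cell x al be r \<delta> = {y. \<bar>al (fst y - fst x)\<bar> < r \<and> \<bar>be (fst y - fst x)\<bar> < r \<and> \<bar>snd y - snd x\<bar> < \<delta>}"

text \<open>\<open>K\<close> lists the arms that pass above \<open>x\<close>; so between the two
  strands of a crossing the box looks as if it were below a straight strand. The clauses collect
  what is used later about the link above a small box: arms no longer occur, only walls, sky and,
  for \<open>i\<close> in \<open>K\<close>, the arc \<open>A i\<close> that carries arm
  \<open>i\<close>.\<close>

definition cross_cell where
  "cross_cell D x al be d e r \<delta> K A \<longleftrightarrow>
     linear al \<and> linear be \<and> al d = 1 \<and> al e = 0 \<and> be d = 0 \<and> be e = 1 \<and>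
     (\<forall>q. al q *\<^sub>R d + be q *\<^sub>R e = q) \<and> 0 < r \<and> 0 < \<delta> \<and> K \<subseteq> {..<4} \<and>
     cell x al be r \<delta> \<inter> support D = {} \<and>
     (\<forall>y\<in>cell x al be r \<delta>. al (fst y - fst x) \<noteq> 0 \<longrightarrow> be (fst y - fst x) \<noteq> 0 \<longrightarrow> y \<in> sky D) \<and>
     (\<forall>y\<in>cell x al be r \<delta>. \<forall>i<4. 0 < par al be i (fst y - fst x) \<longrightarrow> nor al be i (fst y - fst x) = 0 \<longrightarrow>
        (if i \<in> K then \<exists>z\<in>A i. wall D y z (nor al be i) else y \<in> sky D)) \<and>
     (\<forall>i\<in>K. A i \<in> arcs D) \<and>
     (K = {} \<longrightarrow> cell x al be r \<delta> \<subseteq> sky D) \<and>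
     (K \<noteq> {} \<longrightarrow> (\<forall>y\<in>cell x al be r \<delta>. fst y = fst x \<longrightarrow> y \<notin> sky D)) \<and>
     (\<forall>y\<in>cell x al be r \<delta>. \<forall>z \<phi>. fst y = fst x \<longrightarrow> wall D y z \<phi> \<longrightarrow>
        K = {0, 2} \<and> z \<in> A 0 \<and> (\<exists>c. c \<noteq> 0 \<and> (\<forall>q. \<phi> q = c * be q))) \<and>
     (K = {} \<or> K = {0, 2} \<and> A 0 = A 2 \<or> K = {0, 1} \<and> A 0 = A 1 \<or>
      K = {0, 1, 2, 3} \<and> A 0 = A 2 \<and> (\<exists>v u. crossing D v u \<and> fst u = fst x \<and> snd x < snd u \<and>
        v \<in> A 0 \<and> under_arcs D u = {A 1, A 3})) \<and>
     (\<forall>v u. crossing D v u \<longrightarrow> fst u = fst x \<longrightarrow> snd x < snd u \<longrightarrow>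
        K = {0, 1, 2, 3} \<and> v \<in> A 0 \<and> under_arcs D u = {A 1, A 3})"

lemma arcs_eq: "arcs D = components (support D - under_points D)"
  by (simp add: arcs_def under_points_def)

lemma arc_subset: "A \<in> arcs D \<Longrightarrow> A \<subseteq> support D - under_points D"
  by (simp add: arcs_eq in_components_subset)

lemma arc_connected: "A \<in> arcs D \<Longrightarrow> connected A"
  by (simp add: arcs_eq in_components_connected)

lemma arc_disjoint: "A \<in> arcs D \<Longrightarrow> A' \<in> arcs D \<Longrightarrow> z \<in> A \<Longrightarrow> z \<in> A' \<Longrightarrow> A = A'"
  unfolding arcs_eq using components_eq by blast

lemma arc_exists: "z \<in> support D \<Longrightarrow> z \<notin> under_points D \<Longrightarrow> \<exists>A\<in>arcs D. z \<in> A"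
  unfolding arcs_eq using Union_components[of "support D - under_points D"] by blast

lemma arc_maximal: "A \<in> arcs D \<Longrightarrow> connected C \<Longrightarrow> C \<subseteq> support D - under_points D \<Longrightarrow> z \<in> A \<Longrightarrow> z \<in> C \<Longrightarrow> C \<subseteq> A"
  unfolding arcs_eq using components_maximal[of A "support D - under_points D" C] by blast

lemma sky_disjoint: "sky D \<inter> support D = {}"
  by (auto simp: sky_def)

lemma linear_par: "linear al \<Longrightarrow> linear be \<Longrightarrow> i < 4 \<Longrightarrow> linear (par al be i)"
  using linear_compose_neg[of al] linear_compose_neg[of be]
  unfolding index4 par_def by (elim disjE) simp_all

lemma linear_nor: "linear al \<Longrightarrow> linear be \<Longrightarrow> i < 4 \<Longrightarrow> linear (nor al be i)"
  by (auto simp: nor_def index4)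

context regular_diagram
begin

lemma crossing_unique: "crossing D v u \<Longrightarrow> z \<in> L \<Longrightarrow> fst z = fst u \<Longrightarrow> z = u \<or> z = v"
  unfolding crossing_def using no_triple[of z u v] by (metis less_irrefl)

lemma unique_not_under:
  assumes "\<And>z'. z' \<in> L \<Longrightarrow> fst z' = fst z \<Longrightarrow> z' = z"
  shows "z \<notin> under_points D"
proof
  assume "z \<in> under_points D"
  then obtain v where v: "v \<in> L" "fst v = fst z" "snd z < snd v" by (auto simp: under_points_def crossing_def)
  then have "v = z" using assms by blast
  then show False using v by simp
qed

lemma arm_systemD:
  assumes "arm_system L p al be d e r K Z V"
  shows "linear al" "linear be" "al d = 1" "al e = 0" "be d = 0" "be e = 1"
    "q = al q *\<^sub>R d + be q *\<^sub>R e" "0 < r" "K \<subseteq> {..<4}"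
    "\<And>i. i \<in> K \<Longrightarrow> fst (Z i) = p" "\<And>i. i \<in> K \<Longrightarrow> fst (V i) = dir d e i"
proof -
  show "linear al" "linear be" "al d = 1" "al e = 0" "be d = 0" "be e = 1" "0 < r" "K \<subseteq> {..<4}"
    using assms unfolding arm_system_def by - (elim conjE, assumption)+
  have "\<forall>q. al q *\<^sub>R d + be q *\<^sub>R e = q"
    using assms unfolding arm_system_def by - (elim conjE, assumption)
  then show "q = al q *\<^sub>R d + be q *\<^sub>R e" by (rule allE) (erule sym)
  have "\<forall>i\<in>K. fst (Z i) = p \<and> fst (V i) = dir d e i"
    using assms unfolding arm_system_def by - (elim conjE, assumption)
  then show "\<And>i. i \<in> K \<Longrightarrow> fst (Z i) = p" "\<And>i. i \<in> K \<Longrightarrow> fst (V i) = dir d e i" by blast+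
qed

lemma arm_coord:
  assumes a: "arm_system L p al be d e r K Z V" and i: "i < 4"
  shows "al (t *\<^sub>R dir d e i) = t * [1,0,-1,0] ! i" "be (t *\<^sub>R dir d e i) = t * [0,1,0,-1] ! i"
  by (rule dir_coord[OF arm_systemD(1-6)[OF a] i])+

lemma arm_fst:
  assumes "arm_system L p al be d e r K Z V" "i \<in> K"
  shows "i < 4" "fst (Z i) = p" "fst (Z i + t *\<^sub>R V i) = p + t *\<^sub>R dir d e i"
  using arm_systemD(9-11)[OF assms(1)] assms(2) by auto

lemma arm_point:
  assumes a: "arm_system L p al be d e r K Z V" and i: "i \<in> K" and t: "0 \<le> t" "t < r"
  shows "Z i + t *\<^sub>R V i \<in> L"
proof -
  have i4: "i < 4" using arm_fst[OF a i] by blast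
  have "\<bar>al (fst (Z i + t *\<^sub>R V i) - p)\<bar> < r" "\<bar>be (fst (Z i + t *\<^sub>R V i) - p)\<bar> < r"
    unfolding arm_fst(3)[OF a i] using arm_coord[OF a i4, of t] t i4 by (auto simp: index4)
  then show ?thesis using a i t unfolding arm_system_def by blast
qed

lemma arm_points:
  assumes a: "arm_system L p al be d e r K Z V" and y: "y \<in> L"
    and "\<bar>al (fst y - p)\<bar> < r" "\<bar>be (fst y - p)\<bar> < r"
  obtains i t where "i \<in> K" "0 \<le> t" "y = Z i + t *\<^sub>R V i" "fst y - p = t *\<^sub>R dir d e i" "t < r"
proof -
  obtain i t where it: "i \<in> K" "0 \<le> t" "y = Z i + t *\<^sub>R V i" using assms unfolding arm_system_def by blast
  have i4: "i < 4" using arm_fst[OF a it(1)] by blast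
  have f: "fst y - p = t *\<^sub>R dir d e i" using arm_fst(3)[OF a it(1)] it(3) by simp
  have "t < r" using assms(3,4) arm_coord[OF a i4, of t] i4 it(2) unfolding f by (auto simp: index4)
  then show ?thesis using that it f by blast
qed

lemma arm_par_nor:
  assumes a: "arm_system L p al be d e r K Z V" and "i < 4" "j < 4"
    and "0 < par al be j (t *\<^sub>R dir d e i)" "nor al be j (t *\<^sub>R dir d e i) = 0" "0 \<le> t"
  shows "i = j" "par al be j (t *\<^sub>R dir d e i) = t" "0 < t"
proof -
  let ?q = "t *\<^sub>R dir d e i"
  have c: "al ?q = t * [1,0,-1,0] ! i" "be ?q = t * [0,1,0,-1] ! i" using arm_coord[OF a assms(2)] by auto
  have "i = j \<and> par al be j ?q = t \<and> 0 < t"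
    using assms(2,3) assms(4-6) c unfolding index4 par_def nor_def
    by (elim disjE) simp_all
  then show "i = j" "par al be j (t *\<^sub>R dir d e i) = t" "0 < t" by auto
qed

lemma ray_vector:
  assumes a: "arm_system L p al be d e r K Z V" and "j < 4" "nor al be j q = 0"
  shows "q = par al be j q *\<^sub>R dir d e j"
proof -
  have q: "q = al q *\<^sub>R d + be q *\<^sub>R e" by (rule arm_systemD(7)[OF a])
  show ?thesis using assms(2,3) by (subst q) (auto simp: index4 ray_defs)
qed

text \<open>Where \<open>par al be j\<close> is positive, only arm \<open>j\<close> remains, and
  there it is the graph of the affine function \<open>h\<close> over its ray.\<close>

lemma arm_wall:
  assumes a: "arm_system L p al be d e r K Z V" and j: "j \<in> K" and t: "0 < t" "t < r"
    and y: "fst y = p + t *\<^sub>R dir d e j" "snd y < snd (Z j + t *\<^sub>R V j)"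
  shows "wall D y (Z j + t *\<^sub>R V j) (nor al be j)"
proof -
  note lin = arm_systemD(1,2)[OF a] and r = arm_systemD(8)[OF a]
  have j4: "j < 4" using arm_fst[OF a j] by blast
  define N where "N = {q. \<bar>al (q - p)\<bar> < r \<and> \<bar>be (q - p)\<bar> < r \<and> 0 < par al be j (q - p)}"
  have cont: "continuous_on S (\<lambda>q. f (q - p))" if "linear f" for f :: "real^2 \<Rightarrow> real" and S
    by (rule linear_continuous_on_compose[OF _ that]) (intro continuous_intros)
  note conts = cont[OF lin(1)] cont[OF lin(2)] cont[OF linear_par[OF lin j4]]
  have oN: "open N" unfolding N_def
    by (intro open_Collect_conj open_Collect_less continuous_on_rabs continuous_on_const conts)
  have fy: "fst y - p = t *\<^sub>R dir d e j" using y by simp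
  have pt: "par al be j (fst y - p) = t" "nor al be j (fst y - p) = 0"
    unfolding fy using arm_coord[OF a j4, of t] j4 by (auto simp: index4 ray_defs)
  have "fst y \<in> N" unfolding N_def mem_Collect_eq using pt arm_coord[OF a j4, of t] t j4 unfolding fy
    by (auto simp: index4)
  then obtain \<eta> where \<eta>: "\<eta> > 0" "ball (fst y) \<eta> \<subseteq> N" using oN open_contains_ball by blast
  define h where "h q = snd (Z j) + par al be j (q - p) * snd (V j)" for q
  have hc: "continuous_on (ball (fst y) \<eta>) h" unfolding h_def
    by (intro continuous_on_add continuous_on_mult continuous_on_const conts)
  moreover have mem: "(q, s) \<in> L \<longleftrightarrow> nor al be j (q - fst y) = 0 \<and> s = h q" if q: "q \<in> ball (fst y) \<eta>" for q s
  proof -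
    have qN: "\<bar>al (q - p)\<bar> < r" "\<bar>be (q - p)\<bar> < r" "0 < par al be j (q - p)" using q \<eta> by (auto simp: N_def)
    have "nor al be j (q - p) - nor al be j (fst y - p) = nor al be j (q - fst y)"
      using linear_diff[OF linear_nor[OF lin j4], of "q - p" "fst y - p"] by simp
    then have n: "nor al be j (q - fst y) = nor al be j (q - p)" using pt by simp
    show ?thesis unfolding n
    proof
      assume qs: "(q, s) \<in> L"
      obtain i t' where it: "i \<in> K" "0 \<le> t'" "(q,s) = Z i + t' *\<^sub>R V i" "q - p = t' *\<^sub>R dir d e i" "t' < r"
        using arm_points[OF a qs] qN by (metis fst_conv)
      have i4: "i < 4" using arm_fst[OF a it(1)] by blast
      have "i = j"
      proof (rule ccontr)
        assume "i \<noteq> j"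
        then show False using qN(3) arm_coord[OF a i4, of t'] i4 j4 it(2) unfolding it(4)
          by (auto simp: index4 ray_defs)
      qed
      then have "par al be j (q - p) = t'" "nor al be j (q - p) = 0"
        unfolding it(4) using arm_coord[OF a i4, of t'] i4 by (auto simp: index4 ray_defs)
      moreover have "s = snd (Z i + t' *\<^sub>R V i)" using it(3) by (metis snd_conv)
      ultimately show "nor al be j (q - p) = 0 \<and> s = h q" using \<open>i = j\<close> by (simp add: h_def)
    next
      assume "nor al be j (q - p) = 0 \<and> s = h q"
      then have n0: "nor al be j (q - p) = 0" and s: "s = h q" by auto
      let ?t = "par al be j (q - p)"
      have "q - p = ?t *\<^sub>R dir d e j" by (rule ray_vector[OF a j4 n0])
      then have "(q, s) = Z j + ?t *\<^sub>R V j"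
        using arm_fst(3)[OF a j, of ?t] by (auto simp: prod_eq_iff s h_def algebra_simps)
      moreover have "?t < r" using qN j4 by (auto simp: index4 ray_defs)
      ultimately show "(q, s) \<in> L" using arm_point[OF a j, of ?t] qN(3) by auto
    qed
  qed
  moreover have "\<exists>q. nor al be j q \<noteq> 0"
    using arm_systemD(3-6)[OF a] j4 unfolding index4 nor_def by (auto intro: exI[of _ d] exI[of _ e])
  moreover have "Z j + t *\<^sub>R V j \<in> L" using arm_point[OF a j] t by auto
  ultimately show ?thesis
    unfolding wall_def
  proof (intro conjI)
    show "fst (Z j + t *\<^sub>R V j) = fst y" by (simp only: y(1) arm_fst(3)[OF a j])
    show "\<exists>\<eta>>0. \<exists>h. continuous_on (ball (fst y) \<eta>) h \<and>
        (\<forall>q\<in>ball (fst y) \<eta>. \<forall>t. (q, t) \<in> L \<longleftrightarrow> nor al be j (q - fst y) = 0 \<and> t = h q)"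
      using \<eta>(1) hc mem by blast
  qed (use linear_nor[OF lin j4] y(2) in blast)+
qed

lemma wall_unique: "wall D y z \<phi> \<Longrightarrow> z' \<in> L \<Longrightarrow> fst z' = fst y \<Longrightarrow> z' = z"
proof -
  assume w: "wall D y z \<phi>" and z': "z' \<in> L" "fst z' = fst y"
  have z: "z \<in> L" "fst z = fst y" using w by (auto simp: wall_def)
  obtain \<eta> h where "\<eta> > 0" and h: "\<forall>q\<in>ball (fst y) \<eta>. \<forall>t. (q, t) \<in> L \<longleftrightarrow> \<phi> (q - fst y) = 0 \<and> t = h q"
    using w unfolding wall_def by blast
  then have "fst y \<in> ball (fst y) \<eta>" by simp
  then have "t = h (fst y)" if "(fst y, t) \<in> L" for t using h that by blast
  moreover have "(fst y, snd z) = z" "(fst y, snd z') = z'" using z z' by (simp_all add: prod_eq_iff)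
  ultimately have "snd z = h (fst y)" "snd z' = h (fst y)" using z z' by metis+
  then show "z' = z" using z z' by (simp add: prod_eq_iff)
qed

lemma wall_top:
  assumes "wall D y z \<phi>" shows "z \<in> L - under_points D" "y \<notin> sky D" "y \<notin> L"
proof -
  have z: "z \<in> L" "fst z = fst y" "snd y < snd z" using assms by (auto simp: wall_def)
  have "z \<notin> under_points D"
  proof (rule unique_not_under)
    show "z' = z" if "z' \<in> L" "fst z' = fst z" for z' using wall_unique[OF assms that(1)] that(2) z(2) by simp
  qed
  then show "z \<in> L - under_points D" using z by blast
  show "y \<notin> sky D" using z by (auto simp: sky_def)
  show "y \<notin> L" using wall_unique[OF assms, of y] z by auto
qed

lemma arm_not_under:
  assumes a: "arm_system L p al be d e r K Z V" and j: "j \<in> K" and t: "0 < t" "t < r"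
  shows "Z j + t *\<^sub>R V j \<in> L - under_points D"
proof -
  have "wall D (p + t *\<^sub>R dir d e j, snd (Z j + t *\<^sub>R V j) - 1) (Z j + t *\<^sub>R V j) (nor al be j)"
    by (rule arm_wall[OF a j t]) auto
  then show ?thesis using wall_top(1) by blast
qed

end

section \<open>Boxes around the points of the complement\<close>

lemma finite_positive_bound:
  assumes "finite K" "\<And>i. i \<in> K \<Longrightarrow> 0 < (f i :: real)"
  obtains m where "m > 0" "\<And>i. i \<in> K \<Longrightarrow> m \<le> f i"
proof (rule that[of "Min (insert 1 (f ` K))"])
  show "0 < Min (insert 1 (f ` K))" using assms by simp
  show "Min (insert 1 (f ` K)) \<le> f i" if "i \<in> K" for i using assms(1) that by simp
qed

context regular_diagram
begin

lemma arm_system_mono: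
  assumes a: "arm_system L p al be d e r K Z V" and "0 < r'" "r' \<le> r"
  shows "arm_system L p al be d e r' K Z V"
proof -
  have "y \<in> L \<longleftrightarrow> (\<exists>i\<in>K. \<exists>t\<ge>0. y = Z i + t *\<^sub>R V i)"
    if "\<bar>al (fst y - p)\<bar> < r'" "\<bar>be (fst y - p)\<bar> < r'" for y
  proof -
    have "\<bar>al (fst y - p)\<bar> < r" "\<bar>be (fst y - p)\<bar> < r" using that assms(3) by linarith+
    then show ?thesis using a unfolding arm_system_def by blast
  qed
  then show ?thesis using a assms(2) unfolding arm_system_def by blast
qed

text \<open>Each point of the open arm is alone in its fibre, so the open arm avoids the under
  points and, being connected, lies in one arc. The starting point \<open>Z i\<close> belongs to
  this arc too unless it is an under point, where the link is cut.\<close>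

lemma arm_arc:
  assumes a: "arm_system L p al be d e r K Z V" and i: "i \<in> K"
  obtains A where "A \<in> arcs D" "\<And>t. 0 < t \<Longrightarrow> t < r \<Longrightarrow> Z i + t *\<^sub>R V i \<in> A"
    "Z i \<notin> under_points D \<Longrightarrow> Z i \<in> A"
proof -
  have r: "0 < r" using arm_systemD(8)[OF a] .
  have "Z i + (r/2) *\<^sub>R V i \<in> L - under_points D" using arm_not_under[OF a i, of "r/2"] r by simp
  then obtain A where A: "A \<in> arcs D" "Z i + (r/2) *\<^sub>R V i \<in> A" using arc_exists by blast
  have conn: "connected ((\<lambda>t. Z i + t *\<^sub>R V i) ` I)" if "connected I" for I
    by (rule connected_continuous_image[OF _ that]) (intro continuous_intros)
  have sub: "(\<lambda>t. Z i + t *\<^sub>R V i) ` I \<subseteq> A"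
    if I: "connected I" "r/2 \<in> I" "\<And>t. t \<in> I \<Longrightarrow> Z i + t *\<^sub>R V i \<in> L - under_points D" for I
  proof (rule arc_maximal[OF A(1) conn[OF I(1)] _ A(2)])
    show "(\<lambda>t. Z i + t *\<^sub>R V i) ` I \<subseteq> L - under_points D" using I(3) by blast
    show "Z i + (r/2) *\<^sub>R V i \<in> (\<lambda>t. Z i + t *\<^sub>R V i) ` I" using I(2) by blast
  qed
  show ?thesis
  proof (rule that[OF A(1)])
    fix t :: real assume t: "0 < t" "t < r"
    have "(\<lambda>t. Z i + t *\<^sub>R V i) ` {0<..<r} \<subseteq> A"
      by (rule sub) (use r arm_not_under[OF a i] in auto)
    then have "\<forall>t\<in>{0<..<r}. Z i + t *\<^sub>R V i \<in> A" unfolding image_subset_iff .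
    then show "Z i + t *\<^sub>R V i \<in> A" using t by simp
  next
    assume nu: "Z i \<notin> under_points D"
    have Zi: "Z i \<in> L" using arm_point[OF a i, of 0] r by simp
    have "(\<lambda>t. Z i + t *\<^sub>R V i) ` {0..<r} \<subseteq> A"
    proof (rule sub)
      fix t assume "t \<in> {0..<r}"
      then show "Z i + t *\<^sub>R V i \<in> L - under_points D"
        using arm_not_under[OF a i, of t] nu Zi by (cases "t = 0") auto
    qed (use r in auto)
    then have "Z i + 0 *\<^sub>R V i \<in> A" using r by (metis atLeastLessThan_iff image_subset_iff order_refl)
    then show "Z i \<in> A" by simp
  qed
qed

text \<open>Removing two closed segments of the upper strand leaves a neighbourhood \<open>Q\<close>
  of the lower point over which only the arms 1 and 3 are met; so every arc adherent to that point
  contains points of one of them.\<close>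

lemma arm_under_arcs:
  assumes a: "arm_system L p al be d e r K Z V" and K: "K = {0, 1, 2, 3}"
    and Z: "Z 0 = Z 2" "Z 1 = Z 3" "snd (Z 1) < snd (Z 0)"
    and A: "\<And>i. i \<in> K \<Longrightarrow> A i \<in> arcs D" "\<And>i t. i \<in> K \<Longrightarrow> 0 < t \<Longrightarrow> t < r \<Longrightarrow> Z i + t *\<^sub>R V i \<in> A i"
  shows "under_arcs D (Z 1) = {A 1, A 3}"
proof (intro equalityI subsetI)
  have r: "0 < r" using arm_systemD(8)[OF a] .
  have ZK: "Z i \<in> L" "fst (Z i) = p" if "i \<in> K" for i
    using arm_point[OF a that, of 0] r arm_fst(2)[OF a that] by auto
  have under: "Z 1 \<in> under_points D"
    unfolding under_points_def crossing_def using ZK[of 0] ZK[of 1] K Z by auto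
  {
    fix C assume "C \<in> {A 1, A 3}"
    then obtain i where i: "i \<in> K" "Z i = Z 1" "C = A i" using K Z by auto
    have "Z i \<in> closure (A i)"
      unfolding closure_approachable
    proof (intro allI impI)
      fix \<epsilon> :: real assume \<epsilon>: "\<epsilon> > 0"
      define t where "t = min (r/2) (\<epsilon> / (2 * (1 + norm (V i))))"
      have n: "0 < 2 * (1 + norm (V i))" by (simp add: add_pos_nonneg)
      then have t: "0 < t" "t < r" using r \<epsilon> by (auto simp: t_def)
      have "t * norm (V i) < \<epsilon>"
      proof -
        have "t * norm (V i) \<le> \<epsilon> / (2 * (1 + norm (V i))) * norm (V i)"
          by (rule mult_right_mono) (auto simp: t_def)
        also have "\<dots> < \<epsilon>" using n \<epsilon> by (simp add: field_simps) (smt (verit) mult_nonneg_nonneg norm_ge_zero)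
        finally show ?thesis .
      qed
      then show "\<exists>y\<in>A i. dist y (Z i) < \<epsilon>"
        using A(2)[OF i(1) t] t by (intro bexI[of _ "Z i + t *\<^sub>R V i"]) (auto simp: dist_norm)
    qed
    then show "C \<in> under_arcs D (Z 1)" using A(1)[OF i(1)] i by (simp add: under_arcs_def)
  }
  fix C assume "C \<in> under_arcs D (Z 1)"
  then have C: "C \<in> arcs D" "Z 1 \<in> closure C" by (auto simp: under_arcs_def)
  define S where "S i = closed_segment (Z i) (Z i + (r/2) *\<^sub>R V i)" for i
  have nS: "Z 1 \<notin> S i" if i: "i \<in> K" "Z i = Z 0" for i
  proof
    assume "Z 1 \<in> S i"
    then obtain t where t: "0 \<le> t" "Z 1 = Z i + t *\<^sub>R ((r/2) *\<^sub>R V i)" unfolding S_def by (rule segE)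
    have "i < 4" using arm_fst[OF a i(1)] by blast
    have "p = p + (t * (r/2)) *\<^sub>R dir d e i"
      using arm_fst(3)[OF a i(1), of "t * (r/2)"] t(2) ZK(2)[of 1] K by simp
    then have "(t * (r/2)) *\<^sub>R dir d e i = 0" by simp
    then have "al ((t * (r/2)) *\<^sub>R dir d e i) = 0" "be ((t * (r/2)) *\<^sub>R dir d e i) = 0"
      using linear_0[OF arm_systemD(1)[OF a]] linear_0[OF arm_systemD(2)[OF a]] by auto
    then have "t * (r/2) = 0" using arm_coord[OF a \<open>i < 4\<close>, of "t * (r/2)"] \<open>i < 4\<close> unfolding index4
      by (elim disjE) simp_all
    then have "t = 0" using r by simp
    then show False using t(2) i Z by simp
  qed
  note lin = arm_systemD(1,2)[OF a]
  define Q where "Q = {y :: space. \<bar>al (fst y - p)\<bar> < r/2 \<and> \<bar>be (fst y - p)\<bar> < r/2} - S 0 - S 2"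
  have cont: "continuous_on UNIV (\<lambda>y::space. f (fst y - p))" if "linear f" for f :: "real^2 \<Rightarrow> real"
    by (rule linear_continuous_on_compose[OF _ that]) (intro continuous_intros)
  have "open {y :: space. \<bar>al (fst y - p)\<bar> < r/2 \<and> \<bar>be (fst y - p)\<bar> < r/2}"
    by (intro open_Collect_conj open_Collect_less continuous_on_rabs continuous_on_const cont[OF lin(1)] cont[OF lin(2)])
  then have "open Q" unfolding Q_def S_def by (intro open_Diff closed_segment)
  moreover have "Z 1 \<in> Q" unfolding Q_def using nS[of 0] nS[of 2] K Z ZK(2)[of 1] r
      linear_0[OF lin(1)] linear_0[OF lin(2)] by simp
  ultimately obtain y where y: "y \<in> C" "y \<in> Q"
    using C(2) unfolding closure_iff_nhds_not_empty by blast
  have yS: "y \<in> L" "y \<notin> under_points D" using arc_subset[OF C(1)] y(1) by auto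
  have a': "arm_system L p al be d e (r/2) K Z V" by (rule arm_system_mono[OF a]) (use r in auto)
  obtain i t where it: "i \<in> K" "0 \<le> t" "y = Z i + t *\<^sub>R V i" "t < r/2"
    using arm_points[OF a' yS(1)] y(2) unfolding Q_def by blast
  have "i \<noteq> 0 \<and> i \<noteq> 2"
  proof -
    have "y \<in> S i"
      unfolding S_def it(3) using segI[of "t / (r/2)" "Z i" "(r/2) *\<^sub>R V i"] it(2,4) r by simp
    moreover have "y \<notin> S 0" "y \<notin> S 2" using y(2) unfolding Q_def by blast+
    ultimately show ?thesis by metis
  qed
  then have i: "i = 1 \<or> i = 3" using it(1) K by auto
  have "t \<noteq> 0" using it(3) yS(2) under i Z by auto
  then have "y \<in> A i" using A(2)[OF it(1), of t] it r by simp
  then have "C = A i" using arc_disjoint[OF C(1) A(1)[OF it(1)] y(1)] by blast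
  then show "C \<in> {A 1, A 3}" using i by auto
qed

text \<open>If the box is small, every arm over it stays entirely above or entirely below the box,
  so it suffices to compare the heights \<open>snd (Z i)\<close> with \<open>snd x\<close>.\<close>

lemma cross_cell_exists:
  assumes x: "x \<notin> L" and \<epsilon>: "\<epsilon> > 0"
  obtains al be d e r \<delta> K A where "cross_cell D x al be d e r \<delta> K A" "cell x al be r \<delta> \<subseteq> ball x \<epsilon>"
proof -
  let ?p = "fst x"
  obtain al be d e r0 K0 Z V where a0: "arm_system L ?p al be d e r0 K0 Z V" and cases: "arm_cases K0 Z"
    and fib: "\<And>z. z \<in> L \<Longrightarrow> fst z = ?p \<Longrightarrow> \<exists>i\<in>K0. Z i = z"
    by (rule arms[of "fst x"]) (rule that; assumption)
  note c = arm_systemD(1-7)[OF a0] and r0 = arm_systemD(8)[OF a0] and K04 = arm_systemD(9)[OF a0]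
  have finK: "finite K0" using K04 finite_subset by blast
  have ZL: "Z i \<in> L" "fst (Z i) = ?p" if "i \<in> K0" for i
    using arm_point[OF a0 that, of 0] r0 arm_fst(2)[OF a0 that] by auto
  define K where "K = {i \<in> K0. snd x < snd (Z i)}"
  have KK0: "i \<in> K0" if "i \<in> K" for i using that by (simp add: K_def)
  have dz: "snd (Z i) \<noteq> snd x" if "i \<in> K0" for i
    using ZL[OF that] x by (metis prod_eq_iff)
  \<comment> \<open>\<open>m\<close> is at most half of each height gap between \<open>x\<close> and
    the fibre. One \<open>m\<close> is spent on the height of the box (\<open>\<delta>\<close>), the
    other on the rise of the arms over the box (\<open>r1\<close>).\<close>
  obtain m where m: "m > 0" "\<And>i. i \<in> K0 \<Longrightarrow> m \<le> \<bar>snd (Z i) - snd x\<bar> / 2"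
    by (rule finite_positive_bound[OF finK, of "\<lambda>i. \<bar>snd (Z i) - snd x\<bar> / 2"]) (use dz in auto)
  obtain r1 where r1: "r1 > 0" "\<And>i. i \<in> K0 \<Longrightarrow> r1 \<le> m / (1 + \<bar>snd (V i)\<bar>)"
    by (rule finite_positive_bound[OF finK, of
      "\<lambda>i. m / (1 + \<bar>snd (V i)\<bar>)"]) (use m in \<open>auto intro: divide_pos_pos\<close>)
  define M where "M = norm d + norm e"
  have "d \<noteq> 0" using c(3) linear_0[OF c(1)] by auto
  then have M: "M > 0" unfolding M_def by (simp add: add_pos_nonneg)
  define \<delta> where "\<delta> = min m (\<epsilon> / 2)"
  define r where "r = min r0 (min r1 (\<epsilon> / (2 * M)))"
  have \<delta>: "0 < \<delta>" "\<delta> \<le> m" "\<delta> \<le> \<epsilon> / 2" using m \<epsilon> by (auto simp: \<delta>_def)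
  have r: "0 < r" "r \<le> r0" "r \<le> r1" "r \<le> \<epsilon> / (2 * M)" using r0 r1 \<epsilon> M by (auto simp: r_def)
  have a: "arm_system L ?p al be d e r K0 Z V" by (rule arm_system_mono[OF a0 r(1,2)])
  let ?B = "cell x al be r \<delta>"
  have Bc: "\<bar>al (fst y - ?p)\<bar> < r" "\<bar>be (fst y - ?p)\<bar> < r" "\<bar>snd y - snd x\<bar> < \<delta>" if "y \<in> ?B" for y
    using that by (auto simp: cell_def)
  have small: "?B \<subseteq> ball x \<epsilon>"
  proof
    fix y assume y: "y \<in> ?B"
    let ?q = "fst y - ?p"
    have "norm ?q \<le> norm (al ?q *\<^sub>R d) + norm (be ?q *\<^sub>R e)" by (subst c(7)[of ?q]) (rule norm_triangle_ineq)
    also have "\<dots> = \<bar>al ?q\<bar> * norm d + \<bar>be ?q\<bar> * norm e" by simp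
    also have "\<dots> \<le> r * norm d + r * norm e"
      using Bc[OF y] by (intro add_mono mult_right_mono) auto
    also have "\<dots> = r * M" by (simp add: M_def algebra_simps)
    also have "\<dots> \<le> (\<epsilon> / (2 * M)) * M" using r(4) M by (intro mult_right_mono) auto
    also have "\<dots> = \<epsilon> / 2" using M by simp
    finally have "norm ?q \<le> \<epsilon> / 2" .
    moreover have "norm (y - x) \<le> norm (fst (y - x)) + norm (snd (y - x))"
      using norm_Pair_le[of "fst (y - x)" "snd (y - x)"] by (simp only: prod.collapse)
    ultimately have "norm (y - x) < \<epsilon>" using Bc(3)[OF y] \<delta> by simp
    then show "y \<in> ball x \<epsilon>" by (simp add: dist_norm norm_minus_commute)
  qed
  have hgt: "(i \<in> K \<longrightarrow> snd y < snd (Z i + t *\<^sub>R V i)) \<and> (i \<notin> K \<longrightarrow> snd (Z i + t *\<^sub>R V i) < snd y)"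
    if y: "y \<in> ?B" and i: "i \<in> K0" and t: "0 \<le> t" "t < r" for y i t
  proof -
    have "t * \<bar>snd (V i)\<bar> \<le> r1 * \<bar>snd (V i)\<bar>" using t r by (intro mult_right_mono) auto
    also have "\<dots> \<le> m / (1 + \<bar>snd (V i)\<bar>) * \<bar>snd (V i)\<bar>" using r1(2)[OF i] by (intro mult_right_mono) auto
    also have "\<dots> \<le> m" using m(1) by (simp add: field_simps)
    finally have "\<bar>t * snd (V i)\<bar> \<le> m" using t by (simp add: abs_mult)
    moreover have "\<bar>snd y - snd x\<bar> < m" using Bc(3)[OF y] \<delta> by simp
    ultimately show ?thesis using m(2)[OF i] dz[OF i] i unfolding K_def by (auto simp: abs_if split: if_splits)
  qed
  have above: "\<exists>i\<in>K0. \<exists>t. 0 \<le> t \<and> t < r \<and> z = Z i + t *\<^sub>R V i \<and> fst y - ?p = t *\<^sub>R dir d e i"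
    if y: "y \<in> ?B" and z: "z \<in> L" "fst z = fst y" for y z
    using arm_points[OF a z(1)] Bc(1,2)[OF y] z(2) by metis
  have below: "y \<in> sky D" if y: "y \<in> ?B"
    and "\<And>i t. i \<in> K \<Longrightarrow> 0 \<le> t \<Longrightarrow> t < r \<Longrightarrow> fst y - ?p = t *\<^sub>R dir d e i \<Longrightarrow> False" for y
    unfolding sky_def
  proof (intro CollectI ballI impI)
    fix z assume z: "z \<in> L" "fst z = fst y"
    obtain i t where it: "i \<in> K0" "0 \<le> t" "t < r" "z = Z i + t *\<^sub>R V i" "fst y - ?p = t *\<^sub>R dir d e i"
      using above[OF y z] by blast
    then have "i \<notin> K" using that(2) by blast
    then show "snd z < snd y" using hgt[OF y it(1-3)] it(4) by simp
  qed
  have "\<forall>i\<in>K0. \<exists>A. A \<in> arcs D \<and> (\<forall>t. 0 < t \<longrightarrow> t < r \<longrightarrow> Z i + t *\<^sub>R V i \<in> A) \<and> (Z i \<notin> under_points D \<longrightarrow> Z i \<in> A)"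
    using arm_arc[OF a] by metis
  then obtain A where A: "\<And>i. i \<in> K0 \<Longrightarrow> A i \<in> arcs D"
    "\<And>i t. i \<in> K0 \<Longrightarrow> 0 < t \<Longrightarrow> t < r \<Longrightarrow> Z i + t *\<^sub>R V i \<in> A i"
    "\<And>i. i \<in> K0 \<Longrightarrow> Z i \<notin> under_points D \<Longrightarrow> Z i \<in> A i" by metis
  have top: "Z i \<notin> under_points D" if i: "i \<in> K0" and max: "\<And>j. j \<in> K0 \<Longrightarrow> snd (Z j) \<le> snd (Z i)" for i
  proof
    assume "Z i \<in> under_points D"
    then obtain v where v: "v \<in> L" "fst v = fst (Z i)" "snd (Z i) < snd v"
      by (auto simp: under_points_def crossing_def)
    then obtain j where "j \<in> K0" "Z j = v" using fib[OF v(1)] ZL(2)[OF i] by auto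
    then show False using max v(3) by fastforce
  qed
  have eqA: "A i = A j" if "i \<in> K0" "j \<in> K0" "Z i = Z j" "Z i \<notin> under_points D" for i j
    using arc_disjoint[OF A(1)[OF that(1)] A(1)[OF that(2)] A(3)[OF that(1)]] A(3)[OF that(2)] that by metis
  \<comment> \<open>At a crossing the lower strand lies above \<open>x\<close> only together with
    the upper one, so \<open>K = {1, 3}\<close> cannot arise.\<close>
  have Kc: "K = {} \<or> K = {0, 2} \<and> Z 0 = Z 2 \<and> 0 \<in> K0 \<and> 2 \<in> K0 \<and> Z 0 \<notin> under_points D \<or>
      K = {0, 1} \<and> Z 0 = Z 1 \<and> 0 \<in> K0 \<and> 1 \<in> K0 \<and> Z 0 \<notin> under_points D \<or>
      K = {0, 1, 2, 3} \<and> K0 = {0, 1, 2, 3} \<and> Z 0 = Z 2 \<and> Z 1 = Z 3 \<and> snd (Z 1) < snd (Z 0) \<and> Z 0 \<notin> under_points D"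
  proof -
    consider "K0 = {}" | "K0 = {0, 2}" "Z 0 = Z 2" | "K0 = {0, 1}" "Z 0 = Z 1" |
      "K0 = {0, 1, 2, 3}" "Z 0 = Z 2" "Z 1 = Z 3" "snd (Z 1) < snd (Z 0)"
      using cases unfolding arm_cases_def by blast
    then show ?thesis
    proof cases
      case 1 then show ?thesis by (simp add: K_def)
    next
      case 2
      then have "Z 0 \<notin> under_points D" by (intro top) auto
      moreover have "K = {} \<or> K = {0, 2}" unfolding K_def 2(1) using 2(2) by auto
      ultimately show ?thesis using 2 by blast
    next
      case 3
      then have "Z 0 \<notin> under_points D" by (intro top) auto
      moreover have "K = {} \<or> K = {0, 1}" unfolding K_def 3(1) using 3(2) by auto
      ultimately show ?thesis using 3 by blast
    next
      case 4
      then have "Z 0 \<notin> under_points D" by (intro top) auto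
      moreover have "K = {} \<or> K = {0, 2} \<or> K = {0, 1, 2, 3}" unfolding K_def 4(1) using 4(2-4) by auto
      ultimately show ?thesis using 4 by blast
    qed
  qed
  have UA: "under_arcs D (Z 1) = {A 1, A 3}"
    if "K0 = {0, 1, 2, 3}" "Z 0 = Z 2" "Z 1 = Z 3" "snd (Z 1) < snd (Z 0)"
    by (rule arm_under_arcs[OF a that A(1,2)])
  have cr: "crossing D (Z 0) (Z 1)" if "K0 = {0, 1, 2, 3}" "snd (Z 1) < snd (Z 0)"
    unfolding crossing_def using ZL[of 0] ZL[of 1] that by simp
  have "cross_cell D x al be d e r \<delta> K A"
    unfolding cross_cell_def
  proof (intro conjI)
    show "\<forall>q. al q *\<^sub>R d + be q *\<^sub>R e = q" using c(7) by metis
    show "K \<subseteq> {..<4}" using K04 KK0 by blast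
    show "?B \<inter> L = {}"
    proof -
      have False if y: "y \<in> ?B" "y \<in> L" for y
      proof -
        obtain i t where it: "i \<in> K0" "0 \<le> t" "t < r" "y = Z i + t *\<^sub>R V i" using above[OF y] by blast
        then show False using hgt[OF y(1) it(1-3)] by auto
      qed
      then show ?thesis by blast
    qed
    show "\<forall>y\<in>?B. al (fst y - ?p) \<noteq> 0 \<longrightarrow> be (fst y - ?p) \<noteq> 0 \<longrightarrow> y \<in> sky D"
    proof (intro ballI impI)
      fix y assume y: "y \<in> ?B" and n: "al (fst y - ?p) \<noteq> 0" "be (fst y - ?p) \<noteq> 0"
      show "y \<in> sky D"
      proof (rule below[OF y])
        fix i t assume it: "i \<in> K" "fst y - ?p = t *\<^sub>R dir d e i"
        have "i < 4" using arm_fst[OF a KK0[OF it(1)]] by blast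
        then show False using n arm_coord[OF a, of i t] unfolding it(2) index4 by (elim disjE) simp_all
      qed
    qed
    show "\<forall>y\<in>?B. \<forall>i<4. 0 < par al be i (fst y - ?p) \<longrightarrow> nor al be i (fst y - ?p) = 0 \<longrightarrow>
        (if i \<in> K then \<exists>z\<in>A i. wall D y z (nor al be i) else y \<in> sky D)"
    proof (intro ballI allI impI)
      fix y i assume y: "y \<in> ?B" and i: "i < (4::nat)"
        and pn: "0 < par al be i (fst y - ?p)" "nor al be i (fst y - ?p) = 0"
      show "if i \<in> K then \<exists>z\<in>A i. wall D y z (nor al be i) else y \<in> sky D"
      proof (cases "i \<in> K")
        case True
        let ?t = "par al be i (fst y - ?p)"
        have tr: "?t < r" using Bc(1,2)[OF y] i unfolding index4 par_def by (elim disjE) simp_all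
        have "fst y - ?p = ?t *\<^sub>R dir d e i" by (rule ray_vector[OF a i pn(2)])
        then have fy: "fst y = ?p + ?t *\<^sub>R dir d e i" by (metis add.commute diff_add_cancel)
        have "wall D y (Z i + ?t *\<^sub>R V i) (nor al be i)"
          by (rule arm_wall[OF a KK0[OF True] pn(1) tr fy]) (use hgt[OF y KK0[OF True] _ tr] pn(1) True in auto)
        then show ?thesis using A(2)[OF KK0[OF True] pn(1) tr] True by auto
      next
        case False
        have "y \<in> sky D"
        proof (rule below[OF y])
          fix j t assume jt: "j \<in> K" "0 \<le> t" "fst y - ?p = t *\<^sub>R dir d e j"
          have j4: "j < 4" using arm_fst[OF a KK0[OF jt(1)]] by blast
          have "j = i" by (rule arm_par_nor(1)[OF a j4 i pn[unfolded jt(3)] jt(2)])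
          then show False using False jt(1) by simp
        qed
        then show ?thesis using False by simp
      qed
    qed
    show "\<forall>i\<in>K. A i \<in> arcs D" using A(1) KK0 by blast
    show sk: "K = {} \<longrightarrow> ?B \<subseteq> sky D" using below by blast
    show "K \<noteq> {} \<longrightarrow> (\<forall>y\<in>?B. fst y = ?p \<longrightarrow> y \<notin> sky D)"
    proof (intro impI ballI)
      fix y assume "K \<noteq> {}" and y: "y \<in> ?B" "fst y = ?p"
      then obtain i where i: "i \<in> K" by blast
      have "snd y < snd (Z i)" using hgt[OF y(1) KK0[OF i], of 0] i r by auto
      then show "y \<notin> sky D" using ZL[OF KK0[OF i]] y(2) unfolding sky_def by force
    qed
    show "\<forall>y\<in>?B. \<forall>z \<phi>. fst y = ?p \<longrightarrow> wall D y z \<phi> \<longrightarrow>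
        K = {0, 2} \<and> z \<in> A 0 \<and> (\<exists>c. c \<noteq> 0 \<and> (\<forall>q. \<phi> q = c * be q))"
    proof (intro ballI allI impI)
      fix y z \<phi> assume y: "y \<in> ?B" "fst y = ?p" and w: "wall D y z \<phi>"
      have lin: "linear \<phi>" using w by (simp add: wall_def)
      obtain q0 where q0: "\<phi> q0 \<noteq> 0" using w unfolding wall_def by blast
      obtain \<eta> h where \<eta>: "\<eta> > 0" and h: "\<forall>q\<in>ball (fst y) \<eta>. \<forall>t. (q, t) \<in> L \<longleftrightarrow> \<phi> (q - fst y) = 0 \<and> t = h q"
        using w unfolding wall_def by blast
      have Kne: "K \<noteq> {}" using sk wall_top(2)[OF w] y(1) by blast
      \<comment> \<open>The projection of arm \<open>i\<close> lies in the zero line of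
        \<open>\<phi>\<close>. Two independent rays would make \<open>\<phi>\<close> vanish, so on
        the vertical axis of the box walls occur only below a straight strand.\<close>
      have dir0: "\<phi> (dir d e i) = 0" if i: "i \<in> K" for i
      proof -
        define t where "t = min (r/2) (\<eta> / (2 * (1 + norm (dir d e i))))"
        have n: "0 < 2 * (1 + norm (dir d e i))" by (simp add: add_pos_nonneg)
        then have t: "0 < t" "t < r" using r \<eta> by (auto simp: t_def)
        have "t * norm (dir d e i) \<le> \<eta> / (2 * (1 + norm (dir d e i))) * norm (dir d e i)"
          by (rule mult_right_mono) (auto simp: t_def)
        also have "\<dots> < \<eta>" using n \<eta> by (simp add: field_simps) (smt (verit) mult_nonneg_nonneg norm_ge_zero)
        finally have "?p + t *\<^sub>R dir d e i \<in> ball (fst y) \<eta>" using y(2) t by (simp add: dist_norm)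
        moreover have "(?p + t *\<^sub>R dir d e i, snd (Z i + t *\<^sub>R V i)) = Z i + t *\<^sub>R V i"
          using arm_fst(3)[OF a KK0[OF i], of t] by (metis prod.collapse)
        then have "(?p + t *\<^sub>R dir d e i, snd (Z i + t *\<^sub>R V i)) \<in> L"
          using arm_point[OF a KK0[OF i], of t] t by simp
        ultimately have "\<phi> (?p + t *\<^sub>R dir d e i - fst y) = 0" using h by blast
        then have "\<phi> (t *\<^sub>R dir d e i) = 0" using y(2) by simp
        then show ?thesis using t linear_scale[OF lin, of t "dir d e i"] by simp
      qed
      have \<phi>q: "\<phi> q = al q * \<phi> d + be q * \<phi> e" for q
        by (subst c(7)[of q]) (simp add: linear_add[OF lin] linear_scale[OF lin])
      have d0: "dir d e 0 = d" "dir d e 1 = e" by (simp_all add: dir_def)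
      have "\<not> (0 \<in> K \<and> 1 \<in> K)"
      proof
        assume "0 \<in> K \<and> 1 \<in> K"
        then have "\<phi> d = 0" "\<phi> e = 0" using dir0[of 0] dir0[of 1] d0 by auto
        then show False using q0 \<phi>q[of q0] by simp
      qed
      then have K: "K = {0, 2}" "Z 0 \<notin> under_points D" using Kc Kne by auto
      then have "\<phi> d = 0" using dir0[of 0] d0 by auto
      then have q: "\<phi> q = \<phi> e * be q" for q using \<phi>q[of q] by simp
      have "\<phi> e \<noteq> 0" using q0 q[of q0] by auto
      moreover have "z \<in> A 0"
      proof -
        have "0 \<in> K0" using K(1) KK0 by blast
        then have "Z 0 = z" using wall_unique[OF w] ZL y(2) by metis
        then show ?thesis using A(3)[OF \<open>0 \<in> K0\<close> K(2)] by simp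
      qed
      ultimately show "K = {0, 2} \<and> z \<in> A 0 \<and> (\<exists>c. c \<noteq> 0 \<and> (\<forall>q. \<phi> q = c * be q))" using K(1) q by blast
    qed
    show "K = {} \<or> K = {0, 2} \<and> A 0 = A 2 \<or> K = {0, 1} \<and> A 0 = A 1 \<or>
      K = {0, 1, 2, 3} \<and> A 0 = A 2 \<and> (\<exists>v u. crossing D v u \<and> fst u = ?p \<and> snd x < snd u \<and>
        v \<in> A 0 \<and> under_arcs D u = {A 1, A 3})"
    proof -
      consider "K = {}" | "K = {0, 2}" "Z 0 = Z 2" "0 \<in> K0" "2 \<in> K0" "Z 0 \<notin> under_points D" |
        "K = {0, 1}" "Z 0 = Z 1" "0 \<in> K0" "1 \<in> K0" "Z 0 \<notin> under_points D" |
        "K = {0, 1, 2, 3}" "K0 = {0, 1, 2, 3}" "Z 0 = Z 2" "Z 1 = Z 3" "snd (Z 1) < snd (Z 0)"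
          "Z 0 \<notin> under_points D"
        using Kc by blast
      then show ?thesis
      proof cases
        case 2 then show ?thesis using eqA[of 0 2] by blast
      next
        case 3 then show ?thesis using eqA[of 0 1] by blast
      next
        case 4
        have "0 \<in> K0" "1 \<in> K0" "2 \<in> K0" "1 \<in> K" using 4 by auto
        then have "A 0 = A 2" "Z 0 \<in> A 0" "fst (Z 1) = ?p" "snd x < snd (Z 1)"
          using eqA[of 0 2] A(3)[of 0] ZL(2)[of 1] 4 by (auto simp: K_def)
        then show ?thesis using UA[OF 4(2-5)] cr[OF 4(2,5)] 4(1) by blast
      qed blast
    qed
    show "\<forall>v u. crossing D v u \<longrightarrow> fst u = ?p \<longrightarrow> snd x < snd u \<longrightarrow>
        K = {0, 1, 2, 3} \<and> v \<in> A 0 \<and> under_arcs D u = {A 1, A 3}"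
    proof (intro allI impI)
      fix v u assume vu: "crossing D v u" "fst u = ?p" "snd x < snd u"
      then have L: "v \<in> L" "u \<in> L" "fst v = ?p" "snd u < snd v" by (auto simp: crossing_def)
      obtain i where i: "i \<in> K0" "Z i = u" using fib[OF L(2) vu(2)] by blast
      obtain j where j: "j \<in> K0" "Z j = v" using fib[OF L(1,3)] by blast
      have K0: "K0 = {0, 1, 2, 3}" "Z 0 = Z 2" "Z 1 = Z 3" "snd (Z 1) < snd (Z 0)"
        using cases i j L(4) unfolding arm_cases_def by auto
      then have uv: "Z 1 = u" "Z 0 = v" using i j L(4) by auto
      then have "1 \<in> K" using K0(1) vu(3) by (simp add: K_def)
      then have "K \<noteq> {}" "K \<noteq> {0, 2}" by auto
      moreover have "Z 0 \<noteq> Z 1" using K0(4) by auto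
      ultimately have "K = {0, 1, 2, 3}" "Z 0 \<notin> under_points D" using Kc by blast+
      then show "K = {0, 1, 2, 3} \<and> v \<in> A 0 \<and> under_arcs D u = {A 1, A 3}"
        using UA[OF K0] A(3)[of 0] K0(1) uv by auto
    qed
  qed (fact c r(1) \<delta>(1))+
  then show ?thesis using that small by blast
qed

end

section \<open>Sections of a coloring\<close>

text \<open>
  A section is a potential on the complement that jumps by the color of an arc across the curtain below
  that arc.  Nothing is required below crossing points, where it is forced by the Fox relation.
\<close>

definition section_on :: "diagram \<Rightarrow> (space set \<Rightarrow> 'g::group_add) \<Rightarrow> space set \<Rightarrow> (space \<Rightarrow> 'g) \<Rightarrow> bool" where
  "section_on D \<gamma> U s \<longleftrightarrow>
     (\<forall>y\<in>U \<inter> sky D. \<exists>e>0. \<forall>a\<in>ball y e. s a = s y) \<and>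
     (\<forall>y\<in>U. \<forall>z \<phi> A. wall D y z \<phi> \<longrightarrow> A \<in> arcs D \<longrightarrow> z \<in> A \<longrightarrow>
        (\<exists>e>0. \<forall>a\<in>ball y e. \<forall>b\<in>ball y e. \<phi> (fst a - fst y) * \<phi> (fst b - fst y) < 0 \<longrightarrow> s b = s a + \<gamma> A))"

lemma section_on_subset: "section_on D \<gamma> U s \<Longrightarrow> V \<subseteq> U \<Longrightarrow> section_on D \<gamma> V s"
  unfolding section_on_def by blast

lemma section_on_translate:
  assumes "section_on D \<gamma> U s" shows "section_on D \<gamma> U (\<lambda>a. g + s a)"
  unfolding section_on_def
proof (intro conjI ballI allI impI)
  fix y assume "y \<in> U \<inter> sky D"
  then obtain e where "e > 0" "\<forall>a\<in>ball y e. s a = s y" using assms unfolding section_on_def by blast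
  then show "\<exists>e>0. \<forall>a\<in>ball y e. g + s a = g + s y" by (intro exI[of _ e]) metis
next
  fix y z \<phi> A assume "y \<in> U" "wall D y z \<phi>" "A \<in> arcs D" "z \<in> A"
  then obtain e where "e > 0"
    "\<forall>a\<in>ball y e. \<forall>b\<in>ball y e. \<phi> (fst a - fst y) * \<phi> (fst b - fst y) < 0 \<longrightarrow> s b = s a + \<gamma> A"
    using assms unfolding section_on_def by blast
  then show "\<exists>e>0. \<forall>a\<in>ball y e. \<forall>b\<in>ball y e. \<phi> (fst a - fst y) * \<phi> (fst b - fst y) < 0 \<longrightarrow>
    g + s b = g + s a + \<gamma> A"
    by (intro exI[of _ e]) (metis add.assoc)
qed

section \<open>The open sky, the functionals of walls, and the quadrants of a box\<close>

lemma sky_open: "open (sky D)"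
proof -
  \<comment> \<open>The complement of the sky is the link together with everything below it: the sum
    of a compact set and a closed set.\<close>
  have "- sky D = {x + y |x y. x \<in> support D \<and> y \<in> {0} \<times> {..0}}"
  proof (intro equalityI subsetI)
    fix y assume "y \<in> - sky D"
    then obtain z where z: "z \<in> support D" "fst z = fst y" "snd y \<le> snd z" by (auto simp: sky_def not_less)
    then have "y = z + (0, snd y - snd z)" "(0, snd y - snd z) \<in> {0} \<times> {..0}" by (auto simp: prod_eq_iff)
    then show "y \<in> {x + y |x y. x \<in> support D \<and> y \<in> {0} \<times> {..0}}" using z by blast
  next
    fix y assume "y \<in> {x + y |x y. x \<in> support D \<and> y \<in> {0::real^2} \<times> {..0::real}}"
    then obtain z t where "z \<in> support D" "t \<le> 0" "y = z + (0, t)" by auto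
    then have "z \<in> support D \<and> fst z = fst y \<and> \<not> snd z < snd y" by simp
    then show "y \<in> - sky D" unfolding sky_def by blast
  qed
  moreover have "{x + y |x y. x \<in> support D \<and>
    y \<in> {0} \<times> {..0}} = (\<Union>x\<in>support D. \<Union>y\<in>{0::real^2} \<times> {..0::real}. {x + y})"
    by blast
  moreover have "closed (\<Union>x\<in>support D. \<Union>y\<in>{0::real^2} \<times> {..0::real}. {x + y})"
    by (rule compact_closed_sums[OF compact_support]) (intro closed_Times closed_singleton closed_atMost)
  ultimately show ?thesis by (simp add: open_closed)
qed

lemma near_point:
  fixes y v :: "'a::real_normed_vector"
  assumes "open U" "y \<in> U" shows "\<forall>\<^sub>F \<tau> in at_right (0::real). y + \<tau> *\<^sub>R v \<in> U"
proof -
  have "((\<lambda>\<tau>. y + \<tau> *\<^sub>R v) \<longlongrightarrow> y + 0 *\<^sub>R v) (at_right 0)" by (intro tendsto_intros)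
  then show ?thesis using assms by (auto dest!: topological_tendstoD)
qed

lemma linear_same_kernel:
  fixes \<phi> \<psi> :: "'a::real_normed_vector \<Rightarrow> real"
  assumes lin: "linear \<phi>" "linear \<psi>" and ne: "\<psi> w \<noteq> 0" and e: "e > 0"
    and ker: "\<And>v. norm v < e \<Longrightarrow> \<phi> v = 0 \<longleftrightarrow> \<psi> v = 0"
  obtains c where "c \<noteq> 0" "\<And>v. \<phi> v = c * \<psi> v"
proof -
  have ker': "\<phi> v = 0 \<longleftrightarrow> \<psi> v = 0" for v
  proof -
    define t where "t = e / (2 * (1 + norm v))"
    have n: "0 < 2 * (1 + norm v)" by (simp add: add_pos_nonneg)
    then have t: "t > 0" using e by (simp add: t_def)
    have "norm (t *\<^sub>R v) < e" using n e t
      by (simp add: t_def field_simps) (smt (verit) mult_nonneg_nonneg norm_ge_zero)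
    then have "\<phi> (t *\<^sub>R v) = 0 \<longleftrightarrow> \<psi> (t *\<^sub>R v) = 0" by (rule ker)
    then show ?thesis using t by (simp add: linear_scale[OF lin(1)] linear_scale[OF lin(2)])
  qed
  have "\<phi> v = \<phi> w / \<psi> w * \<psi> v" for v
  proof -
    have "\<psi> (v - (\<psi> v / \<psi> w) *\<^sub>R w) = 0" using ne by (simp add: linear_diff[OF lin(2)] linear_scale[OF lin(2)])
    then have "\<phi> (v - (\<psi> v / \<psi> w) *\<^sub>R w) = 0" using ker' by blast
    then show ?thesis by (simp add: linear_diff[OF lin(1)] linear_scale[OF lin(1)])
  qed
  moreover have "\<phi> w / \<psi> w \<noteq> 0" using ne ker'[of w] by simp
  ultimately show ?thesis using that by blast
qed

text \<open>Close to \<open>fst y\<close> both functionals vanish exactly on the projection of the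
  link, so their kernels agree. Hence the sign of
  \<open>\<phi> (fst a - fst y) * \<phi> (fst b - fst y)\<close>, which is all that a section sees
  of \<open>\<phi>\<close>, does not depend on the choice of \<open>\<phi>\<close>.\<close>

lemma wall_proportional:
  assumes "wall D y z \<phi>" "wall D y z' \<psi>"
  obtains c where "c \<noteq> 0" "\<And>v. \<phi> v = c * \<psi> v"
proof -
  obtain \<eta> h where 1: "\<eta> > 0" "\<forall>q\<in>ball (fst y) \<eta>. \<forall>t. (q, t) \<in> support D \<longleftrightarrow> \<phi> (q - fst y) = 0 \<and> t = h q"
    using assms(1) unfolding wall_def by blast
  obtain \<eta>' h' where 2: "\<eta>' > 0" "\<forall>q\<in>ball (fst y) \<eta>'. \<forall>t. (q, t) \<in> support D \<longleftrightarrow> \<psi> (q - fst y) = 0 \<and> t = h' q"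
    using assms(2) unfolding wall_def by blast
  obtain w where w: "\<psi> w \<noteq> 0" using assms(2) unfolding wall_def by blast
  have lin: "linear \<phi>" "linear \<psi>" using assms by (auto simp: wall_def)
  have "\<phi> v = 0 \<longleftrightarrow> \<psi> v = 0" if "norm v < min \<eta> \<eta>'" for v
  proof -
    have b: "fst y + v \<in> ball (fst y) \<eta>" "fst y + v \<in> ball (fst y) \<eta>'" using that by (auto simp: dist_norm)
    have "\<phi> (fst y + v - fst y) = 0 \<longleftrightarrow> (\<exists>t. (fst y + v, t) \<in> support D)" using 1(2) b(1) by blast
    also have "\<dots> \<longleftrightarrow> \<psi> (fst y + v - fst y) = 0" using 2(2) b(2) by blast
    finally show ?thesis by simp
  qed
  then show ?thesis using linear_same_kernel[OF lin w, of "min \<eta> \<eta>'"] that 1(1) 2(1) by auto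
qed

text \<open>Quadrant \<open>i\<close> lies between the rays \<open>i\<close> and
  \<open>i + 1\<close>; hence ray \<open>i\<close> separates the quadrants \<open>i\<close> and
  \<open>i + 3\<close> modulo 4.\<close>

definition quadrant where
  "quadrant x al be r \<delta> i = {y \<in> cell x al be r \<delta>. 0 < par al be i (fst y - fst x) \<and>
    0 < par al be ((i + 1) mod 4) (fst y - fst x)}"

lemma cross_cellD:
  assumes "cross_cell D x al be d e r \<delta> K A"
  shows "linear al" "linear be" "al d = 1" "al e = 0" "be d = 0" "be e = 1" "0 < r" "0 < \<delta>" "K \<subseteq> {..<4}"
    "cell x al be r \<delta> \<inter> support D = {}"
    "\<And>y. y \<in> cell x al be r \<delta> \<Longrightarrow> al (fst y - fst x) \<noteq> 0 \<Longrightarrow> be (fst y - fst x) \<noteq> 0 \<Longrightarrow> y \<in> sky D"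
    "\<And>y i. y \<in> cell x al be r \<delta> \<Longrightarrow> i < 4 \<Longrightarrow> 0 < par al be i (fst y - fst x) \<Longrightarrow> nor al be i (fst y - fst x) = 0 \<Longrightarrow>
        i \<in> K \<Longrightarrow> \<exists>z\<in>A i. wall D y z (nor al be i)"
    "\<And>y i. y \<in> cell x al be r \<delta> \<Longrightarrow> i < 4 \<Longrightarrow> 0 < par al be i (fst y - fst x) \<Longrightarrow> nor al be i (fst y - fst x) = 0 \<Longrightarrow>
        i \<notin> K \<Longrightarrow> y \<in> sky D"
    "\<And>i. i \<in> K \<Longrightarrow> A i \<in> arcs D"
    "K = {} \<Longrightarrow> cell x al be r \<delta> \<subseteq> sky D"
    "\<And>y. K \<noteq> {} \<Longrightarrow> y \<in> cell x al be r \<delta> \<Longrightarrow> fst y = fst x \<Longrightarrow> y \<notin> sky D"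
    "\<And>y z \<phi>. y \<in> cell x al be r \<delta> \<Longrightarrow> fst y = fst x \<Longrightarrow> wall D y z \<phi> \<Longrightarrow>
        K = {0, 2} \<and> z \<in> A 0 \<and> (\<exists>c. c \<noteq> 0 \<and> (\<forall>q. \<phi> q = c * be q))"
    "K = {} \<or> K = {0, 2} \<and> A 0 = A 2 \<or> K = {0, 1} \<and> A 0 = A 1 \<or>
      K = {0, 1, 2, 3} \<and> A 0 = A 2 \<and> (\<exists>v u. crossing D v u \<and> fst u = fst x \<and> snd x < snd u \<and>
        v \<in> A 0 \<and> under_arcs D u = {A 1, A 3})"
    "\<And>v u. crossing D v u \<Longrightarrow> fst u = fst x \<Longrightarrow> snd x < snd u \<Longrightarrow>
        K = {0, 1, 2, 3} \<and> v \<in> A 0 \<and> under_arcs D u = {A 1, A 3}"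
    "\<And>q. al q = 0 \<Longrightarrow> be q = 0 \<Longrightarrow> q = 0"
proof -
  note * = assms[unfolded cross_cell_def]
  show "linear al" "linear be" "al d = 1" "al e = 0" "be d = 0" "be e = 1" "0 < r" "0 < \<delta>" "K \<subseteq> {..<4}"
    "cell x al be r \<delta> \<inter> support D = {}"
    "K = {} \<or> K = {0, 2} \<and> A 0 = A 2 \<or> K = {0, 1} \<and> A 0 = A 1 \<or>
      K = {0, 1, 2, 3} \<and> A 0 = A 2 \<and> (\<exists>v u. crossing D v u \<and> fst u = fst x \<and> snd x < snd u \<and>
        v \<in> A 0 \<and> under_arcs D u = {A 1, A 3})"
    using * by - (elim conjE, assumption)+
  have 1: "\<forall>y\<in>cell x al be r \<delta>. al (fst y - fst x) \<noteq> 0 \<longrightarrow> be (fst y - fst x) \<noteq> 0 \<longrightarrow> y \<in> sky D"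
    using * by - (elim conjE, assumption)
  then show "\<And>y. y \<in> cell x al be r \<delta> \<Longrightarrow> al (fst y - fst x) \<noteq> 0 \<Longrightarrow> be (fst y - fst x) \<noteq> 0 \<Longrightarrow> y \<in> sky D" by blast
  have 2: "\<forall>y\<in>cell x al be r \<delta>. \<forall>i<4. 0 < par al be i (fst y - fst x) \<longrightarrow> nor al be i (fst y - fst x) = 0 \<longrightarrow>
        (if i \<in> K then \<exists>z\<in>A i. wall D y z (nor al be i) else y \<in> sky D)"
    using * by - (elim conjE, assumption)
  show "\<And>y i. y \<in> cell x al be r \<delta> \<Longrightarrow> i < 4 \<Longrightarrow> 0 < par al be i (fst y - fst x) \<Longrightarrow> nor al be i (fst y - fst x) = 0 \<Longrightarrow>
        i \<in> K \<Longrightarrow> \<exists>z\<in>A i. wall D y z (nor al be i)" using 2 by fastforce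
  show "\<And>y i. y \<in> cell x al be r \<delta> \<Longrightarrow> i < 4 \<Longrightarrow> 0 < par al be i (fst y - fst x) \<Longrightarrow> nor al be i (fst y - fst x) = 0 \<Longrightarrow>
        i \<notin> K \<Longrightarrow> y \<in> sky D" using 2 by fastforce
  have 3: "\<forall>i\<in>K. A i \<in> arcs D" using * by - (elim conjE, assumption)
  then show "\<And>i. i \<in> K \<Longrightarrow> A i \<in> arcs D" by blast
  have 4: "K = {} \<longrightarrow> cell x al be r \<delta> \<subseteq> sky D" using * by - (elim conjE, assumption)
  then show "K = {} \<Longrightarrow> cell x al be r \<delta> \<subseteq> sky D" by blast
  have 5: "K \<noteq> {} \<longrightarrow> (\<forall>y\<in>cell x al be r \<delta>. fst y = fst x \<longrightarrow> y \<notin> sky D)" using * by - (elim conjE, assumption)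
  then show "\<And>y. K \<noteq> {} \<Longrightarrow> y \<in> cell x al be r \<delta> \<Longrightarrow> fst y = fst x \<Longrightarrow> y \<notin> sky D" by blast
  have 6: "\<forall>y\<in>cell x al be r \<delta>. \<forall>z \<phi>. fst y = fst x \<longrightarrow> wall D y z \<phi> \<longrightarrow>
        K = {0, 2} \<and> z \<in> A 0 \<and> (\<exists>c. c \<noteq> 0 \<and> (\<forall>q. \<phi> q = c * be q))" using * by - (elim conjE, assumption)
  then show "\<And>y z \<phi>. y \<in> cell x al be r \<delta> \<Longrightarrow> fst y = fst x \<Longrightarrow> wall D y z \<phi> \<Longrightarrow>
        K = {0, 2} \<and> z \<in> A 0 \<and> (\<exists>c. c \<noteq> 0 \<and> (\<forall>q. \<phi> q = c * be q))" by blast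
  have 7: "\<forall>v u. crossing D v u \<longrightarrow> fst u = fst x \<longrightarrow> snd x < snd u \<longrightarrow>
        K = {0, 1, 2, 3} \<and> v \<in> A 0 \<and> under_arcs D u = {A 1, A 3}" using * by - (elim conjE, assumption)
  then show "\<And>v u. crossing D v u \<Longrightarrow> fst u = fst x \<Longrightarrow> snd x < snd u \<Longrightarrow>
        K = {0, 1, 2, 3} \<and> v \<in> A 0 \<and> under_arcs D u = {A 1, A 3}" by blast
  have "\<forall>q. al q *\<^sub>R d + be q *\<^sub>R e = q" using * by - (elim conjE, assumption)
  then show "q = 0" if "al q = 0" "be q = 0" for q using that by (metis add.right_neutral scale_zero_left)
qed

lemma cell_open: "linear al \<Longrightarrow> linear be \<Longrightarrow> open (cell x al be r \<delta>)"
proof -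
  assume lin: "linear al" "linear be"
  have cont: "continuous_on UNIV (\<lambda>y::space. f (fst y - fst x))" if "linear f" for f :: "real^2 \<Rightarrow> real"
    by (rule linear_continuous_on_compose[OF _ that]) (intro continuous_intros)
  show ?thesis unfolding cell_def
    by (intro open_Collect_conj open_Collect_less continuous_on_rabs continuous_on_const cont[OF lin(1)] cont[OF lin(2)])
       (intro continuous_intros)
qed

lemma convex_linear_less: "linear f \<Longrightarrow> convex {y::space. c < f (fst y - p)}" for f :: "real^2 \<Rightarrow> real"
proof -
  assume lin: "linear f"
  have "{y::space. c < f (fst y - p)} = (\<lambda>y. f (fst y)) -` {c + f p <..}"
    by (auto simp: linear_diff[OF lin])
  moreover have "linear (\<lambda>y::space. f (fst y))" using linear_compose[OF linear_fst lin] by (simp add: o_def)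
  ultimately show ?thesis by (metis convex_linear_vimage convex_real_interval(3))
qed

lemma cell_eq: "linear al \<Longrightarrow> linear be \<Longrightarrow>
  cell x al be r \<delta> = {y. - r < al (fst y - fst x)} \<inter> {y. - r < - al (fst y - fst x)} \<inter>
   ({y. - r < be (fst y - fst x)} \<inter> {y. - r < - be (fst y - fst x)}) \<inter> UNIV \<times> {snd x - \<delta> <..< snd x + \<delta>}"
  unfolding cell_def by (auto simp: abs_less_iff)

lemma cell_convex:
  assumes lin: "linear al" "linear be" shows "convex (cell x al be r \<delta>)"
  unfolding cell_eq[OF lin]
  by (intro convex_Int convex_Times convex_UNIV convex_real_interval convex_linear_less[OF lin(1)] convex_linear_less[OF lin(2)]
     convex_linear_less[OF linear_compose_neg[OF lin(1)]] convex_linear_less[OF linear_compose_neg[OF lin(2)]])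

lemma quadrant_convex:
  assumes lin: "linear al" "linear be" and i: "i < 4" shows "convex (quadrant x al be r \<delta> i)"
proof -
  have "quadrant x al be r \<delta> i = cell x al be r \<delta> \<inter> ({y. 0 < par al be i (fst y - fst x)} \<inter> {y. 0 < par al be ((i + 1) mod 4) (fst y - fst x)})"
    by (auto simp: quadrant_def)
  moreover have "(i + 1) mod 4 < 4" by simp
  ultimately show ?thesis
    using cell_convex[OF lin] convex_linear_less[OF linear_par[OF lin i]] convex_linear_less[OF linear_par[OF lin]]
    by (metis convex_Int)
qed

lemma quadrant_sky:
  assumes c: "cross_cell D x al be d e r \<delta> K A" and i: "i < 4"
  shows "quadrant x al be r \<delta> i \<subseteq> cell x al be r \<delta> \<inter> sky D"
proof
  fix y assume y: "y \<in> quadrant x al be r \<delta> i"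
  then have "al (fst y - fst x) \<noteq> 0" "be (fst y - fst x) \<noteq> 0"
    using i unfolding quadrant_def index4 by (auto simp: par_def)
  then show "y \<in> cell x al be r \<delta> \<inter> sky D" using cross_cellD(11)[OF c] y by (auto simp: quadrant_def)
qed

text \<open>Small steps from a point of ray \<open>i\<close> along
  \<open>dir d e ((i + 1) mod 4)\<close> and against it enter the two quadrants beside the
  ray.\<close>

lemma quadrant_adjacent:
  assumes lin: "linear al" "linear be" and v: "al d = 1" "al e = 0" "be d = 0" "be e = (1::real)" and i: "i < 4"
    and U: "open U" "y \<in> U" and y: "y \<in> cell x al be r \<delta>" "0 < par al be i (fst y - fst x)"
      "nor al be i (fst y - fst x) = 0"
  obtains a b where "a \<in> quadrant x al be r \<delta> i \<inter> U" "b \<in> quadrant x al be r \<delta> ((i + 3) mod 4) \<inter> U"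
    "nor al be i (fst a - fst x) * nor al be i (fst b - fst x) < 0"
proof -
  let ?B = "cell x al be r \<delta>"
  define w where "w = (dir d e ((i + 1) mod 4), 0::real)"
  have "open (U \<inter> ?B)" "y \<in> U \<inter> ?B" using U(2) y by (auto intro: open_Int[OF U(1) cell_open[OF lin]])
  note np = near_point[OF this]
  have "\<forall>\<^sub>F \<tau> in at_right (0::real). 0 < \<tau>" by (simp add: eventually_at_right_less)
  then have "\<forall>\<^sub>F \<tau> in at_right (0::real). y + \<tau> *\<^sub>R w \<in> U \<inter> ?B \<and> y + \<tau> *\<^sub>R (- w) \<in> U \<inter> ?B \<and> 0 < \<tau>"
    using np[of w] np[of "- w"] by eventually_elim blast
  from eventually_happens'[OF trivial_limit_at_right_real this]
  obtain \<tau> where \<tau>: "y + \<tau> *\<^sub>R w \<in> U \<inter> ?B" "y + \<tau> *\<^sub>R (- w) \<in> U \<inter> ?B" "0 < \<tau>"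
    by blast
  let ?q = "fst y - fst x"
  have i1: "(i + 1) mod 4 < 4" by simp
  note c = dir_coord[OF lin v i1, of \<tau>]
  have "fst (y + \<tau> *\<^sub>R w) - fst x = ?q + \<tau> *\<^sub>R dir d e ((i + 1) mod 4)"
    "fst (y + \<tau> *\<^sub>R (- w)) - fst x = ?q - \<tau> *\<^sub>R dir d e ((i + 1) mod 4)" by (simp_all add: w_def algebra_simps)
  then have co: "al (fst (y + \<tau> *\<^sub>R w) - fst x) = al ?q + \<tau> * [1,0,-1,0] ! ((i + 1) mod 4)"
    "be (fst (y + \<tau> *\<^sub>R w) - fst x) = be ?q + \<tau> * [0,1,0,-1] ! ((i + 1) mod 4)"
    "al (fst (y + \<tau> *\<^sub>R (- w)) - fst x) = al ?q - \<tau> * [1,0,-1,0] ! ((i + 1) mod 4)"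
    "be (fst (y + \<tau> *\<^sub>R (- w)) - fst x) = be ?q - \<tau> * [0,1,0,-1] ! ((i + 1) mod 4)"
    using c by (simp_all only: linear_add[OF lin(1)] linear_add[OF lin(2)] linear_diff[OF lin(1)] linear_diff[OF lin(2)])
  define a b where "a = y + \<tau> *\<^sub>R w" and "b = y + \<tau> *\<^sub>R (- w)"
  define a1 a2 b1 b2 where "a1 = al (fst a - fst x)" and "a2 = be (fst a - fst x)" and "b1 = al (fst b - fst x)"
    and "b2 = be (fst b - fst x)"
  define q1 q2 where "q1 = al ?q" and "q2 = be ?q"
  note co' = co[folded a_def b_def q1_def q2_def, folded a1_def a2_def b1_def b2_def]
  have y': "0 < [q1, q2, - q1, - q2] ! i" "[q2, q1, q2, q1] ! i = 0"
    using y(2,3) i unfolding index4 par_def nor_def q1_def q2_def by (elim disjE; simp)+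
  have P: "0 < [a1, a2, - a1, - a2] ! i \<and> 0 < [a1, a2, - a1, - a2] ! ((i + 1) mod 4) \<and>
     0 < [b1, b2, - b1, - b2] ! ((i + 3) mod 4) \<and> 0 < [b1, b2, - b1, - b2] ! i \<and>
     [a2, a1, a2, a1] ! i * [b2, b1, b2, b1] ! i < 0"
  proof -
    consider "i = 0" | "i = 1" | "i = 2" | "i = 3" using i by linarith
    then show ?thesis
    proof cases
      case 1
      then have "0 < q1" "q2 = 0" "a1 = q1" "a2 = \<tau>" "b1 = q1" "b2 = - \<tau>" using y' co' by simp_all
      then show ?thesis using 1 \<tau>(3) by (simp add: mult_less_0_iff)
    next
      case 2
      then have "0 < q2" "q1 = 0" "a1 = - \<tau>" "a2 = q2" "b1 = \<tau>" "b2 = q2" using y' co' by simp_all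
      then show ?thesis using 2 \<tau>(3) by (simp add: mult_less_0_iff)
    next
      case 3
      then have "q1 < 0" "q2 = 0" "a1 = q1" "a2 = - \<tau>" "b1 = q1" "b2 = \<tau>" using y' co' by simp_all
      then show ?thesis using 3 \<tau>(3) by (simp add: mult_less_0_iff)
    next
      case 4
      then have "q2 < 0" "q1 = 0" "a1 = \<tau>" "a2 = q2" "b1 = - \<tau>" "b2 = q2" using y' co' by simp_all
      then show ?thesis using 4 \<tau>(3) by (simp add: mult_less_0_iff)
    qed
  qed
  have parv: "par al be k (fst a - fst x) = [a1, a2, - a1, - a2] ! k"
    "par al be k (fst b - fst x) = [b1, b2, - b1, - b2] ! k"
     "nor al be k (fst a - fst x) = [a2, a1, a2, a1] ! k" "nor al be k (fst b - fst x) = [b2, b1, b2, b1] ! k"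
       if "k < 4" for k
    using that unfolding index4 par_def nor_def a1_def a2_def b1_def b2_def by (elim disjE; simp)+
  have i3: "((i + 3) mod 4 + 1) mod 4 = i" using i unfolding index4 by auto
  show ?thesis
  proof (rule that)
    show "a \<in> quadrant x al be r \<delta> i \<inter> U"
      using \<tau>(1) P unfolding quadrant_def a_def[symmetric] by (simp add: parv i)
    show "b \<in> quadrant x al be r \<delta> ((i + 3) mod 4) \<inter> U"
      using \<tau>(2) P i3 unfolding quadrant_def b_def[symmetric] by (simp add: parv i)
    show "nor al be i (fst a - fst x) * nor al be i (fst b - fst x) < 0" using P by (simp add: parv i)
  qed
qed

lemma quadrant_cover:
  assumes "y \<in> cell x al be r \<delta>" "al (fst y - fst x) \<noteq> 0" "be (fst y - fst x) \<noteq> 0"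
  shows "\<exists>i<4. y \<in> quadrant x al be r \<delta> i"
proof -
  consider "al (fst y - fst x) > 0 \<and> be (fst y - fst x) > 0" |
    "al (fst y - fst x) < 0 \<and> be (fst y - fst x) > 0" |
    "al (fst y - fst x) < 0 \<and> be (fst y - fst x) < 0" | "al (fst y - fst x) > 0 \<and> be (fst y - fst x) < 0"
    using assms(2,3) by linarith
  then show ?thesis
  proof cases
    case 1 then show ?thesis using assms(1) by (intro exI[of _ 0]) (simp add: quadrant_def par_def)
  next
    case 2 then show ?thesis using assms(1) by (intro exI[of _ 1]) (simp add: quadrant_def par_def)
  next
    case 3 then show ?thesis using assms(1) by (intro exI[of _ 2]) (simp add: quadrant_def par_def)
  next
    case 4 then show ?thesis using assms(1) by (intro exI[of _ 3]) (simp add: quadrant_def par_def)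
  qed
qed

text \<open>A step along \<open>d + e\<close> adds the same \<open>\<tau>\<close> to both
  coordinates, and for small positive \<open>\<tau>\<close> both become non-zero.\<close>

lemma quadrant_dense:
  assumes lin: "linear al" "linear be" and v: "al d = 1" "al e = 0" "be d = 0" "be e = (1::real)"
    and U: "open U" "y \<in> U" and y: "y \<in> cell x al be r \<delta>"
  obtains i a where "i < 4" "a \<in> quadrant x al be r \<delta> i" "a \<in> U"
proof -
  let ?B = "cell x al be r \<delta>"
  define w where "w = (d + e, 0::real)"
  have "open (U \<inter> ?B)" "y \<in> U \<inter> ?B" using U(2) y by (auto intro: open_Int[OF U(1) cell_open[OF lin]])
  note np = near_point[OF this, of w]
  have nz: "\<forall>\<^sub>F \<tau> in at_right (0::real). q + \<tau> \<noteq> 0" for q :: real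
  proof (cases "q < 0")
    case True
    have "\<forall>\<^sub>F \<tau> in at_right (0::real). \<tau> < - q" using True unfolding eventually_at
      by (intro exI[of _ "- q"]) (auto simp: dist_real_def)
    then show ?thesis by eventually_elim simp
  next
    case False
    have "\<forall>\<^sub>F \<tau> in at_right (0::real). 0 < \<tau>" by (simp add: eventually_at_right_less)
    then show ?thesis by eventually_elim (use False in simp)
  qed
  have "\<forall>\<^sub>F \<tau> in at_right (0::real). y + \<tau> *\<^sub>R w \<in> U \<inter> ?B \<and> al (fst y - fst x) + \<tau> \<noteq> 0 \<and>
    be (fst y - fst x) + \<tau> \<noteq> 0"
    using np nz[of "al (fst y - fst x)"] nz[of "be (fst y - fst x)"] by eventually_elim blast
  from eventually_happens'[OF trivial_limit_at_right_real this]
  obtain \<tau> where \<tau>: "y + \<tau> *\<^sub>R w \<in> U \<inter> ?B" "al (fst y - fst x) + \<tau> \<noteq> 0" "be (fst y - fst x) + \<tau> \<noteq> 0"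
    by blast
  have "fst (y + \<tau> *\<^sub>R w) - fst x = (fst y - fst x) + \<tau> *\<^sub>R (d + e)" by (simp add: w_def)
  then have "al (fst (y + \<tau> *\<^sub>R w) - fst x) = al (fst y - fst x) + \<tau>"
    "be (fst (y + \<tau> *\<^sub>R w) - fst x) = be (fst y - fst x) + \<tau>"
    by (simp_all only: linear_add[OF lin(1)] linear_add[OF lin(2)] linear_scale[OF lin(1)] linear_scale[OF lin(2)] v) simp_all
  then obtain i where "i < 4" "y + \<tau> *\<^sub>R w \<in> quadrant x al be r \<delta> i"
    using quadrant_cover[of "y + \<tau> *\<^sub>R w" x al be r \<delta>] \<tau> by auto
  then show ?thesis using that \<tau>(1) by blast
qed

lemma ray_point:
  assumes c: "cross_cell D x al be d e r \<delta> K A" and i: "i < 4"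
  obtains y where "y \<in> cell x al be r \<delta>" "0 < par al be i (fst y - fst x)" "nor al be i (fst y - fst x) = 0"
proof -
  note c' = cross_cellD(1-8)[OF c]
  let ?y = "(fst x + (r/2) *\<^sub>R dir d e i, snd x)"
  have f: "fst ?y - fst x = (r/2) *\<^sub>R dir d e i" by simp
  note co = dir_coord[OF c'(1-6) i, of "r/2"]
  show ?thesis
  proof (rule that[of ?y])
    show "?y \<in> cell x al be r \<delta>" "0 < par al be i (fst ?y - fst x)" "nor al be i (fst ?y - fst x) = 0"
      unfolding cell_def mem_Collect_eq f using co i c'(7,8) unfolding index4 par_def nor_def
        by (elim disjE; simp)+
  qed
qed

section \<open>Uniqueness and existence of sections over a box\<close>

lemma section_on_sky:
  assumes "section_on D \<gamma> U s" "y \<in> U" "y \<in> sky D"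
  obtains e where "e > 0" "\<And>a. a \<in> ball y e \<Longrightarrow> s a = s y"
  using assms(1)[unfolded section_on_def, THEN conjunct1] assms(2,3) that by blast

lemma section_on_wall:
  assumes "section_on D \<gamma> U s" "y \<in> U" "wall D y z \<phi>" "A \<in> arcs D" "z \<in> A"
  obtains e where "e > 0" "\<And>a b. a \<in> ball y e \<Longrightarrow> b \<in> ball y e \<Longrightarrow>
    \<phi> (fst a - fst y) * \<phi> (fst b - fst y) < 0 \<Longrightarrow> s b = s a + \<gamma> A"
proof -
  have "\<forall>y\<in>U. \<forall>z \<phi> A. wall D y z \<phi> \<longrightarrow> A \<in> arcs D \<longrightarrow> z \<in> A \<longrightarrow>
        (\<exists>e>0. \<forall>a\<in>ball y e. \<forall>b\<in>ball y e. \<phi> (fst a - fst y) * \<phi> (fst b - fst y) < 0 \<longrightarrow> s b = s a + \<gamma> A)"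
    using assms(1) unfolding section_on_def by (rule conjunct2)
  then have "\<exists>e>0. \<forall>a\<in>ball y e. \<forall>b\<in>ball y e. \<phi> (fst a - fst y) * \<phi> (fst b - fst y) < 0 \<longrightarrow> s b = s a + \<gamma> A"
    using assms(2-) by blast
  then show ?thesis using that by blast
qed

text \<open>Both sections jump on the right by the same amount, so \<open>s' - s\<close> does not
  jump at all: the two copies of \<open>\<gamma> (A i)\<close> cancel. It is thus constant along the
  cycle of the four quadrants, and every sky point of the box is close to one of them.\<close>

lemma section_unique:
  fixes s s' :: "space \<Rightarrow> 'g::group_add"
  assumes c: "cross_cell D x al be d e r \<delta> K A"
    and s: "section_on D \<gamma> (cell x al be r \<delta>) s" and s': "section_on D \<gamma> (cell x al be r \<delta>) s'"
  obtains g where "\<And>y. y \<in> cell x al be r \<delta> \<inter> sky D \<Longrightarrow> s' y = g + s y"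
proof -
  let ?B = "cell x al be r \<delta>" and ?Q = "quadrant x al be r \<delta>"
  note lin = cross_cellD(1,2)[OF c] and v = cross_cellD(3-6)[OF c]
  define f where "f y = s' y - s y" for y
  have loc: "\<exists>e>0. \<forall>a\<in>ball y e. f a = f y" if "y \<in> ?B \<inter> sky D" for y
  proof -
    have y: "y \<in> ?B" "y \<in> sky D" using that by auto
    obtain e1 where e1: "e1 > 0" "\<And>a. a \<in> ball y e1 \<Longrightarrow> s a = s y" by (rule section_on_sky[OF s y]) blast
    obtain e2 where e2: "e2 > 0" "\<And>a. a \<in> ball y e2 \<Longrightarrow> s' a = s' y" by (rule section_on_sky[OF s' y]) blast
    have "f a = f y" if "a \<in> ball y (min e1 e2)" for a
      using e1(2)[of a] e2(2)[of a] that by (simp add: f_def)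
    moreover have "min e1 e2 > 0" using e1(1) e2(1) by simp
    ultimately show ?thesis by blast
  qed
  have constq: "f a = f b" if "i < 4" "a \<in> ?Q i" "b \<in> ?Q i" for i a b
  proof (rule locally_constant_on_connected[OF convex_connected[OF quadrant_convex[OF lin \<open>i < 4\<close>]] that(2,3)])
    fix y assume "y \<in> ?Q i"
    then have "y \<in> ?B \<inter> sky D" using quadrant_sky[OF c \<open>i < 4\<close>] by blast
    then show "\<exists>e>0. \<forall>a\<in>ball y e \<inter> ?Q i. f a = f y" using loc by blast
  qed
  have step: "\<exists>a\<in>?Q i. \<exists>b\<in>?Q ((i + 3) mod 4). f a = f b" if i: "i < 4" for i
  proof -
    obtain y where y: "y \<in> ?B" "0 < par al be i (fst y - fst x)" "nor al be i (fst y - fst x) = 0"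
      using ray_point[OF c i] by blast
    show ?thesis
    proof (cases "i \<in> K")
      case True
      then obtain z where z: "z \<in> A i" "wall D y z (nor al be i)" using cross_cellD(12)[OF c y(1) i y(2,3)]
        by blast
      have Ai: "A i \<in> arcs D" using cross_cellD(14)[OF c True] .
      obtain e1 where e1: "e1 > 0" "\<And>a b. a \<in> ball y e1 \<Longrightarrow> b \<in> ball y e1 \<Longrightarrow>
        nor al be i (fst a - fst y) * nor al be i (fst b - fst y) < 0 \<Longrightarrow> s b = s a + \<gamma> (A i)"
        by (rule section_on_wall[OF s y(1) z(2) Ai z(1)]) blast
      obtain e2 where e2: "e2 > 0" "\<And>a b. a \<in> ball y e2 \<Longrightarrow> b \<in> ball y e2 \<Longrightarrow>
        nor al be i (fst a - fst y) * nor al be i (fst b - fst y) < 0 \<Longrightarrow> s' b = s' a + \<gamma> (A i)"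
        by (rule section_on_wall[OF s' y(1) z(2) Ai z(1)]) blast
      obtain a b where ab: "a \<in> ?Q i \<inter> ball y (min e1 e2)" "b \<in> ?Q ((i + 3) mod 4) \<inter> ball y (min e1 e2)"
        "nor al be i (fst a - fst x) * nor al be i (fst b - fst x) < 0"
        by (rule quadrant_adjacent[OF lin v i _ _ y, of "ball y (min e1 e2)"]) (use e1(1) e2(1) in auto)
      have n: "nor al be i (fst a - fst y) = nor al be i (fst a - fst x)" for a
        using linear_diff[OF linear_nor[OF lin i], of "fst a - fst x" "fst y - fst x"] y(3) by simp
      have "s b = s a + \<gamma> (A i)" "s' b = s' a + \<gamma> (A i)" using e1(2)[of a b] e2(2)[of a b] ab
        by (simp_all add: n)
      then have "f a = f b" by (simp add: f_def group_add_simps del: add_uminus_conv_diff)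
      then show ?thesis using ab by blast
    next
      case False
      then have "y \<in> ?B \<inter> sky D" using cross_cellD(13)[OF c y(1) i y(2,3)] y by blast
      then obtain e where e: "e > 0" "\<forall>a\<in>ball y e. f a = f y" using loc by blast
      obtain a b where ab: "a \<in> ?Q i \<inter> ball y e" "b \<in> ?Q ((i + 3) mod 4) \<inter> ball y e"
        by (rule quadrant_adjacent[OF lin v i _ _ y, of "ball y e"]) (use e(1) in auto)
      then have "f a = f y" "f b = f y" using e(2) by blast+
      then have "f a = f b" by simp
      then show ?thesis using ab by blast
    qed
  qed
  have adj: "f a = f b" if ab: "i < 4" "a \<in> ?Q i" "b \<in> ?Q ((i + 3) mod 4)" for i a b
  proof -
    obtain a' b' where a'b': "a' \<in> ?Q i" "b' \<in> ?Q ((i + 3) mod 4)" "f a' = f b'" using step[OF ab(1)] by blast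
    have "f a = f a'" "f b = f b'" using constq[OF ab(1,2) a'b'(1)] constq[OF _ ab(3) a'b'(2)] by simp_all
    then show ?thesis using a'b'(3) by simp
  qed
  have ne: "\<exists>a. a \<in> ?Q i" if "i < 4" for i using step[OF that] by blast
  obtain a0 a1 a2 where q: "a0 \<in> ?Q 0" "a1 \<in> ?Q 1" "a2 \<in> ?Q 2" using ne[of 0] ne[of 1] ne[of 2] by auto
  have "f a = f a0" if "i < 4" "a \<in> ?Q i" for i a
  proof -
    have a1: "f a1 = f a0" using adj[of 1 a1 a0] q by simp
    have a2: "f a2 = f a1" using adj[of 2 a2 a1] q by simp
    have "f a = f a2" if "a \<in> ?Q 3" using adj[of 3 a a2] q that by simp
    then show ?thesis using that a1 a2 constq[of 0 a a0] constq[of 1 a a1] constq[of 2 a a2] q unfolding index4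
      by auto
  qed
  note all = this
  have "s' y = f a0 + s y" if y: "y \<in> ?B \<inter> sky D" for y
  proof -
    obtain e where e: "e > 0" "\<forall>a\<in>ball y e. f a = f y" using loc[OF y] by blast
    obtain i a where "i < 4" "a \<in> ?Q i" "a \<in> ball y e"
      by (rule quadrant_dense[OF lin v, of "ball y e" y x r \<delta>]) (use e y in auto)
    then have "f y = f a0" using all e(2) by metis
    then show ?thesis unfolding f_def by (metis diff_add_cancel)
  qed
  then show ?thesis by (rule that)
qed

text \<open>The Fox relation in an arbitrary group: as every value is its own inverse, it says that
  \<open>\<gamma> c\<close> is the conjugate of \<open>\<gamma> a\<close> by
  \<open>\<gamma> b\<close>.\<close>

definition group_coloring :: "diagram \<Rightarrow> (space set \<Rightarrow> 'g::group_add) \<Rightarrow> bool" where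
  "group_coloring D \<gamma> \<longleftrightarrow> (\<forall>A\<in>arcs D. \<gamma> A + \<gamma> A = 0) \<and>
     (\<forall>v u a b c. crossing D v u \<longrightarrow> b \<in> arcs D \<longrightarrow> v \<in> b \<longrightarrow> under_arcs D u = {a, c} \<longrightarrow>
        \<gamma> b + \<gamma> a + \<gamma> b + \<gamma> c = 0)"

text \<open>Relations around a point may be rotated cyclically, so the starting quadrant is a matter
  of choice.\<close>

lemma add_eq_0_commute: "a + b = 0 \<longleftrightarrow> b + a = (0::'g::group_add)"
  by (metis add.inverse_unique left_minus)

text \<open>The section is constant on each quadrant, its values being the partial sums of the jumps
  met on a turn around the axis of the box. The turn closes up because all jumps together give 0:
  below a crossing by the Fox relation, below a straight strand or a corner by
  \<open>\<gamma> A + \<gamma> A = 0\<close>.\<close>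

lemma section_exists:
  fixes \<gamma> :: "space set \<Rightarrow> 'g::group_add"
  assumes c: "cross_cell D x al be d e r \<delta> K A" and \<gamma>: "group_coloring D \<gamma>"
    and D: "regular_diagram D"
    and H: "0 \<in> H" "\<And>g h. g \<in> H \<Longrightarrow> h \<in> H \<Longrightarrow> g + h \<in> H" "\<And>A. A \<in> arcs D \<Longrightarrow> \<gamma> A \<in> H"
  obtains s where "section_on D \<gamma> (cell x al be r \<delta>) s" "\<And>y. s y \<in> H"
proof -
  interpret regular_diagram D by (rule D)
  let ?B = "cell x al be r \<delta>"
  note lin = cross_cellD(1,2)[OF c] and v = cross_cellD(3-6)[OF c]
  define g where "g i = (if i \<in> K then \<gamma> (A i) else 0)" for i
  have gg: "g i + g i = 0" for i
    using \<gamma> cross_cellD(14)[OF c] by (auto simp: g_def group_coloring_def)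
  have gH: "g i \<in> H" for i using H cross_cellD(14)[OF c] by (auto simp: g_def)
  have sum: "g 1 + g 2 + g 3 + g 0 = 0"
    using cross_cellD(18)[OF c]
  proof (elim disjE conjE exE)
    assume "K = {}" then show ?thesis by (simp add: g_def)
  next
    assume "K = {0, 2}" "A 0 = A 2" then show ?thesis using gg[of 0] by (simp add: g_def)
  next
    assume "K = {0, 1}" "A 0 = A 1" then show ?thesis using gg[of 0] by (simp add: g_def)
  next
    fix v' u assume K: "K = {0, 1, 2, 3}" "A 0 = A 2"
      and cr: "crossing D v' u" "v' \<in> A 0" "under_arcs D u = {A 1, A 3}"
    have "A 0 \<in> arcs D" using cross_cellD(14)[OF c, of 0] K by simp
    moreover have "under_arcs D u = {A 3, A 1}" using cr(3) by (simp add: insert_commute)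
    ultimately have "\<gamma> (A 0) + \<gamma> (A 3) + \<gamma> (A 0) + \<gamma> (A 1) = 0"
      using \<gamma> cr(1,2) unfolding group_coloring_def by blast
    then have "\<gamma> (A 1) + (\<gamma> (A 0) + \<gamma> (A 3) + \<gamma> (A 0)) = 0" by (simp only: add_eq_0_commute)
    then show ?thesis using K by (simp add: g_def add.assoc)
  qed
  define qv where "qv i = [0, g 1, g 1 + g 2, g 1 + g 2 + g 3] ! i" for i
  have qs: "qv 0 = 0" "qv 1 = g 1" "qv 2 = g 1 + g 2" "qv 3 = g 1 + g 2 + g 3" by (simp_all add: qv_def)
  \<comment> \<open>Entering quadrant \<open>i\<close> across ray \<open>i\<close> adds
    \<open>g i\<close>; crossing back adds the same element, since \<open>g i + g i = 0\<close>. For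
    \<open>i = 0\<close> this is the closing relation \<open>sum\<close>.\<close>
  have step: "qv i = qv ((i + 3) mod 4) + g i" "qv ((i + 3) mod 4) = qv i + g i" if i: "i < 4" for i
  proof -
    have m: "3 mod 4 = (3::nat)" "(0 + 3) mod 4 = (3::nat)" "(1 + 3) mod 4 = (0::nat)"
      "(2 + 3) mod 4 = (1::nat)" "(3 + 3) mod 4 = (2::nat)" by simp_all
    show 1: "qv i = qv ((i + 3) mod 4) + g i"
      using i unfolding index4 by (elim disjE) (simp_all only: m qs sum add_0_left)
    have "qv i + g i = qv ((i + 3) mod 4) + (g i + g i)" by (subst 1) (simp only: add.assoc)
    then show "qv ((i + 3) mod 4) = qv i + g i" by (simp only: gg add_0_right)
  qed
  \<comment> \<open>Points on a ray must be given to one of the two quadrants beside it. The choice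
    is harmless: at a wall the value is free, and along a ray without a wall both quadrants carry
    the same value.\<close>
  define idx where "idx y = (if 0 \<le> be (fst y - fst x) then if 0 \<le> al (fst y - fst x) then 0 else 1
      else if al (fst y - fst x) < 0 then 2 else (3::nat))" for y :: space
  define s where "s y = qv (idx y)" for y
  have sH: "s y \<in> H" for y
  proof -
    have "idx y < 4" by (simp add: idx_def)
    then show ?thesis unfolding s_def index4 using gH H(1,2) qs by (elim disjE) auto
  qed
  have near_ray: "idx a = i \<or> idx a = (i + 3) mod 4" if "i < 4" "0 < par al be i (fst a - fst x)" for i a
    using that unfolding index4 idx_def par_def by (elim disjE) auto
  have across_ray: "idx a = i \<and> idx b = (i + 3) mod 4 \<or> idx b = i \<and> idx a = (i + 3) mod 4"
    if "i < 4" "0 < par al be i (fst a - fst x)" "0 < par al be i (fst b - fst x)"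
      "nor al be i (fst a - fst x) * nor al be i (fst b - fst x) < 0" for i a b
    using that unfolding index4 idx_def par_def nor_def by (elim disjE) (auto simp: mult_less_0_iff)
  have cont: "continuous_on UNIV (\<lambda>y::space. f (fst y - fst x))" if "linear f" for f :: "real^2 \<Rightarrow> real"
    by (rule linear_continuous_on_compose[OF _ that]) (intro continuous_intros)
  have nbhd: "\<exists>e>0. \<forall>a\<in>ball y e. 0 < f (fst a - fst x)" if f: "linear f" "0 < f (fst y - fst x)"
    for f :: "real^2 \<Rightarrow> real" and y :: space
  proof -
    have "open {a::space. 0 < f (fst a - fst x)}" by (intro open_Collect_less continuous_on_const cont f(1))
    then show ?thesis using f(2) unfolding open_contains_ball by blast
  qed
  have rays: "(\<exists>i<4. 0 < par al be i (fst y - fst x) \<and> nor al be i (fst y - fst x) = 0) \<or> fst y = fst x \<or>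
     al (fst y - fst x) \<noteq> 0 \<and> be (fst y - fst x) \<noteq> 0" for y :: space
  proof (cases "al (fst y - fst x) = 0")
    case True
    consider "be (fst y - fst x) > 0" | "be (fst y - fst x) < 0" | "be (fst y - fst x) = 0" by linarith
    then show ?thesis
    proof cases
      case 1 then show ?thesis using True by (intro disjI1 exI[of _ 1]) (simp add: par_def nor_def)
    next
      case 2 then show ?thesis using True by (intro disjI1 exI[of _ 3]) (simp add: par_def nor_def)
    next
      case 3 then show ?thesis using True cross_cellD(20)[OF c, of "fst y - fst x"] by simp
    qed
  next
    case False
    show ?thesis
    proof (cases "be (fst y - fst x) = 0")
      case True
      consider "al (fst y - fst x) > 0" | "al (fst y - fst x) < 0" using False by linarith
      then show ?thesis
      proof cases
        case 1 then show ?thesis using True by (intro disjI1 exI[of _ 0]) (simp add: par_def nor_def)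
      next
        case 2 then show ?thesis using True by (intro disjI1 exI[of _ 2]) (simp add: par_def nor_def)
      qed
    qed (use False in simp)
  qed
  have "section_on D \<gamma> ?B s"
    unfolding section_on_def
  proof (intro conjI ballI allI impI)
    fix y assume y: "y \<in> ?B \<inter> sky D"
    consider i where "i < 4" "0 < par al be i (fst y - fst x)" "nor al be i (fst y - fst x) = 0" |
      "fst y = fst x" |
      "al (fst y - fst x) \<noteq> 0" "be (fst y - fst x) \<noteq> 0" using rays[of y] by blast
    then show "\<exists>e>0. \<forall>a\<in>ball y e. s a = s y"
    proof cases
      case (1 i)
      have "i \<notin> K"
      proof
        assume "i \<in> K"
        then obtain z where "wall D y z (nor al be i)" using cross_cellD(12)[OF c _ 1(1-3)] y by blast
        then show False using wall_top(2) y by blast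
      qed
      then have "g i = 0" by (simp add: g_def)
      then have q: "qv ((i + 3) mod 4) = qv i" using step(2)[OF 1(1)] by simp
      obtain e where e: "e > 0" "\<forall>a\<in>ball y e. 0 < par al be i (fst a - fst x)"
        using nbhd[OF linear_par[OF lin 1(1)] 1(2)] by blast
      have "s a = qv i" if "a \<in> ball y e" for a
        using near_ray[OF 1(1), of a] e(2) that q unfolding s_def by metis
      then have "s a = s y" if "a \<in> ball y e" for a using that e(1) by simp
      then show ?thesis using e(1) by blast
    next
      case 2
      \<comment> \<open>A sky point on the axis of the box means that no arm passes above the box,
        so all jumps are 0.\<close>
      have "K = {}" using cross_cellD(16)[OF c _ _ 2] y by blast
      then have "g i = 0" for i by (simp add: g_def)
      then have "qv i = 0" if "i < 4" for i using that qs unfolding index4 by auto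
      then have "s a = 0" for a unfolding s_def idx_def by simp
      then show ?thesis by (intro exI[of _ 1]) simp
    next
      case 3
      define f1 where "f1 = (if 0 < al (fst y - fst x) then al else (\<lambda>q. - al q))"
      define f2 where "f2 = (if 0 < be (fst y - fst x) then be else (\<lambda>q. - be q))"
      have f: "linear f1" "linear f2" unfolding f1_def f2_def
        using lin linear_compose_neg[OF lin(1)] linear_compose_neg[OF lin(2)] by simp_all
      have p: "0 < f1 (fst y - fst x)" "0 < f2 (fst y - fst x)" using 3 by (auto simp: f1_def f2_def)
      obtain e1 where e1: "e1 > 0" "\<forall>a\<in>ball y e1. 0 < f1 (fst a - fst x)" using nbhd[OF f(1) p(1)] by blast
      obtain e2 where e2: "e2 > 0" "\<forall>a\<in>ball y e2. 0 < f2 (fst a - fst x)" using nbhd[OF f(2) p(2)] by blast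
      have "s a = s y" if "a \<in> ball y (min e1 e2)" for a
      proof -
        have "0 < f1 (fst a - fst x)" "0 < f2 (fst a - fst x)" using e1(2) e2(2) that by auto
        then have "idx a = idx y" using p unfolding idx_def f1_def f2_def by (auto split: if_splits)
        then show ?thesis by (simp add: s_def)
      qed
      moreover have "min e1 e2 > 0" using e1(1) e2(1) by simp
      ultimately show ?thesis by blast
    qed
  next
    fix y z \<phi> C assume y: "y \<in> ?B" and w: "wall D y z \<phi>" and C: "C \<in> arcs D" "z \<in> C"
    have ysky: "y \<notin> sky D" by (rule wall_top(2)[OF w])
    consider i where "i < 4" "0 < par al be i (fst y - fst x)" "nor al be i (fst y - fst x) = 0" |
      "fst y = fst x" |
      "al (fst y - fst x) \<noteq> 0" "be (fst y - fst x) \<noteq> 0" using rays[of y] by blast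
    then show "\<exists>e>0. \<forall>a\<in>ball y e. \<forall>b\<in>ball y e. \<phi> (fst a - fst y) * \<phi> (fst b - fst y) < 0 \<longrightarrow> s b = s a + \<gamma> C"
    proof cases
      case (1 i)
      have iK: "i \<in> K" using cross_cellD(13)[OF c y 1] ysky by blast
      obtain z' where z': "z' \<in> A i" "wall D y z' (nor al be i)" using cross_cellD(12)[OF c y 1 iK] by blast
      have "z' \<in> L" "fst z' = fst y" using z'(2) by (auto simp: wall_def)
      then have "z' = z" using wall_unique[OF w] by blast
      then have CA: "C = A i" using arc_disjoint[OF C(1) cross_cellD(14)[OF c iK] C(2)] z' by blast
      have gi: "g i = \<gamma> C" using iK CA by (simp add: g_def)
      obtain k where k: "k \<noteq> 0" "\<And>v. \<phi> v = k * nor al be i v" using wall_proportional[OF w z'(2)] by blast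
      obtain e where e: "e > 0" "\<forall>a\<in>ball y e. 0 < par al be i (fst a - fst x)"
        using nbhd[OF linear_par[OF lin 1(1)] 1(2)] by blast
      have n: "nor al be i (fst a - fst y) = nor al be i (fst a - fst x)" for a
        using linear_diff[OF linear_nor[OF lin 1(1)], of "fst a - fst x" "fst y - fst x"] 1(3) by simp
      have "s b = s a + \<gamma> C" if ab: "a \<in> ball y e" "b \<in> ball y e" "\<phi> (fst a - fst y) * \<phi> (fst b - fst y) < 0"
        for a b
      proof -
        have "(k * k) * (nor al be i (fst a - fst x) * nor al be i (fst b - fst x)) < 0"
          using ab(3) unfolding k(2) n by (simp add: algebra_simps)
        moreover have "0 < k * k" using k(1) by (simp add: zero_less_mult_iff) linarith
        ultimately have "nor al be i (fst a - fst x) * nor al be i (fst b - fst x) < 0"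
          by (simp only: mult_less_0_iff) auto
        moreover have "0 < par al be i (fst a - fst x)" "0 < par al be i (fst b - fst x)" using e(2) ab by auto
        ultimately have "idx a = i \<and> idx b = (i + 3) mod 4 \<or> idx b = i \<and> idx a = (i + 3) mod 4"
          using across_ray[OF 1(1)] by blast
        then show ?thesis using step[OF 1(1)] unfolding s_def gi by metis
      qed
      then show ?thesis using e(1) by blast
    next
      case 2
      obtain k where K: "K = {0, 2}" "z \<in> A 0" and k: "k \<noteq> 0" "\<And>q. \<phi> q = k * be q"
        using cross_cellD(17)[OF c y 2 w] by blast
      have "0 \<in> K" using K by simp
      then have CA: "C = A 0" using arc_disjoint[OF C(1) cross_cellD(14)[OF c] C(2) K(2)] by blast
      have "K \<noteq> {}" "1 \<notin> K" using K(1) by simp_all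
      then have A02: "A 0 = A 2" using cross_cellD(18)[OF c] by blast
      have gs: "g 0 = \<gamma> C" "g 1 = 0" "g 2 = \<gamma> C" "g 3 = 0" using CA A02 by (simp_all add: g_def K(1))
      \<comment> \<open>With equal jumps at the rays 0 and 2 and none at the others,
        \<open>s\<close> depends only on the sign of \<open>be\<close>; so it also jumps correctly
        at points of the axis, which lie on no ray.\<close>
      have sb: "s a = (if 0 \<le> be (fst a - fst x) then 0 else \<gamma> C)" for a
        unfolding s_def idx_def using qs gs by simp
      have "s b = s a + \<gamma> C" if ab: "\<phi> (fst a - fst y) * \<phi> (fst b - fst y) < 0" for a b
      proof -
        have "(k * k) * (be (fst a - fst x) * be (fst b - fst x)) < 0"
          using ab unfolding k(2) 2 by (simp add: algebra_simps)
        moreover have "0 < k * k" using k(1) by (simp add: zero_less_mult_iff) linarith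
        ultimately have "be (fst a - fst x) * be (fst b - fst x) < 0" by (simp only: mult_less_0_iff) auto
        then show ?thesis unfolding sb using gg[of 0] gs by (auto simp: mult_less_0_iff)
      qed
      then show ?thesis by (intro exI[of _ 1]) auto
    next
      case 3
      then show ?thesis using cross_cellD(11)[OF c y] ysky by blast
    qed
  qed
  then show ?thesis using that sH by blast
qed

section \<open>From colorings to cocycles\<close>

text \<open>The values will be taken in one type that contains the dihedral groups for all moduli;
  the set \<open>H\<close> singles out the group of the given modulus.\<close>

definition subgroup_add :: "'g::group_add set \<Rightarrow> bool" where
  "subgroup_add H \<longleftrightarrow> 0 \<in> H \<and> (\<forall>g\<in>H. \<forall>h\<in>H. g - h \<in> H)"

lemma subgroup_addD:
  assumes "subgroup_add H"
  shows "0 \<in> H" "g \<in> H \<Longrightarrow> h \<in> H \<Longrightarrow> g - h \<in> H" "g \<in> H \<Longrightarrow> - g \<in> H" "g \<in> H \<Longrightarrow> h \<in> H \<Longrightarrow> g + h \<in> H"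
    "g \<in> H \<Longrightarrow> h \<in> H \<Longrightarrow> - g + h \<in> H"
proof -
  show 0: "0 \<in> H" and d: "g \<in> H \<Longrightarrow> h \<in> H \<Longrightarrow> g - h \<in> H" for g h using assms by (auto simp: subgroup_add_def)
  show m: "g \<in> H \<Longrightarrow> - g \<in> H" for g using d[OF 0] by simp
  show a: "g \<in> H \<Longrightarrow> h \<in> H \<Longrightarrow> g + h \<in> H" for g h using d[OF _ m, of g h] by simp
  show "g \<in> H \<Longrightarrow> h \<in> H \<Longrightarrow> - g + h \<in> H" using a[OF m] by simp
qed

definition valued_in :: "space set \<Rightarrow> 'g set \<Rightarrow> (space \<Rightarrow> space \<Rightarrow> 'g) \<Rightarrow> bool" where
  "valued_in X H w \<longleftrightarrow> (\<forall>x\<in>X. \<exists>e>0. \<forall>a\<in>ball x e. \<forall>b\<in>ball x e. w a b \<in> H)"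

text \<open>
  The sign of a meridional cocycle is non-trivial on arbitrarily small loops around every point of the link;
  it has no local potential \<open>k\<close> there.
\<close>

definition meridional :: "space set \<Rightarrow> ('g \<Rightarrow> bool) \<Rightarrow> (space \<Rightarrow> space \<Rightarrow> 'g) \<Rightarrow> bool" where
  "meridional L sg w \<longleftrightarrow> (\<forall>z\<in>L. \<forall>V. open V \<longrightarrow> z \<in> V \<longrightarrow>
     \<not> (\<exists>k::space \<Rightarrow> bool. \<forall>y\<in>V - L. \<exists>e>0. \<forall>a\<in>ball y e. \<forall>b\<in>ball y e. sg (w a b) \<longleftrightarrow> k a \<noteq> k b))"

text \<open>
  The normalisation \<open>k p = 0\<close> at a base point in the sky makes the coloring determined by the cocycle,
  not only up to a global conjugation.
\<close>

definition represents :: "diagram \<Rightarrow> space \<Rightarrow> (space set \<Rightarrow> 'g::group_add) \<Rightarrow> (space \<Rightarrow> space \<Rightarrow> 'g) \<Rightarrow> bool" where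
  "represents D p \<gamma> w \<longleftrightarrow> (\<exists>k. k p = 0 \<and>
     (\<forall>x\<in>- support D. \<exists>e>0. section_on D \<gamma> (ball x e) (\<lambda>a. w x a - k a)))"

text \<open>A homomorphism to the group of order 2, written with \<open>bool\<close> and
  \<open>\<noteq>\<close>, whose non-trivial class consists of involutions, such as the determinant
  on a dihedral group.\<close>

definition sign_hom :: "('g::group_add \<Rightarrow> bool) \<Rightarrow> bool" where
  "sign_hom sg \<longleftrightarrow> (\<forall>a b. sg (a + b) \<longleftrightarrow> sg a \<noteq> sg b) \<and> (\<forall>a. sg a \<longrightarrow> a + a = 0)"

lemma sign_homD:
  assumes "sign_hom sg"
  shows "sg (a + b) \<longleftrightarrow> sg a \<noteq> sg b" "\<not> sg 0" "sg (- a) \<longleftrightarrow> sg a" "sg (a - b) \<longleftrightarrow> sg a \<noteq> sg b" "sg a \<Longrightarrow> a + a = 0"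
proof -
  show 1: "sg (a + b) \<longleftrightarrow> sg a \<noteq> sg b" for a b using assms by (simp add: sign_hom_def)
  show 2: "\<not> sg 0" using 1[of 0 0] by simp
  show 3: "sg (- a) \<longleftrightarrow> sg a" for a using 1[of "- a" a] 2 by simp
  show "sg (a - b) \<longleftrightarrow> sg a \<noteq> sg b" using 1[of a "- b"] 3[of b] by simp
  show "sg a \<Longrightarrow> a + a = 0" using assms by (simp add: sign_hom_def)
qed

text \<open>The local form of the link in \<open>wall\<close> does not involve the height of
  \<open>y\<close>, and its zero line can be re-centred at each of its points; so every point below
  the strand near \<open>y\<close> has a wall too.\<close>

lemma wall_shift:
  assumes w: "wall D y z \<phi>"
  obtains \<eta> h where "\<eta> > 0" "continuous_on (ball (fst y) \<eta>) h" "h (fst y) = snd z"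
    "\<And>q t. q \<in> ball (fst y) \<eta> \<Longrightarrow> (q, t) \<in> support D \<longleftrightarrow> \<phi> (q - fst y) = 0 \<and> t = h q"
    "\<And>q s. q \<in> ball (fst y) \<eta> \<Longrightarrow> \<phi> (q - fst y) = 0 \<Longrightarrow> s < h q \<Longrightarrow> wall D (q, s) (q, h q) \<phi>"
proof -
  have lin: "linear \<phi>" and z: "z \<in> support D" "fst z = fst y" and ne: "\<exists>q. \<phi> q \<noteq> 0" using w
    by (auto simp: wall_def)
  obtain \<eta> h where \<eta>: "\<eta> > 0" "continuous_on (ball (fst y) \<eta>) h"
    "\<forall>q\<in>ball (fst y) \<eta>. \<forall>t. (q, t) \<in> support D \<longleftrightarrow> \<phi> (q - fst y) = 0 \<and> t = h q"
    using w unfolding wall_def by blast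
  have "(fst y, snd z) \<in> support D" using z by (metis prod.collapse)
  then have hz: "h (fst y) = snd z" using \<eta>(1,3) by (metis centre_in_ball)
  show ?thesis
  proof (rule that[OF \<eta>(1,2) hz])
    show "(q, t) \<in> support D \<longleftrightarrow> \<phi> (q - fst y) = 0 \<and> t = h q" if "q \<in> ball (fst y) \<eta>" for q t using \<eta>(3) that
      by blast
    fix q s assume q: "q \<in> ball (fst y) \<eta>" "\<phi> (q - fst y) = 0" "s < h q"
    obtain \<eta>' where \<eta>': "\<eta>' > 0" "ball q \<eta>' \<subseteq> ball (fst y) \<eta>" using q(1) by (meson open_ball open_contains_ball)
    have sh: "\<phi> (q' - q) = \<phi> (q' - fst y)" for q'
      using linear_diff[OF lin, of "q' - fst y" "q - fst y"] q(2) by simp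
    have qL: "(q, h q) \<in> support D" using \<eta>(3) q by blast
    have c: "continuous_on (ball q \<eta>') h" using \<eta>(2) \<eta>'(2) by (rule continuous_on_subset)
    have m: "\<forall>q'\<in>ball q \<eta>'. \<forall>t. (q', t) \<in> support D \<longleftrightarrow> \<phi> (q' - q) = 0 \<and> t = h q'"
      unfolding sh using \<eta>(3) \<eta>'(2) by blast
    show "wall D (q, s) (q, h q) \<phi>"
      unfolding wall_def fst_conv snd_conv
      by (intro conjI lin ne qL refl q(3) exI[of _ \<eta>'] exI[of _ h] c m \<eta>'(1))
  qed
qed

lemma wall_lower: "wall D y z \<phi> \<Longrightarrow> s < snd z \<Longrightarrow> wall D (fst y, s) z \<phi>"
  unfolding wall_def by simp

lemma wall_side_sky:
  assumes w: "wall D y z \<phi>"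
  obtains e where "e > 0" "\<And>a. a \<in> ball y e \<Longrightarrow> \<phi> (fst a - fst y) \<noteq> 0 \<Longrightarrow> a \<in> sky D"
proof -
  obtain \<eta> h where \<eta>: "\<eta> > 0" "\<And>q t. q \<in> ball (fst y) \<eta> \<Longrightarrow> (q, t) \<in> support D \<longleftrightarrow> \<phi> (q - fst y) = 0 \<and> t = h q"
    by (rule wall_shift[OF w]) blast
  show ?thesis
  proof (rule that[OF \<eta>(1)])
    fix a assume a: "a \<in> ball y \<eta>" "\<phi> (fst a - fst y) \<noteq> 0"
    have "dist (fst y) (fst a) \<le> dist y a" by (rule dist_fst_le)
    then have "fst a \<in> ball (fst y) \<eta>" using a by simp
    then have "(fst a, t) \<notin> support D" for t using \<eta>(2) a(2) by blast
    then have "False" if "z \<in> support D" "fst z = fst a" for z using that by (metis prod.collapse)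
    then show "a \<in> sky D" unfolding sky_def by blast
  qed
qed

lemma wall_sides:
  assumes w: "wall D y z \<phi>" and e: "e > 0"
  obtains a b where "a \<in> ball y e" "b \<in> ball y e" "a \<in> sky D" "b \<in> sky D" "0 < \<phi> (fst a - fst y)"
    "\<phi> (fst b - fst y) < 0"
    "snd a = snd y" "snd b = snd y"
proof -
  have lin: "linear \<phi>" using w by (simp add: wall_def)
  obtain v0 where v0: "\<phi> v0 \<noteq> 0" using w unfolding wall_def by blast
  define v where "v = (if 0 < \<phi> v0 then v0 else - v0)"
  have v: "0 < \<phi> v" using v0 by (auto simp: v_def linear_neg[OF lin])
  obtain e' where e': "e' > 0" "\<And>a. a \<in> ball y e' \<Longrightarrow> \<phi> (fst a - fst y) \<noteq> 0 \<Longrightarrow> a \<in> sky D"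
    by (rule wall_side_sky[OF w]) blast
  let ?U = "ball y (min e e')"
  have U: "open ?U" "y \<in> ?U" using e e' by auto
  have "\<forall>\<^sub>F \<tau> in at_right (0::real). 0 < \<tau>" by (simp add: eventually_at_right_less)
  then have "\<forall>\<^sub>F \<tau> in at_right (0::real). y + \<tau> *\<^sub>R (v, 0) \<in> ?U \<and> y + \<tau> *\<^sub>R (- v, 0) \<in> ?U \<and> 0 < \<tau>"
    using near_point[OF U, of "(v, 0)"] near_point[OF U, of "(- v, 0)"] by eventually_elim blast
  from eventually_happens'[OF trivial_limit_at_right_real this]
  obtain \<tau> where \<tau>: "y + \<tau> *\<^sub>R (v, 0) \<in> ?U" "y + \<tau> *\<^sub>R (- v, 0) \<in> ?U" "0 < \<tau>" by blast
  define a b where "a = y + \<tau> *\<^sub>R (v, 0)" and "b = y + \<tau> *\<^sub>R (- v, 0)"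
  have pa: "0 < \<phi> (fst a - fst y)" "\<phi> (fst b - fst y) < 0"
    using v \<tau>(3) by (simp_all add: a_def b_def linear_scale[OF lin] linear_neg[OF lin] mult_pos_neg)
  have U': "a \<in> ?U" "b \<in> ?U" using \<tau> by (simp_all only: a_def b_def)
  then have "a \<in> ball y e'" "b \<in> ball y e'" by auto
  then have "a \<in> sky D" "b \<in> sky D" using e'(2)[of a] e'(2)[of b] pa by auto
  moreover have "a \<in> ball y e" "b \<in> ball y e" using U' by auto
  ultimately show ?thesis using that pa by (simp add: a_def b_def)
qed

text \<open>Both clauses of \<open>section_on\<close> can be tested at sky points: the sky is open,
  and close to a wall every point off its line belongs to the sky.\<close>

lemma section_on_cong:
  assumes s: "section_on D \<gamma> U s" and U: "open U" and eq: "\<And>a. a \<in> U \<Longrightarrow> a \<in> sky D \<Longrightarrow> s' a = s a"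
  shows "section_on D \<gamma> U s'"
  unfolding section_on_def
proof (intro conjI ballI allI impI)
  fix y assume y: "y \<in> U \<inter> sky D"
  obtain e1 where e1: "e1 > 0" "\<And>a. a \<in> ball y e1 \<Longrightarrow> s a = s y" by (rule section_on_sky[OF s]) (use y in blast)+
  have "open (U \<inter> sky D)" using U sky_open by blast
  then obtain e2 where e2: "e2 > 0" "ball y e2 \<subseteq> U \<inter> sky D" using y open_contains_ball by metis
  have "s' a = s' y" if a: "a \<in> ball y (min e1 e2)" for a
  proof -
    have "a \<in> ball y e1" "a \<in> ball y e2" using a by auto
    then have "a \<in> U" "a \<in> sky D" using e2(2) by blast+
    then show ?thesis using e1(2)[OF \<open>a \<in> ball y e1\<close>] eq[of a] eq[of y] y by simp
  qed
  moreover have "min e1 e2 > 0" using e1 e2 by simp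
  ultimately show "\<exists>e>0. \<forall>a\<in>ball y e. s' a = s' y" by blast
next
  fix y z \<phi> A assume y: "y \<in> U" and w: "wall D y z \<phi>" "A \<in> arcs D" "z \<in> A"
  obtain e1 where e1: "e1 > 0"
    "\<And>a b. a \<in> ball y e1 \<Longrightarrow> b \<in> ball y e1 \<Longrightarrow> \<phi> (fst a - fst y) * \<phi> (fst b - fst y) < 0 \<Longrightarrow> s b = s a + \<gamma> A"
    by (rule section_on_wall[OF s y w]) blast
  obtain e2 where e2: "e2 > 0" "\<And>a. a \<in> ball y e2 \<Longrightarrow> \<phi> (fst a - fst y) \<noteq> 0 \<Longrightarrow> a \<in> sky D"
    by (rule wall_side_sky[OF w(1)]) blast
  obtain e3 where e3: "e3 > 0" "ball y e3 \<subseteq> U" using U y open_contains_ball by metis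
  have "s' b = s' a + \<gamma> A" if ab: "a \<in> ball y (min e1 (min e2 e3))" "b \<in> ball y (min e1 (min e2 e3))"
    "\<phi> (fst a - fst y) * \<phi> (fst b - fst y) < 0" for a b
  proof -
    have "\<phi> (fst a - fst y) \<noteq> 0" "\<phi> (fst b - fst y) \<noteq> 0" using ab(3) by auto
    then have "a \<in> sky D" "b \<in> sky D" using e2(2) ab by auto
    moreover have "a \<in> U" "b \<in> U" using e3(2) ab by auto
    moreover have "s b = s a + \<gamma> A" using e1(2) ab by auto
    ultimately show ?thesis using eq[of a] eq[of b] by simp
  qed
  moreover have "min e1 (min e2 e3) > 0" using e1 e2 e3 by simp
  ultimately show "\<exists>e>0. \<forall>a\<in>ball y e. \<forall>b\<in>ball y e. \<phi> (fst a - fst y) * \<phi> (fst b - fst y) < 0 \<longrightarrow>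
    s' b = s' a + \<gamma> A"
    by blast
qed

section \<open>Topology of the sky and of the complement\<close>

lemma sky_contractible: "contractible (sky D)"
proof -
  obtain M where M: "\<And>z. z \<in> support D \<Longrightarrow> snd z < M"
  proof -
    have "bounded (snd ` support D)" by (rule bounded_snd[OF compact_imp_bounded[OF compact_support]])
    then obtain B where "\<forall>x\<in>snd ` support D. norm x \<le> B" by (auto simp: bounded_iff)
    then have "snd z < B + 1" if "z \<in> support D" for z using that by force
    then show ?thesis using that by blast
  qed
  \<comment> \<open>Raising a point keeps it in the sky. So the sky is first pushed above the height
    \<open>M\<close> of the whole link and then contracted inside that half-space.\<close>
  define f :: "space \<Rightarrow> space" where "f y = (fst y, max (snd y) M)" for y
  have up: "y' \<in> sky D" if "y \<in> sky D" "fst y' = fst y" "snd y \<le> snd y'" for y y'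
    using that unfolding sky_def by (auto intro: less_le_trans)
  have top: "y \<in> sky D" if "M \<le> snd y" for y using that M unfolding sky_def by (auto intro: less_le_trans)
  have 1: "homotopic_with_canon (\<lambda>x. True) (sky D) (sky D) id f"
  proof (rule homotopic_with_linear)
    show "continuous_on (sky D) f" unfolding f_def by (intro continuous_intros)
    show "closed_segment (id y) (f y) \<subseteq> sky D" if y: "y \<in> sky D" for y
    proof
      fix x assume "x \<in> closed_segment (id y) (f y)"
      then obtain u where u: "0 \<le> u" "u \<le> 1" "x = (1 - u) *\<^sub>R y + u *\<^sub>R f y" by (auto simp: in_segment)
      have "fst x = (1 - u) *\<^sub>R fst y + u *\<^sub>R fst y" unfolding u(3) f_def by simp
      then have "fst x = fst y" by (simp add: algebra_simps)
      moreover have "snd x = snd y + u * (max (snd y) M - snd y)" unfolding u(3) f_def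
        by (simp add: algebra_simps)
      ultimately show "x \<in> sky D" using u by (intro up[OF y]) auto
    qed
  qed auto
  have 2: "homotopic_with_canon (\<lambda>x. True) (sky D) (sky D) f (\<lambda>_. (0, M))"
  proof (rule homotopic_with_linear)
    show "continuous_on (sky D) f" unfolding f_def by (intro continuous_intros)
    show "closed_segment (f y) (0, M) \<subseteq> sky D" if y: "y \<in> sky D" for y
    proof -
      have "convex (UNIV \<times> {M..} :: space set)" by (intro convex_Times convex_UNIV convex_real_interval)
      then have "closed_segment (f y) (0, M) \<subseteq> UNIV \<times> {M..}"
        by (rule closed_segment_subset[rotated 2]) (auto simp: f_def)
      then show ?thesis using top by force
    qed
  qed auto
  show ?thesis unfolding contractible_def using homotopic_with_trans[OF 1 2] by blast
qed

lemma sky_connected: "connected (sky D)"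
  using sky_contractible contractible_imp_connected by blast

lemma sky_nonempty: "\<exists>p. p \<in> sky D"
proof -
  have "bounded (snd ` support D)" by (rule bounded_snd[OF compact_imp_bounded[OF compact_support]])
  then obtain B where "\<forall>x\<in>snd ` support D. norm x \<le> B" by (auto simp: bounded_iff)
  then have "(0, B + 1) \<in> sky D" unfolding sky_def by force
  then show ?thesis by blast
qed

context regular_diagram
begin

lemma complement_open: "open (- L)"
  using compact_imp_closed[OF compact_support] by (simp add: open_Compl)

lemma cell_ball:
  assumes c: "cross_cell D x al be d e r \<delta> K A"
  obtains \<epsilon> where "\<epsilon> > 0" "ball x \<epsilon> \<subseteq> cell x al be r \<delta>"
proof -
  note c' = cross_cellD(1-8)[OF c]
  have "x \<in> cell x al be r \<delta>" using c' by (simp add: cell_def linear_0)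
  then show ?thesis using that cell_open[OF c'(1,2)] open_contains_ball by metis
qed

lemma sky_dense: "- L \<subseteq> closure (sky D)"
proof
  fix x assume x: "x \<in> - L"
  show "x \<in> closure (sky D)"
    unfolding closure_approachable
  proof (intro allI impI)
    fix \<epsilon> :: real assume "\<epsilon> > 0"
    obtain al be d e r \<delta> K A where c: "cross_cell D x al be d e r \<delta> K A" "cell x al be r \<delta> \<subseteq> ball x \<epsilon>"
      using cross_cell_exists[OF _ \<open>\<epsilon> > 0\<close>] x by blast
    obtain y where y: "y \<in> cell x al be r \<delta>" using cell_ball[OF c(1)] by (metis centre_in_ball subsetD)
    obtain i a where "i < 4" "a \<in> quadrant x al be r \<delta> i"
      by (rule quadrant_dense[OF cross_cellD(1-6)[OF c(1)], of UNIV y x r \<delta>]) (use y in auto)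
    then have "a \<in> sky D" "a \<in> ball x \<epsilon>" using quadrant_sky[OF c(1), of i] c(2) by blast+
    then show "\<exists>y\<in>sky D. dist y x < \<epsilon>" by (auto simp: dist_commute)
  qed
qed

lemma complement_connected: "connected (- L)"
  by (rule connected_intermediate_closure[OF sky_connected _ sky_dense]) (use sky_disjoint in blast)

lemma section_unique_near:
  fixes s s' :: "space \<Rightarrow> 'g::group_add"
  assumes s: "section_on D \<gamma> U s" and s': "section_on D \<gamma> U s'" and x: "x \<in> U" "open U" "x \<notin> L"
  obtains g e where "e > 0" "\<And>y. y \<in> ball x e \<Longrightarrow> y \<in> sky D \<Longrightarrow> s' y = g + s y"
proof -
  obtain \<epsilon> where \<epsilon>: "\<epsilon> > 0" "ball x \<epsilon> \<subseteq> U" using x open_contains_ball by metis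
  obtain al be d e r \<delta> K A where c: "cross_cell D x al be d e r \<delta> K A" "cell x al be r \<delta> \<subseteq> ball x \<epsilon>"
    using cross_cell_exists[OF x(3) \<epsilon>(1)] by blast
  have sub: "cell x al be r \<delta> \<subseteq> U" using c(2) \<epsilon>(2) by blast
  obtain g where g: "\<And>y. y \<in> cell x al be r \<delta> \<inter> sky D \<Longrightarrow> s' y = g + s y"
    using section_unique[OF c(1) section_on_subset[OF s sub] section_on_subset[OF s' sub]] by blast
  obtain e' where "e' > 0" "ball x e' \<subseteq> cell x al be r \<delta>" using cell_ball[OF c(1)] by blast
  then show ?thesis using that[of e' g] g by blast
qed

end

lemma locally_constant_on_convex:
  assumes P: "convex P" "a \<in> P" "b \<in> P" and loc: "\<And>x. x \<in> P \<Longrightarrow> \<exists>e>0. \<forall>y\<in>ball x e. f y = f x"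
  shows "f a = f (b::'a::real_normed_vector)"
  by (rule locally_constant_on_connected[OF convex_connected[OF P(1)] P(2,3)]) (use loc in blast)

context regular_diagram
begin

text \<open>Even if \<open>z\<close> is a corner or a crossing point, a short way along an arm
  starting at \<open>z\<close> the link has walls below it; and the open arm belongs to the arc of
  \<open>z\<close> whenever \<open>z\<close> has one.\<close>

lemma walls_dense:
  assumes z: "z \<in> L" and \<epsilon>: "\<epsilon> > 0"
  obtains y z' \<phi> where "wall D y z' \<phi>" "z' \<in> ball z \<epsilon>" "\<And>A. A \<in> arcs D \<Longrightarrow> z \<in> A \<Longrightarrow> z' \<in> A"
proof -
  obtain al be d e r K Z V where a: "arm_system L (fst z) al be d e r K Z V" and "arm_cases K Z"
    and fib: "\<And>z'. z' \<in> L \<Longrightarrow> fst z' = fst z \<Longrightarrow> \<exists>i\<in>K. Z i = z'"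
    by (rule arms[of "fst z"]) (rule that; assumption)
  obtain i where i: "i \<in> K" "Z i = z" using fib[OF z] by blast
  have r: "0 < r" using arm_systemD(8)[OF a] .
  define t where "t = min (r/2) (\<epsilon> / (2 * (1 + norm (V i))))"
  have n: "0 < 2 * (1 + norm (V i))" by (simp add: add_pos_nonneg)
  then have t: "0 < t" "t < r" using r \<epsilon> by (auto simp: t_def)
  have "t * norm (V i) \<le> \<epsilon> / (2 * (1 + norm (V i))) * norm (V i)"
    by (rule mult_right_mono) (auto simp: t_def)
  also have "\<dots> < \<epsilon>" using n \<epsilon> by (simp add: field_simps) (smt (verit) mult_nonneg_nonneg norm_ge_zero)
  finally have 1: "Z i + t *\<^sub>R V i \<in> ball z \<epsilon>" using i(2) t by (simp add: dist_norm)
  have 2: "wall D (fst z + t *\<^sub>R dir d e i, snd (Z i + t *\<^sub>R V i) - 1) (Z i + t *\<^sub>R V i) (nor al be i)"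
    by (rule arm_wall[OF a i(1) t]) auto
  obtain B where B: "B \<in> arcs D" "\<And>t. 0 < t \<Longrightarrow> t < r \<Longrightarrow> Z i + t *\<^sub>R V i \<in> B"
    "Z i \<notin> under_points D \<Longrightarrow> Z i \<in> B" by (rule arm_arc[OF a i(1)]) blast
  have "Z i + t *\<^sub>R V i \<in> A" if A: "A \<in> arcs D" "z \<in> A" for A
  proof -
    have "z \<notin> under_points D" using arc_subset[OF A(1)] A(2) by blast
    then have "z \<in> B" using B(3) i(2) by simp
    then have "A = B" using arc_disjoint[OF A(1) B(1) A(2)] by blast
    then show ?thesis using B(2)[OF t] by simp
  qed
  then show ?thesis using that 1 2 by blast
qed

context
  fixes w :: "space \<Rightarrow> space \<Rightarrow> 'g::group_add" and \<gamma> :: "space set \<Rightarrow> 'g"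
  assumes w: "cocycle (- L) w"
    and sec: "\<And>x. x \<in> - L \<Longrightarrow> \<exists>e>0. section_on D \<gamma> (ball x e) (\<lambda>a. w x a)"
begin

lemma section_cocycle_sky:
  assumes y: "y \<in> sky D"
  obtains e where "e > 0" "\<And>a b. a \<in> ball y e \<Longrightarrow> b \<in> ball y e \<Longrightarrow> w a b = 0"
proof -
  have yX: "y \<in> - L" using y sky_disjoint by blast
  obtain e1 where e1: "e1 > 0" "section_on D \<gamma> (ball y e1) (\<lambda>a. w y a)" using sec[OF yX] by blast
  have yy: "y \<in> ball y e1" using e1(1) by simp
  obtain e2 where e2: "e2 > 0" "\<And>a. a \<in> ball y e2 \<Longrightarrow> w y a = w y y"
    by (rule section_on_sky[OF e1(2) yy y]) (rule that; assumption)
  obtain e3 where e3: "e3 > 0" "cocycle_on (ball y e3) w" using w yX unfolding cocycle_def by blast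
  have "w a b = 0" if ab: "a \<in> ball y (min e2 e3)" "b \<in> ball y (min e2 e3)" for a b
  proof -
    have B: "a \<in> ball y e3" "b \<in> ball y e3" "y \<in> ball y e3" using ab e3 by auto
    have "w y a = w y y" "w y b = w y y" using ab e2(2)[of a] e2(2)[of b] by auto
    then show ?thesis
      using cocycle_onD[OF e3(2) B(3,1,2)] cocycle_on_refl[OF e3(2) B(3)] by simp
  qed
  then show ?thesis using that[of "min e2 e3"] e2(1) e3(1) by auto
qed

lemma section_cocycle_wall:
  assumes y: "wall D y z \<phi>" "A \<in> arcs D" "z \<in> A"
  obtains e where "e > 0"
    "\<And>a b. a \<in> ball y e \<Longrightarrow> b \<in> ball y e \<Longrightarrow> \<phi> (fst a - fst y) * \<phi> (fst b - fst y) < 0 \<Longrightarrow> w a b = \<gamma> A"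
proof -
  have yX: "y \<in> - L" using wall_top(3)[OF y(1)] by blast
  obtain e1 where e1: "e1 > 0" "section_on D \<gamma> (ball y e1) (\<lambda>a. w y a)" using sec[OF yX] by blast
  have yy: "y \<in> ball y e1" using e1(1) by simp
  obtain e2 where e2: "e2 > 0" "\<And>a b. a \<in> ball y e2 \<Longrightarrow> b \<in> ball y e2 \<Longrightarrow>
      \<phi> (fst a - fst y) * \<phi> (fst b - fst y) < 0 \<Longrightarrow> w y b = w y a + \<gamma> A"
    by (rule section_on_wall[OF e1(2) yy y]) blast
  obtain e3 where e3: "e3 > 0" "cocycle_on (ball y e3) w" using w yX unfolding cocycle_def by blast
  have "w a b = \<gamma> A" if ab: "a \<in> ball y (min e2 e3)" "b \<in> ball y (min e2 e3)"
    "\<phi> (fst a - fst y) * \<phi> (fst b - fst y) < 0" for a b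
  proof -
    have B: "a \<in> ball y e3" "b \<in> ball y e3" "y \<in> ball y e3" using ab e3 by auto
    have "w y b = w y a + \<gamma> A" using ab e2(2)[of a b] by auto
    then show ?thesis using cocycle_onD[OF e3(2) B(3,1,2)] by (metis add_left_cancel)
  qed
  then show ?thesis using that[of "min e2 e3"] e2(1) e3(1) by auto
qed

text \<open>A small loop around the strand consists of a way over the top, along which
  \<open>k\<close> is constant because \<open>w\<close> is 0 in the sky, and of a passage through
  the curtain, at which \<open>k\<close> must change because \<open>sg (\<gamma> A)\<close>.
  \<open>walls_dense\<close> moves the argument to a point \<open>z'\<close> near \<open>z\<close>
  where the strand is a graph.\<close>

lemma section_cocycle_meridional:
  assumes sg: "sign_hom sg" and \<gamma>: "\<And>A. A \<in> arcs D \<Longrightarrow> sg (\<gamma> A)"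
  shows "meridional L sg w"
  unfolding meridional_def
proof (intro ballI allI impI notI)
  fix z V assume z: "z \<in> L" and V: "open V" "z \<in> V"
    and "\<exists>k :: space \<Rightarrow> bool. \<forall>y\<in>V - L. \<exists>e>0. \<forall>a\<in>ball y e. \<forall>b\<in>ball y e. sg (w a b) = (k a \<noteq> k b)"
  then obtain k :: "space \<Rightarrow> bool"
    where k: "\<And>y. y \<in> V - L \<Longrightarrow> \<exists>e>0. \<forall>a\<in>ball y e. \<forall>b\<in>ball y e. sg (w a b) = (k a \<noteq> k b)" by blast
  obtain \<epsilon> where \<epsilon>: "\<epsilon> > 0" "ball z \<epsilon> \<subseteq> V" using V open_contains_ball by metis
  have "\<exists>y0 z' \<phi>. wall D y0 z' \<phi> \<and> z' \<in> ball z \<epsilon>"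
    by (rule walls_dense[OF z \<epsilon>(1)]) (intro exI conjI, assumption+)
  then obtain y0 z' \<phi> where w0: "wall D y0 z' \<phi>" and z': "z' \<in> ball z \<epsilon>" by blast
  have z'L: "z' \<in> L" "z' \<notin> under_points D" "fst z' = fst y0" using wall_top(1)[OF w0] w0 unfolding wall_def
    by blast+
  obtain A where A: "A \<in> arcs D" "z' \<in> A" using arc_exists[OF z'L(1,2)] by blast
  have lin: "linear \<phi>" using w0 unfolding wall_def by (rule conjunct1)
  let ?q = "fst y0" and ?s = "snd z'"
  obtain \<eta> h where \<eta>: "\<eta> > 0" "continuous_on (ball ?q \<eta>) h" "h ?q = ?s"
    "\<And>q t. q \<in> ball ?q \<eta> \<Longrightarrow> (q, t) \<in> L \<longleftrightarrow> \<phi> (q - ?q) = 0 \<and> t = h q"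
    by (rule wall_shift[OF w0]) (rule that; assumption)
  have "z' \<in> V" using z' \<epsilon>(2) by blast
  then obtain \<rho> where \<rho>: "\<rho> > 0" "ball z' \<rho> \<subseteq> V" using V(1) open_contains_ball by blast
  have "?q \<in> ball ?q \<eta>" using \<eta>(1) by simp
  then have "isCont h ?q" using \<eta>(2) continuous_on_eq_continuous_at[OF open_ball] by blast
  moreover have "0 < \<rho>/4" using \<rho>(1) by simp
  ultimately obtain \<nu>1 where \<nu>1: "\<nu>1 > 0" "\<And>q. dist q ?q < \<nu>1 \<Longrightarrow> dist (h q) (h ?q) < \<rho>/4"
    unfolding continuous_at_eps_delta by blast
  \<comment> \<open>Over the disc \<open>N\<close> the strand stays within \<open>\<rho>/4\<close>
    of its height at the centre, and \<open>N\<close> times the heights within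
    \<open>\<rho>/2\<close> lies in \<open>V\<close>. This leaves room for a slab above the strand,
    between \<open>\<rho>/4\<close> and \<open>\<rho>/2\<close>; its middle height is
    \<open>3*\<rho>/8\<close>.\<close>
  define \<nu> where "\<nu> = min \<eta> (min \<nu>1 (\<rho>/2))"
  have \<nu>: "\<nu> > 0" "\<nu> \<le> \<eta>" "\<nu> \<le> \<nu>1" "\<nu> \<le> \<rho>/2" using \<eta>(1) \<nu>1(1) \<rho>(1) by (auto simp: \<nu>_def)
  define N where "N = ball ?q \<nu>"
  have inV: "(q, s) \<in> V" if "q \<in> N" "?s - \<rho>/2 < s" "s < ?s + \<rho>/2" for q s
  proof -
    have "\<bar>s - ?s\<bar> < \<rho>/2" using that(2,3) by linarith
    note that = that(1) this
    have "norm (q - fst z', s - ?s) \<le> norm (q - fst z') + norm (s - ?s)" by (rule norm_Pair_le)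
    also have "\<dots> < \<rho>" using that \<nu>(4) z'L(3) by (simp add: N_def dist_norm norm_minus_commute)
    also have "(q - fst z', s - ?s) = (q, s) - z'" by (simp add: prod_eq_iff)
    finally have "(q, s) \<in> ball z' \<rho>" by (simp add: dist_norm norm_minus_commute)
    then show ?thesis using \<rho>(2) by blast
  qed
  have over: "\<phi> (q - ?q) = 0 \<and> t < ?s + \<rho>/4" if "q \<in> N" "(q, t) \<in> L" for q t
  proof -
    have "q \<in> ball ?q \<eta>" using that(1) \<nu>(2) by (auto simp: N_def)
    then have "(q, t) \<in> L \<longleftrightarrow> \<phi> (q - ?q) = 0 \<and> t = h q" by (rule \<eta>(4))
    then have t: "\<phi> (q - ?q) = 0" "t = h q" using that(2) by (metis (no_types))+
    moreover have "dist (h q) (h ?q) < \<rho>/4" using \<nu>1(2)[of q] that(1) \<nu>(3) by (simp add: N_def dist_commute)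
    ultimately have "\<bar>h q - ?s\<bar> < \<rho>/4" using \<eta>(3) by (simp only: dist_real_def)
    then have "t < ?s + \<rho>/4" using t(2) by linarith
    then show ?thesis using t(1) by blast
  qed
  have kconst: "k a = k b" if P: "convex P" "P \<subseteq> V \<inter> sky D" "a \<in> P" "b \<in> P" for P a b
  proof (rule locally_constant_on_convex[OF P(1,3,4)])
    fix x assume "x \<in> P"
    then have x: "x \<in> V" "x \<in> sky D" using P(2) by auto
    then have xV: "x \<in> V - L" using sky_disjoint[of D] by auto
    obtain e1 where e1: "e1 > 0" "\<forall>a\<in>ball x e1. \<forall>b\<in>ball x e1. sg (w a b) = (k a \<noteq> k b)" using k[OF xV] by blast
    obtain e2 where e2: "e2 > 0" "\<And>a b. a \<in> ball x e2 \<Longrightarrow> b \<in> ball x e2 \<Longrightarrow> w a b = 0"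
      by (rule section_cocycle_sky[OF x(2)]) (rule that; assumption)
    have "k y = k x" if y: "y \<in> ball x (min e1 e2)" for y
    proof -
      have "sg (w y x) = (k y \<noteq> k x)" using e1 y by auto
      moreover have "w y x = 0" using e2(2)[of y x] e2(1) y by auto
      ultimately show ?thesis using sign_homD(2)[OF sg] by auto
    qed
    moreover have "min e1 e2 > 0" using e1 e2 by simp
    ultimately show "\<exists>e>0. \<forall>y\<in>ball x e. k y = k x" by blast
  qed
  define side where "side \<psi> = {y. 0 < \<psi> (fst y - ?q)} \<inter> (N \<times> {?s - \<rho>/2<..<?s + \<rho>/2})" for \<psi> :: "real^2 \<Rightarrow> real"
  define upper where "upper = N \<times> {?s + \<rho>/4<..<?s + \<rho>/2}"
  have side: "convex (side \<psi>)" "side \<psi> \<subseteq> V \<inter> sky D" if \<psi>: "linear \<psi>" "\<And>q. 0 < \<psi> q \<Longrightarrow> \<phi> q \<noteq> 0" for \<psi>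
  proof -
    show "convex (side \<psi>)" unfolding side_def N_def
      by (intro convex_Int convex_linear_less[OF \<psi>(1)] convex_Times convex_ball convex_real_interval)
    show "side \<psi> \<subseteq> V \<inter> sky D"
    proof
      fix y assume y: "y \<in> side \<psi>"
      then have q: "fst y \<in> N" "?s - \<rho>/2 < snd y" "snd y < ?s + \<rho>/2" "\<phi> (fst y - ?q) \<noteq> 0" using \<psi>(2)
        by (auto simp: side_def mem_Times_iff)
      have "(fst y, t) \<notin> L" for t using over[OF q(1)] q(4) by blast
      then have False if "z \<in> L" "fst z = fst y" for z using that by (metis prod.collapse)
      then have "y \<in> sky D" unfolding sky_def by blast
      then show "y \<in> V \<inter> sky D" using inV[OF q(1-3)] by simp
    qed
  qed
  have upper: "convex upper" "upper \<subseteq> V \<inter> sky D"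
  proof -
    show "convex upper" unfolding upper_def N_def by (intro convex_Times convex_ball convex_real_interval)
    show "upper \<subseteq> V \<inter> sky D"
    proof
      fix y assume y: "y \<in> upper"
      then have q: "fst y \<in> N" "?s - \<rho>/2 < snd y" "snd y < ?s + \<rho>/2" "?s + \<rho>/4 < snd y" using \<rho>(1)
        by (auto simp: upper_def mem_Times_iff)
      have "snd z < snd y" if z: "z \<in> L" "fst z = fst y" for z
      proof -
        have "(fst y, snd z) \<in> L" using z by (metis prod.collapse)
        then have "snd z < ?s + \<rho>/4" using over[OF q(1)] by blast
        then show ?thesis using q(4) by linarith
      qed
      then have "y \<in> sky D" unfolding sky_def by blast
      then show "y \<in> V \<inter> sky D" using inV[OF q(1-3)] by simp
    qed
  qed
  have link_up: "k a = k (fst a, ?s + 3*\<rho>/8)" if \<psi>: "linear \<psi>" "\<And>q. 0 < \<psi> q \<Longrightarrow> \<phi> q \<noteq> 0" and a: "a \<in> side \<psi>"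
    for \<psi> a
    by (rule kconst[OF side[OF \<psi>] a]) (use a \<rho>(1) in \<open>auto simp: side_def\<close>)
  \<comment> \<open>The wall point \<open>y0\<close> may lie far below \<open>V\<close>; it is
    replaced by a point of the same vertical line just below the strand.\<close>
  define y1 where "y1 = (?q, ?s - \<rho>/4)"
  have w1: "wall D y1 z' \<phi>" unfolding y1_def by (rule wall_lower[OF w0]) (use \<rho>(1) in simp)
  have y1V: "y1 \<in> V - L" using inV[of ?q "?s - \<rho>/4"] \<nu>(1) \<rho>(1) wall_top(3)[OF w1] by (simp add: y1_def N_def)
  obtain e1 where e1: "e1 > 0" "\<forall>a\<in>ball y1 e1. \<forall>b\<in>ball y1 e1. sg (w a b) = (k a \<noteq> k b)" using k[OF y1V] by blast
  obtain e2 where e2: "e2 > 0" "\<And>a b. a \<in> ball y1 e2 \<Longrightarrow> b \<in> ball y1 e2 \<Longrightarrow>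
      \<phi> (fst a - fst y1) * \<phi> (fst b - fst y1) < 0 \<Longrightarrow> w a b = \<gamma> A"
    by (rule section_cocycle_wall[OF w1 A]) (rule that; assumption)
  have "min (min e1 e2) \<nu> > 0" using e1 e2 \<nu> by simp
  then obtain a b where ab: "a \<in> ball y1 (min (min e1 e2) \<nu>)" "b \<in> ball y1 (min (min e1 e2) \<nu>)"
    "0 < \<phi> (fst a - fst y1)" "\<phi> (fst b - fst y1) < 0" "snd a = snd y1" "snd b = snd y1"
    by (rule wall_sides[OF w1]) blast
  have N: "fst a \<in> N" "fst b \<in> N"
    using ab(1,2) dist_fst_le[of y1 a] dist_fst_le[of y1 b] by (auto simp: N_def y1_def)
  have lin': "linear (\<lambda>q. - \<phi> q)" by (rule linear_compose_neg[OF lin])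
  have "a \<in> side \<phi>" "b \<in> side (\<lambda>q. - \<phi> q)"
    using ab N \<rho>(1) by (auto simp: side_def mem_Times_iff y1_def)
  then have "k a = k (fst a, ?s + 3*\<rho>/8)" "k b = k (fst b, ?s + 3*\<rho>/8)"
    using link_up[OF lin] link_up[OF lin'] by auto
  moreover have "k (fst a, ?s + 3*\<rho>/8) = k (fst b, ?s + 3*\<rho>/8)"
    by (rule kconst[OF upper]) (use N \<rho>(1) in \<open>auto simp: upper_def\<close>)
  ultimately have "k a = k b" by simp
  moreover have "sg (w a b) = (k a \<noteq> k b)" using e1(2) ab(1,2) by auto
  moreover have "w a b = \<gamma> A" using e2(2)[of a b] ab by (auto simp: mult_pos_neg)
  ultimately show False using \<gamma>[OF A(1)] by simp
qed

end

lemma coloring_cocycle: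
  fixes \<gamma> :: "space set \<Rightarrow> 'g::group_add"
  assumes \<gamma>: "group_coloring D \<gamma>" and H: "subgroup_add H" "\<And>A. A \<in> arcs D \<Longrightarrow> \<gamma> A \<in> H"
    and sg: "sign_hom sg" "\<And>A. A \<in> arcs D \<Longrightarrow> sg (\<gamma> A)"
  obtains w where "cocycle (- L) w" "valued_in (- L) H w" "meridional L sg w" "represents D p \<gamma> w"
proof -
  \<comment> \<open>Membership in \<open>H\<close> is asked only on the sky, where values are
    meaningful. The constant between two such sections is read off at a sky point, so it lies in
    \<open>H\<close> as well.\<close>
  define sc where "sc U s \<longleftrightarrow> section_on D \<gamma> U s \<and> (\<forall>y\<in>U \<inter> sky D. s y \<in> H)" for U s
  have ex: "\<exists>e>0. ball x e \<subseteq> - L \<and> (\<exists>s. sc (ball x e) s)" if x: "x \<in> - L" for x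
  proof -
    have xL: "x \<notin> L" using x by blast
    obtain al be d e r \<delta> K A where c: "cross_cell D x al be d e r \<delta> K A" and "cell x al be r \<delta> \<subseteq> ball x 1"
      by (rule cross_cell_exists[OF xL zero_less_one]) (rule that; assumption)
    have "\<exists>s. section_on D \<gamma> (cell x al be r \<delta>) s \<and> (\<forall>y. s y \<in> H)"
    proof (rule section_exists[OF c \<gamma> regular_diagram_axioms subgroup_addD(1)[OF H(1)]])
      show "g + h \<in> H" if "g \<in> H" "h \<in> H" for g h using subgroup_addD(4)[OF H(1) that] .
      show "\<gamma> A \<in> H" if "A \<in> arcs D" for A using H(2)[OF that] .
    qed blast
    then obtain s where s: "section_on D \<gamma> (cell x al be r \<delta>) s" "\<And>y. s y \<in> H" by blast
    obtain e' where e': "e' > 0" "ball x e' \<subseteq> cell x al be r \<delta>" using cell_ball[OF c] by blast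
    have "sc (ball x e') s" unfolding sc_def using section_on_subset[OF s(1) e'(2)] s(2) by blast
    moreover have "ball x e' \<subseteq> - L" using cross_cellD(10)[OF c] e'(2) by blast
    ultimately show ?thesis using e'(1) by blast
  qed
  obtain w where w: "cocycle (- L) w"
    "\<And>x e s. ball x e \<subseteq> - L \<Longrightarrow> sc (ball x e) s \<Longrightarrow> \<exists>\<kappa>. (\<forall>a\<in>ball x e \<inter> sky D. \<kappa> a = s a) \<and>
       (\<forall>a\<in>ball x e. \<kappa> a \<in> H) \<and> (\<forall>a\<in>ball x e. \<forall>b\<in>ball x e. w a b = - \<kappa> a + \<kappa> b)"
  proof (rule sections_cocycle[where sec = sc and X = "- L" and T = "sky D" and H = H])
    show "open (- L)" by (rule complement_open)
    show "- L \<subseteq> closure (sky D)" by (rule sky_dense)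
    show "sc V s" if "sc U s" "V \<subseteq> U" for U V s
      using that section_on_subset[of D \<gamma> U s V] unfolding sc_def by blast
    show "\<exists>g\<in>H. \<exists>e>0. \<forall>z\<in>ball x e \<inter> sky D. s' z = g + s z"
      if s: "sc U s" "sc U s'" and U: "x \<in> U" "U \<subseteq> - L" "open U" for U s s' x
    proof -
      have xL: "x \<notin> L" using U by blast
      have ss: "section_on D \<gamma> U s" "section_on D \<gamma> U s'" using s by (auto simp: sc_def)
      obtain g e where g: "e > 0" "\<And>y. y \<in> ball x e \<Longrightarrow> y \<in> sky D \<Longrightarrow> s' y = g + s y"
        by (rule section_unique_near[OF ss U(1,3) xL]) (rule that; assumption)
      obtain e' where e': "e' > 0" "ball x e' \<subseteq> U" using U open_contains_ball by metis
      have xX: "x \<in> - L" using xL by simp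
      obtain y where y: "y \<in> sky D" "y \<in> ball x (min e e')"
        using dense_in_ball[OF sky_dense xX, of "min e e'"] g(1) e'(1) by auto
      have "s' y = g + s y" using g(2)[of y] y by auto
      then have "g = s' y - s y" by simp
      moreover have "y \<in> U \<inter> sky D" using y e'(2) by auto
      ultimately have "g \<in> H" using s subgroup_addD(2)[OF H(1)] unfolding sc_def by blast
      then show ?thesis using g by blast
    qed
    show "\<exists>e>0. ball x e \<subseteq> - L \<and> (\<exists>s. sc (ball x e) s)" if "x \<in> - L" for x by (rule ex[OF that])
    show "\<exists>e>0. sc (ball x e) (\<lambda>_. 0)" if x: "x \<in> sky D" for x
    proof -
      obtain e where e: "e > 0" "ball x e \<subseteq> sky D" using sky_open x open_contains_ball by metis
      have "section_on D \<gamma> (ball x e) (\<lambda>_. 0)"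
        unfolding section_on_def
      proof (intro conjI ballI allI impI)
        show "\<exists>e>0. \<forall>a\<in>ball y e. 0 = (0::'g)" for y :: space by (intro exI[of _ 1]) simp
        fix y z \<phi> A assume "y \<in> ball x e" "wall D y z \<phi>"
        then have False using e(2) wall_top(2) by blast
        then show "\<exists>e>0. \<forall>a\<in>ball y e. \<forall>b\<in>ball y e. \<phi> (fst a - fst y) * \<phi> (fst b - fst y) < 0 \<longrightarrow> 0 = 0 + \<gamma> A" ..
      qed
      then show ?thesis unfolding sc_def using e(1) subgroup_addD(1)[OF H(1)] by blast
    qed
    show "- g + h \<in> H" if "g \<in> H" "h \<in> H" for g h using subgroup_addD(5)[OF H(1) that] .
  qed (rule that; assumption)
  have sec: "\<exists>e>0. section_on D \<gamma> (ball x e) (\<lambda>a. w x a)" if x: "x \<in> - L" for x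
  proof -
    obtain e s where e: "e > 0" "ball x e \<subseteq> - L" "sc (ball x e) s" using ex[OF x] by blast
    obtain \<kappa> where \<kappa>: "\<forall>a\<in>ball x e \<inter> sky D. \<kappa> a = s a" "\<forall>a\<in>ball x e. \<forall>b\<in>ball x e. w a b = - \<kappa> a + \<kappa> b"
      using w(2)[OF e(2,3)] by blast
    have "section_on D \<gamma> (ball x e) (\<lambda>a. - \<kappa> x + s a)"
      using e(3) unfolding sc_def by (intro section_on_translate) blast
    then have "section_on D \<gamma> (ball x e) (\<lambda>a. w x a)"
    proof (rule section_on_cong)
      show "w x a = - \<kappa> x + s a" if "a \<in> ball x e" "a \<in> sky D" for a
        using \<kappa> that e(1) by (metis IntI centre_in_ball)
    qed auto
    then show ?thesis using e(1) by blast
  qed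
  have "valued_in (- L) H w"
    unfolding valued_in_def
  proof
    fix x assume "x \<in> - L"
    then obtain e s where e: "e > 0" "ball x e \<subseteq> - L" "sc (ball x e) s" using ex by blast
    obtain \<kappa> where \<kappa>: "\<forall>a\<in>ball x e. \<kappa> a \<in> H" "\<forall>a\<in>ball x e. \<forall>b\<in>ball x e. w a b = - \<kappa> a + \<kappa> b"
      using w(2)[OF e(2,3)] by blast
    have "w a b \<in> H" if "a \<in> ball x e" "b \<in> ball x e" for a b
      using \<kappa> that subgroup_addD(5)[OF H(1)] by metis
    then show "\<exists>e>0. \<forall>a\<in>ball x e. \<forall>b\<in>ball x e. w a b \<in> H" using e(1) by blast
  qed
  moreover have "meridional L sg w" by (rule section_cocycle_meridional[OF w(1) sec sg])
  moreover have "represents D p \<gamma> w" unfolding represents_def using sec by (intro exI[of _ "\<lambda>_. 0"]) simp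
  ultimately show ?thesis using that w(1) by blast
qed

end

section \<open>From cocycles to colorings\<close>

lemma wall_nbhd:
  assumes w: "wall D y z \<phi>"
  obtains e where "e > 0" "\<And>a. a \<in> ball y e \<Longrightarrow> a \<in> sky D \<longleftrightarrow> \<phi> (fst a - fst y) \<noteq> 0"
    "\<And>a. a \<in> ball y e \<Longrightarrow> \<phi> (fst a - fst y) = 0 \<Longrightarrow> \<exists>z'. wall D a z' \<phi>"
proof -
  obtain \<eta> h where \<eta>: "\<eta> > 0" "continuous_on (ball (fst y) \<eta>) h" "h (fst y) = snd z"
    "\<And>q t. q \<in> ball (fst y) \<eta> \<Longrightarrow> (q, t) \<in> support D \<longleftrightarrow> \<phi> (q - fst y) = 0 \<and> t = h q"
    "\<And>q s. q \<in> ball (fst y) \<eta> \<Longrightarrow> \<phi> (q - fst y) = 0 \<Longrightarrow> s < h q \<Longrightarrow> wall D (q, s) (q, h q) \<phi>"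
    by (rule wall_shift[OF w]) (rule that; assumption)
  have yz: "snd y < snd z" using w unfolding wall_def by blast
  \<comment> \<open>Half of the gap between \<open>y\<close> and the strand: one half is for the
    size of the ball, the other for the variation of \<open>h\<close>, so that the ball stays below
    the strand.\<close>
  define \<rho> where "\<rho> = (snd z - snd y) / 2"
  have \<rho>: "\<rho> > 0" using yz by (simp add: \<rho>_def)
  have "fst y \<in> ball (fst y) \<eta>" using \<eta>(1) by simp
  then have "isCont h (fst y)" using \<eta>(2) continuous_on_eq_continuous_at[OF open_ball] by blast
  then obtain \<nu> where \<nu>: "\<nu> > 0" "\<And>q. dist q (fst y) < \<nu> \<Longrightarrow> dist (h q) (h (fst y)) < \<rho>"
    unfolding continuous_at_eps_delta using \<rho> by blast
  obtain e0 where e0: "e0 > 0" "\<And>a. a \<in> ball y e0 \<Longrightarrow> \<phi> (fst a - fst y) \<noteq> 0 \<Longrightarrow> a \<in> sky D"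
    by (rule wall_side_sky[OF w]) (rule that; assumption)
  define e where "e = min (min e0 \<eta>) (min \<nu> \<rho>)"
  have e: "e > 0" "e \<le> e0" "e \<le> \<eta>" "e \<le> \<nu>" "e \<le> \<rho>" using e0 \<eta>(1) \<nu>(1) \<rho> by (auto simp: e_def)
  have wl: "\<exists>z'. wall D a z' \<phi>" if a: "a \<in> ball y e" "\<phi> (fst a - fst y) = 0" for a
  proof -
    have d: "dist (fst y) (fst a) < e" "dist (snd y) (snd a) < e"
      using a(1) dist_fst_le[of y a] dist_snd_le[of y a] by (auto intro: le_less_trans)
    have zy: "2 * \<rho> = snd z - snd y" by (simp add: \<rho>_def)
    have "dist (h (fst a)) (h (fst y)) < \<rho>" by (rule \<nu>(2)) (use d(1) e(4) in \<open>simp add: dist_commute\<close>)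
    then have "\<bar>h (fst a) - snd z\<bar> < \<rho>" unfolding \<eta>(3) by (simp only: dist_real_def)
    moreover have "\<bar>snd y - snd a\<bar> < \<rho>" using d(2) e(5) unfolding dist_real_def by linarith
    ultimately have lt: "snd a < h (fst a)" using zy by linarith
    have "fst a \<in> ball (fst y) \<eta>" using d(1) e(3) by simp
    then have "wall D (fst a, snd a) (fst a, h (fst a)) \<phi>" using \<eta>(5) a(2) lt by blast
    then show ?thesis by auto
  qed
  have "a \<in> sky D \<longleftrightarrow> \<phi> (fst a - fst y) \<noteq> 0" if a: "a \<in> ball y e" for a
  proof
    assume s: "a \<in> sky D"
    show "\<phi> (fst a - fst y) \<noteq> 0"
    proof
      assume "\<phi> (fst a - fst y) = 0"
      then obtain z' where "wall D a z' \<phi>" using wl a by blast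
      then have "z' \<in> support D \<and> fst z' = fst a \<and> snd a < snd z'" unfolding wall_def by blast
      then show False using s unfolding sky_def by force
    qed
  next
    assume "\<phi> (fst a - fst y) \<noteq> 0"
    then show "a \<in> sky D" using e0(2)[of a] a e(2) by auto
  qed
  then show ?thesis using that e(1) wl by blast
qed

section \<open>Jumps of a normal cocycle across the curtains\<close>

lemma line_shift:
  assumes "linear \<phi>" "\<phi> (fst y' - fst y) = 0" shows "\<phi> (fst a - fst y') = \<phi> (fst (a::space) - fst (y::space))"
  using linear_diff[OF assms(1), of "fst a - fst y" "fst y' - fst y"] assms(2) by simp

text \<open>The sky is contractible, so every cocycle is equivalent to one vanishing there.\<close>

locale normal_cocycle = regular_diagram +
  fixes w :: "space \<Rightarrow> space \<Rightarrow> 'g::group_add" and H :: "'g set" and sg :: "'g \<Rightarrow> bool"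
  assumes wc: "cocycle (- L) w"
    and zero: "\<And>y. y \<in> sky D \<Longrightarrow> \<exists>e>0. \<forall>a\<in>ball y e. \<forall>b\<in>ball y e. w a b = 0"
    and wH: "\<And>x. x \<in> - L \<Longrightarrow> \<exists>e>0. \<forall>a\<in>ball x e \<inter> sky D. \<forall>b\<in>ball x e \<inter> sky D. w a b \<in> H"
    and mer: "meridional L sg w" and sub: "subgroup_add H" and sg: "sign_hom sg"
begin

text \<open>Local vanishing spreads along a convex set inside one domain of the cocycle rule,
  because \<open>w a y\<close> is locally constant in \<open>y\<close>.\<close>

lemma sky_convex_zero:
  assumes P: "convex P" "P \<subseteq> sky D" "P \<subseteq> S" "a \<in> P" "b \<in> P" and S: "cocycle_on S w" "open S"
  shows "w a b = 0"
proof -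
  have "w a b = w a a"
  proof (rule locally_constant_on_convex[OF P(1,5,4)])
    fix x assume x: "x \<in> P"
    obtain e1 where e1: "e1 > 0" "\<forall>a\<in>ball x e1. \<forall>b\<in>ball x e1. w a b = 0" using zero x P(2) by blast
    obtain e2 where e2: "e2 > 0" "ball x e2 \<subseteq> S" using S(2) x P(3) open_contains_ball by (metis subsetD)
    have "w a y = w a x" if y: "y \<in> ball x (min e1 e2)" for y
    proof -
      have "w x y = 0" using e1 y by auto
      moreover have "w a x + w x y = w a y" by (rule cocycle_onD[OF S(1)]) (use P x e2(2) y in auto)
      ultimately show ?thesis by simp
    qed
    moreover have "min e1 e2 > 0" using e1 e2 by simp
    ultimately show "\<exists>e>0. \<forall>y\<in>ball x e. w a y = w a x" by blast
  qed
  also have "\<dots> = 0" by (rule cocycle_on_refl[OF S(1)]) (use P in blast)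
  finally show ?thesis .
qed

text \<open>In a small ball the two sides of the curtain are convex parts of the sky, so
  \<open>w\<close> is 0 within each side and has a single value from the positive to the negative
  one. This value is not yet known to be its own inverse, so the direction is recorded.\<close>

lemma wall_jump_oriented:
  assumes y: "wall D y z \<phi>"
  obtains g e where "e > 0" "g \<in> H" "cocycle_on (ball y e) w"
    "\<And>a. a \<in> ball y e \<Longrightarrow> a \<in> sky D \<longleftrightarrow> \<phi> (fst a - fst y) \<noteq> 0"
    "\<And>a b. a \<in> ball y e \<Longrightarrow> b \<in> ball y e \<Longrightarrow> 0 < \<phi> (fst a - fst y) * \<phi> (fst b - fst y) \<Longrightarrow> w a b = 0"
    "\<And>a b. a \<in> ball y e \<Longrightarrow> b \<in> ball y e \<Longrightarrow> 0 < \<phi> (fst a - fst y) \<Longrightarrow> \<phi> (fst b - fst y) < 0 \<Longrightarrow> w a b = g \<and>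
      w b a = - g"
proof -
  have yX: "y \<in> - L" using wall_top(3)[OF y] by blast
  have lin: "linear \<phi>" using y unfolding wall_def by (rule conjunct1)
  obtain e1 where e1: "e1 > 0" "cocycle_on (ball y e1) w" using wc yX unfolding cocycle_def by blast
  obtain e2 where e2: "e2 > 0" "\<forall>a\<in>ball y e2 \<inter> sky D. \<forall>b\<in>ball y e2 \<inter> sky D. w a b \<in> H" using wH[OF yX] by blast
  obtain e3 where e3: "e3 > 0" "\<And>a. a \<in> ball y e3 \<Longrightarrow> a \<in> sky D \<longleftrightarrow> \<phi> (fst a - fst y) \<noteq> 0"
    by (rule wall_nbhd[OF y]) (rule that; assumption)
  define e where "e = min e1 (min e2 e3)"
  have e: "e > 0" "ball y e \<subseteq> ball y e1" "ball y e \<subseteq> ball y e2" "ball y e \<subseteq> ball y e3" using e1 e2 e3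
    by (auto simp: e_def)
  have c: "cocycle_on (ball y e) w" by (rule cocycle_on_subset[OF e1(2) e(2)])
  have s: "a \<in> sky D \<longleftrightarrow> \<phi> (fst a - fst y) \<noteq> 0" if "a \<in> ball y e" for a using e3(2) e(4) that by blast
  have one: "w a b = 0" if \<psi>: "linear \<psi>" "\<And>q. 0 < \<psi> q \<Longrightarrow> \<phi> q \<noteq> 0"
      and ab: "a \<in> ball y e" "b \<in> ball y e" "0 < \<psi> (fst a - fst y)" "0 < \<psi> (fst b - fst y)"
        for \<psi> :: "real^2 \<Rightarrow> real" and a b
  proof (rule sky_convex_zero[of "ball y e \<inter> {a. 0 < \<psi> (fst a - fst y)}", OF _ _ _ _ _ c open_ball])
    show "convex (ball y e \<inter> {a. 0 < \<psi> (fst a - fst y)})"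
      by (rule convex_Int[OF convex_ball convex_linear_less[OF \<psi>(1)]])
    show "ball y e \<inter> {a. 0 < \<psi> (fst a - fst y)} \<subseteq> sky D" using s \<psi>(2) by blast
  qed (use ab in auto)
  have same: "w a b = 0" if ab: "a \<in> ball y e" "b \<in> ball y e" "0 < \<phi> (fst a - fst y) * \<phi> (fst b - fst y)"
    for a b
  proof (cases "0 < \<phi> (fst a - fst y)")
    case True
    then have "0 < \<phi> (fst b - fst y)" using ab(3) by (simp add: zero_less_mult_iff)
    then show ?thesis using one[OF lin _ ab(1,2) True] by fastforce
  next
    case False
    then have n: "0 < - \<phi> (fst a - fst y)" "0 < - \<phi> (fst b - fst y)" using ab(3)
      by (simp_all add: zero_less_mult_iff)
    then show ?thesis using one[OF linear_compose_neg[OF lin] _ ab(1,2) n] by fastforce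
  qed
  obtain a0 b0 where 0: "a0 \<in> ball y e" "b0 \<in> ball y e" "a0 \<in> sky D" "b0 \<in> sky D" "0 < \<phi> (fst a0 - fst y)"
    "\<phi> (fst b0 - fst y) < 0"
    by (rule wall_sides[OF y e(1)]) (rule that; assumption)
  have gH: "w a0 b0 \<in> H" using e2(2) e(3) 0 by blast
  have opp: "w a b = w a0 b0 \<and> w b a = - w a0 b0"
    if ab: "a \<in> ball y e" "b \<in> ball y e" "0 < \<phi> (fst a - fst y)" "\<phi> (fst b - fst y) < 0" for a b
  proof -
    have "w a a0 = 0" using same[OF ab(1) 0(1)] ab 0 by simp
    moreover have "w b0 b = 0" using same[OF 0(2) ab(2)] ab 0 by (simp add: mult_neg_neg)
    moreover have "w a b = w a a0 + w a0 b0 + w b0 b"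
      using cocycle_onD[OF c ab(1) 0(1,2)] cocycle_onD[OF c ab(1) 0(2) ab(2)] by simp
    ultimately have "w a b = w a0 b0" by simp
    then show ?thesis using cocycle_on_sym[OF c ab(1,2)] by simp
  qed
  show ?thesis by (rule that[OF e(1) gH c s same opp])
qed

text \<open>Connectedness: the curtain is the image of a convex set times a half-line under the
  shear that adds \<open>h\<close>.\<close>

lemma wall_curtain:
  assumes y: "wall D y z \<phi>"
  obtains \<eta> h C where "\<eta> > 0" "C = {x. fst x \<in> ball (fst y) \<eta> \<and> \<phi> (fst x - fst y) = 0 \<and> snd x < h (fst x)}"
    "connected C" "y \<in> C"
    "\<And>y'. y' \<in> C \<Longrightarrow> \<exists>z'. wall D y' z' \<phi>" "h (fst y) = snd z"
    "\<And>q t. q \<in> ball (fst y) \<eta> \<Longrightarrow> (q, t) \<in> L \<longleftrightarrow> \<phi> (q - fst y) = 0 \<and> t = h q"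
    "\<And>y'. y' \<in> C \<Longrightarrow> \<phi> (fst y' - fst y) = 0"
proof -
  have lin: "linear \<phi>" using y unfolding wall_def by (rule conjunct1)
  obtain \<eta> h where \<eta>: "\<eta> > 0" "continuous_on (ball (fst y) \<eta>) h" "h (fst y) = snd z"
    "\<And>q t. q \<in> ball (fst y) \<eta> \<Longrightarrow> (q, t) \<in> support D \<longleftrightarrow> \<phi> (q - fst y) = 0 \<and> t = h q"
    "\<And>q s. q \<in> ball (fst y) \<eta> \<Longrightarrow> \<phi> (q - fst y) = 0 \<Longrightarrow> s < h q \<Longrightarrow> wall D (q, s) (q, h q) \<phi>"
    by (rule wall_shift[OF y]) (rule that; assumption)
  define S where "S = {q \<in> ball (fst y) \<eta>. \<phi> (q - fst y) = 0}"
  define C where "C = {x. fst x \<in> ball (fst y) \<eta> \<and> \<phi> (fst x - fst y) = 0 \<and> snd x < h (fst x)}"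
  have "S = ball (fst y) \<eta> \<inter> (\<phi> -` {\<phi> (fst y)})" by (auto simp: S_def linear_diff[OF lin])
  moreover have "convex (\<phi> -` {\<phi> (fst y)})" by (rule convex_linear_vimage[OF lin]) simp
  ultimately have "convex S" using convex_Int[OF convex_ball] by simp
  then have "connected (S \<times> {..<(0::real)})" by (intro convex_connected convex_Times convex_real_interval)
  moreover have "continuous_on (S \<times> {..<(0::real)}) (\<lambda>x. (fst x, h (fst x) + snd x))"
  proof (intro continuous_on_Pair continuous_on_add)
    show "continuous_on (S \<times> {..<0}) (\<lambda>x. h (fst x))"
      by (rule continuous_on_compose2[OF \<eta>(2) continuous_on_fst[OF continuous_on_id]]) (auto simp: S_def)
  qed (intro continuous_intros)+
  ultimately have "connected ((\<lambda>x. (fst x, h (fst x) + snd x)) ` (S \<times> {..<(0::real)}))"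
    by (rule connected_continuous_image[rotated])
  moreover have "(\<lambda>x. (fst x, h (fst x) + snd x)) ` (S \<times> {..<(0::real)}) = C"
  proof (intro equalityI subsetI)
    fix x assume "x \<in> C"
    then have "x = (fst (fst x, snd x - h (fst x)), h (fst (fst x, snd x - h (fst x))) + snd (fst x, snd x - h (fst x)))"
      "(fst x, snd x - h (fst x)) \<in> S \<times> {..<(0::real)}" by (auto simp: C_def S_def)
    then show "x \<in> (\<lambda>x. (fst x, h (fst x) + snd x)) ` (S \<times> {..<(0::real)})" by (rule image_eqI)
  qed (auto simp: C_def S_def)
  ultimately have conn: "connected C" by simp
  have yz: "snd y < snd z" using y unfolding wall_def by blast
  have yC: "y \<in> C" using yz \<eta>(1,3) linear_0[OF lin] unfolding C_def by simp
  have walls: "\<exists>z'. wall D y' z' \<phi>" if "y' \<in> C" for y'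
  proof -
    have "wall D (fst y', snd y') (fst y', h (fst y')) \<phi>" by (rule \<eta>(5)) (use that in \<open>simp_all add: C_def\<close>)
    then show ?thesis by auto
  qed
  have "\<phi> (fst y' - fst y) = 0" if "y' \<in> C" for y' using that unfolding C_def by auto
  then show ?thesis using that[OF \<eta>(1) C_def conn yC walls \<eta>(3,4)] by blast
qed

text \<open>If the sign of the jump were trivial at one point, it would be so along the whole
  connected curtain. The sign cocycle would then vanish near every point of \<open>V - L\<close> on
  the sky, hence have a potential there by \<open>gauge_extend\<close>, which
  \<open>meridional\<close> forbids at \<open>z\<close>.\<close>

lemma wall_jump_sign:
  assumes y: "wall D y z \<phi>" and e: "e > 0"
    and opp: "\<And>a b. a \<in> ball y e \<Longrightarrow> b \<in> ball y e \<Longrightarrow> 0 < \<phi> (fst a - fst y) \<Longrightarrow> \<phi> (fst b - fst y) < 0 \<Longrightarrow> w a b = g"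
  shows "sg g"
proof (rule ccontr)
  assume ng: "\<not> sg g"
  have lin: "linear \<phi>" using y unfolding wall_def by (rule conjunct1)
  have zL: "z \<in> L" "fst z = fst y" using y unfolding wall_def by blast+
  obtain \<eta> h C where C: "\<eta> > 0" "C = {x. fst x \<in> ball (fst y) \<eta> \<and> \<phi> (fst x - fst y) = 0 \<and> snd x < h (fst x)}"
    "connected C" "y \<in> C"
    "\<And>y'. y' \<in> C \<Longrightarrow> \<exists>z'. wall D y' z' \<phi>" "h (fst y) = snd z"
    "\<And>q t. q \<in> ball (fst y) \<eta> \<Longrightarrow> (q, t) \<in> L \<longleftrightarrow> \<phi> (q - fst y) = 0 \<and> t = h q"
    "\<And>y'. y' \<in> C \<Longrightarrow> \<phi> (fst y' - fst y) = 0"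
    by (rule wall_curtain[OF y]) (rule that; assumption)
  \<comment> \<open>Only sky points near \<open>y'\<close> are tested, so the condition makes sense
    in the sky and on the curtain alike.\<close>
  define f where "f y' \<longleftrightarrow> (\<exists>e>0. \<forall>a\<in>ball y' e \<inter> sky D. \<forall>b\<in>ball y' e \<inter> sky D. \<not> sg (w a b))" for y'
  have loc: "\<exists>e>0. \<forall>y''\<in>ball y' e \<inter> C. f y'' = f y'" if y': "y' \<in> C" for y'
  proof -
    obtain z' where z': "wall D y' z' \<phi>" using C(5)[OF y'] by blast
    obtain g' e' where g': "e' > 0" "g' \<in> H" "cocycle_on (ball y' e') w"
      "\<And>a. a \<in> ball y' e' \<Longrightarrow> a \<in> sky D \<longleftrightarrow> \<phi> (fst a - fst y') \<noteq> 0"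
      "\<And>a b. a \<in> ball y' e' \<Longrightarrow> b \<in> ball y' e' \<Longrightarrow> 0 < \<phi> (fst a - fst y') * \<phi> (fst b - fst y') \<Longrightarrow> w a b = 0"
      "\<And>a b. a \<in> ball y' e' \<Longrightarrow> b \<in> ball y' e' \<Longrightarrow> 0 < \<phi> (fst a - fst y') \<Longrightarrow> \<phi> (fst b - fst y') < 0 \<Longrightarrow> w a b = g' \<and>
        w b a = - g'"
      by (rule wall_jump_oriented[OF z']) (rule that; assumption)
    have "f y'' \<longleftrightarrow> \<not> sg g'" if y'': "y'' \<in> ball y' e'" "y'' \<in> C" for y''
    proof
      assume "f y''"
      then obtain e1 where e1: "e1 > 0" "\<forall>a\<in>ball y'' e1 \<inter> sky D. \<forall>b\<in>ball y'' e1 \<inter> sky D. \<not> sg (w a b)"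
        unfolding f_def by blast
      obtain e2 where e2: "e2 > 0" "ball y'' e2 \<subseteq> ball y' e'" using y''(1)
        by (meson open_ball open_contains_ball)
      obtain z'' where z'': "wall D y'' z'' \<phi>" using C(5)[OF y''(2)] by blast
      have "min e1 e2 > 0" using e1 e2 by simp
      then obtain a b where ab: "a \<in> ball y'' (min e1 e2)" "b \<in> ball y'' (min e1 e2)" "a \<in> sky D" "b \<in> sky D"
        "0 < \<phi> (fst a - fst y'')" "\<phi> (fst b - fst y'') < 0"
        by (rule wall_sides[OF z'']) (rule that; assumption)
      have sh: "\<phi> (fst c - fst y'') = \<phi> (fst c - fst y')" for c :: space
        using line_shift[OF lin C(8)[OF y''(2)], of c] line_shift[OF lin C(8)[OF y'], of c] by simp
      have "a \<in> ball y'' e2" "b \<in> ball y'' e2" using ab by auto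
      then have B: "a \<in> ball y' e'" "b \<in> ball y' e'" using e2(2) by blast+
      have "w a b = g'" using g'(6)[OF B] ab(5,6) unfolding sh by blast
      moreover have "\<not> sg (w a b)" using e1(2) ab by auto
      ultimately show "\<not> sg g'" by simp
    next
      assume ng': "\<not> sg g'"
      obtain e2 where e2: "e2 > 0" "ball y'' e2 \<subseteq> ball y' e'" using y''(1)
        by (meson open_ball open_contains_ball)
      have "\<not> sg (w a b)" if ab: "a \<in> ball y'' e2 \<inter> sky D" "b \<in> ball y'' e2 \<inter> sky D" for a b
      proof -
        have B: "a \<in> ball y' e'" "b \<in> ball y' e'" using ab e2(2) by blast+
        have "\<phi> (fst a - fst y') \<noteq> 0" "\<phi> (fst b - fst y') \<noteq> 0" using g'(4) B ab by auto
        then consider "0 < \<phi> (fst a - fst y') * \<phi> (fst b - fst y')" | "0 < \<phi> (fst a - fst y')"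
          "\<phi> (fst b - fst y') < 0" |
          "0 < \<phi> (fst b - fst y')" "\<phi> (fst a - fst y') < 0" by (fastforce simp: zero_less_mult_iff)
        then show ?thesis
        proof cases
          case 1 then show ?thesis using g'(5)[OF B] sign_homD(2)[OF sg] by simp
        next
          case 2 then show ?thesis using g'(6)[OF B] ng' by simp
        next
          case 3 then show ?thesis using g'(6)[OF B(2,1)] ng' sign_homD(3)[OF sg] by simp
        qed
      qed
      then show "f y''" unfolding f_def using e2(1) by blast
    qed
    note key = this
    have "f y' \<longleftrightarrow> \<not> sg g'" using key[of y'] g'(1) y' by simp
    then have "f y'' = f y'" if "y'' \<in> ball y' e' \<inter> C" for y'' using key[of y''] that by simp
    then show ?thesis using g'(1) by blast
  qed
  have fy: "f y"
  proof -
    obtain g' e' where g': "e' > 0" "g' \<in> H" "cocycle_on (ball y e') w"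
      "\<And>a. a \<in> ball y e' \<Longrightarrow> a \<in> sky D \<longleftrightarrow> \<phi> (fst a - fst y) \<noteq> 0"
      "\<And>a b. a \<in> ball y e' \<Longrightarrow> b \<in> ball y e' \<Longrightarrow> 0 < \<phi> (fst a - fst y) * \<phi> (fst b - fst y) \<Longrightarrow> w a b = 0"
      "\<And>a b. a \<in> ball y e' \<Longrightarrow> b \<in> ball y e' \<Longrightarrow> 0 < \<phi> (fst a - fst y) \<Longrightarrow> \<phi> (fst b - fst y) < 0 \<Longrightarrow> w a b = g' \<and>
        w b a = - g'"
      by (rule wall_jump_oriented[OF y]) (rule that; assumption)
    have "min e e' > 0" using e g'(1) by simp
    then obtain a b where "a \<in> ball y (min e e')" "b \<in> ball y (min e e')" "a \<in> sky D" "b \<in> sky D"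
      "0 < \<phi> (fst a - fst y)" "\<phi> (fst b - fst y) < 0"
      by (rule wall_sides[OF y]) (rule that; assumption)
    then have "g' = g" using g'(6)[of a b] opp[of a b] by auto
    then have ng': "\<not> sg g'" using ng by simp
    have "\<not> sg (w a b)" if ab: "a \<in> ball y e' \<inter> sky D" "b \<in> ball y e' \<inter> sky D" for a b
    proof -
      have B: "a \<in> ball y e'" "b \<in> ball y e'" using ab by auto
      have "\<phi> (fst a - fst y) \<noteq> 0" "\<phi> (fst b - fst y) \<noteq> 0" using g'(4) B ab by auto
      then consider "0 < \<phi> (fst a - fst y) * \<phi> (fst b - fst y)" | "0 < \<phi> (fst a - fst y)"
        "\<phi> (fst b - fst y) < 0" |
        "0 < \<phi> (fst b - fst y)" "\<phi> (fst a - fst y) < 0" by (fastforce simp: zero_less_mult_iff)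
      then show ?thesis
      proof cases
        case 1 then show ?thesis using g'(5)[OF B] sign_homD(2)[OF sg] by simp
      next
        case 2 then show ?thesis using g'(6)[OF B] ng' by simp
      next
        case 3 then show ?thesis using g'(6)[OF B(2,1)] ng' sign_homD(3)[OF sg] by simp
      qed
    qed
    then show ?thesis unfolding f_def using g'(1) by blast
  qed
  have fC: "f y'" if y': "y' \<in> C" for y'
    using locally_constant_on_connected[OF C(3,4) y' loc] fy by blast
  \<comment> \<open>A full vertical cylinder: over the disc the link is a single strand, so
    \<open>V - L\<close> consists of sky points and of the curtain \<open>C\<close>.\<close>
  define V where "V = {v::space. fst v \<in> ball (fst y) \<eta>}"
  have "V = ball (fst y) \<eta> \<times> UNIV" by (auto simp: V_def)
  then have oV: "open V" by (simp add: open_Times)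
  have zV: "z \<in> V" using zL C(1) by (simp add: V_def)
  have fV: "f v" if v: "v \<in> V - L" for v
  proof (cases "v \<in> sky D")
    case True
    obtain e1 where "e1 > 0" "\<forall>a\<in>ball v e1. \<forall>b\<in>ball v e1. w a b = 0" using zero[OF True] by blast
    then show ?thesis unfolding f_def using sign_homD(2)[OF sg] by (intro exI[of _ e1]) auto
  next
    case False
    then obtain z' where z': "z' \<in> L" "fst z' = fst v" "snd v \<le> snd z'" by (auto simp: sky_def not_less)
    have q: "fst v \<in> ball (fst y) \<eta>" using v by (simp add: V_def)
    have "(fst v, snd z') \<in> L" using z' by (metis prod.collapse)
    then have *: "\<phi> (fst v - fst y) = 0" "snd z' = h (fst v)" using C(7)[OF q] by blast+
    have "snd v \<noteq> h (fst v)" using v z' * by (metis DiffD2 prod_eq_iff)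
    then have "snd v < h (fst v)" using z'(3) * by simp
    then have "v \<in> C" unfolding C(2) using q * by simp
    then show ?thesis by (rule fC)
  qed
  \<comment> \<open>The sign with values in \<open>bit\<close>, a \<open>group_add\<close> of order
    2, to which \<open>gauge_extend\<close> applies.\<close>
  define u where "u a b = (if sg (w a b) then 1 else 0 :: bit)" for a b
  have "cocycle (V - L) u"
    unfolding cocycle_def
  proof
    fix x assume "x \<in> V - L"
    then have "x \<in> - L" by blast
    then obtain e where e: "e > 0" "cocycle_on (ball x e) w" using wc unfolding cocycle_def by blast
    have "cocycle_on (ball x e) u"
      unfolding cocycle_on_def
    proof (intro ballI)
      fix a b c assume "a \<in> ball x e" "b \<in> ball x e" "c \<in> ball x e"
      then have "w a c = w a b + w b c" using cocycle_onD[OF e(2)] by simp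
      then show "u a b + u b c = u a c" unfolding u_def by (simp add: sign_homD(1)[OF sg])
    qed
    then show "\<exists>e>0. cocycle_on (ball x e) u" using e(1) by blast
  qed
  moreover have "cocycle (V - L) (\<lambda>_ _. 0 :: bit)" unfolding cocycle_def cocycle_on_def
    by (intro ballI exI[of _ 1]) simp
  moreover have "gauge_on (V - L) (sky D) (\<lambda>_. 0) (\<lambda>_ _. 0) u"
    unfolding gauge_on_def
  proof
    fix x assume "x \<in> V - L"
    then obtain e where e: "e > 0" "\<forall>a\<in>ball x e \<inter> sky D. \<forall>b\<in>ball x e \<inter> sky D. \<not> sg (w a b)" using fV
      unfolding f_def by blast
    then show "\<exists>e>0. \<forall>a\<in>ball x e \<inter> sky D. \<forall>b\<in>ball x e \<inter> sky D. u a b = - 0 + 0 + 0"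
      by (intro exI[of _ e]) (simp add: u_def)
  qed
  moreover have "open (V - L)" using open_Int[OF oV complement_open] by (simp add: Diff_eq)
  moreover have "V - L \<subseteq> closure (sky D)" using sky_dense by blast
  ultimately obtain k' where k': "gauge_on (V - L) UNIV k' (\<lambda>_ _. 0) u"
    using gauge_extend[of "V - L" "sky D" "\<lambda>_ _. 0" u "\<lambda>_. 0"] by blast
  have "\<exists>k::space \<Rightarrow> bool. \<forall>y\<in>V - L. \<exists>e>0. \<forall>a\<in>ball y e. \<forall>b\<in>ball y e. sg (w a b) \<longleftrightarrow> k a \<noteq> k b"
  proof (rule exI[of _ "\<lambda>a. k' a = 1"], rule ballI)
    fix x assume "x \<in> V - L"
    then obtain e where e: "e > 0" "\<forall>a\<in>ball x e. \<forall>b\<in>ball x e. u a b = - k' a + 0 + k' b"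
      using k' unfolding gauge_on_def Int_UNIV_right by blast
    have "sg (w a b) \<longleftrightarrow> (k' a = 1) \<noteq> (k' b = 1)" if "a \<in> ball x e" "b \<in> ball x e" for a b
    proof -
      have "u a b = - k' a + 0 + k' b" using e(2) that by blast
      then show ?thesis unfolding u_def by (cases "k' a"; cases "k' b") (auto split: if_splits)
    qed
    then show "\<exists>e>0. \<forall>a\<in>ball x e. \<forall>b\<in>ball x e. sg (w a b) \<longleftrightarrow> (k' a = 1) \<noteq> (k' b = 1)" using e(1) by blast
  qed
  then show False using mer zL(1) oV zV unfolding meridional_def by blast
qed

text \<open>A jump of non-trivial sign is an involution, so both directions of crossing give the
  same element.\<close>

lemma wall_jump_exists:
  assumes y: "wall D y z \<phi>"
  obtains g e where "e > 0" "g \<in> H" "sg g" "\<And>a. a \<in> ball y e \<Longrightarrow> a \<in> sky D \<longleftrightarrow> \<phi> (fst a - fst y) \<noteq> 0"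
    "\<And>a b. a \<in> ball y e \<Longrightarrow> b \<in> ball y e \<Longrightarrow> 0 < \<phi> (fst a - fst y) * \<phi> (fst b - fst y) \<Longrightarrow> w a b = 0"
    "\<And>a b. a \<in> ball y e \<Longrightarrow> b \<in> ball y e \<Longrightarrow> \<phi> (fst a - fst y) * \<phi> (fst b - fst y) < 0 \<Longrightarrow> w a b = g"
proof -
  obtain g e where g: "e > 0" "g \<in> H" "cocycle_on (ball y e) w"
      "\<And>a. a \<in> ball y e \<Longrightarrow> a \<in> sky D \<longleftrightarrow> \<phi> (fst a - fst y) \<noteq> 0"
      "\<And>a b. a \<in> ball y e \<Longrightarrow> b \<in> ball y e \<Longrightarrow> 0 < \<phi> (fst a - fst y) * \<phi> (fst b - fst y) \<Longrightarrow> w a b = 0"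
      "\<And>a b. a \<in> ball y e \<Longrightarrow> b \<in> ball y e \<Longrightarrow> 0 < \<phi> (fst a - fst y) \<Longrightarrow> \<phi> (fst b - fst y) < 0 \<Longrightarrow> w a b = g \<and>
        w b a = - g"
    by (rule wall_jump_oriented[OF y]) (rule that; assumption)
  have s: "sg g" by (rule wall_jump_sign[OF y g(1)]) (use g(6) in blast)+
  have "- g = g" using sign_homD(5)[OF sg s] by (simp add: minus_unique)
  then have "w a b = g" if "a \<in> ball y e" "b \<in> ball y e" "\<phi> (fst a - fst y) * \<phi> (fst b - fst y) < 0" for a b
    using g(6)[OF that(1,2)] g(6)[OF that(2,1)] that(3) by (auto simp: mult_less_0_iff)
  then show ?thesis using that[OF g(1,2) s g(4,5)] by blast
qed

text \<open>Independent of the functional of the wall. The condition on the sign excludes the value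
  0, which pairs of points on the same side of the curtain produce in every ball.\<close>

definition jump :: "space \<Rightarrow> 'g" where
  "jump y = (THE g. sg g \<and> (\<forall>e>0. \<exists>a\<in>ball y e \<inter> sky D. \<exists>b\<in>ball y e \<inter> sky D. w a b = g))"

lemma wall_jump:
  assumes y: "wall D y z \<phi>"
  obtains e where "e > 0" "jump y \<in> H" "sg (jump y)"
    "\<And>a b. a \<in> ball y e \<Longrightarrow> b \<in> ball y e \<Longrightarrow> \<phi> (fst a - fst y) * \<phi> (fst b - fst y) < 0 \<Longrightarrow> w a b = jump y"
proof -
  obtain g e where g: "e > 0" "g \<in> H" "sg g" "\<And>a. a \<in> ball y e \<Longrightarrow> a \<in> sky D \<longleftrightarrow> \<phi> (fst a - fst y) \<noteq> 0"
    "\<And>a b. a \<in> ball y e \<Longrightarrow> b \<in> ball y e \<Longrightarrow> 0 < \<phi> (fst a - fst y) * \<phi> (fst b - fst y) \<Longrightarrow> w a b = 0"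
    "\<And>a b. a \<in> ball y e \<Longrightarrow> b \<in> ball y e \<Longrightarrow> \<phi> (fst a - fst y) * \<phi> (fst b - fst y) < 0 \<Longrightarrow> w a b = g"
    by (rule wall_jump_exists[OF y]) (rule that; assumption)
  have "jump y = g"
    unfolding jump_def
  proof (rule the_equality)
    show "sg g \<and> (\<forall>e>0. \<exists>a\<in>ball y e \<inter> sky D. \<exists>b\<in>ball y e \<inter> sky D. w a b = g)"
    proof (intro conjI allI impI)
      fix e' :: real assume "e' > 0"
      then have "min e e' > 0" using g(1) by simp
      then obtain a b where ab: "a \<in> ball y (min e e')" "b \<in> ball y (min e e')" "a \<in> sky D" "b \<in> sky D"
        "0 < \<phi> (fst a - fst y)" "\<phi> (fst b - fst y) < 0"
        by (rule wall_sides[OF y]) (rule that; assumption)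
      have B: "a \<in> ball y e" "b \<in> ball y e" "a \<in> ball y e'" "b \<in> ball y e'" using ab by auto
      have "w a b = g" using g(6)[OF B(1,2)] ab(5,6) by (simp add: mult_pos_neg)
      then show "\<exists>a\<in>ball y e' \<inter> sky D. \<exists>b\<in>ball y e' \<inter> sky D. w a b = g" using B ab by blast
    qed (rule g(3))
  next
    fix g' assume g': "sg g' \<and> (\<forall>e>0. \<exists>a\<in>ball y e \<inter> sky D. \<exists>b\<in>ball y e \<inter> sky D. w a b = g')"
    then obtain a b where ab: "a \<in> ball y e" "b \<in> ball y e" "a \<in> sky D" "b \<in> sky D" "w a b = g'" using g(1)
      by blast
    then have "\<phi> (fst a - fst y) \<noteq> 0" "\<phi> (fst b - fst y) \<noteq> 0" using g(4) by auto
    then consider "0 < \<phi> (fst a - fst y) * \<phi> (fst b - fst y)" | "\<phi> (fst a - fst y) * \<phi> (fst b - fst y) < 0"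
      by (metis linorder_neqE_linordered_idom mult_eq_0_iff)
    then show "g' = g"
    proof cases
      case 1
      then have "g' = 0" using g(5)[OF ab(1,2)] ab(5) by simp
      then show ?thesis using g' sign_homD(2)[OF sg] by simp
    qed (use g(6)[OF ab(1,2)] ab(5) in simp)
  qed
  then show ?thesis using that[OF g(1)] g(2,3,6) by blast
qed

lemma jump_near:
  assumes y: "wall D y z \<phi>"
  obtains e where "e > 0" "\<And>y' z'. y' \<in> ball y e \<Longrightarrow> \<phi> (fst y' - fst y) = 0 \<Longrightarrow> wall D y' z' \<phi> \<Longrightarrow> jump y' = jump y"
proof -
  have lin: "linear \<phi>" using y unfolding wall_def by (rule conjunct1)
  obtain e where e: "e > 0" "jump y \<in> H" "sg (jump y)"
    "\<And>a b. a \<in> ball y e \<Longrightarrow> b \<in> ball y e \<Longrightarrow> \<phi> (fst a - fst y) * \<phi> (fst b - fst y) < 0 \<Longrightarrow> w a b = jump y"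
    by (rule wall_jump[OF y]) (rule that; assumption)
  show ?thesis
  proof (rule that[OF e(1)])
    fix y' z' assume y': "y' \<in> ball y e" "\<phi> (fst y' - fst y) = 0" and w': "wall D y' z' \<phi>"
    obtain e' where e': "e' > 0" "jump y' \<in> H" "sg (jump y')"
      "\<And>a b. a \<in> ball y' e' \<Longrightarrow> b \<in> ball y' e' \<Longrightarrow> \<phi> (fst a - fst y') * \<phi> (fst b - fst y') < 0 \<Longrightarrow> w a b = jump y'"
      by (rule wall_jump[OF w']) (rule that; assumption)
    obtain e2 where e2: "e2 > 0" "ball y' e2 \<subseteq> ball y e" using y'(1) by (meson open_ball open_contains_ball)
    have "min e' e2 > 0" using e' e2 by simp
    then obtain a b where ab: "a \<in> ball y' (min e' e2)" "b \<in> ball y' (min e' e2)" "a \<in> sky D" "b \<in> sky D"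
      "0 < \<phi> (fst a - fst y')" "\<phi> (fst b - fst y') < 0"
      by (rule wall_sides[OF w']) (rule that; assumption)
    have B1: "a \<in> ball y' e'" "b \<in> ball y' e'" "a \<in> ball y' e2" "b \<in> ball y' e2" using ab by auto
    then have B2: "a \<in> ball y e" "b \<in> ball y e" using e2(2) by blast+
    have "w a b = jump y'" using e'(4)[OF B1(1,2)] ab(5,6) by (simp add: mult_pos_neg)
    moreover have "w a b = jump y"
      using e(4)[OF B2] ab(5,6) unfolding line_shift[OF lin y'(2)] by (simp add: mult_pos_neg)
    ultimately show "jump y' = jump y" by simp
  qed
qed

text \<open>Below a wall point the vertical line meets no other part of the link, so the jump can be
  followed along the half-line under \<open>z\<close>.\<close>

lemma jump_lower:
  assumes y: "wall D y z \<phi>" and s: "s < snd z" shows "jump (fst y, s) = jump y"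
proof -
  let ?I = "{fst y} \<times> {..<snd z}"
  have yz: "snd y < snd z" using y unfolding wall_def by blast
  have "jump (fst y, s) = jump (fst y, snd y)"
  proof (rule locally_constant_on_connected[of ?I])
    show "connected ?I" by (intro convex_connected convex_Times convex_singleton convex_real_interval)
    fix x assume x: "x \<in> ?I"
    have wl: "wall D x' z \<phi>" if x': "x' \<in> ?I" for x'
    proof -
      have "fst x' = fst y" "snd x' < snd z" using x' by (auto simp: mem_Times_iff)
      then show ?thesis using wall_lower[OF y, of "snd x'"] by (metis prod.collapse)
    qed
    have lin: "linear \<phi>" using y unfolding wall_def by (rule conjunct1)
    obtain e where e: "e > 0" "\<And>y' z'. y' \<in> ball x e \<Longrightarrow> \<phi> (fst y' - fst x) = 0 \<Longrightarrow> wall D y' z' \<phi> \<Longrightarrow>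
      jump y' = jump x"
      by (rule jump_near[OF wl[OF x]]) (rule that; assumption)
    have "jump x' = jump x" if x': "x' \<in> ball x e \<inter> ?I" for x'
    proof (rule e(2))
      show "x' \<in> ball x e" using x' by blast
      show "\<phi> (fst x' - fst x) = 0" using x x' linear_0[OF lin] by (auto simp: mem_Times_iff)
      show "wall D x' z \<phi>" using wl x' by blast
    qed
    then show "\<exists>e>0. \<forall>y\<in>ball x e \<inter> ?I. jump y = jump x" using e(1) by blast
  qed (use s yz in \<open>simp_all add: mem_Times_iff\<close>)
  then show ?thesis by simp
qed

text \<open>\<open>g i\<close> is the value of \<open>w\<close> on the way into quadrant
  \<open>i\<close> across ray \<open>i\<close>; a full turn gives \<open>w (q 0) (q 0)\<close>,
  which is 0. Below a crossing this will be the Fox relation, below a single strand it equates the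
  jumps at its two arms.\<close>

lemma cell_jumps:
  assumes c: "cross_cell D x al be d e r \<delta> K A" and b: "cell x al be r \<delta> \<subseteq> S" "open S" "cocycle_on S w"
  obtains g where "g 1 + g 2 + g 3 + g 0 = (0::'g)" "\<And>i. i < 4 \<Longrightarrow> i \<notin> K \<Longrightarrow> g i = 0"
    "\<And>i y. i \<in> K \<Longrightarrow> y \<in> cell x al be r \<delta> \<Longrightarrow> 0 < par al be i (fst y - fst x) \<Longrightarrow> nor al be i (fst y - fst x) = 0 \<Longrightarrow>
      jump y = g i"
proof -
  let ?B = "cell x al be r \<delta>" and ?Q = "quadrant x al be r \<delta>"
  note lin = cross_cellD(1,2)[OF c] and v = cross_cellD(3-6)[OF c]
  have QS: "?Q i \<subseteq> S" "?Q i \<subseteq> sky D" if "i < 4" for i using quadrant_sky[OF c that] b(1) by auto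
  have Q0: "w a b = 0" if "i < 4" "a \<in> ?Q i" "b \<in> ?Q i" for i a b
    by (rule sky_convex_zero[OF quadrant_convex[OF lin \<open>i < 4\<close>] QS(2,1)[OF \<open>i < 4\<close>] that(2,3) b(3,2)])
  have "\<exists>a. a \<in> ?Q i" if i: "i < 4" for i
  proof -
    obtain y where y: "y \<in> ?B" "0 < par al be i (fst y - fst x)" "nor al be i (fst y - fst x) = 0"
      by (rule ray_point[OF c i]) (rule that; assumption)
    obtain a b where "a \<in> ?Q i \<inter> UNIV" "b \<in> ?Q ((i + 3) mod 4) \<inter> UNIV"
      "nor al be i (fst a - fst x) * nor al be i (fst b - fst x) < 0"
      by (rule quadrant_adjacent[OF lin v i open_UNIV UNIV_I y]) (rule that; assumption)
    then show ?thesis by blast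
  qed
  then have "\<forall>i\<in>{..<4}. \<exists>a. a \<in> ?Q i" by blast
  then obtain q where q: "\<And>i. i < 4 \<Longrightarrow> q i \<in> ?Q i" by (metis lessThan_iff)
  define g where "g i = w (q ((i + 3) mod 4)) (q i)" for i
  have m4: "(i + 3) mod 4 < 4" for i :: nat by simp
  have g: "w b a = g i" if i: "i < 4" and ab: "a \<in> ?Q i" "b \<in> ?Q ((i + 3) mod 4)" for i a b
  proof -
    let ?j = "(i + 3) mod 4"
    have S: "a \<in> S" "b \<in> S" "q i \<in> S" "q ?j \<in> S" using QS(1)[OF i] QS(1)[OF m4] ab q[OF i] q[OF m4] by blast+
    have "w b a = w b (q ?j) + (w (q ?j) (q i) + w (q i) a)"
      using cocycle_onD[OF b(3) S(4,3,1)] cocycle_onD[OF b(3) S(2,4,1)] by simp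
    then show ?thesis using Q0[OF m4 ab(2) q[OF m4]] Q0[OF i q[OF i] ab(1)] by (simp add: g_def)
  qed
  have sum: "g 1 + g 2 + g 3 + g 0 = 0"
  proof -
    have S: "q 0 \<in> S" "q 1 \<in> S" "q 2 \<in> S" "q 3 \<in> S"
      using q[of 0] q[of 1] q[of 2] q[of 3] QS(1)[of 0] QS(1)[of 1] QS(1)[of 2] QS(1)[of 3] by auto
    have gs: "g 1 = w (q 0) (q 1)" "g 2 = w (q 1) (q 2)" "g 3 = w (q 2) (q 3)" "g 0 = w (q 3) (q 0)"
      by (simp_all add: g_def)
    show ?thesis unfolding gs cocycle_onD[OF b(3) S(1,2,3)] cocycle_onD[OF b(3) S(1,3,4)] cocycle_onD[OF b(3) S(1,4,1)]
      by (rule cocycle_on_refl[OF b(3) S(1)])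
  qed
  have gK: "jump y = g i" if i: "i \<in> K"
    and y: "y \<in> ?B" "0 < par al be i (fst y - fst x)" "nor al be i (fst y - fst x) = 0" for i y
  proof -
    have i4: "i < 4" using i cross_cellD(9)[OF c] by auto
    obtain z where z: "wall D y z (nor al be i)" using cross_cellD(12)[OF c y(1) i4 y(2,3) i] by blast
    obtain e' where e': "e' > 0" "jump y \<in> H" "sg (jump y)"
      "\<And>a b. a \<in> ball y e' \<Longrightarrow> b \<in> ball y e' \<Longrightarrow> nor al be i (fst a - fst y) * nor al be i (fst b - fst y) < 0 \<Longrightarrow>
        w a b = jump y"
      by (rule wall_jump[OF z]) (rule that; assumption)
    have yb: "y \<in> ball y e'" using e'(1) by simp
    obtain a b where ab: "a \<in> ?Q i \<inter> ball y e'" "b \<in> ?Q ((i + 3) mod 4) \<inter> ball y e'"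
      "nor al be i (fst a - fst x) * nor al be i (fst b - fst x) < 0"
      by (rule quadrant_adjacent[OF lin v i4 open_ball yb y]) (rule that; assumption)
    have "w b a = jump y"
    proof (rule e'(4))
      show "nor al be i (fst b - fst y) * nor al be i (fst a - fst y) < 0"
        unfolding line_shift[OF linear_nor[OF lin i4] y(3)] using ab(3) by (simp only: mult.commute)
    qed (use ab in blast)+
    moreover have "w b a = g i" by (rule g[OF i4]) (use ab in blast)+
    ultimately show ?thesis by simp
  qed
  have g0: "g i = 0" if i: "i < 4" "i \<notin> K" for i
  proof -
    obtain y where y: "y \<in> ?B" "0 < par al be i (fst y - fst x)" "nor al be i (fst y - fst x) = 0"
      by (rule ray_point[OF c i(1)]) (rule that; assumption)
    have "y \<in> sky D" by (rule cross_cellD(13)[OF c y(1) i(1) y(2,3) i(2)])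
    then obtain e' where e': "e' > 0" "\<forall>a\<in>ball y e'. \<forall>b\<in>ball y e'. w a b = 0" using zero by blast
    have yb: "y \<in> ball y e'" using e'(1) by simp
    obtain a b where ab: "a \<in> ?Q i \<inter> ball y e'" "b \<in> ?Q ((i + 3) mod 4) \<inter> ball y e'"
      "nor al be i (fst a - fst x) * nor al be i (fst b - fst x) < 0"
      by (rule quadrant_adjacent[OF lin v i(1) open_ball yb y]) (rule that; assumption)
    have "w b a = g i" by (rule g[OF i(1)]) (use ab in blast)+
    moreover have "w b a = 0" using e'(2) ab by blast
    ultimately show ?thesis by simp
  qed
  show ?thesis by (rule that[OF sum g0 gK])
qed

lemma cell_walls:
  assumes c: "cross_cell D x al be d e r \<delta> K A" and y: "y \<in> cell x al be r \<delta>" and w: "wall D y z \<phi>"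
  shows "(\<exists>i\<in>K. 0 < par al be i (fst y - fst x) \<and> nor al be i (fst y - fst x) = 0) \<or>
    fst y = fst x \<and> K = {0, 2} \<and> (\<exists>c. c \<noteq> 0 \<and> (\<forall>q. \<phi> q = c * be q))"
proof -
  have ns: "y \<notin> sky D" by (rule wall_top(2)[OF w])
  show ?thesis
  proof (cases "fst y = fst x")
    case True
    then show ?thesis using cross_cellD(17)[OF c y True w] by blast
  next
    case False
    have "al (fst y - fst x) = 0 \<or> be (fst y - fst x) = 0" using cross_cellD(11)[OF c y] ns by blast
    moreover have "\<not> (al (fst y - fst x) = 0 \<and> be (fst y - fst x) = 0)"
      using cross_cellD(20)[OF c, of "fst y - fst x"] False by auto
    ultimately consider "0 < al (fst y - fst x)" "be (fst y - fst x) = 0" | "0 < be (fst y - fst x)"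
      "al (fst y - fst x) = 0" |
      "al (fst y - fst x) < 0" "be (fst y - fst x) = 0" | "be (fst y - fst x) < 0" "al (fst y - fst x) = 0"
        by linarith
    then have "\<exists>i<4. 0 < par al be i (fst y - fst x) \<and> nor al be i (fst y - fst x) = 0"
    proof cases
      case 1 then show ?thesis by (intro exI[of _ 0]) (simp add: par_def nor_def)
    next
      case 2 then show ?thesis by (intro exI[of _ 1]) (simp add: par_def nor_def)
    next
      case 3 then show ?thesis by (intro exI[of _ 2]) (simp add: par_def nor_def)
    next
      case 4 then show ?thesis by (intro exI[of _ 3]) (simp add: par_def nor_def)
    qed
    then obtain i where i: "i < 4" "0 < par al be i (fst y - fst x)" "nor al be i (fst y - fst x) = 0" by blast
    then have "i \<in> K" using cross_cellD(13)[OF c y] ns by blast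
    then show ?thesis using i by blast
  qed
qed

text \<open>Let \<open>x\<close> be just below \<open>z\<close> and above every other point of the
  fibre. Then only the strand of \<open>z\<close> passes over the box, the relation of
  \<open>cell_jumps\<close> becomes \<open>g i + g 0 = 0\<close>, and the two arms have equal jumps
  because these are involutions. At an under point the upper strand would interfere.\<close>

lemma jump_local:
  assumes z: "z \<in> L" "z \<notin> under_points D"
  obtains g \<eta> where "\<eta> > 0" "\<And>y z' \<phi>. wall D y z' \<phi> \<Longrightarrow> z' \<in> ball z \<eta> \<Longrightarrow> jump y = g"
proof -
  obtain s where s: "s < snd z" "\<And>u. u \<in> L \<Longrightarrow> fst u = fst z \<Longrightarrow> u \<noteq> z \<Longrightarrow> snd u < s"
  proof (cases "\<exists>u. u \<in> L \<and> fst u = fst z \<and> u \<noteq> z")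
    case True
    then obtain u where u: "u \<in> L" "fst u = fst z" "u \<noteq> z" by blast
    have "crossing D u z" if "snd z < snd u" unfolding crossing_def using z(1) u(1,2) that by blast
    then have "\<not> snd z < snd u" using z(2) unfolding under_points_def by blast
    moreover have "snd z \<noteq> snd u" using u by (metis prod_eq_iff)
    ultimately have lt: "snd u < snd z" by simp
    have only: "u' = u" if "u' \<in> L" "fst u' = fst z" "u' \<noteq> z" for u'
      using no_triple[of u' u z] that u z(1) by auto
    show ?thesis
    proof (rule that[of "(snd u + snd z) / 2"])
      show "snd u' < (snd u + snd z) / 2" if "u' \<in> L" "fst u' = fst z" "u' \<noteq> z" for u'
        using only[OF that] lt by simp
    qed (use lt in simp)
  next
    case False
    show ?thesis by (rule that[of "snd z - 1"]) (use False in auto)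
  qed
  define x where "x = (fst z, s)"
  have above: "u = z" if "u \<in> L" "fst u = fst x" "snd x \<le> snd u" for u
    using s(2)[of u] that by (force simp: x_def)
  have "snd x \<noteq> snd z" using s(1) by (simp add: x_def)
  then have "x \<noteq> z" by metis
  then have xL: "x \<notin> L" using above[of x] by blast
  then obtain \<epsilon> where \<epsilon>: "\<epsilon> > 0" "cocycle_on (ball x \<epsilon>) w" using wc unfolding cocycle_def by blast
  obtain al be d e r \<delta> K A where c: "cross_cell D x al be d e r \<delta> K A" "cell x al be r \<delta> \<subseteq> ball x \<epsilon>"
    by (rule cross_cell_exists[OF xL \<epsilon>(1)]) (rule that; assumption)
  let ?B = "cell x al be r \<delta>"
  note lin = cross_cellD(1,2)[OF c(1)] and v = cross_cellD(3-6)[OF c(1)]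
  obtain g where g: "g 1 + g 2 + g 3 + g 0 = (0::'g)" "\<And>i. i < 4 \<Longrightarrow> i \<notin> K \<Longrightarrow> g i = 0"
    "\<And>i y. i \<in> K \<Longrightarrow> y \<in> ?B \<Longrightarrow> 0 < par al be i (fst y - fst x) \<Longrightarrow> nor al be i (fst y - fst x) = 0 \<Longrightarrow> jump y = g i"
    by (rule cell_jumps[OF c open_ball \<epsilon>(2)]) (rule that; assumption)
  have K4: "K \<subseteq> {..<4}" by (rule cross_cellD(9)[OF c(1)])
  have xB: "x \<in> ?B" using linear_0[OF lin(1)] linear_0[OF lin(2)] cross_cellD(7,8)[OF c(1)]
    by (simp add: cell_def)
  have "x \<notin> sky D" using z(1) s(1) unfolding sky_def x_def by force
  then have Kne: "K \<noteq> {}" using cross_cellD(15)[OF c(1)] xB by blast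
  have Kna: "K \<noteq> {0, 1, 2, 3}"
  proof
    assume "K = {0, 1, 2, 3}"
    then have "1 \<in> K" "2 \<in> K" by simp_all
    then have "K \<noteq> {}" "K \<noteq> {0, 2}" "K \<noteq> {0, 1}" by auto
    then obtain v u where vu: "crossing D v u" "fst u = fst x" "snd x < snd u" using cross_cellD(18)[OF c(1)]
      by blast
    then have "u = z" "v = z" using above[of u] above[of v] by (auto simp: crossing_def)
    then show False using vu(1) by (simp add: crossing_def)
  qed
  have K: "K = {0, 2} \<or> K = {0, 1}" using cross_cellD(18)[OF c(1)] Kne Kna by blast
  have gH: "g i + g i = 0" if i: "i \<in> K" for i
  proof -
    have i4: "i < 4" using i K4 by auto
    obtain y where y: "y \<in> ?B" "0 < par al be i (fst y - fst x)" "nor al be i (fst y - fst x) = 0"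
      by (rule ray_point[OF c(1) i4]) (rule that; assumption)
    obtain z' where z': "wall D y z' (nor al be i)" using cross_cellD(12)[OF c(1) y(1) i4 y(2,3) i] by blast
    have "sg (jump y)" by (rule wall_jump[OF z'])
    then show ?thesis using g(3)[OF i y] sign_homD(5)[OF sg] by simp
  qed
  have geq: "g i = g 0" if i: "i \<in> K" for i
  proof -
    have 0: "0 \<in> K" using K by auto
    have n: "- g 0 = g 0" using gH[OF 0] by (simp add: minus_unique)
    have "i = 0 \<or> g i + g 0 = 0"
    proof (cases "K = {0, 2}")
      case True
      then have "1 \<notin> K" "3 \<notin> K" by simp_all
      then have "g 1 = 0" "g 3 = 0" using g(2) by auto
      then show ?thesis using g(1) i True by auto
    next
      case False
      then have K1: "K = {0, 1}" using K by blast
      then have "2 \<notin> K" "3 \<notin> K" by simp_all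
      then have "g 2 = 0" "g 3 = 0" using g(2) by auto
      then show ?thesis using g(1) i K1 by auto
    qed
    then show ?thesis using n by (metis eq_neg_iff_add_eq_0)
  qed
  have all: "jump y = g 0" if y: "y \<in> ?B" and wy: "wall D y z' \<phi>" for y z' \<phi>
    using cell_walls[OF c(1) y wy]
  proof (elim disjE bexE conjE exE)
    fix i assume "i \<in> K" "0 < par al be i (fst y - fst x)" "nor al be i (fst y - fst x) = 0"
    then show ?thesis using g(3)[OF _ y] geq by simp
  next
    \<comment> \<open>On the axis of the box there is no ray to read the jump from; the wall point
      is moved a little along \<open>d\<close> onto ray 0.\<close>
    fix k assume k: "fst y = fst x" "K = {0, 2}" "k \<noteq> 0" "\<forall>q. \<phi> q = k * be q"
    obtain e1 where e1: "e1 > 0"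
      "\<And>y' z'. y' \<in> ball y e1 \<Longrightarrow> \<phi> (fst y' - fst y) = 0 \<Longrightarrow> wall D y' z' \<phi> \<Longrightarrow> jump y' = jump y"
      by (rule jump_near[OF wy]) (rule that; assumption)
    obtain e2 where e2: "e2 > 0" "\<And>a. a \<in> ball y e2 \<Longrightarrow> \<phi> (fst a - fst y) = 0 \<Longrightarrow> \<exists>z'. wall D a z' \<phi>"
      by (rule wall_nbhd[OF wy]) (rule that; assumption)
    let ?U = "?B \<inter> (ball y e1 \<inter> ball y e2)"
    have "open ?U" by (intro open_Int cell_open lin open_ball)
    moreover have "y \<in> ?U" using y e1(1) e2(1) by simp
    ultimately have U: "open ?U" "y \<in> ?U" by blast+
    note np = near_point[OF U, of "(d, 0)"]
    have "\<forall>\<^sub>F \<tau> in at_right (0::real). 0 < \<tau>" by (simp add: eventually_at_right_less)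
    then have "\<forall>\<^sub>F \<tau> in at_right (0::real). y + \<tau> *\<^sub>R (d, 0) \<in> ?U \<and> 0 < \<tau>" using np by eventually_elim blast
    from eventually_happens'[OF trivial_limit_at_right_real this]
    obtain \<tau> where \<tau>: "y + \<tau> *\<^sub>R (d, 0) \<in> ?U" "0 < \<tau>" by blast
    define y' where "y' = y + \<tau> *\<^sub>R (d, 0::real)"
    have f: "fst y' - fst x = \<tau> *\<^sub>R d" "fst y' - fst y = \<tau> *\<^sub>R d" using k(1) by (simp_all add: y'_def)
    have al': "al (fst y' - fst x) = \<tau>" "be (fst y' - fst x) = 0" unfolding f(1)
      by (simp_all add: linear_scale[OF lin(1)] linear_scale[OF lin(2)] v)
    have \<phi>0: "\<phi> (fst y' - fst y) = 0" using k(4) al'(2) unfolding f by simp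
    have y'U: "y' \<in> ?B" "y' \<in> ball y e1" "y' \<in> ball y e2" using \<tau>(1) unfolding y'_def[symmetric] by blast+
    obtain z'' where "wall D y' z'' \<phi>" using e2(2)[OF y'U(3) \<phi>0] by blast
    then have "jump y' = jump y" by (rule e1(2)[OF y'U(2) \<phi>0])
    moreover have "jump y' = g 0"
    proof (rule g(3)[OF _ y'U(1)])
      show "0 \<in> K" using k(2) by simp
      show "0 < par al be 0 (fst y' - fst x)" using al' \<tau>(2) by (simp add: par_def)
      show "nor al be 0 (fst y' - fst x) = 0" using al' by (simp add: nor_def)
    qed
    ultimately show ?thesis by simp
  qed
  obtain e' where e': "e' > 0" "ball x e' \<subseteq> ?B" by (rule cell_ball[OF c(1)])
  show ?thesis
  \<comment> \<open>Within this radius \<open>z'\<close> is higher than \<open>s\<close> and its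
    projection is over the box, so the wall can be lowered to height \<open>s\<close>, where all
    jumps are known.\<close>
  proof (rule that[of "min e' (snd z - s)" "g 0"])
    show "0 < min e' (snd z - s)" using e'(1) s(1) by simp
    fix y z' \<phi> assume wy: "wall D y z' \<phi>" and z': "z' \<in> ball z (min e' (snd z - s))"
    have fz: "fst z' = fst y" using wy unfolding wall_def by blast
    have d: "dist (fst z) (fst z') < e'" "dist (snd z) (snd z') < snd z - s"
      using z' dist_fst_le[of z z'] dist_snd_le[of z z'] by auto
    have sz: "s < snd z'" using d(2) unfolding dist_real_def by linarith
    have "dist x (fst y, s) = dist (fst z) (fst z')" unfolding x_def fz by (simp add: dist_Pair_Pair)
    then have "(fst y, s) \<in> ?B" using d(1) e'(2) by auto
    then have "jump (fst y, s) = g 0" using all wall_lower[OF wy sz] by blast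
    then show "jump y = g 0" using jump_lower[OF wy sz] by simp
  qed
qed

section \<open>The color of an arc, read off the jumps below it\<close>

definition is_color :: "space \<Rightarrow> 'g \<Rightarrow> bool" where
  "is_color z g \<longleftrightarrow> (\<exists>\<eta>>0. \<forall>y z' \<phi>. wall D y z' \<phi> \<longrightarrow> z' \<in> ball z \<eta> \<longrightarrow> jump y = g)"

lemma is_color_unique:
  assumes "z \<in> L" "is_color z g" "is_color z g'" shows "g = g'"
proof -
  obtain \<eta> \<eta>' where e: "\<eta> > 0" "\<forall>y z' \<phi>. wall D y z' \<phi> \<longrightarrow> z' \<in> ball z \<eta> \<longrightarrow> jump y = g"
    "\<eta>' > 0" "\<forall>y z' \<phi>. wall D y z' \<phi> \<longrightarrow> z' \<in> ball z \<eta>' \<longrightarrow> jump y = g'"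
    using assms(2,3) unfolding is_color_def by blast
  have "min \<eta> \<eta>' > 0" using e by simp
  then obtain y z' \<phi> where y: "wall D y z' \<phi>" "z' \<in> ball z (min \<eta> \<eta>')" and "\<And>A. A \<in> arcs D \<Longrightarrow> z \<in> A \<Longrightarrow> z' \<in> A"
    by (rule walls_dense[OF assms(1)]) (rule that; assumption)
  have "z' \<in> ball z \<eta>" "z' \<in> ball z \<eta>'" using y(2) by auto
  then have "jump y = g" "jump y = g'" using e(2,4) y(1) by blast+
  then show ?thesis by simp
qed

lemma is_color_exists: "z \<in> L - under_points D \<Longrightarrow> \<exists>g. is_color z g"
proof -
  assume "z \<in> L - under_points D"
  then have z: "z \<in> L" "z \<notin> under_points D" by simp_all
  obtain g \<eta> where g: "\<eta> > 0" "\<And>y z' \<phi>. wall D y z' \<phi> \<Longrightarrow> z' \<in> ball z \<eta> \<Longrightarrow> jump y = g"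
    by (rule jump_local[OF z]) (rule that; assumption)
  then have "is_color z g" unfolding is_color_def by (intro exI[of _ \<eta>] conjI allI impI)
  then show ?thesis by (rule exI)
qed

lemma is_color_near:
  assumes "is_color z g"
  shows "\<exists>e>0. \<forall>z'\<in>ball z e. is_color z' g"
proof -
  obtain \<eta> where e: "\<eta> > 0" "\<forall>y z' \<phi>. wall D y z' \<phi> \<longrightarrow> z' \<in> ball z \<eta> \<longrightarrow> jump y = g"
    using assms unfolding is_color_def by blast
  have "is_color z' g" if z': "z' \<in> ball z \<eta>" for z'
  proof -
    obtain \<eta>' where "\<eta>' > 0" "ball z' \<eta>' \<subseteq> ball z \<eta>" using z' by (meson open_ball open_contains_ball)
    then show ?thesis unfolding is_color_def using e(2) by blast
  qed
  then show ?thesis using e(1) by blast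
qed

text \<open>A color at a point is a color at all nearby points and is unique on the link, so it is
  constant along the connected arc.\<close>

lemma color_of_arc:
  assumes A: "A \<in> arcs D"
  obtains g where "\<And>z. z \<in> A \<Longrightarrow> is_color z g"
proof -
  have sub: "A \<subseteq> L - under_points D" by (rule arc_subset[OF A])
  define G where "G z = (THE g. is_color z g)" for z
  have G: "is_color z (G z)" if zA: "z \<in> A" for z
  proof -
    have z: "z \<in> L - under_points D" using sub zA by (rule subsetD)
    obtain g where g: "is_color z g" using is_color_exists[OF z] by (rule exE)
    show ?thesis unfolding G_def
    proof (rule theI[of _ g])
      show "is_color z g" by (rule g)
      show "g' = g" if "is_color z g'" for g' by (rule is_color_unique[OF DiffD1[OF z] that g])
    qed
  qed
  have const: "G a = G b" if ab: "a \<in> A" "b \<in> A" for a b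
  proof (rule locally_constant_on_connected[OF arc_connected[OF A] ab])
    fix z assume z: "z \<in> A"
    obtain e where e: "e > 0" "\<forall>z'\<in>ball z e. is_color z' (G z)" using is_color_near[OF G[OF z]] by blast
    have "G z' = G z" if z': "z' \<in> ball z e \<inter> A" for z'
    proof -
      have "is_color z' (G z)" using e(2) z' by blast
      moreover have "is_color z' (G z')" by (rule G) (use z' in blast)
      moreover have "z' \<in> L" using z' sub by blast
      ultimately show ?thesis using is_color_unique by blast
    qed
    then show "\<exists>e>0. \<forall>y\<in>ball z e \<inter> A. G y = G z" using e(1) by blast
  qed
  have "A \<noteq> {}" using A unfolding arcs_eq by (rule in_components_nonempty)
  then obtain a where a: "a \<in> A" by blast
  show ?thesis
  proof (rule that[of "G a"])
    show "is_color z (G a)" if "z \<in> A" for z using G[OF that] const[OF that a] by simp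
  qed
qed

lemma normal_cocycle_coloring:
  obtains \<gamma> where "group_coloring D \<gamma>" "\<And>A. A \<in> arcs D \<Longrightarrow> \<gamma> A \<in> H \<and> sg (\<gamma> A)"
    "\<And>x. x \<in> - L \<Longrightarrow> \<exists>e>0. section_on D \<gamma> (ball x e) (\<lambda>a. w x a)"
proof -
  have "\<forall>A\<in>arcs D. \<exists>g. \<forall>z\<in>A. is_color z g" using color_of_arc by meson
  then obtain \<gamma> where \<gamma>: "\<And>A z. A \<in> arcs D \<Longrightarrow> z \<in> A \<Longrightarrow> is_color z (\<gamma> A)" by metis
  have jump: "jump y = \<gamma> A" if y: "wall D y z \<phi>" "A \<in> arcs D" "z \<in> A" for y z \<phi> A
  proof -
    obtain \<eta> where e: "\<eta> > 0" "\<forall>y z' \<phi>. wall D y z' \<phi> \<longrightarrow> z' \<in> ball z \<eta> \<longrightarrow> jump y = \<gamma> A"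
      using \<gamma>[OF y(2,3)] unfolding is_color_def by blast
    have "z \<in> ball z \<eta>" using e(1) by simp
    then show ?thesis using e(2) y(1) by blast
  qed
  have Hs: "\<gamma> A \<in> H \<and> sg (\<gamma> A)" if A: "A \<in> arcs D" for A
  proof -
    have "A \<noteq> {}" using A unfolding arcs_eq by (rule in_components_nonempty)
    then obtain z where z: "z \<in> A" by blast
    then have zL: "z \<in> L" using arc_subset[OF A] by blast
    obtain y z' \<phi> where y: "wall D y z' \<phi>" "z' \<in> ball z 1" "\<And>A. A \<in> arcs D \<Longrightarrow> z \<in> A \<Longrightarrow> z' \<in> A"
      by (rule walls_dense[OF zL zero_less_one]) (rule that; assumption)
    have j: "jump y = \<gamma> A" by (rule jump[OF y(1) A y(3)[OF A z]])
    have "jump y \<in> H" by (rule wall_jump[OF y(1)])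
    moreover have "sg (jump y)" by (rule wall_jump[OF y(1)])
    ultimately show ?thesis unfolding j by blast
  qed
  have col: "group_coloring D \<gamma>"
    unfolding group_coloring_def
  proof (intro conjI ballI allI impI)
    show "\<gamma> A + \<gamma> A = 0" if "A \<in> arcs D" for A using Hs[OF that] sign_homD(5)[OF sg] by blast
    fix v u a b c assume cr: "crossing D v u" and b: "b \<in> arcs D" "v \<in> b" and ac: "under_arcs D u = {a, c}"
    \<comment> \<open>Below both strands of the crossing, so that the box sees all four arms and
      \<open>cell_jumps\<close> yields the Fox relation.\<close>
    define x where "x = (fst u, snd u - 1)"
    have uv: "snd u < snd v" using cr by (simp add: crossing_def)
    have "x \<notin> L"
    proof
      assume "x \<in> L"
      moreover have "fst x = fst u" by (simp add: x_def)
      ultimately have "x = u \<or> x = v" using crossing_unique[OF cr] by blast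
      then have "snd x = snd u \<or> snd x = snd v" by metis
      then show False using uv by (simp add: x_def)
    qed
    then obtain \<epsilon> where \<epsilon>: "\<epsilon> > 0" "cocycle_on (ball x \<epsilon>) w" using wc unfolding cocycle_def by blast
    obtain al be d e r \<delta> K A where cb: "cross_cell D x al be d e r \<delta> K A" "cell x al be r \<delta> \<subseteq> ball x \<epsilon>"
      by (rule cross_cell_exists[OF \<open>x \<notin> L\<close> \<epsilon>(1)]) (rule that; assumption)
    obtain g where g: "g 1 + g 2 + g 3 + g 0 = (0::'g)" "\<And>i. i < 4 \<Longrightarrow> i \<notin> K \<Longrightarrow> g i = 0"
      "\<And>i y. i \<in> K \<Longrightarrow> y \<in> cell x al be r \<delta> \<Longrightarrow> 0 < par al be i (fst y - fst x) \<Longrightarrow> nor al be i (fst y - fst x) = 0 \<Longrightarrow>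
        jump y = g i"
      by (rule cell_jumps[OF cb open_ball \<epsilon>(2)]) (rule that; assumption)
    have K: "K = {0, 1, 2, 3}" "v \<in> A 0" "under_arcs D u = {A 1, A 3}"
      using cross_cellD(19)[OF cb(1) cr] by (simp_all add: x_def)
    have gA: "g i = \<gamma> (A i)" if i: "i \<in> K" for i
    proof -
      have i4: "i < 4" using i cross_cellD(9)[OF cb(1)] by auto
      obtain y where y: "y \<in> cell x al be r \<delta>" "0 < par al be i (fst y - fst x)"
        "nor al be i (fst y - fst x) = 0"
        by (rule ray_point[OF cb(1) i4]) (rule that; assumption)
      obtain z' where z': "z' \<in> A i" "wall D y z' (nor al be i)"
        using cross_cellD(12)[OF cb(1) y(1) i4 y(2,3) i] by blast
      have "jump y = \<gamma> (A i)" by (rule jump[OF z'(2) cross_cellD(14)[OF cb(1) i] z'(1)])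
      then show ?thesis using g(3)[OF i y] by simp
    qed
    have "1 \<in> K" "2 \<in> K" "0 \<in> K" "3 \<in> K" using K(1) by simp_all
    then have "K \<noteq> {}" "K \<noteq> {0, 2}" "K \<noteq> {0, 1}" by auto
    then have A02: "A 0 = A 2" using cross_cellD(18)[OF cb(1)] by blast
    have bA: "b = A 0" by (rule arc_disjoint[OF b(1) cross_cellD(14)[OF cb(1) \<open>0 \<in> K\<close>] b(2) K(2)])
    have s: "\<gamma> (A 1) + \<gamma> b + \<gamma> (A 3) + \<gamma> b = 0"
      using g(1) gA[OF \<open>0 \<in> K\<close>] gA[OF \<open>1 \<in> K\<close>] gA[OF \<open>2 \<in> K\<close>] gA[OF \<open>3 \<in> K\<close>] A02 bA by simp
    have "{a, c} = {A 1, A 3}" using ac K(3) by simp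
    then consider "a = A 1" "c = A 3" | "a = A 3" "c = A 1" unfolding doubleton_eq_iff by blast
    then show "\<gamma> b + \<gamma> a + \<gamma> b + \<gamma> c = 0"
    proof cases
      case 1
      have "\<gamma> b + (\<gamma> (A 1) + \<gamma> b + \<gamma> (A 3)) = 0" by (subst add_eq_0_commute) (rule s)
      then show ?thesis using 1 by (simp only: add.assoc)
    next
      case 2
      have "\<gamma> (A 1) + (\<gamma> b + \<gamma> (A 3) + \<gamma> b) = 0" using s by (simp only: add.assoc)
      then have "\<gamma> b + \<gamma> (A 3) + \<gamma> b + \<gamma> (A 1) = 0" by (subst add_eq_0_commute)
      then show ?thesis using 2 by simp
    qed
  qed
  \<comment> \<open>On a ball around \<open>x\<close> where \<open>w\<close> is a cocycle,
    \<open>w x\<close> is itself a section: it is locally constant in the sky and changes by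
    \<open>jump y\<close> at a wall.\<close>
  have sec: "\<exists>e>0. section_on D \<gamma> (ball x e) (\<lambda>a. w x a)" if x: "x \<in> - L" for x
  proof -
    obtain \<epsilon> where \<epsilon>: "\<epsilon> > 0" "cocycle_on (ball x \<epsilon>) w" using wc x unfolding cocycle_def by blast
    have xb: "x \<in> ball x \<epsilon>" using \<epsilon>(1) by simp
    have "section_on D \<gamma> (ball x \<epsilon>) (\<lambda>a. w x a)"
      unfolding section_on_def
    proof (intro conjI ballI allI impI)
      fix y assume y: "y \<in> ball x \<epsilon> \<inter> sky D"
      obtain e1 where e1: "e1 > 0" "\<forall>a\<in>ball y e1. \<forall>b\<in>ball y e1. w a b = 0" using zero y by blast
      obtain e2 where e2: "e2 > 0" "ball y e2 \<subseteq> ball x \<epsilon>" using y by (meson IntD1 open_ball open_contains_ball)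
      have "w x a = w x y" if a: "a \<in> ball y (min e1 e2)" for a
      proof -
        have B: "a \<in> ball y e1" "y \<in> ball y e1" "a \<in> ball y e2" using a e1(1) by auto
        then have "w y a = 0" using e1(2) by blast
        moreover have "w x y + w y a = w x a" by (rule cocycle_onD[OF \<epsilon>(2) xb]) (use y B e2(2) in blast)+
        ultimately show ?thesis by simp
      qed
      moreover have "min e1 e2 > 0" using e1 e2 by simp
      ultimately show "\<exists>e>0. \<forall>a\<in>ball y e. w x a = w x y" by blast
    next
      fix y z \<phi> A assume y: "y \<in> ball x \<epsilon>" and wy: "wall D y z \<phi>" and A: "A \<in> arcs D" "z \<in> A"
      obtain e1 where e1: "e1 > 0" "jump y \<in> H" "sg (jump y)"
        "\<And>a b. a \<in> ball y e1 \<Longrightarrow> b \<in> ball y e1 \<Longrightarrow> \<phi> (fst a - fst y) * \<phi> (fst b - fst y) < 0 \<Longrightarrow> w a b = jump y"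
        by (rule wall_jump[OF wy]) (rule that; assumption)
      obtain e2 where e2: "e2 > 0" "ball y e2 \<subseteq> ball x \<epsilon>" using y by (meson open_ball open_contains_ball)
      have "w x b = w x a + \<gamma> A" if ab: "a \<in> ball y (min e1 e2)" "b \<in> ball y (min e1 e2)"
        "\<phi> (fst a - fst y) * \<phi> (fst b - fst y) < 0" for a b
      proof -
        have B: "a \<in> ball y e1" "b \<in> ball y e1" "a \<in> ball y e2" "b \<in> ball y e2" using ab by auto
        have "w a b = \<gamma> A" using e1(4)[OF B(1,2) ab(3)] jump[OF wy A] by simp
        moreover have "w x a + w a b = w x b" by (rule cocycle_onD[OF \<epsilon>(2) xb]) (use B e2(2) in blast)+
        ultimately show ?thesis by simp
      qed
      moreover have "min e1 e2 > 0" using e1 e2 by simp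
      ultimately show "\<exists>e>0. \<forall>a\<in>ball y e. \<forall>b\<in>ball y e. \<phi> (fst a - fst y) * \<phi> (fst b - fst y) < 0 \<longrightarrow>
        w x b = w x a + \<gamma> A"
        by blast
    qed
    then show ?thesis using \<epsilon>(1) by blast
  qed
  show ?thesis by (rule that[OF col Hs sec])
qed

end

section \<open>Colorings and based gauge classes of cocycles\<close>

definition gauge_equiv :: "space set \<Rightarrow> space \<Rightarrow> (space \<Rightarrow> space \<Rightarrow> 'g::group_add) \<Rightarrow> (space \<Rightarrow> space \<Rightarrow> 'g) \<Rightarrow> bool" where
  "gauge_equiv X p w w' \<longleftrightarrow> (\<exists>k. k p = 0 \<and> gauge_on X UNIV k w w')"

context regular_diagram
begin

text \<open>The potential of \<open>w\<close> on the contractible sky, shifted to vanish at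
  \<open>p\<close>, serves as the gauge that turns \<open>w\<close> into a normal cocycle
  \<open>w0\<close>; the same \<open>k\<close> then witnesses \<open>represents\<close>.\<close>

lemma cocycle_coloring:
  fixes w :: "space \<Rightarrow> space \<Rightarrow> 'g::group_add"
  assumes w: "cocycle (- L) w" "valued_in (- L) H w" "meridional L sg w" and H: "subgroup_add H"
    and sg: "sign_hom sg"
    and p: "p \<in> sky D"
  obtains \<gamma> where "group_coloring D \<gamma>" "\<And>A. A \<in> arcs D \<Longrightarrow> \<gamma> A \<in> H \<and> sg (\<gamma> A)" "represents D p \<gamma> w"
proof -
  have sX: "sky D \<subseteq> - L" using sky_disjoint by blast
  obtain k1 where k1: "gauge_on (sky D) UNIV k1 (\<lambda>_ _. 0) w"
    using cocycle_contractible[OF sky_open sky_contractible cocycle_subset[OF w(1) sX]] by blast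
  define k where "k a = - k1 p + k1 a" for a
  have kp: "k p = 0" by (simp add: k_def)
  have k: "\<exists>e>0. \<forall>a\<in>ball y e. \<forall>b\<in>ball y e. w a b = - k a + k b" if y: "y \<in> sky D" for y
  proof -
    obtain e where e: "e > 0" "\<forall>a\<in>ball y e. \<forall>b\<in>ball y e. w a b = - k1 a + 0 + k1 b"
      using k1 y unfolding gauge_on_def Int_UNIV_right by blast
    have "w a b = - k a + k b" if "a \<in> ball y e" "b \<in> ball y e" for a b
      using e(2) that by (simp add: k_def group_add_simps del: add_uminus_conv_diff)
    then show ?thesis using e(1) by blast
  qed
  \<comment> \<open>\<open>k\<close> starts with \<open>k p = 0\<close>, its local increments are
    values of \<open>w\<close> and lie in \<open>H\<close>, and the sky is connected.\<close>
  have kH: "k a \<in> H" if a: "a \<in> sky D" for a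
  proof -
    have "(k a \<in> H) = (k p \<in> H)"
    proof (rule locally_constant_on_connected[OF sky_connected a p])
      fix x assume x: "x \<in> sky D"
      obtain e1 where e1: "e1 > 0" "\<forall>a\<in>ball x e1. \<forall>b\<in>ball x e1. w a b = - k a + k b" using k[OF x] by blast
      obtain e2 where e2: "e2 > 0" "\<forall>a\<in>ball x e2. \<forall>b\<in>ball x e2. w a b \<in> H" using w(2) x sX
        unfolding valued_in_def by blast
      have "(k y \<in> H) = (k x \<in> H)" if y: "y \<in> ball x (min e1 e2)" for y
      proof -
        have B: "y \<in> ball x e1" "y \<in> ball x e2" "x \<in> ball x e1" "x \<in> ball x e2" using y e1(1) e2(1) by auto
        have wxy: "w x y = - k x + k y" "w x y \<in> H" using e1(2) e2(2) B by blast+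
        then have "k y = k x + w x y" "k x = k y - w x y"
          by (simp_all add: group_add_simps del: add_uminus_conv_diff)
        then show ?thesis using subgroup_addD(2,4)[OF H] wxy(2) by metis
      qed
      moreover have "min e1 e2 > 0" using e1 e2 by simp
      ultimately show "\<exists>e>0. \<forall>y\<in>ball x e \<inter> sky D. (k y \<in> H) = (k x \<in> H)" by blast
    qed
    then show ?thesis using kp subgroup_addD(1)[OF H] by simp
  qed
  define w0 where "w0 a b = k a + w a b - k b" for a b
  interpret n: normal_cocycle D w0 H sg
  proof
    show "cocycle (- L) w0" unfolding w0_def by (rule cocycle_gauge[OF w(1)])
    show "\<exists>e>0. \<forall>a\<in>ball y e. \<forall>b\<in>ball y e. w0 a b = 0" if y: "y \<in> sky D" for y
    proof -
      obtain e where e: "e > 0" "\<forall>a\<in>ball y e. \<forall>b\<in>ball y e. w a b = - k a + k b" using k[OF y] by blast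
      have "w0 a b = 0" if "a \<in> ball y e" "b \<in> ball y e" for a b
        using e(2) that by (simp add: w0_def group_add_simps del: add_uminus_conv_diff)
      then show ?thesis using e(1) by blast
    qed
    \<comment> \<open>Only sky points can be asked for: off the sky nothing is known about the
      values of the gauge \<open>k\<close>.\<close>
    show "\<exists>e>0. \<forall>a\<in>ball x e \<inter> sky D. \<forall>b\<in>ball x e \<inter> sky D. w0 a b \<in> H" if x: "x \<in> - L" for x
    proof -
      obtain e where e: "e > 0" "\<forall>a\<in>ball x e. \<forall>b\<in>ball x e. w a b \<in> H" using w(2) x unfolding valued_in_def
        by blast
      have "w0 a b \<in> H" if "a \<in> ball x e \<inter> sky D" "b \<in> ball x e \<inter> sky D" for a b
        unfolding w0_def using e(2) that kH subgroup_addD(2,4)[OF H] by (metis IntD1 IntD2)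
      then show ?thesis using e(1) by blast
    qed
    show "meridional L sg w0"
      unfolding meridional_def
    proof (intro ballI allI impI notI)
      fix z V assume z: "z \<in> L" "open V" "z \<in> V"
        and "\<exists>m::space \<Rightarrow> bool. \<forall>y\<in>V - L. \<exists>e>0. \<forall>a\<in>ball y e. \<forall>b\<in>ball y e. sg (w0 a b) = (m a \<noteq> m b)"
      then obtain m :: "space \<Rightarrow> bool"
        where m: "\<forall>y\<in>V - L. \<exists>e>0. \<forall>a\<in>ball y e. \<forall>b\<in>ball y e. sg (w0 a b) = (m a \<noteq> m b)" by blast
      \<comment> \<open>The gauge changes the sign cocycle by a coboundary, which is absorbed into
        the potential.\<close>
      define m' where "m' a = (m a \<noteq> sg (k a))" for a
      have ss: "sg (w a b) = (sg (k a) \<noteq> (sg (w0 a b) \<noteq> sg (k b)))" for a b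
        unfolding w0_def by (auto simp: sign_homD[OF sg])
      have "\<forall>y\<in>V - L. \<exists>e>0. \<forall>a\<in>ball y e. \<forall>b\<in>ball y e. sg (w a b) = (m' a \<noteq> m' b)"
      proof
        fix y assume "y \<in> V - L"
        then obtain e where e: "e > 0" "\<forall>a\<in>ball y e. \<forall>b\<in>ball y e. sg (w0 a b) = (m a \<noteq> m b)" using m by blast
        have "sg (w a b) = (m' a \<noteq> m' b)" if "a \<in> ball y e" "b \<in> ball y e" for a b
        proof -
          have "sg (w0 a b) = (m a \<noteq> m b)" using e(2) that by blast
          then show ?thesis unfolding ss m'_def by auto
        qed
        then show "\<exists>e>0. \<forall>a\<in>ball y e. \<forall>b\<in>ball y e. sg (w a b) = (m' a \<noteq> m' b)" using e(1) by blast
      qed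
      then show False using w(3) z unfolding meridional_def by blast
    qed
  qed (rule H, rule sg)
  obtain \<gamma> where \<gamma>: "group_coloring D \<gamma>" "\<And>A. A \<in> arcs D \<Longrightarrow> \<gamma> A \<in> H \<and> sg (\<gamma> A)"
    "\<And>x. x \<in> - L \<Longrightarrow> \<exists>e>0. section_on D \<gamma> (ball x e) (\<lambda>a. w0 x a)"
    by (rule n.normal_cocycle_coloring) (rule that; assumption)
  have "represents D p \<gamma> w"
    unfolding represents_def
  proof (intro exI[of _ k] conjI ballI kp)
    fix x assume "x \<in> - L"
    then obtain e where e: "e > 0" "section_on D \<gamma> (ball x e) (\<lambda>a. w0 x a)" using \<gamma>(3) by blast
    have "section_on D \<gamma> (ball x e) (\<lambda>a. - k x + w0 x a)" by (rule section_on_translate[OF e(2)])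
    moreover have "(\<lambda>a. - k x + w0 x a) = (\<lambda>a. w x a - k a)"
      by (rule ext) (simp add: w0_def group_add_simps del: add_uminus_conv_diff)
    ultimately show "\<exists>e>0. section_on D \<gamma> (ball x e) (\<lambda>a. w x a - k a)" using e(1) by auto
  qed
  then show ?thesis using that \<gamma>(1,2) by blast
qed

lemma representsE:
  fixes w :: "space \<Rightarrow> space \<Rightarrow> 'g::group_add"
  assumes "represents D p \<gamma> w"
  obtains k where "k p = 0" "\<And>x. x \<in> - L \<Longrightarrow> \<exists>e>0. section_on D \<gamma> (ball x e) (\<lambda>a. w x a - k a)"
proof -
  from assms[unfolded represents_def] obtain k
    where k: "k p = 0 \<and> (\<forall>x\<in>- L. \<exists>e>0. section_on D \<gamma> (ball x e) (\<lambda>a. w x a - k a))" by (rule exE)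
  show ?thesis by (rule that[of k]) (rule conjunct1[OF k], erule bspec[OF conjunct2[OF k]])
qed

text \<open>The two potentials have the same local differences on the connected sky and agree at
  \<open>p\<close>, so they agree on the sky, and the jumps across a wall of \<open>A\<close> can be
  compared. Without the base point they could differ by a constant, and the colorings by a
  conjugation.\<close>

lemma represents_unique:
  fixes w :: "space \<Rightarrow> space \<Rightarrow> 'g::group_add"
  assumes r: "represents D p \<gamma> w" "represents D p \<gamma>' w" and p: "p \<in> sky D" and A: "A \<in> arcs D"
  shows "\<gamma> A = \<gamma>' A"
proof -
  obtain k where k: "k p = 0" "\<And>x. x \<in> - L \<Longrightarrow> \<exists>e>0. section_on D \<gamma> (ball x e) (\<lambda>a. w x a - k a)"
    by (rule representsE[OF r(1)]) (rule that; assumption)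
  obtain k' where k': "k' p = 0" "\<And>x. x \<in> - L \<Longrightarrow> \<exists>e>0. section_on D \<gamma>' (ball x e) (\<lambda>a. w x a - k' a)"
    by (rule representsE[OF r(2)]) (rule that; assumption)
  have kk: "k a = k' a" if a: "a \<in> sky D" for a
  proof -
    have "k a - k' a = k p - k' p"
    proof (rule locally_constant_on_connected[OF sky_connected a p])
      fix x assume x: "x \<in> sky D"
      then have xX: "x \<in> - L" using sky_disjoint by blast
      obtain e1 where e1: "e1 > 0" "section_on D \<gamma> (ball x e1) (\<lambda>a. w x a - k a)" using k(2)[OF xX] by blast
      obtain e2 where e2: "e2 > 0" "section_on D \<gamma>' (ball x e2) (\<lambda>a. w x a - k' a)" using k'(2)[OF xX] by blast
      have x1: "x \<in> ball x e1" and x2: "x \<in> ball x e2" using e1 e2 by auto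
      obtain e3 where e3: "e3 > 0" "\<And>a. a \<in> ball x e3 \<Longrightarrow> w x a - k a = w x x - k x"
        by (rule section_on_sky[OF e1(2) x1 x]) (rule that; assumption)
      obtain e4 where e4: "e4 > 0" "\<And>a. a \<in> ball x e4 \<Longrightarrow> w x a - k' a = w x x - k' x"
        by (rule section_on_sky[OF e2(2) x2 x]) (rule that; assumption)
      have "k y - k' y = k x - k' x" if y: "y \<in> ball x (min e3 e4)" for y
      proof -
        have 1: "w x y - k y = w x x - k x" and 2: "w x y - k' y = w x x - k' x" using e3(2)[of y] e4(2)[of y] y
          by auto
        have "k y - k' y = - (w x y - k y) + (w x y - k' y)"
          by (simp add: group_add_simps del: add_uminus_conv_diff)
        also have "\<dots> = k x - k' x" unfolding 1 2 by (simp add: group_add_simps del: add_uminus_conv_diff)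
        finally show ?thesis .
      qed
      moreover have "min e3 e4 > 0" using e3 e4 by simp
      ultimately show "\<exists>e>0. \<forall>y\<in>ball x e \<inter> sky D. k y - k' y = k x - k' x" by blast
    qed
    then show ?thesis using k(1) k'(1) by simp
  qed
  have "A \<noteq> {}" using A unfolding arcs_eq by (rule in_components_nonempty)
  then obtain z where z: "z \<in> A" by blast
  then have zL: "z \<in> L" using arc_subset[OF A] by blast
  obtain y z' \<phi> where y: "wall D y z' \<phi>" "z' \<in> ball z 1" "\<And>A. A \<in> arcs D \<Longrightarrow> z \<in> A \<Longrightarrow> z' \<in> A"
    by (rule walls_dense[OF zL zero_less_one]) (rule that; assumption)
  have z'A: "z' \<in> A" by (rule y(3)[OF A z])
  have yX: "y \<in> - L" using wall_top(3)[OF y(1)] by blast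
  obtain e1 where e1: "e1 > 0" "section_on D \<gamma> (ball y e1) (\<lambda>a. w y a - k a)" using k(2)[OF yX] by blast
  obtain e2 where e2: "e2 > 0" "section_on D \<gamma>' (ball y e2) (\<lambda>a. w y a - k' a)" using k'(2)[OF yX] by blast
  have x1: "y \<in> ball y e1" and x2: "y \<in> ball y e2" using e1 e2 by auto
  obtain e3 where e3: "e3 > 0"
    "\<And>a b. a \<in> ball y e3 \<Longrightarrow> b \<in> ball y e3 \<Longrightarrow> \<phi> (fst a - fst y) * \<phi> (fst b - fst y) < 0 \<Longrightarrow>
      w y b - k b = w y a - k a + \<gamma> A"
    by (rule section_on_wall[OF e1(2) x1 y(1) A z'A]) (rule that; assumption)
  obtain e4 where e4: "e4 > 0"
    "\<And>a b. a \<in> ball y e4 \<Longrightarrow> b \<in> ball y e4 \<Longrightarrow> \<phi> (fst a - fst y) * \<phi> (fst b - fst y) < 0 \<Longrightarrow>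
      w y b - k' b = w y a - k' a + \<gamma>' A"
    by (rule section_on_wall[OF e2(2) x2 y(1) A z'A]) (rule that; assumption)
  have "min e3 e4 > 0" using e3 e4 by simp
  then obtain a b where ab: "a \<in> ball y (min e3 e4)" "b \<in> ball y (min e3 e4)" "a \<in> sky D" "b \<in> sky D"
    "0 < \<phi> (fst a - fst y)" "\<phi> (fst b - fst y) < 0"
    by (rule wall_sides[OF y(1)]) (rule that; assumption)
  have B: "a \<in> ball y e3" "b \<in> ball y e3" "a \<in> ball y e4" "b \<in> ball y e4" using ab by auto
  have neg: "\<phi> (fst a - fst y) * \<phi> (fst b - fst y) < 0" using ab(5,6) by (simp add: mult_pos_neg)
  have "w y a - k a + \<gamma> A = w y a - k a + \<gamma>' A"
    using e3(2)[OF B(1,2) neg] e4(2)[OF B(3,4) neg] kk[OF ab(3)] kk[OF ab(4)] by metis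
  then show ?thesis by simp
qed

text \<open>By uniqueness of sections \<open>w x - k\<close> and \<open>w' x - k'\<close> differ by
  a left constant near \<open>x\<close>, so on the sky \<open>- k + k'\<close> is a gauge from
  \<open>w\<close> to \<open>w'\<close>. It vanishes at \<open>p\<close> and extends over the
  curtains by density.\<close>

lemma represents_gauge_equiv:
  fixes w :: "space \<Rightarrow> space \<Rightarrow> 'g::group_add"
  assumes r: "represents D p \<gamma> w" "represents D p \<gamma> w'" and w: "cocycle (- L) w" "cocycle (- L) w'"
    and p: "p \<in> sky D"
  shows "gauge_equiv (- L) p w w'"
proof -
  obtain k where k: "k p = 0" "\<And>x. x \<in> - L \<Longrightarrow> \<exists>e>0. section_on D \<gamma> (ball x e) (\<lambda>a. w x a - k a)"
    by (rule representsE[OF r(1)]) (rule that; assumption)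
  obtain k' where k': "k' p = 0" "\<And>x. x \<in> - L \<Longrightarrow> \<exists>e>0. section_on D \<gamma> (ball x e) (\<lambda>a. w' x a - k' a)"
    by (rule representsE[OF r(2)]) (rule that; assumption)
  have "gauge_on (- L) (sky D) (\<lambda>a. - k a + k' a) w w'"
    unfolding gauge_on_def
  proof
    fix x assume x: "x \<in> - L"
    obtain e1 where e1: "e1 > 0" "section_on D \<gamma> (ball x e1) (\<lambda>a. w x a - k a)" using k(2)[OF x] by blast
    obtain e2 where e2: "e2 > 0" "section_on D \<gamma> (ball x e2) (\<lambda>a. w' x a - k' a)" using k'(2)[OF x] by blast
    obtain e3 where e3: "e3 > 0" "cocycle_on (ball x e3) w" using w(1) x unfolding cocycle_def by blast
    obtain e4 where e4: "e4 > 0" "cocycle_on (ball x e4) w'" using w(2) x unfolding cocycle_def by blast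
    let ?e = "min e1 e2"
    have s: "section_on D \<gamma> (ball x ?e) (\<lambda>a. w x a - k a)" by (rule section_on_subset[OF e1(2)]) auto
    have s': "section_on D \<gamma> (ball x ?e) (\<lambda>a. w' x a - k' a)" by (rule section_on_subset[OF e2(2)]) auto
    have xe: "x \<in> ball x ?e" "x \<notin> L" using e1 e2 x by auto
    obtain g e5 where g: "e5 > 0" "\<And>y. y \<in> ball x e5 \<Longrightarrow> y \<in> sky D \<Longrightarrow> w' x y - k' y = g + (w x y - k y)"
      by (rule section_unique_near[OF s s' xe(1) open_ball xe(2)]) (rule that; assumption)
    define e where "e = min e5 (min e3 e4)"
    have "w' a b = - (- k a + k' a) + w a b + (- k b + k' b)"
      if ab: "a \<in> ball x e \<inter> sky D" "b \<in> ball x e \<inter> sky D" for a b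
    proof -
      have B: "a \<in> ball x e3" "b \<in> ball x e3" "a \<in> ball x e4" "b \<in> ball x e4" "a \<in> ball x e5" "b \<in> ball x e5"
        "x \<in> ball x e3" "x \<in> ball x e4"
        using ab e3(1) e4(1) by (auto simp: e_def)
      have wx: "w' x y = g + (w x y - k y) + k' y" if "y \<in> ball x e5" "y \<in> sky D" for y
        using g(2)[OF that] by (metis diff_add_cancel)
      have "w' a b = - w' x a + w' x b" using cocycle_onD[OF e4(2) B(8,3,4)] by (metis minus_add_cancel)
      also have "\<dots> = - (- k a + k' a) + (- w x a + w x b) + (- k b + k' b)"
        using wx[OF B(5)] wx[OF B(6)] ab by (simp add: group_add_simps del: add_uminus_conv_diff)
      also have "- w x a + w x b = w a b" using cocycle_onD[OF e3(2) B(7,1,2)] by (metis minus_add_cancel)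
      finally show ?thesis .
    qed
    moreover have "e > 0" using g e3 e4 by (simp add: e_def)
    ultimately show "\<exists>e>0. \<forall>a\<in>ball x e \<inter> sky D. \<forall>b\<in>ball x e \<inter> sky D. w' a b = - (- k a + k' a) + w a b + (- k b + k' b)" by blast
  qed
  then obtain K where K: "\<And>x. x \<in> sky D \<Longrightarrow> K x = - k x + k' x" "gauge_on (- L) UNIV K w w'"
    using gauge_extend[OF complement_open sky_dense w] by blast
  have "K p = 0" using K(1)[OF p] k(1) k'(1) by simp
  then show ?thesis unfolding gauge_equiv_def using K(2) by blast
qed

lemma represents_gauge:
  fixes w :: "space \<Rightarrow> space \<Rightarrow> 'g::group_add"
  assumes r: "represents D p \<gamma> w" and g: "gauge_equiv (- L) p w w'"
  shows "represents D p \<gamma> w'"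
proof -
  obtain k where k: "k p = 0" "\<And>x. x \<in> - L \<Longrightarrow> \<exists>e>0. section_on D \<gamma> (ball x e) (\<lambda>a. w x a - k a)"
    by (rule representsE[OF r(1)]) (rule that; assumption)
  obtain K where K: "K p = 0" "gauge_on (- L) UNIV K w w'" using g unfolding gauge_equiv_def by blast
  show ?thesis
    unfolding represents_def
  proof (intro exI[of _ "\<lambda>a. k a + K a"] conjI ballI)
    show "k p + K p = 0" using k(1) K(1) by simp
    fix x assume x: "x \<in> - L"
    obtain e1 where e1: "e1 > 0" "section_on D \<gamma> (ball x e1) (\<lambda>a. w x a - k a)" using k(2)[OF x] by blast
    obtain e2 where e2: "e2 > 0" "\<forall>a\<in>ball x e2. \<forall>b\<in>ball x e2. w' a b = - K a + w a b + K b"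
      using K(2) x unfolding gauge_on_def Int_UNIV_right by blast
    let ?e = "min e1 e2"
    have "section_on D \<gamma> (ball x ?e) (\<lambda>a. w x a - k a)" by (rule section_on_subset[OF e1(2)]) auto
    then have "section_on D \<gamma> (ball x ?e) (\<lambda>a. - K x + (w x a - k a))" by (rule section_on_translate)
    then have "section_on D \<gamma> (ball x ?e) (\<lambda>a. w' x a - (k a + K a))"
    proof (rule section_on_cong)
      fix a assume "a \<in> ball x ?e"
      then have "w' x a = - K x + w x a + K a" using e2 by auto
      then show "w' x a - (k a + K a) = - K x + (w x a - k a)"
        by (simp add: group_add_simps del: add_uminus_conv_diff)
    qed simp
    moreover have "?e > 0" using e1 e2 by simp
    ultimately show "\<exists>e>0. section_on D \<gamma> (ball x e) (\<lambda>a. w' x a - (k a + K a))" by blast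
  qed
qed

text \<open>For the endomorphisms \<open>affine_dih\<close> this makes affine maps of colorings act
  on cocycles.\<close>

lemma represents_hom:
  fixes w :: "space \<Rightarrow> space \<Rightarrow> 'g::group_add" and f :: "'g \<Rightarrow> 'h::group_add"
  assumes r: "represents D p \<gamma> w" and f: "\<And>a b. f (a + b) = f a + f b"
  shows "represents D p (\<lambda>A. f (\<gamma> A)) (\<lambda>a b. f (w a b))"
proof -
  have f0: "f 0 = 0" using f[of 0 0] by (metis add.right_neutral add_left_cancel)
  have "f (- a) = - f a" for a using f[of "- a" a] f0 by (simp add: eq_neg_iff_add_eq_0)
  then have fd: "f (a - b) = f a - f b" for a b using f[of a "- b"] by simp
  obtain k where k: "k p = 0" "\<And>x. x \<in> - L \<Longrightarrow> \<exists>e>0. section_on D \<gamma> (ball x e) (\<lambda>a. w x a - k a)"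
    by (rule representsE[OF r(1)]) (rule that; assumption)
  have sec: "section_on D (\<lambda>A. f (\<gamma> A)) U (\<lambda>a. f (s a))" if s: "section_on D \<gamma> U s" for U s
    unfolding section_on_def
  proof (intro conjI ballI allI impI)
    fix y assume y: "y \<in> U \<inter> sky D"
    obtain e where e: "e > 0" "\<And>a. a \<in> ball y e \<Longrightarrow> s a = s y" by (rule section_on_sky[OF s]) (use y in blast)+
    have "f (s a) = f (s y)" if "a \<in> ball y e" for a using arg_cong[OF e(2)[OF that], of f] .
    then show "\<exists>e>0. \<forall>a\<in>ball y e. f (s a) = f (s y)" using e(1) by blast
  next
    fix y z \<phi> A assume y: "y \<in> U" "wall D y z \<phi>" "A \<in> arcs D" "z \<in> A"
    obtain e where e: "e > 0" "\<And>a b. a \<in> ball y e \<Longrightarrow> b \<in> ball y e \<Longrightarrow> \<phi> (fst a - fst y) * \<phi> (fst b - fst y) < 0 \<Longrightarrow>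
      s b = s a + \<gamma> A"
      by (rule section_on_wall[OF s y]) (rule that; assumption)
    have "f (s b) = f (s a) + f (\<gamma> A)"
      if "a \<in> ball y e" "b \<in> ball y e" "\<phi> (fst a - fst y) * \<phi> (fst b - fst y) < 0" for a b
      using arg_cong[OF e(2)[OF that], of f] f by simp
    then show "\<exists>e>0. \<forall>a\<in>ball y e. \<forall>b\<in>ball y e. \<phi> (fst a - fst y) * \<phi> (fst b - fst y) < 0 \<longrightarrow>
      f (s b) = f (s a) + f (\<gamma> A)"
      using e(1) by blast
  qed
  show ?thesis
    unfolding represents_def
  proof (intro exI[of _ "\<lambda>a. f (k a)"] conjI ballI)
    show "f (k p) = 0" using k(1) f0 by simp
    fix x assume "x \<in> - L"
    then obtain e where e: "e > 0" "section_on D \<gamma> (ball x e) (\<lambda>a. w x a - k a)" using k(2) by blast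
    then show "\<exists>e>0. section_on D (\<lambda>A. f (\<gamma> A)) (ball x e) (\<lambda>a. f (w x a) - f (k a))"
      using sec[OF e(2)] unfolding fd by blast
  qed
qed

end

section \<open>Colors as reflections of the circle\<close>

text \<open>
  The pair \<open>(z, e)\<close> is the isometry \<open>x \<mapsto> z x\<close> of the circle, preceded by complex conjugation if \<open>e\<close>.
  A type cannot depend on \<open>m\<close>, hence one group for all moduli.
\<close>

typedef dih = "{x::complex \<times> bool. cmod (fst x) = 1}"
  by (rule exI[of _ "(1, False)"]) simp

definition angle :: "dih \<Rightarrow> complex" where "angle x = fst (Rep_dih x)"

definition flips :: "dih \<Rightarrow> bool" where "flips x = snd (Rep_dih x)"

definition mk_dih :: "complex \<Rightarrow> bool \<Rightarrow> dih" where "mk_dih z e = Abs_dih (z, e)"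

lemma angle_mk [simp]: "cmod z = 1 \<Longrightarrow> angle (mk_dih z e) = z"
  by (simp add: angle_def mk_dih_def Abs_dih_inverse)

lemma flips_mk [simp]: "cmod z = 1 \<Longrightarrow> flips (mk_dih z e) = e"
  by (simp add: flips_def mk_dih_def Abs_dih_inverse)

lemma cmod_angle [simp]: "cmod (angle x) = 1"
  using Rep_dih[of x] by (simp add: angle_def)

lemma dih_eq_iff: "x = y \<longleftrightarrow> angle x = angle y \<and> flips x = flips y"
  unfolding Rep_dih_inject[symmetric] prod_eq_iff angle_def flips_def ..

lemma unit_cnj: "cmod z = 1 \<Longrightarrow> z * cnj z = 1" "cmod z = 1 \<Longrightarrow> cnj z * z = 1"
  using complex_norm_square[of z] by (simp_all add: mult.commute)

instantiation dih :: group_add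
begin

definition zero_dih :: dih where "0 = mk_dih 1 False"

definition plus_dih :: "dih \<Rightarrow> dih \<Rightarrow> dih" where
  "x + y = mk_dih (angle x * (if flips x then cnj (angle y) else angle y)) (flips x \<noteq> flips y)"

definition uminus_dih :: "dih \<Rightarrow> dih" where
  "- x = mk_dih (if flips x then angle x else cnj (angle x)) (flips x)"

definition minus_dih :: "dih \<Rightarrow> dih \<Rightarrow> dih" where "x - y = x + - (y::dih)"

lemma angle_zero [simp]: "angle 0 = 1" and flips_zero [simp]: "\<not> flips 0"
  by (simp_all add: zero_dih_def)

lemma angle_plus [simp]: "angle (x + y) = angle x * (if flips x then cnj (angle y) else angle y)"
  by (simp add: plus_dih_def norm_mult)

lemma flips_plus [simp]: "flips (x + y) \<longleftrightarrow> flips x \<noteq> flips y"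
  by (simp add: plus_dih_def norm_mult)

lemma angle_uminus [simp]: "angle (- x) = (if flips x then angle x else cnj (angle x))"
  by (simp add: uminus_dih_def)

lemma flips_uminus [simp]: "flips (- x) = flips x"
  by (simp add: uminus_dih_def)

instance
proof
  fix x y z :: dih
  show "x + y + z = x + (y + z)" by (auto simp: dih_eq_iff)
  show "0 + x = x" "x + 0 = x" by (auto simp: dih_eq_iff)
  show "- x + x = 0" by (auto simp: dih_eq_iff unit_cnj)
  show "x + - y = x - y" by (simp add: minus_dih_def)
qed

end

lemma sign_hom_flips: "sign_hom flips"
  by (auto simp: sign_hom_def dih_eq_iff unit_cnj)

text \<open>For \<open>m > 1\<close> this is the dihedral group of order \<open>2 * m\<close>, as a
  subgroup of all isometries of the circle.\<close>

definition root_dih :: "int \<Rightarrow> dih set" where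
  "root_dih m = {x. angle x ^ nat m = 1}"

lemma subgroup_root_dih: "subgroup_add (root_dih m)"
proof -
  have "x - y \<in> root_dih m" if "x \<in> root_dih m" "y \<in> root_dih m" for x y
  proof -
    have "angle x ^ nat m = 1" "angle y ^ nat m = 1" using that by (simp_all add: root_dih_def)
    moreover from this have "cnj (angle y) ^ nat m = 1" by (metis complex_cnj_one complex_cnj_power)
    ultimately show ?thesis by (simp add: root_dih_def minus_dih_def power_mult_distrib del: add_uminus_conv_diff)
  qed
  then show ?thesis by (simp add: subgroup_add_def root_dih_def)
qed

definition reflection :: "int \<Rightarrow> int \<Rightarrow> dih" where
  "reflection m c = mk_dih (cis (2 * pi * c / m)) True"

lemma angle_reflection [simp]: "angle (reflection m c) = cis (2 * pi * c / m)"
  and flips_reflection [simp]: "flips (reflection m c)"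
  by (simp_all add: reflection_def)

lemma cis_root_eq_1:
  fixes m k :: int assumes "m > 1" shows "cis (2 * pi * k / m) = 1 \<longleftrightarrow> m dvd k"
proof
  assume "cis (2 * pi * k / m) = 1"
  then have "cos (2 * pi * k / m) = 1" by (simp add: complex_eq_iff)
  then obtain n :: int where "2 * pi * k / m = real_of_int n * 2 * pi" unfolding cos_one_2pi_int by blast
  then have "real_of_int k = real_of_int (m * n)" using assms by (simp add: field_simps)
  then show "m dvd k" by (metis dvd_triv_left of_int_eq_iff)
next
  assume "m dvd k"
  then obtain n where "k = m * n" by (rule dvdE)
  then have "2 * pi * k / m = 2 * pi * n" using assms by simp
  then show "cis (2 * pi * k / m) = 1" by (simp add: complex_eq_iff)
qed

lemma reflection_in_root: "m > 1 \<Longrightarrow> reflection m c \<in> root_dih m"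
  by (simp add: root_dih_def Complex.DeMoivre)

text \<open>Two reflections with colors \<open>b\<close>, \<open>a\<close> compose to the rotation
  by \<open>b - a\<close> steps; two such pairs give the rotation by \<open>2 * b - a - c\<close>
  steps.\<close>

lemma reflection_fox:
  assumes m: "m > 1"
  shows "reflection m b + reflection m a + reflection m b + reflection m c = 0 \<longleftrightarrow> [2 * b = a + c] (mod m)"
proof -
  have "angle (reflection m b + reflection m a + reflection m b + reflection m c) = cis (2 * pi * (2 * b - a - c) / m)"
    by (simp add: cis_cnj cis_mult diff_divide_distrib add_divide_distrib algebra_simps)
  moreover have "m dvd (2 * b - a - c) \<longleftrightarrow> [2 * b = a + c] (mod m)" by (simp add: cong_iff_dvd_diff algebra_simps)
  ultimately show ?thesis using cis_root_eq_1[OF m, of "2 * b - a - c"] by (simp add: dih_eq_iff)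
qed

lemma reflection_inj:
  assumes m: "m > 1" and c: "c \<in> Z_mod m" "c' \<in> Z_mod m" and e: "reflection m c = reflection m c'"
  shows "c = c'"
proof -
  have "cis (2 * pi * (c - c') / m) = cis (2 * pi * c / m) * cnj (cis (2 * pi * c' / m))"
    by (simp add: cis_cnj cis_mult diff_divide_distrib algebra_simps)
  also have "\<dots> = 1" using e by (simp add: dih_eq_iff unit_cnj del: cis_cnj)
  finally have "m dvd c - c'" using cis_root_eq_1[OF m] by blast
  then show ?thesis using c by (metis atLeastLessThan_iff mod_eq_dvd_iff mod_pos_pos_trivial)
qed

lemma reflection_surj:
  assumes m: "m > 1" and x: "x \<in> root_dih m" "flips x"
  obtains c where "c \<in> Z_mod m" "x = reflection m c"
proof -
  have n: "nat m > 0" using m by simp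
  have "angle x \<in> (\<lambda>k. cis (2 * pi * real k / real (nat m))) ` {..<nat m}"
    using bij_betw_imp_surj_on[OF Complex.bij_betw_roots_unity[OF n]] x(1) by (simp add: root_dih_def)
  then obtain k where k: "k < nat m" "angle x = cis (2 * pi * real k / real (nat m))" by blast
  show ?thesis
  proof (rule that[of "int k"])
    show "int k \<in> Z_mod m" using k(1) by auto
    show "x = reflection m (int k)" using k(2) x(2) m by (simp add: dih_eq_iff)
  qed
qed

text \<open>A group endomorphism inducing an affine map on reflections. The slope is an exponent and
  may be any natural number, in particular 0, which gives the constant maps; the factor
  \<open>u\<close> is given to reflections only and cancels in a product of two of them.\<close>

definition affine_dih :: "nat \<Rightarrow> complex \<Rightarrow> dih \<Rightarrow> dih" where
  "affine_dih l u x = mk_dih (angle x ^ l * (if flips x then u else 1)) (flips x)"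

lemma angle_affine [simp]: "cmod u = 1 \<Longrightarrow> angle (affine_dih l u x) = angle x ^ l * (if flips x then u else 1)"
  and flips_affine [simp]: "cmod u = 1 \<Longrightarrow> flips (affine_dih l u x) = flips x"
  by (simp_all add: affine_dih_def norm_mult norm_power)

lemma affine_dih_add:
  assumes "cmod u = 1" shows "affine_dih l u (x + y) = affine_dih l u x + affine_dih l u y"
proof -
  have "angle x ^ l * u * (cnj (angle y ^ l) * cnj u) = angle x ^ l * cnj (angle y ^ l) * (u * cnj u)"
    by (simp only: mult_ac)
  then have "angle x ^ l * u * (cnj (angle y ^ l) * cnj u) = angle x ^ l * cnj (angle y ^ l)"
    using unit_cnj(1)[OF assms] by simp
  then show ?thesis using assms
    by (cases "flips x"; cases "flips y") (simp_all add: dih_eq_iff power_mult_distrib)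
qed

lemma affine_dih_root:
  assumes "cmod u = 1" "u ^ nat m = 1" "x \<in> root_dih m" shows "affine_dih l u x \<in> root_dih m"
proof -
  have "(angle x ^ l) ^ nat m = 1" using assms(3)
    by (simp add: root_dih_def power_mult[symmetric] mult.commute[of l]) (simp add: power_mult)
  then show ?thesis using assms by (simp add: root_dih_def power_mult_distrib)
qed

definition affine_mod :: "int \<Rightarrow> nat \<Rightarrow> int \<Rightarrow> int \<Rightarrow> int" where
  "affine_mod m l \<mu> c = (int l * c + \<mu>) mod m"

lemma affine_dih_reflection:
  assumes m: "m > 1"
  shows "affine_dih l (cis (2 * pi * \<mu> / m)) (reflection m c) = reflection m (affine_mod m l \<mu> c)"
proof -
  define q where "q = (int l * c + \<mu>) div m"
  have am: "affine_mod m l \<mu> c = int l * c + \<mu> - m * q" unfolding affine_mod_def q_def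
    by (simp add: minus_mult_div_eq_mod)
  have "2 * pi * real_of_int (affine_mod m l \<mu> c) / m = (real l * (2 * pi * c / m) + 2 * pi * \<mu> / m) + 2 * pi * (of_int (- q))"
    using m unfolding am by (simp add: field_simps)
  then have "cis (2 * pi * real_of_int (affine_mod m l \<mu> c) / m)
      = cis (real l * (2 * pi * c / m) + 2 * pi * \<mu> / m) * cis (2 * pi * of_int (- q))"
    by (simp only: cis_mult)
  also have "cis (2 * pi * of_int (- q)) = 1" by (simp add: complex_eq_iff del: of_int_minus)
  finally show ?thesis by (simp add: dih_eq_iff Complex.DeMoivre cis_mult)
qed

text \<open>The operation takes \<open>j\<close> and \<open>j + 1\<close> to \<open>j + 2\<close>,
  so by induction \<open>f\<close> is determined by \<open>f 0\<close> and \<open>f 1\<close>. The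
  slope is the representative of \<open>f 1 - f 0\<close> in \<open>Z_mod m\<close>, to be usable as
  an exponent.\<close>

lemma aut_affine:
  assumes m: "m > 1" and f: "f \<in> carrier (Aut_group m)"
  obtains l \<mu> where "\<And>c. c \<in> Z_mod m \<Longrightarrow> f c = affine_mod m l \<mu> c"
proof -
  have fZ: "f c \<in> Z_mod m" if "c \<in> Z_mod m" for c
    using f that by (auto simp: Aut_group_def Bij_def dest: bij_betwE)
  have hom: "f (quandle_op m a b) = quandle_op m (f a) (f b)" if "a \<in> Z_mod m" "b \<in> Z_mod m" for a b
    using f that by (simp add: Aut_group_def)
  define l where "l = nat ((f 1 - f 0) mod m)"
  have l: "int l = (f 1 - f 0) mod m" unfolding l_def using m by simp
  have red: "(2 * (a mod m) - b mod m) mod m = (2 * a - b) mod m" for a b :: int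
  proof -
    have "2 * (a mod m) - b mod m - (2 * a - b) = m * (b div m - 2 * (a div m))"
      by (simp add: minus_mult_div_eq_mod[symmetric] right_diff_distrib)
    then show ?thesis unfolding mod_eq_dvd_iff by simp
  qed
  have P: "f (int k) = affine_mod m l (f 0) (int k)" if "int k < m" for k
    using that
  proof (induction k rule: less_induct)
    case (less k)
    consider "k = 0" | "k = 1" | j where "k = Suc (Suc j)" by atomize_elim presburger
    then show ?case
    proof cases
      case 1
      then show ?thesis using fZ[of 0] m by (simp add: affine_mod_def)
    next
      case 2
      have "affine_mod m l (f 0) 1 = ((f 1 - f 0) mod m + f 0) mod m" unfolding affine_mod_def l by simp
      also have "\<dots> = (f 1 - f 0 + f 0) mod m" by (rule mod_add_left_eq)
      also have "\<dots> = f 1" using fZ[of 1] m by simp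
      finally show ?thesis using 2 by simp
    next
      case 3
      have j: "int j \<in> Z_mod m" "int (Suc j) \<in> Z_mod m" using less.prems 3 by auto
      have "quandle_op m (int j) (int (Suc j)) = int k" using less.prems 3 by (simp add: quandle_op_def)
      then have "f (int k) = (2 * f (int (Suc j)) - f (int j)) mod m" using hom[OF j]
        by (simp add: quandle_op_def)
      also have "\<dots> = (2 * ((int l * int (Suc j) + f 0) mod m) - (int l * int j + f 0) mod m) mod m"
        using less.IH[of j] less.IH[of "Suc j"] less.prems 3 by (simp add: affine_mod_def)
      also have "\<dots> = (2 * (int l * int (Suc j) + f 0) - (int l * int j + f 0)) mod m"
        by (rule red)
      also have "2 * (int l * int (Suc j) + f 0) - (int l * int j + f 0) = int l * int k + f 0"
        using 3 by (simp add: algebra_simps)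
      finally show ?thesis by (simp add: affine_mod_def)
    qed
  qed
  show ?thesis
  proof (rule that[of l "f 0"])
    fix c assume "c \<in> Z_mod m"
    then show "f c = affine_mod m l (f 0) c" using P[of "nat c"] by simp
  qed
qed

section \<open>Transport along homeomorphisms\<close>

text \<open>The argument is the inverse map: transport along \<open>h\<close> is composition with
  \<open>h'\<close>.\<close>

definition push :: "(space \<Rightarrow> space) \<Rightarrow> (space \<Rightarrow> space \<Rightarrow> 'g) \<Rightarrow> space \<Rightarrow> space \<Rightarrow> 'g" where
  "push h' w a b = w (h' a) (h' b)"

lemma pull_ball:
  fixes h' :: "space \<Rightarrow> space"
  assumes "continuous_on UNIV h'" "e > 0"
  obtains e' where "e' > 0" "\<And>a. a \<in> ball x e' \<Longrightarrow> h' a \<in> ball (h' x) e"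
proof -
  have "open (h' -` ball (h' x) e)" using assms(1) by (rule open_vimage[OF open_ball])
  moreover have "x \<in> h' -` ball (h' x) e" using assms(2) by simp
  ultimately obtain e' where "e' > 0" "ball x e' \<subseteq> h' -` ball (h' x) e" by (meson open_contains_ball)
  then show ?thesis using that by blast
qed

locale space_homeo =
  fixes h h' :: "space \<Rightarrow> space" and L L' :: "space set"
  assumes homeo: "homeomorphism UNIV UNIV h h'" and image: "h ` L = L'"
begin

lemma inverse [simp]: "h' (h x) = x" "h (h' x) = x"
  using homeomorphism_apply1[OF homeo UNIV_I] homeomorphism_apply2[OF homeo UNIV_I] by blast+

lemma continuous: "continuous_on UNIV h" "continuous_on UNIV h'"
  using homeomorphism_cont1[OF homeo] homeomorphism_cont2[OF homeo] .

lemma mem: "h' y \<in> L \<longleftrightarrow> y \<in> L'" "h y \<in> L' \<longleftrightarrow> y \<in> L"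
proof -
  have "inj h" by (rule inj_on_inverseI[of _ h']) simp
  then show 2: "h y \<in> L' \<longleftrightarrow> y \<in> L" for y unfolding image[symmetric] by (rule inj_image_mem_iff)
  show "h' y \<in> L \<longleftrightarrow> y \<in> L'" using 2[of "h' y"] by simp
qed

lemma cocycle_push:
  assumes w: "cocycle (- L) w" shows "cocycle (- L') (push h' w)"
  unfolding cocycle_def
proof
  fix x assume "x \<in> - L'"
  then have "h' x \<in> - L" using mem(1) by simp
  then obtain e where e: "e > 0" "cocycle_on (ball (h' x) e) w" using w unfolding cocycle_def by blast
  obtain e' where e': "e' > 0" "\<And>a. a \<in> ball x e' \<Longrightarrow> h' a \<in> ball (h' x) e"
    by (rule pull_ball[OF continuous(2) e(1)]) (rule that; assumption)
  have "cocycle_on (ball x e') (push h' w)"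
    unfolding cocycle_on_def push_def
  proof (intro ballI)
    fix a b c assume "a \<in> ball x e'" "b \<in> ball x e'" "c \<in> ball x e'"
    then show "w (h' a) (h' b) + w (h' b) (h' c) = w (h' a) (h' c)" by (intro cocycle_onD[OF e(2)] e'(2))
  qed
  then show "\<exists>e>0. cocycle_on (ball x e) (push h' w)" using e'(1) by blast
qed

lemma valued_push:
  assumes w: "valued_in (- L) H w" shows "valued_in (- L') H (push h' w)"
  unfolding valued_in_def
proof
  fix x assume "x \<in> - L'"
  then have "h' x \<in> - L" using mem(1) by simp
  then obtain e where e: "e > 0" "\<forall>a\<in>ball (h' x) e. \<forall>b\<in>ball (h' x) e. w a b \<in> H" using w unfolding valued_in_def
    by blast
  obtain e' where e': "e' > 0" "\<And>a. a \<in> ball x e' \<Longrightarrow> h' a \<in> ball (h' x) e"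
    by (rule pull_ball[OF continuous(2) e(1)]) (rule that; assumption)
  have "\<forall>a\<in>ball x e'. \<forall>b\<in>ball x e'. push h' w a b \<in> H" unfolding push_def using e(2) e'(2) by blast
  then show "\<exists>e>0. \<forall>a\<in>ball x e. \<forall>b\<in>ball x e. push h' w a b \<in> H" using e'(1) by blast
qed

text \<open>\<open>meridional\<close> speaks of arbitrary open neighbourhoods and arbitrary
  potentials, so a potential on \<open>V - L'\<close> simply pulls back along \<open>h\<close> to
  the preimage of \<open>V\<close>.\<close>

lemma meridional_push:
  assumes w: "meridional L sg w" shows "meridional L' sg (push h' w)"
  unfolding meridional_def
proof (intro ballI allI impI notI)
  fix z V assume z: "z \<in> L'" and V: "open V" "z \<in> V"
    and "\<exists>k :: space \<Rightarrow> bool. \<forall>y\<in>V - L'. \<exists>e>0. \<forall>a\<in>ball y e. \<forall>b\<in>ball y e. sg (push h' w a b) = (k a \<noteq> k b)"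
  then obtain k :: "space \<Rightarrow> bool"
    where k: "\<forall>y\<in>V - L'. \<exists>e>0. \<forall>a\<in>ball y e. \<forall>b\<in>ball y e. sg (push h' w a b) = (k a \<noteq> k b)" by (elim exE)
  have "\<exists>e>0. \<forall>a\<in>ball y e. \<forall>b\<in>ball y e. sg (w a b) = (k (h a) \<noteq> k (h b))" if y: "y \<in> h -` V - L" for y
  proof -
    have "h y \<in> V - L'" using y mem(2) by simp
    with k have "\<exists>e>0. \<forall>a\<in>ball (h y) e. \<forall>b\<in>ball (h y) e. sg (push h' w a b) = (k a \<noteq> k b)" by (rule bspec)
    then obtain e where e: "e > 0" "\<forall>a\<in>ball (h y) e. \<forall>b\<in>ball (h y) e. sg (push h' w a b) = (k a \<noteq> k b)"
      by (elim exE conjE)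
    obtain e' where e': "e' > 0" "\<And>a. a \<in> ball y e' \<Longrightarrow> h a \<in> ball (h y) e"
      by (rule pull_ball[OF continuous(1) e(1)]) (rule that; assumption)
    have "sg (w a b) = (k (h a) \<noteq> k (h b))" if "a \<in> ball y e'" "b \<in> ball y e'" for a b
      using e(2)[THEN bspec, OF e'(2)[OF that(1)], THEN bspec, OF e'(2)[OF that(2)]] by (simp add: push_def)
    then show ?thesis using e'(1) by (intro exI[of _ e'] conjI ballI)
  qed
  then have "\<forall>y\<in>h -` V - L. \<exists>e>0. \<forall>a\<in>ball y e. \<forall>b\<in>ball y e. sg (w a b) = ((k \<circ> h) a \<noteq> (k \<circ> h) b)"
    unfolding o_def by (rule ballI)
  then have ex: "\<exists>k :: space \<Rightarrow> bool. \<forall>y\<in>h -` V - L. \<exists>e>0. \<forall>a\<in>ball y e. \<forall>b\<in>ball y e. sg (w a b) = (k a \<noteq> k b)"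
    by (rule exI[where P = "\<lambda>k. \<forall>y\<in>h -` V - L. \<exists>e>0. \<forall>a\<in>ball y e. \<forall>b\<in>ball y e. sg (w a b) = (k a \<noteq> k b)"
      and x = "k \<circ> h"])
  have "open (h -` V)" using V(1) continuous(1) by (rule open_vimage)
  moreover have "h' z \<in> h -` V" using V(2) by simp
  moreover have "h' z \<in> L" using z mem(1) by simp
  ultimately show False using w ex unfolding meridional_def by blast
qed

lemma gauge_push:
  fixes w w2 :: "space \<Rightarrow> space \<Rightarrow> 'g::group_add"
  assumes p: "h p = p'" and g: "gauge_equiv (- L) p w w2" shows "gauge_equiv (- L') p' (push h' w) (push h' w2)"
proof -
  obtain k where k: "k p = 0" "gauge_on (- L) UNIV k w w2" using g unfolding gauge_equiv_def by blast
  have "gauge_on (- L') UNIV (\<lambda>a. k (h' a)) (push h' w) (push h' w2)"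
    unfolding gauge_on_def Int_UNIV_right
  proof
    fix x assume "x \<in> - L'"
    then have "h' x \<in> - L" using mem(1) by simp
    then obtain e where e: "e > 0" "\<forall>a\<in>ball (h' x) e. \<forall>b\<in>ball (h' x) e. w2 a b = - k a + w a b + k b"
      using k(2) unfolding gauge_on_def Int_UNIV_right by blast
    obtain e' where e': "e' > 0" "\<And>a. a \<in> ball x e' \<Longrightarrow> h' a \<in> ball (h' x) e"
      by (rule pull_ball[OF continuous(2) e(1)]) (rule that; assumption)
    have "push h' w2 a b = - k (h' a) + push h' w a b + k (h' b)" if "a \<in> ball x e'" "b \<in> ball x e'" for a b
      unfolding push_def by (rule e(2)[THEN bspec, OF e'(2)[OF that(1)], THEN bspec, OF e'(2)[OF that(2)]])
    then show "\<exists>e>0. \<forall>a\<in>ball x e. \<forall>b\<in>ball x e. push h' w2 a b = - k (h' a) + push h' w a b + k (h' b)"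
      using e'(1) by (intro exI[of _ e'] conjI ballI)
  qed
  moreover have "k (h' p') = 0" using k(1) p by auto
  ultimately show ?thesis unfolding gauge_equiv_def by (intro exI[of _ "\<lambda>a. k (h' a)"] conjI)
qed

lemma push_push: "push h (push h' w) = w"
  by (intro ext) (simp add: push_def)

lemma space_homeo_sym: "space_homeo h' h L' L"
proof
  show "homeomorphism UNIV UNIV h' h" using homeo by (rule homeomorphism_symD)
  show "h' ` L' = L" unfolding image[symmetric] by (force simp: image_iff)
qed

end

section \<open>Cocycles that realize a coloring\<close>

definition link_cocycle :: "int \<Rightarrow> space set \<Rightarrow> (space \<Rightarrow> space \<Rightarrow> dih) \<Rightarrow> bool" where
  "link_cocycle m L w \<longleftrightarrow> cocycle (- L) w \<and> valued_in (- L) (root_dih m) w \<and> meridional L flips w"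

definition realizes :: "int \<Rightarrow> diagram \<Rightarrow> space \<Rightarrow> (space set \<Rightarrow> int) \<Rightarrow> (space \<Rightarrow> space \<Rightarrow> dih) \<Rightarrow> bool" where
  "realizes m D p C w \<longleftrightarrow> C \<in> colorings m D \<and> link_cocycle m (support D) w \<and>
     represents D p (\<lambda>A. reflection m (C A)) w"

lemma (in space_homeo) link_cocycle_push: "link_cocycle m L w \<Longrightarrow> link_cocycle m L' (push h' w)"
  unfolding link_cocycle_def using cocycle_push valued_push meridional_push by blast

lemma link_cocycle_affine:
  assumes m: "m > 1" and w: "link_cocycle m L w"
  shows "link_cocycle m L (\<lambda>a b. affine_dih l (cis (2 * pi * real_of_int \<mu> / m)) (w a b))"
proof -
  let ?u = "cis (2 * pi * real_of_int \<mu> / m)"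
  have u: "cmod ?u = 1" "?u ^ nat m = 1" using reflection_in_root[OF m, of \<mu>] by (simp_all add: root_dih_def)
  have c: "cocycle (- L) w" and v: "valued_in (- L) (root_dih m) w" and me: "meridional L flips w"
    using w unfolding link_cocycle_def by blast+
  have "valued_in (- L) (root_dih m) (\<lambda>a b. affine_dih l ?u (w a b))"
    using v affine_dih_root[OF u] unfolding valued_in_def by blast
  moreover have "meridional L flips (\<lambda>a b. affine_dih l ?u (w a b))"
    using me unfolding meridional_def flips_affine[OF u(1)] .
  ultimately show ?thesis
    unfolding link_cocycle_def
      by (intro conjI cocycle_hom[where f = "affine_dih l ?u", OF c affine_dih_add[OF u(1)]])
qed

lemma under_arcs_subset:
  assumes "under_arcs D u = {a, c}" shows "a \<in> arcs D" "c \<in> arcs D"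
proof -
  have "a \<in> under_arcs D u" "c \<in> under_arcs D u" unfolding assms by simp_all
  then show "a \<in> arcs D" "c \<in> arcs D" unfolding under_arcs_def by simp_all
qed

context regular_diagram
begin

lemma coloring_range: "C \<in> colorings m D \<Longrightarrow> A \<in> arcs D \<Longrightarrow> C A \<in> Z_mod m"
  unfolding colorings_def by (rule PiE_mem[of C]) simp_all

lemma coloring_fox:
  assumes C: "C \<in> colorings m D" and cr: "crossing D v u" and b: "b \<in> arcs D" "v \<in> b"
    and u: "under_arcs D u = {a, c}"
  shows "[2 * C b = C a + C c] (mod m)"
proof -
  have "\<forall>v u. crossing D v u \<longrightarrow> (\<forall>a b c. b \<in> arcs D \<and> v \<in> b \<and> under_arcs D u = {a, c} \<longrightarrow>
    [2 * C b = C a + C c] (mod m))"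
    by (rule conjunct2[OF C[unfolded colorings_def mem_Collect_eq]])
  then show ?thesis using cr b u by blast
qed

lemma realizes_exists:
  assumes m: "m > 1" and C: "C \<in> colorings m D"
  obtains w where "realizes m D p C w"
proof -
  have "group_coloring D (\<lambda>A. reflection m (C A))"
    unfolding group_coloring_def
  proof (intro conjI ballI allI impI)
    show "reflection m (C A) + reflection m (C A) = 0" for A
      using sign_homD(5)[OF sign_hom_flips] by simp
    fix v u a b c assume "crossing D v u" "b \<in> arcs D" "v \<in> b" "under_arcs D u = {a, c}"
    then have "[2 * C b = C a + C c] (mod m)" by (rule coloring_fox[OF C])
    then show "reflection m (C b) + reflection m (C a) + reflection m (C b) + reflection m (C c) = 0"
      using reflection_fox[OF m] by blast
  qed
  then obtain w where "cocycle (- L) w" "valued_in (- L) (root_dih m) w" "meridional L flips w"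
    "represents D p (\<lambda>A. reflection m (C A)) w"
    by (rule coloring_cocycle[OF _ subgroup_root_dih reflection_in_root[OF m] sign_hom_flips flips_reflection]) (rule that; assumption)
  then show ?thesis using that C unfolding realizes_def link_cocycle_def by blast
qed

lemma represents_cong:
  fixes w :: "space \<Rightarrow> space \<Rightarrow> 'g::group_add"
  assumes r: "represents D p \<gamma> w" and eq: "\<And>A. A \<in> arcs D \<Longrightarrow> \<gamma> A = \<gamma>' A"
  shows "represents D p \<gamma>' w"
proof -
  obtain k where k: "k p = 0" "\<And>x. x \<in> - L \<Longrightarrow> \<exists>e>0. section_on D \<gamma> (ball x e) (\<lambda>a. w x a - k a)"
    by (rule representsE[OF r]) (rule that; assumption)
  have sec: "section_on D \<gamma>' U s" if s: "section_on D \<gamma> U s" for U s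
    unfolding section_on_def
  proof (intro conjI ballI allI impI)
    show "\<exists>e>0. \<forall>a\<in>ball y e. s a = s y" if "y \<in> U \<inter> sky D" for y
      by (rule bspec[OF conjunct1[OF s[unfolded section_on_def]] that])
    fix y z \<phi> A assume y: "y \<in> U" "wall D y z \<phi>" "A \<in> arcs D" "z \<in> A"
    obtain e where e: "e > 0" "\<And>a b. a \<in> ball y e \<Longrightarrow> b \<in> ball y e \<Longrightarrow> \<phi> (fst a - fst y) * \<phi> (fst b - fst y) < 0 \<Longrightarrow>
      s b = s a + \<gamma> A"
      by (rule section_on_wall[OF s y]) (rule that; assumption)
    show "\<exists>e>0. \<forall>a\<in>ball y e. \<forall>b\<in>ball y e. \<phi> (fst a - fst y) * \<phi> (fst b - fst y) < 0 \<longrightarrow> s b = s a + \<gamma>' A"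
      by (intro exI[of _ e] conjI ballI impI e(1)) (simp add: e(2) flip: eq[OF y(3)])
  qed
  show ?thesis
    unfolding represents_def
  proof (intro exI[of _ k] conjI ballI k(1))
    fix x assume "x \<in> - L"
    from k(2)[OF this] show "\<exists>e>0. section_on D \<gamma>' (ball x e) (\<lambda>a. w x a - k a)" by (blast intro: sec)
  qed
qed

lemma realizes_coloring:
  assumes m: "m > 1" and w: "link_cocycle m L w" and p: "p \<in> sky D"
  obtains C where "realizes m D p C w"
proof -
  obtain \<gamma> where \<gamma>: "group_coloring D \<gamma>" "\<And>A. A \<in> arcs D \<Longrightarrow> \<gamma> A \<in> root_dih m \<and> flips (\<gamma> A)" "represents D p \<gamma> w"
    by (rule cocycle_coloring[OF _ _ _ subgroup_root_dih sign_hom_flips p, of w])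
      (use w in \<open>unfold link_cocycle_def, blast\<close>)+
  have "\<exists>c. c \<in> Z_mod m \<and> \<gamma> A = reflection m c" if A: "A \<in> arcs D" for A
    by (rule reflection_surj[OF m conjunct1[OF \<gamma>(2)[OF A]] conjunct2[OF \<gamma>(2)[OF A]]]) blast
  then obtain c where c: "\<And>A. A \<in> arcs D \<Longrightarrow> c A \<in> Z_mod m" "\<And>A. A \<in> arcs D \<Longrightarrow> \<gamma> A = reflection m (c A)"
    by metis
  define C where "C = restrict c (arcs D)"
  have Cg: "\<gamma> A = reflection m (C A)" if "A \<in> arcs D" for A using c(2)[OF that] that by (simp add: C_def)
  have "C \<in> colorings m D"
    unfolding colorings_def
  proof (intro CollectI conjI allI impI)
    show "C \<in> arcs D \<rightarrow>\<^sub>E Z_mod m" using c(1) by (auto simp: C_def)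
    fix v u a b d assume cr: "crossing D v u" and h: "b \<in> arcs D \<and> v \<in> b \<and> under_arcs D u = {a, d}"
    have b: "b \<in> arcs D" "v \<in> b" and u: "under_arcs D u = {a, d}" using h by blast+
    have "\<gamma> b + \<gamma> a + \<gamma> b + \<gamma> d = 0" using \<gamma>(1) cr b u unfolding group_coloring_def by blast
    moreover have "a \<in> arcs D" "d \<in> arcs D" by (rule under_arcs_subset[OF u])+
    ultimately show "[2 * C b = C a + C d] (mod m)" using Cg b(1) reflection_fox[OF m] by simp
  qed
  moreover have "represents D p (\<lambda>A. reflection m (C A)) w" by (rule represents_cong[OF \<gamma>(3) Cg])
  ultimately show ?thesis using that w unfolding realizes_def by blast
qed

lemma realizes_unique:
  assumes m: "m > 1" and p: "p \<in> sky D" and r: "realizes m D p C w" "realizes m D p C' w"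
  shows "C = C'"
proof (rule PiE_ext)
  show C: "C \<in> arcs D \<rightarrow>\<^sub>E Z_mod m" "C' \<in> arcs D \<rightarrow>\<^sub>E Z_mod m" using r by (auto simp: realizes_def colorings_def)
  fix A assume A: "A \<in> arcs D"
  have "reflection m (C A) = reflection m (C' A)"
    by (rule represents_unique[OF _ _ p A, of _ w]) (use r in \<open>unfold realizes_def, blast\<close>)+
  then show "C A = C' A" by (rule reflection_inj[OF m PiE_mem[OF C(1) A] PiE_mem[OF C(2) A]])
qed

lemma realizes_gauge:
  assumes "realizes m D p C w" "link_cocycle m L w'" "gauge_equiv (- L) p w w'"
  shows "realizes m D p C w'"
  unfolding realizes_def
proof (intro conjI assms(2))
  have r: "C \<in> colorings m D" "represents D p (\<lambda>A. reflection m (C A)) w" using assms(1) unfolding realizes_def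
    by blast+
  show "C \<in> colorings m D" by (rule r)
  show "represents D p (\<lambda>A. reflection m (C A)) w'" by (rule represents_gauge[OF r(2) assms(3)])
qed

lemma realizes_gauge_equiv:
  assumes "realizes m D p C w" "realizes m D p C w'" "p \<in> sky D"
  shows "gauge_equiv (- L) p w w'"
  by (rule represents_gauge_equiv[of p "\<lambda>A. reflection m (C A)"])
    (use assms in \<open>unfold realizes_def link_cocycle_def, blast\<close>)+

lemma realizes_affine:
  assumes m: "m > 1" and r: "realizes m D p C w"
  shows "realizes m D p (\<lambda>A\<in>arcs D. affine_mod m l \<mu> (C A)) (\<lambda>a b. affine_dih l (cis (2 * pi * real_of_int \<mu> / m)) (w a b))"
proof -
  let ?f = "affine_dih l (cis (2 * pi * real_of_int \<mu> / m))"
  have C: "C \<in> colorings m D" and w: "link_cocycle m L w" and rep: "represents D p (\<lambda>A. reflection m (C A)) w"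
    using r unfolding realizes_def by blast+
  have add: "?f (a + b) = ?f a + ?f b" for a b by (rule affine_dih_add) simp
  have "represents D p (\<lambda>A. ?f (reflection m (C A))) (\<lambda>a b. ?f (w a b))" by (rule represents_hom[OF rep add])
  then have "represents D p (\<lambda>A. reflection m ((\<lambda>A\<in>arcs D. affine_mod m l \<mu> (C A)) A)) (\<lambda>a b. ?f (w a b))"
    by (rule represents_cong) (simp add: affine_dih_reflection[OF m])
  moreover have "(\<lambda>A\<in>arcs D. affine_mod m l \<mu> (C A)) \<in> colorings m D"
    unfolding colorings_def
  proof (intro CollectI conjI allI impI)
    show "(\<lambda>A\<in>arcs D. affine_mod m l \<mu> (C A)) \<in> arcs D \<rightarrow>\<^sub>E Z_mod m" using m by (auto simp: affine_mod_def)
    fix v u a b c assume cr: "crossing D v u" and h: "b \<in> arcs D \<and> v \<in> b \<and> under_arcs D u = {a, c}"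
    have b: "b \<in> arcs D" "v \<in> b" and u: "under_arcs D u = {a, c}" using h by blast+
    have arcs: "a \<in> arcs D" "c \<in> arcs D" by (rule under_arcs_subset[OF u])+
    have "[int l * (2 * C b) + 2 * \<mu> = int l * (C a + C c) + 2 * \<mu>] (mod m)"
      by (rule cong_add[OF cong_mult[OF cong_refl coloring_fox[OF C cr b u]] cong_refl])
    then have "[2 * (int l * C b + \<mu>) = (int l * C a + \<mu>) + (int l * C c + \<mu>)] (mod m)"
      by (simp add: algebra_simps)
    moreover have red: "[affine_mod m l \<mu> x = int l * x + \<mu>] (mod m)" for x
      by (simp add: affine_mod_def cong_def)
    moreover have "[2 * affine_mod m l \<mu> (C b) = 2 * (int l * C b + \<mu>)] (mod m)"
      by (intro cong_mult cong_refl red)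
    moreover have "[(int l * C a + \<mu>) + (int l * C c + \<mu>) = affine_mod m l \<mu> (C a) + affine_mod m l \<mu> (C c)] (mod m)"
      by (intro cong_add cong_sym[OF red])
    ultimately have "[2 * affine_mod m l \<mu> (C b) = affine_mod m l \<mu> (C a) + affine_mod m l \<mu> (C c)] (mod m)"
      by (meson cong_trans)
    then show "[2 * (\<lambda>A\<in>arcs D. affine_mod m l \<mu> (C A)) b = (\<lambda>A\<in>arcs D. affine_mod m l \<mu> (C A)) a + (\<lambda>A\<in>arcs D. affine_mod m l \<mu> (C A)) c] (mod m)"
      using arcs b(1) by simp
  qed
  ultimately show ?thesis unfolding realizes_def using link_cocycle_affine[OF m w] by blast
qed

end

section \<open>Invariance\<close>

locale diagram_homeo = d: regular_diagram D + d': regular_diagram D' + space_homeo h h' "support D" "support D'"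
  for D D' h h' +
  fixes m :: int and p :: space
  assumes m: "m > 1" and p: "p \<in> sky D" "h p \<in> sky D'"
begin

text \<open>A relation, because many cocycles realize the same coloring;
  \<open>corresponds_unique\<close> shows that the choice has no effect.\<close>

definition corresponds :: "(space set \<Rightarrow> int) \<Rightarrow> (space set \<Rightarrow> int) \<Rightarrow> bool" where
  "corresponds C C' \<longleftrightarrow> (\<exists>w. realizes m D p C w \<and> realizes m D' (h p) C' (push h' w))"

lemma corresponds_exists:
  assumes C: "C \<in> colorings m D" shows "\<exists>C'. corresponds C C'"
proof -
  obtain w where w: "realizes m D p C w" by (rule d.realizes_exists[OF m C])
  then have "link_cocycle m (support D') (push h' w)" unfolding realizes_def using link_cocycle_push by blast
  then obtain C' where "realizes m D' (h p) C' (push h' w)" by (rule d'.realizes_coloring[OF m _ p(2)])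
  then show ?thesis unfolding corresponds_def using w by blast
qed

text \<open>Cocycles realizing the same coloring are gauge equivalent with base point
  \<open>p\<close>, the homeomorphism carries this equivalence to base point \<open>h p\<close>, and
  gauge equivalent cocycles realize the same coloring of \<open>D'\<close>.\<close>

lemma corresponds_unique:
  assumes "corresponds C C1" "corresponds C C2" shows "C1 = C2"
proof -
  obtain w1 w2 where w: "realizes m D p C w1" "realizes m D' (h p) C1 (push h' w1)"
    "realizes m D p C w2" "realizes m D' (h p) C2 (push h' w2)" using assms unfolding corresponds_def by blast
  have "gauge_equiv (- support D') (h p) (push h' w1) (push h' w2)"
    by (rule gauge_push[OF refl d.realizes_gauge_equiv[OF w(1,3) p(1)]])
  moreover have "link_cocycle m (support D') (push h' w2)" using w(4) unfolding realizes_def by blast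
  ultimately have "realizes m D' (h p) C1 (push h' w2)" by (intro d'.realizes_gauge[OF w(2)])
  then show ?thesis by (rule d'.realizes_unique[OF m p(2) _ w(4)])
qed

lemma diagram_homeo_sym: "diagram_homeo D' D h' h m (h p)"
proof -
  interpret s: space_homeo h' h "support D'" "support D" by (rule space_homeo_sym)
  show ?thesis by unfold_locales (use m p in simp_all)
qed

lemma corresponds_affine:
  assumes "corresponds C C'"
  shows "corresponds (\<lambda>A\<in>arcs D. affine_mod m l \<mu> (C A)) (\<lambda>A\<in>arcs D'. affine_mod m l \<mu> (C' A))"
proof -
  obtain w where w: "realizes m D p C w" "realizes m D' (h p) C' (push h' w)" using assms
    unfolding corresponds_def by blast
  from d.realizes_affine[OF m w(1)] d'.realizes_affine[OF m w(2)]
  show ?thesis unfolding corresponds_def push_def by blast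
qed

lemma corresponds_colorings: "corresponds C C' \<Longrightarrow> C \<in> colorings m D \<and> C' \<in> colorings m D'"
  unfolding corresponds_def realizes_def by blast

lemma corresponds_converse:
  assumes "corresponds C C'" shows "diagram_homeo.corresponds D' D h' h m (h p) C' C"
proof -
  interpret s: diagram_homeo D' D h' h m "h p" by (rule diagram_homeo_sym)
  obtain w where w: "realizes m D p C w" "realizes m D' (h p) C' (push h' w)" using assms
    unfolding corresponds_def by blast
  then have "realizes m D' (h p) C' (push h' w) \<and> realizes m D (h' (h p)) C (push h (push h' w))"
    unfolding push_push by simp
  then show ?thesis unfolding s.corresponds_def by (rule exI[of _ "push h' w"])
qed

lemma corresponds_injective:
  assumes "corresponds C1 C'" "corresponds C2 C'" shows "C1 = C2"
proof -
  interpret s: diagram_homeo D' D h' h m "h p" by (rule diagram_homeo_sym)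
  show ?thesis by (rule s.corresponds_unique[OF assms[THEN corresponds_converse]])
qed

text \<open>The affine map with slope 0 detects triviality: a coloring is trivial iff some constant map fixes it.\<close>

lemma corresponds_trivial:
  assumes c: "corresponds C C'" and t: "trivial_coloring D C" shows "trivial_coloring D' C'"
proof -
  have C: "C \<in> arcs D \<rightarrow>\<^sub>E Z_mod m" using corresponds_colorings[OF c] by (simp add: colorings_def)
  obtain \<mu> where \<mu>: "\<And>A. A \<in> arcs D \<Longrightarrow> C A = \<mu>" using t unfolding trivial_coloring_def by blast
  have "(\<lambda>A\<in>arcs D. affine_mod m 0 \<mu> (C A)) = C"
  proof
    fix A
    show "(\<lambda>A\<in>arcs D. affine_mod m 0 \<mu> (C A)) A = C A"
    proof (cases "A \<in> arcs D")
      case True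
      then show ?thesis using \<mu>[OF True] PiE_mem[OF C True] by (simp add: affine_mod_def)
    next
      case False
      then show ?thesis using PiE_arb[OF C False] by simp
    qed
  qed
  with corresponds_affine[OF c, of 0 \<mu>] have "corresponds C (\<lambda>A\<in>arcs D'. affine_mod m 0 \<mu> (C' A))" by simp
  then have e: "C' = (\<lambda>A\<in>arcs D'. affine_mod m 0 \<mu> (C' A))" by (rule corresponds_unique[OF c])
  have "C' A = \<mu> mod m" if "A \<in> arcs D'" for A using fun_cong[OF e, of A] that by (simp add: affine_mod_def)
  then show ?thesis unfolding trivial_coloring_def by simp
qed

section \<open>The bijection of colorings and of their classes\<close>

definition transfer :: "(space set \<Rightarrow> int) \<Rightarrow> space set \<Rightarrow> int" where
  "transfer C = (THE C'. corresponds C C')"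

lemma transfer_eq: assumes c: "corresponds C C'" shows "transfer C = C'"
  unfolding transfer_def by (rule the_equality, rule c) (rule corresponds_unique[OF _ c])

lemma corresponds_transfer: "C \<in> colorings m D \<Longrightarrow> corresponds C (transfer C)"
  using corresponds_exists transfer_eq by metis

lemma transfer_inj: "inj_on transfer (colorings m D)"
  by (rule inj_onI) (metis corresponds_transfer corresponds_injective)

lemma transfer_nontrivial: "transfer ` nontrivial_colorings m D = nontrivial_colorings m D'"
proof -
  interpret s: diagram_homeo D' D h' h m "h p" by (rule diagram_homeo_sym)
  have iff: "trivial_coloring D C \<longleftrightarrow> trivial_coloring D' C'" if "corresponds C C'" for C C'
    using corresponds_trivial[OF that] s.corresponds_trivial[OF corresponds_converse[OF that]] by blast
  show ?thesis
  proof (intro equalityI subsetI)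
    fix C' assume "C' \<in> transfer ` nontrivial_colorings m D"
    then obtain C where C: "C \<in> colorings m D" "\<not> trivial_coloring D C" "C' = transfer C"
      unfolding nontrivial_colorings_def by blast
    have "corresponds C C'" unfolding C(3) by (rule corresponds_transfer[OF C(1)])
    then show "C' \<in> nontrivial_colorings m D'"
      using corresponds_colorings iff C(2) unfolding nontrivial_colorings_def by blast
  next
    fix C' assume C': "C' \<in> nontrivial_colorings m D'"
    then obtain C where "s.corresponds C' C" using s.corresponds_exists unfolding nontrivial_colorings_def
      by blast
    then have c: "corresponds C C'" using s.corresponds_converse[of C' C] by simp
    then have "C \<in> nontrivial_colorings m D"
      using corresponds_colorings iff C' unfolding nontrivial_colorings_def by blast
    then show "C' \<in> transfer ` nontrivial_colorings m D" using transfer_eq[OF c] by blast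
  qed
qed

lemma action_affine:
  assumes "C \<in> colorings m D" "\<And>c. c \<in> Z_mod m \<Longrightarrow> g c = affine_mod m l \<mu> c"
  shows "coloring_action D g C = (\<lambda>A\<in>arcs D. affine_mod m l \<mu> (C A))"
  unfolding coloring_action_def using assms d.coloring_range by (intro restrict_ext) blast

lemma corresponds_action:
  assumes g: "g \<in> carrier (Aut_group m)" and c: "corresponds C C'"
  shows "corresponds (coloring_action D g C) (coloring_action D' g C')"
proof -
  interpret s: diagram_homeo D' D h' h m "h p" by (rule diagram_homeo_sym)
  obtain l \<mu> where a: "\<And>c. c \<in> Z_mod m \<Longrightarrow> g c = affine_mod m l \<mu> c" by (rule aut_affine[OF m g]) blast
  have C: "C \<in> colorings m D" "C' \<in> colorings m D'" using corresponds_colorings[OF c] by blast+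
  have "coloring_action D g C = (\<lambda>A\<in>arcs D. affine_mod m l \<mu> (C A))" by (rule action_affine[OF C(1) a])
  moreover have "coloring_action D' g C' = (\<lambda>A\<in>arcs D'. affine_mod m l \<mu> (C' A))"
    by (rule s.action_affine[OF C(2) a])
  ultimately show ?thesis using corresponds_affine[OF c] by simp
qed

lemma transfer_orbit:
  assumes G: "G \<subseteq> carrier (Aut_group m)" and C: "C \<in> colorings m D"
  shows "transfer ` (\<lambda>g. coloring_action D g C) ` G = (\<lambda>g. coloring_action D' g (transfer C)) ` G"
  unfolding image_image
  by (rule image_cong[OF refl]) (use G transfer_eq corresponds_action corresponds_transfer[OF C] in blast)

lemma coloring_classes_eq:
  "coloring_classes m G D = (\<lambda>C. (\<lambda>g. coloring_action D g C) ` G) ` nontrivial_colorings m D"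
  unfolding coloring_classes_def orbits_def orbit_def by auto

lemma transfer_classes:
  assumes G: "G \<subseteq> carrier (Aut_group m)"
  shows "coloring_classes m G D' = (image transfer) ` coloring_classes m G D"
    "coloring_classes m G D \<subseteq> Pow (colorings m D)"
proof -
  interpret s: diagram_homeo D' D h' h m "h p" by (rule diagram_homeo_sym)
  have nt: "C \<in> colorings m D" if "C \<in> nontrivial_colorings m D" for C
    using that unfolding nontrivial_colorings_def by blast
  have "image transfer ` coloring_classes m G D = (\<lambda>C. transfer ` (\<lambda>g. coloring_action D g C) ` G) ` nontrivial_colorings m D"
    unfolding coloring_classes_eq by (rule image_image)
  also have "\<dots> = (\<lambda>C. (\<lambda>g. coloring_action D' g (transfer C)) ` G) ` nontrivial_colorings m D"
    by (rule image_cong[OF refl transfer_orbit[OF G nt]])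
  also have "\<dots> = (\<lambda>C. (\<lambda>g. coloring_action D' g C) ` G) ` transfer ` nontrivial_colorings m D"
    by (rule image_image[symmetric])
  finally show "coloring_classes m G D' = (image transfer) ` coloring_classes m G D"
    unfolding transfer_nontrivial s.coloring_classes_eq by (rule sym)
  show "coloring_classes m G D \<subseteq> Pow (colorings m D)"
    unfolding coloring_classes_eq
    using corresponds_colorings corresponds_action corresponds_transfer nt G by blast
qed

lemma classes_invariant:
  assumes G: "G \<subseteq> carrier (Aut_group m)"
  shows "card (coloring_classes m G D) = card (coloring_classes m G D') \<and>
    class_sizes m G D = class_sizes m G D'"
proof
  let ?K = "coloring_classes m G D"
  \<comment> \<open>Classes consist of colorings, on which \<open>transfer\<close> is injective:
    this gives equal sizes of single classes here, and distinct images of distinct classes in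
    \<open>Inj\<close>.\<close>
  have inj: "inj_on transfer X" if "X \<in> ?K" for X
    by (rule inj_on_subset[OF transfer_inj]) (use transfer_classes(2)[OF G] that in blast)
  have Inj: "inj_on (image transfer) ?K"
    by (rule inj_on_subset[OF inj_on_image_Pow[OF transfer_inj] transfer_classes(2)[OF G]])
  show "card ?K = card (coloring_classes m G D')"
    unfolding transfer_classes(1)[OF G] by (rule card_image[OF Inj, symmetric])
  have "class_sizes m G D' = image_mset card (image_mset (image transfer) (mset_set ?K))"
    unfolding class_sizes_def transfer_classes(1)[OF G] image_mset_mset_set[OF Inj] ..
  also have "\<dots> = image_mset (\<lambda>X. card (transfer ` X)) (mset_set ?K)" by (simp add: multiset.map_comp o_def)
  also have "\<dots> = image_mset card (mset_set ?K)"
  proof (rule image_mset_cong)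
    fix X assume "X \<in># mset_set ?K"
    \<comment> \<open>\<open>mset_set\<close> of an infinite set is empty, so membership implies
      \<open>X \<in> ?K\<close> in both cases.\<close>
    then have "X \<in> ?K" by (cases "finite ?K") simp_all
    then show "card (transfer ` X) = card X" by (rule card_image[OF inj])
  qed
  finally show "class_sizes m G D = class_sizes m G D'" unfolding class_sizes_def by (rule sym)
qed

end

section \<open>Two diagrams of one link\<close>

lemma ambient_isotopic_homeomorphism:
  assumes "ambient_isotopic K L"
  obtains h h' where "homeomorphism UNIV UNIV h h'" "h ` K = L"
proof -
  obtain h where h: "homotopic_with_canon (\<lambda>f. \<exists>g. homeomorphism UNIV UNIV f g) UNIV UNIV id h" "h ` K = L"
    using assms unfolding ambient_isotopic_def by blast
  have "\<exists>g. homeomorphism UNIV UNIV h g" using homotopic_with_imp_property[OF h(1)] by (rule conjunct2)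
  then show ?thesis using that h(2) by blast
qed

text \<open>The homeomorphism from one polygonal link to the other obtained through \<open>L\<close>
  need not send a sky point to a sky point. As the complement of the link is open and connected, a
  second homeomorphism that moves only points of the complement brings the image of \<open>p\<close>
  to a point of the sky of \<open>D'\<close>.\<close>

lemma common_diagrams:
  assumes m: "m > 1" and D: "diagram_of D L" "diagram_of D' L"
  obtains h h' p where "diagram_homeo D D' h h' m p"
proof -
  interpret d: regular_diagram D using D(1) by unfold_locales (simp_all add: diagram_of_def)
  interpret d': regular_diagram D' using D(2) by unfold_locales (simp_all add: diagram_of_def)
  obtain h1 k1 where h1: "homeomorphism UNIV UNIV h1 k1" "h1 ` support D = L"
    by (rule ambient_isotopic_homeomorphism[of "support D" L]) (use D(1) in \<open>simp add: diagram_of_def\<close>)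
  obtain h2 k2 where h2: "homeomorphism UNIV UNIV h2 k2" "h2 ` support D' = L"
    by (rule ambient_isotopic_homeomorphism[of "support D'" L]) (use D(2) in \<open>simp add: diagram_of_def\<close>)
  have hom: "homeomorphism UNIV UNIV (k2 \<circ> h1) (k1 \<circ> h2)"
    by (rule homeomorphism_compose[OF h1(1) homeomorphism_symD[OF h2(1)]])
  have "k2 ` h2 ` support D' = support D'"
    unfolding image_image homeomorphism_apply1[OF h2(1) UNIV_I] by simp
  then have im: "(k2 \<circ> h1) ` support D = support D'" unfolding image_comp[symmetric] h1(2) h2(2)[symmetric] .
  obtain p p' where p: "p \<in> sky D" "p' \<in> sky D'" using sky_nonempty[of D] sky_nonempty[of D'] by blast
  interpret s: space_homeo "k2 \<circ> h1" "k1 \<circ> h2" "support D" "support D'" using hom im by unfold_locales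
  let ?X = "- support D'"
  have pX: "(k2 \<circ> h1) p \<in> ?X" "p' \<in> ?X" using s.mem(2)[of p] p sky_disjoint by blast+
  \<comment> \<open>\<open>homeomorphism_moving_point\<close> works relative to the affine hull,
    which for a non-empty open set is the whole space.\<close>
  have aff: "affine hull ?X = UNIV" using affine_hull_open[OF d'.complement_open] pX by blast
  obtain f g where f: "homeomorphism UNIV UNIV f g" "f ((k2 \<circ> h1) p) = p'" "{x. \<not> (f x = x \<and> g x = x)} \<subseteq> ?X"
    by (rule homeomorphism_moving_point[of ?X UNIV, OF _ _ _ d'.complement_connected pX])
      (use d'.complement_open aff in simp_all)
  have "f ` support D' = support D'"
  proof -
    have "f x = x" if "x \<in> support D'" for x using f(3) that by blast
    then show ?thesis by simp
  qed
  then have im': "(f \<circ> (k2 \<circ> h1)) ` support D = support D'" unfolding image_comp[symmetric, of f] im .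
  have hom': "homeomorphism UNIV UNIV (f \<circ> (k2 \<circ> h1)) ((k1 \<circ> h2) \<circ> g)"
    by (rule homeomorphism_compose[OF hom f(1)])
  have "diagram_homeo D D' (f \<circ> (k2 \<circ> h1)) ((k1 \<circ> h2) \<circ> g) m p"
    by unfold_locales (use hom' im' m p f(2) in \<open>simp_all\<close>)
  then show ?thesis by (rule that)
qed

theorem theorem2p1:
  fixes m :: int and G :: "(int \<Rightarrow> int) set" and L :: "space set" and D D' :: diagram
  assumes "m > 1"
    and "subgroup G (Aut_group m)"
    and "link L"
    and "diagram_of D L" and "diagram_of D' L"
  shows "card (coloring_classes m G D) = card (coloring_classes m G D') \<and>
         class_sizes m G D = class_sizes m G D'"
proof -
  obtain h h' p where "diagram_homeo D D' h h' m p" by (rule common_diagrams[OF assms(1,4,5)])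
  then interpret diagram_homeo D D' h h' m p .
  show ?thesis by (rule classes_invariant[OF subgroup.subset[OF assms(2)]])
qed

end
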